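(* Let $E/F$ be a non-isotrivial elliptic curve and let $H=F^{ab}$ be the maximal abelian extension of $F$ (inside $\bar F$). Then the group $E_{\mathrm{tors}}(H)$ of torsion points of $E$ rational over $H$ is finite.
   Context: Let $p$ be a prime, $\mathbb F_r$ a finite field of characteristic $p$, $\mathcal C$ a geometrically irreducible smooth projective curve over $\mathbb F_r$, and $F=\mathbb F_r(\mathcal C)$ its function field, with a fixed algebraic closure $\bar F$. An elliptic curve $E/F$ is isotrivial if it becomes isomorphic to an elliptic curve defined over a finite field after a finite extension of $F$; equivalently $j(E)\in\bar{\mathbb F}_r$. *)

theory Defs
  imports "HOL-Computational_Algebra.Polynomial"
begin

text \<open>All fields live inside an ambient field of type 'a (later assumed algebraically
closed), so subfields are subsets of 'a.\<close>

definition is_subfield :: "'a::field set \<Rightarrow> bool" where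
  "is_subfield S \<longleftrightarrow> 0 \<in> S \<and> 1 \<in> S \<and>
     (\<forall>x\<in>S. \<forall>y\<in>S. x + y \<in> S \<and> x - y \<in> S \<and> x * y \<in> S) \<and>
     (\<forall>x\<in>S. x \<noteq> 0 \<longrightarrow> inverse x \<in> S)"

definition prime_subfield :: "'a::field set" where
  "prime_subfield = \<Inter>{S. is_subfield S}"

definition algebraic_over :: "'a::field set \<Rightarrow> 'a \<Rightarrow> bool" where
  "algebraic_over K x \<longleftrightarrow>
     (\<exists>q::'a poly. q \<noteq> 0 \<and> (\<forall>i. coeff q i \<in> K) \<and> poly q x = 0)"

definition algebraic_closure_in :: "'a::field set \<Rightarrow> 'a set" where
  "algebraic_closure_in K = {x. algebraic_over K x}"

definition gen_field :: "'a::field set \<Rightarrow> 'a set \<Rightarrow> 'a set" where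
  "gen_field K A = \<Inter>{S. is_subfield S \<and> K \<subseteq> S \<and> A \<subseteq> S}"

definition finite_dim_over :: "'a::field set \<Rightarrow> 'a set \<Rightarrow> bool" where
  "finite_dim_over K L \<longleftrightarrow>
     (\<exists>B. finite B \<and> B \<subseteq> L \<and>
        (\<forall>x\<in>L. \<exists>c. (\<forall>b\<in>B. c b \<in> K) \<and> x = (\<Sum>b\<in>B. c b * b)))"

text \<open>Global function field: the function field of a geometrically irreducible smooth
projective curve over a finite field of characteristic p; equivalently a finite extension
of a rational function field F_p(t) with t transcendental.\<close>
definition global_function_field :: "nat \<Rightarrow> 'a::field set \<Rightarrow> bool" where
  "global_function_field p F \<longleftrightarrow> prime p \<and> of_nat p = (0::'a) \<and> is_subfield F \<and>
     (\<exists>t\<in>F. \<not> algebraic_over prime_subfield t \<and>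
        finite_dim_over (gen_field prime_subfield {t}) F)"

definition aut_over :: "'a::field set \<Rightarrow> 'a set \<Rightarrow> ('a \<Rightarrow> 'a) set" where
  "aut_over F K = {\<sigma>. bij_betw \<sigma> K K \<and>
      (\<forall>x\<in>K. \<forall>y\<in>K. \<sigma> (x + y) = \<sigma> x + \<sigma> y \<and> \<sigma> (x * y) = \<sigma> x * \<sigma> y) \<and>
      (\<forall>x\<in>F. \<sigma> x = x)}"

definition finite_galois_ext :: "'a::field set \<Rightarrow> 'a set \<Rightarrow> bool" where
  "finite_galois_ext F K \<longleftrightarrow> is_subfield F \<and> is_subfield K \<and> F \<subseteq> K \<and>
     finite_dim_over F K \<and> {x\<in>K. \<forall>\<sigma>\<in>aut_over F K. \<sigma> x = x} = F"

definition finite_abelian_ext :: "'a::field set \<Rightarrow> 'a set \<Rightarrow> bool" where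
  "finite_abelian_ext F K \<longleftrightarrow> finite_galois_ext F K \<and>
     (\<forall>\<sigma>\<in>aut_over F K. \<forall>\<tau>\<in>aut_over F K. \<forall>x\<in>K. \<sigma> (\<tau> x) = \<tau> (\<sigma> x))"

definition max_abelian_ext :: "'a::field set \<Rightarrow> 'a set" where
  "max_abelian_ext F = \<Union>{K. finite_abelian_ext F K}"

text \<open>Elliptic curves in general Weierstrass form
  y^2 + a1 x y + a3 y = x^3 + a2 x^2 + a4 x + a6  (Silverman, III.1).\<close>
record 'a weierstrass =
  a1 :: 'a  a2 :: 'a  a3 :: 'a  a4 :: 'a  a6 :: 'a

definition wb2 where "wb2 E = a1 E ^ 2 + 4 * a2 E"
definition wb4 where "wb4 E = 2 * a4 E + a1 E * a3 E"
definition wb6 where "wb6 E = a3 E ^ 2 + 4 * a6 E"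
definition wb8 where "wb8 E = a1 E ^ 2 * a6 E + 4 * a2 E * a6 E - a1 E * a3 E * a4 E
                               + a2 E * a3 E ^ 2 - a4 E ^ 2"
definition wc4 where "wc4 E = wb2 E ^ 2 - 24 * wb4 E"
definition disc :: "'a::field weierstrass \<Rightarrow> 'a" where
  "disc E = - (wb2 E ^ 2 * wb8 E) - 8 * wb4 E ^ 3 - 27 * wb6 E ^ 2
            + 9 * wb2 E * wb4 E * wb6 E"
definition j_inv :: "'a::field weierstrass \<Rightarrow> 'a" where
  "j_inv E = wc4 E ^ 3 / disc E"

definition elliptic_over :: "'a::field set \<Rightarrow> 'a weierstrass \<Rightarrow> bool" where
  "elliptic_over F E \<longleftrightarrow> a1 E \<in> F \<and> a2 E \<in> F \<and> a3 E \<in> F \<and> a4 E \<in> F \<and> a6 E \<in> F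
     \<and> disc E \<noteq> 0"

definition isotrivial :: "'a::field weierstrass \<Rightarrow> bool" where
  "isotrivial E \<longleftrightarrow> algebraic_over prime_subfield (j_inv E)"

text \<open>Points: None is the point at infinity O, Some (x,y) an affine point.\<close>
definition on_curve :: "'a::field weierstrass \<Rightarrow> ('a \<times> 'a) option \<Rightarrow> bool" where
  "on_curve E P = (case P of None \<Rightarrow> True | Some (x, y) \<Rightarrow>
      y ^ 2 + a1 E * x * y + a3 E * y = x ^ 3 + a2 E * x ^ 2 + a4 E * x + a6 E)"

text \<open>Group law (Silverman, Algorithm III.2.3).\<close>
definition ec_add :: "'a::field weierstrass \<Rightarrow> ('a \<times> 'a) option \<Rightarrow> ('a \<times> 'a) option
                      \<Rightarrow> ('a \<times> 'a) option" where
  "ec_add E P Q = (case P of None \<Rightarrow> Q | Some (x1, y1) \<Rightarrow>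
     (case Q of None \<Rightarrow> P | Some (x2, y2) \<Rightarrow>
       (if x1 = x2 \<and> y1 + y2 + a1 E * x2 + a3 E = 0 then None
        else
          let lam = (if x1 \<noteq> x2 then (y2 - y1) / (x2 - x1)
                     else (3 * x1 ^ 2 + 2 * a2 E * x1 + a4 E - a1 E * y1)
                          / (2 * y1 + a1 E * x1 + a3 E));
              nu = (if x1 \<noteq> x2 then (y1 * x2 - y2 * x1) / (x2 - x1)
                    else (- (x1 ^ 3) + a4 E * x1 + 2 * a6 E - a3 E * y1)
                          / (2 * y1 + a1 E * x1 + a3 E));
              x3 = lam ^ 2 + a1 E * lam - a2 E - x1 - x2;
              y3 = - (lam + a1 E) * x3 - nu - a3 E
          in Some (x3, y3))))"

fun ec_mult :: "'a::field weierstrass \<Rightarrow> nat \<Rightarrow> ('a \<times> 'a) option \<Rightarrow> ('a \<times> 'a) option" where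
  "ec_mult E 0 P = None"
| "ec_mult E (Suc n) P = ec_add E P (ec_mult E n P)"

definition rat_points :: "'a::field weierstrass \<Rightarrow> 'a set \<Rightarrow> ('a \<times> 'a) option set" where
  "rat_points E L = {P. on_curve E P \<and> (\<forall>x y. P = Some (x, y) \<longrightarrow> x \<in> L \<and> y \<in> L)}"

definition torsion_points :: "'a::field weierstrass \<Rightarrow> 'a set \<Rightarrow> ('a \<times> 'a) option set" where
  "torsion_points E L = {P \<in> rat_points E L. \<exists>n>0. ec_mult E n P = None}"

end

theory Submission
  imports Defs "HOL-Library.FuncSet" "HOL-Library.Function_Algebras"
begin

text \<open>
  Over a finite extension the curve takes the form y^2 + xy = x^3 + 36ax + a with j = 1728 - 1/a, so
  a is transcendental and the curve has multiplicative reduction wherever a lies in the maximal ideal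
  of a valuation ring; call such a ring bad. The points whose x-coordinate is not in the maximal ideal
  are the good points; they form a subgroup, and they replace the theory of the Tate curve.

  (1) A torsion point that is good at every bad ring vanishes. If it has odd order, doubling permutes a
  finite cycle of points with x-coordinates x_i, and z = disc^n / (prod g(x_i))^2, where g is the
  denominator of the duplication formula, is integral at all valuation rings and a non-unit at a bad one;
  but an element integral everywhere is algebraic over the prime field, hence a unit or 0. Points of order
  two are excluded by a similar quotient.

  (2) Let L be a finite abelian extension of the base field F and U one of the finitely many bad rings of
  F. All bad rings of L above U are conjugate and therefore have the same decomposition group D. For a point
  Q over L and s in D the point sQ - Q is good above U, because Q and sQ have coordinates of equal value. A
  point fixed by D has coordinates that are congruent modulo a to elements of U; since U/aU is finite, two of
  its first multiples are congruent, so that a multiple bounded independently of L is good above U.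

  Induction on the number of rings at which a torsion point is not good yields an exponent for the torsion
  over L that depends on F only, and each n-torsion group is finite.
\<close>


section \<open>Subfields and algebraic elements\<close>

text \<open>The points over \<open>L\<close> modulo the good ones form a group that can grow with
  the ramification of \<open>L\<close> over \<open>F\<close>, so that group cannot supply a bound by
  itself. Passing to \<open>sQ - Q\<close> avoids it: this difference is good above \<open>U\<close>
  whatever the ramification, a fixed number kills it by induction, and so a fixed multiple of
  \<open>Q\<close> is invariant under \<open>D\<close>. Invariant points see no more than the
  completion of \<open>F\<close> at \<open>U\<close>. Commutativity lets one \<open>D\<close> serve
  all rings above \<open>U\<close>, so that the induction removes all of them at once. The model has
  \<open>c4 = 1 - 1728 a\<close> and discriminant \<open>- a (1 - 1728 a)^2\<close>, and it serves
  every characteristic, 2 and 3 included; only \<open>j = 0\<close> and \<open>j = 1728\<close> are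
  out of its reach. At a bad ring it reduces to \<open>y^2 + x y = x^3\<close>, whose node is the
  origin with tangents \<open>y = 0\<close> and \<open>y = - x\<close>: the good points are those
  that avoid the node. Values are never numbers: comparisons are memberships of quotients in a
  valuation ring, and divisibility by \<open>a\<close> takes the place of a uniformizer.\<close>

lemma subfieldD:
  assumes "is_subfield S"
  shows "0 \<in> S" "1 \<in> S" "x \<in> S \<Longrightarrow> y \<in> S \<Longrightarrow> x + y \<in> S" "x \<in> S \<Longrightarrow> y \<in> S \<Longrightarrow> x - y \<in> S"
    "x \<in> S \<Longrightarrow> y \<in> S \<Longrightarrow> x * y \<in> S" "x \<in> S \<Longrightarrow> inverse x \<in> S" "x \<in> S \<Longrightarrow> - x \<in> S"
    "x \<in> S \<Longrightarrow> y \<in> S \<Longrightarrow> x / y \<in> S" "x \<in> S \<Longrightarrow> x ^ n \<in> S"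
    "of_nat n \<in> S" "numeral w \<in> S"
proof -
  show 0: "0 \<in> S" and 1: "1 \<in> S" using assms by (auto simp: is_subfield_def)
  show add: "x + y \<in> S" if "x \<in> S" "y \<in> S" for x y using that assms by (auto simp: is_subfield_def)
  show diff: "x - y \<in> S" if "x \<in> S" "y \<in> S" for x y using that assms by (auto simp: is_subfield_def)
  show mul: "x * y \<in> S" if "x \<in> S" "y \<in> S" for x y using that assms by (auto simp: is_subfield_def)
  show inv: "inverse x \<in> S" if "x \<in> S" for x
    using that assms 0 by (cases "x = 0") (auto simp: is_subfield_def)
  show "- x \<in> S" if "x \<in> S" using diff[OF 0 that] by simp
  show "x / y \<in> S" if "x \<in> S" "y \<in> S" using mul[OF that(1) inv[OF that(2)]] by (simp add: divide_inverse)
  show "x ^ n \<in> S" if "x \<in> S" by (induction n) (auto intro: 1 mul that)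
  show nat: "of_nat n \<in> S" for n by (induction n) (auto intro: 0 1 add)
  show "numeral w \<in> S" using nat[of "numeral w"] by simp
qed

lemma subfield_sum: "is_subfield S \<Longrightarrow> (\<And>i. i \<in> A \<Longrightarrow> f i \<in> S) \<Longrightarrow> sum f A \<in> S"
  by (induction A rule: infinite_finite_induct) (auto intro: subfieldD)

lemma subfield_prod: "is_subfield S \<Longrightarrow> (\<And>i. i \<in> A \<Longrightarrow> f i \<in> S) \<Longrightarrow> prod f A \<in> S"
  by (induction A rule: infinite_finite_induct) (auto intro: subfieldD)

lemma is_subfieldI:
  assumes "0 \<in> S" "1 \<in> S" "\<And>x y. x \<in> S \<Longrightarrow> y \<in> S \<Longrightarrow> x + y \<in> S" "\<And>x. x \<in> S \<Longrightarrow> - x \<in> S"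
    "\<And>x y. x \<in> S \<Longrightarrow> y \<in> S \<Longrightarrow> x * y \<in> S" "\<And>x. x \<in> S \<Longrightarrow> x \<noteq> 0 \<Longrightarrow> inverse x \<in> S"
  shows "is_subfield S"
proof -
  have "x - y \<in> S" if "x \<in> S" "y \<in> S" for x y using assms(3)[OF that(1) assms(4)[OF that(2)]] by simp
  then show ?thesis unfolding is_subfield_def using assms by simp
qed

lemma subfield_UNIV: "is_subfield UNIV" by (simp add: is_subfield_def)

lemma subfield_Inter: "(\<And>S. S \<in> C \<Longrightarrow> is_subfield S) \<Longrightarrow> is_subfield (\<Inter>C)"
  by (auto simp: is_subfield_def)

lemma subfield_prime_subfield: "is_subfield prime_subfield"
  unfolding prime_subfield_def by (rule subfield_Inter) auto

lemma prime_subfield_le: "is_subfield S \<Longrightarrow> prime_subfield \<subseteq> S"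
  unfolding prime_subfield_def by auto

lemma subfield_gen_field: "is_subfield (gen_field K A)"
  unfolding gen_field_def by (rule subfield_Inter) auto

lemma gen_field_incl: "K \<subseteq> gen_field K A" "A \<subseteq> gen_field K A"
  unfolding gen_field_def by auto

lemma gen_field_least: "is_subfield S \<Longrightarrow> K \<subseteq> S \<Longrightarrow> A \<subseteq> S \<Longrightarrow> gen_field K A \<subseteq> S"
  unfolding gen_field_def by auto

lemma gen_field_mono: "K \<subseteq> K' \<Longrightarrow> A \<subseteq> A' \<Longrightarrow> gen_field K A \<subseteq> gen_field K' A'"
  using gen_field_least[OF subfield_gen_field[of K' A'], of K A] gen_field_incl(1)[of K' A'] gen_field_incl(2)[of A' K']
  by auto

lemma gen_field_Un: "gen_field K (A \<union> B) = gen_field (gen_field K A) B"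
proof
  show "gen_field K (A \<union> B) \<subseteq> gen_field (gen_field K A) B"
    using gen_field_incl(1)[of K A] gen_field_incl(2)[of A K]
      gen_field_incl(1)[of "gen_field K A" B] gen_field_incl(2)[of B "gen_field K A"]
    by (intro gen_field_least[OF subfield_gen_field]) auto
  show "gen_field (gen_field K A) B \<subseteq> gen_field K (A \<union> B)"
    using gen_field_incl(2)[of "A \<union> B" K]
    by (intro gen_field_least[OF subfield_gen_field] gen_field_mono) auto
qed

lemma gen_field_empty: "is_subfield K \<Longrightarrow> gen_field K {} = K"
  using gen_field_least[of K K "{}"] gen_field_incl(1)[of K "{}"] by auto

section \<open>Polynomials with coefficients in a subfield\<close>

definition pov :: "'a::field set \<Rightarrow> 'a poly \<Rightarrow> bool" where
  "pov K q \<longleftrightarrow> (\<forall>i. coeff q i \<in> K)"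

lemma povD: "pov K q \<Longrightarrow> coeff q i \<in> K"
  by (simp add: pov_def)

lemma pov_mono: "pov K q \<Longrightarrow> K \<subseteq> S \<Longrightarrow> pov S q"
  by (auto simp: pov_def)

context
  fixes K :: "'a::field set"
  assumes K: "is_subfield K"
begin

lemma pov_0 [simp]: "pov K 0"
  using subfieldD[OF K] by (auto simp: pov_def)

lemma pov_1 [simp]: "pov K 1"
  using subfieldD[OF K] by (auto simp: pov_def coeff_1)

lemma pov_pCons [simp]: "pov K (pCons c q) \<longleftrightarrow> c \<in> K \<and> pov K q"
  by (auto simp: pov_def coeff_pCons split: nat.splits)

lemma pov_add: "pov K q \<Longrightarrow> pov K r \<Longrightarrow> pov K (q + r)"
  using subfieldD[OF K] by (auto simp: pov_def)

lemma pov_diff: "pov K q \<Longrightarrow> pov K r \<Longrightarrow> pov K (q - r)"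
  using subfieldD[OF K] by (auto simp: pov_def)

lemma pov_uminus: "pov K q \<Longrightarrow> pov K (- q)"
  using subfieldD[OF K] by (auto simp: pov_def)

lemma pov_smult: "c \<in> K \<Longrightarrow> pov K q \<Longrightarrow> pov K (smult c q)"
  using subfieldD[OF K] by (auto simp: pov_def)

lemma pov_monom: "c \<in> K \<Longrightarrow> pov K (monom c n)"
  using subfieldD[OF K] by (auto simp: pov_def)

lemma pov_mult: "pov K q \<Longrightarrow> pov K r \<Longrightarrow> pov K (q * r)"
  using subfieldD[OF K] by (auto simp: pov_def coeff_mult intro!: subfield_sum K)

lemma pov_power: "pov K q \<Longrightarrow> pov K (q ^ n)"
  by (induction n) (auto intro: pov_mult)

lemma pov_sum: "(\<And>i. i \<in> A \<Longrightarrow> pov K (f i)) \<Longrightarrow> pov K (sum f A)"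
  by (induction A rule: infinite_finite_induct) (auto intro: pov_add)

lemma pov_prod: "(\<And>i. i \<in> A \<Longrightarrow> pov K (f i)) \<Longrightarrow> pov K (prod f A)"
  by (induction A rule: infinite_finite_induct) (auto intro: pov_mult)

lemma pov_pcompose: "pov K q \<Longrightarrow> pov K r \<Longrightarrow> pov K (pcompose q r)"
  by (induction q) (auto simp: pcompose_pCons intro!: pov_add pov_mult)

lemma poly_in: "pov K q \<Longrightarrow> x \<in> K \<Longrightarrow> poly q x \<in> K"
  using subfieldD[OF K] by (induction q) auto

text \<open>Long division by \<open>m\<close> only ever divides by the leading coefficient of
  \<open>m\<close>, so quotient and remainder stay over \<open>K\<close>.\<close>

lemma pov_division:
  assumes "pov K m" "m \<noteq> 0" "pov K g"
  shows "\<exists>q r. pov K q \<and> pov K r \<and> g = q * m + r \<and> (r = 0 \<or> degree r < degree m)"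
  using assms(3)
\<comment> \<open>The measure puts the zero polynomial strictly below the nonzero constants, which
  have degree 0 too.\<close>
proof (induction "if g = 0 then 0 else Suc (degree g)" arbitrary: g rule: less_induct)
  case (less g)
  show ?case
  proof (cases "g = 0 \<or> degree g < degree m")
    case True
    then show ?thesis using less.prems by (intro exI[of _ 0] exI[of _ g]) auto
  next
    case False
    define c where "c = lead_coeff g / lead_coeff m"
    define h where "h = monom c (degree g - degree m)"
    have c: "c \<in> K" using povD[OF less.prems] povD[OF assms(1)] subfieldD(8)[OF K] by (simp add: c_def)
    have c0: "c \<noteq> 0" using False assms(2) by (auto simp: c_def)
    have hp: "pov K h" unfolding h_def by (rule pov_monom[OF c])
    define g' where "g' = g - h * m"
    have g'p: "pov K g'" unfolding g'_def by (intro pov_diff pov_mult hp assms less.prems)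
    have dh: "degree (h * m) = degree g"
      using False assms(2) c0 by (subst degree_mult_eq) (auto simp: h_def degree_monom_eq)
    have lh: "lead_coeff (h * m) = lead_coeff g"
      using False assms(2) c0 by (subst lead_coeff_mult) (auto simp: h_def degree_monom_eq c_def)
    have "g' = 0 \<or> degree g' < degree g"
    proof (cases "g' = 0")
      case False
      have "degree g' \<le> degree g" unfolding g'_def by (rule degree_diff_le) (auto simp: dh)
      moreover have "coeff g' (degree g) = 0" using lh dh by (simp add: g'_def)
      ultimately show ?thesis using False by (metis le_neq_implies_less leading_coeff_0_iff)
    qed simp
    then have "(if g' = 0 then 0 else Suc (degree g')) < (if g = 0 then 0 else Suc (degree g))"
      using False by auto
    from less.hyps[OF this g'p] obtain q r where qr: "pov K q" "pov K r" "g' = q * m + r" "r = 0 \<or> degree r < degree m"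
      by blast
    show ?thesis
      by (rule exI[of _ "q + h"], rule exI[of _ r])
        (use qr hp in \<open>auto intro: pov_add simp: g'_def algebra_simps\<close>)
  qed
qed

end

lemma algebraic_over_pov: "algebraic_over K x \<longleftrightarrow> (\<exists>q. q \<noteq> 0 \<and> pov K q \<and> poly q x = 0)"
  by (auto simp: algebraic_over_def pov_def)

lemma algebraic_over_mono: "algebraic_over K x \<Longrightarrow> K \<subseteq> S \<Longrightarrow> algebraic_over S x"
  unfolding algebraic_over_pov using pov_mono by blast

lemma algebraic_over_mem: "is_subfield K \<Longrightarrow> x \<in> K \<Longrightarrow> algebraic_over K x"
  unfolding algebraic_over_pov by (rule exI[of _ "[:-x, 1:]"]) (auto simp: subfieldD)

text \<open>Minimality is stated as generation of the ideal of polynomials over \<open>K\<close>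
  that vanish at \<open>x\<close>. This is the form in which a map defined on polynomial values is
  seen to be well defined.\<close>

definition minpoly :: "'a::field set \<Rightarrow> 'a \<Rightarrow> 'a poly \<Rightarrow> bool" where
  "minpoly K x m \<longleftrightarrow> m \<noteq> 0 \<and> pov K m \<and> poly m x = 0 \<and>
     (\<forall>q. pov K q \<longrightarrow> poly q x = 0 \<longrightarrow> (\<exists>s. pov K s \<and> q = s * m))"

lemma minpoly_exists:
  assumes K: "is_subfield K" and "algebraic_over K x"
  obtains m where "minpoly K x m"
proof -
  let ?P = "\<lambda>q. q \<noteq> 0 \<and> pov K q \<and> poly q x = 0"
  from assms obtain q where "?P q" unfolding algebraic_over_pov by blast
  then obtain m where m: "?P m" "\<And>q. ?P q \<Longrightarrow> degree m \<le> degree q"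
    using ex_has_least_nat[of ?P q degree] by blast
  have "\<exists>s. pov K s \<and> q = s * m" if q: "pov K q" "poly q x = 0" for q
  proof -
    from pov_division[OF K, of m q] m q obtain s r where sr: "pov K s" "pov K r" "q = s * m + r"
      "r = 0 \<or> degree r < degree m" by blast
    have "poly r x = 0" using sr(3) q m by simp
    then have "r = 0" using m(2)[of r] sr by force
    then show ?thesis using sr by auto
  qed
  then show ?thesis using m that by (auto simp: minpoly_def)
qed

lemma minpoly_degree:
  assumes "is_subfield K" "minpoly K x m"
  shows "degree m > 0"
proof (rule ccontr)
  assume "\<not> degree m > 0"
  then obtain c where "m = [:c:]" by (metis degree_eq_zeroE neq0_conv)
  then show False using assms(2) by (auto simp: minpoly_def)
qed

text \<open>Gaussian elimination, one equation at a time: if equation \<open>b\<close> involves some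
  unknown \<open>i0\<close>, it is solved for that unknown and substituted into the others;
  otherwise it holds automatically.\<close>

lemma homogeneous_system_solution:
  fixes K :: "'a::field set"
  assumes K: "is_subfield K" and "finite B" "finite I" "card B < card I"
    and "\<And>b i. b \<in> B \<Longrightarrow> i \<in> I \<Longrightarrow> A b i \<in> K"
  shows "\<exists>c. (\<forall>i\<in>I. c i \<in> K) \<and> (\<exists>i\<in>I. c i \<noteq> 0) \<and> (\<forall>b\<in>B. (\<Sum>i\<in>I. A b i * c i) = 0)"
  using assms(2-)
proof (induction B arbitrary: I A rule: finite_induct)
  case empty
  then obtain i where "i \<in> I" by (metis card.empty equals0I less_irrefl)
  then show ?case using subfieldD[OF K] by (intro exI[of _ "\<lambda>_. 1"]) auto
next
  case (insert b B)
  show ?case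
  proof (cases "\<exists>i0\<in>I. A b i0 \<noteq> 0")
    case False
    have "\<exists>c. (\<forall>i\<in>I. c i \<in> K) \<and> (\<exists>i\<in>I. c i \<noteq> 0) \<and> (\<forall>b\<in>B. (\<Sum>i\<in>I. A b i * c i) = 0)"
      by (rule insert.IH) (use insert in auto)
    then obtain c where c: "\<forall>i\<in>I. c i \<in> K" "\<exists>i\<in>I. c i \<noteq> 0" "\<forall>b\<in>B. (\<Sum>i\<in>I. A b i * c i) = 0" by blast
    have "(\<Sum>i\<in>I. A b i * c i) = 0" using False by simp
    then show ?thesis using c by (intro exI[of _ c]) auto
  next
    case True
    then obtain i0 where i0: "i0 \<in> I" "A b i0 \<noteq> 0" by blast
    define J where "J = I - {i0}"
    \<comment> \<open>The other rows after subtracting the multiple of row \<open>b\<close> that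
      clears column \<open>i0\<close>.\<close>
    define A' where "A' = (\<lambda>b' i. A b' i - A b' i0 * A b i / A b i0)"
    have J: "finite J" "card B < card J" using insert i0 by (auto simp: J_def)
    have "\<exists>c. (\<forall>i\<in>J. c i \<in> K) \<and> (\<exists>i\<in>J. c i \<noteq> 0) \<and> (\<forall>b\<in>B. (\<Sum>i\<in>J. A' b i * c i) = 0)"
      by (rule insert.IH[OF J]) (use insert.prems i0 in \<open>auto simp: A'_def J_def intro!: subfieldD[OF K]\<close>)
    then obtain c where c: "\<forall>i\<in>J. c i \<in> K" "\<exists>i\<in>J. c i \<noteq> 0" "\<forall>b\<in>B. (\<Sum>i\<in>J. A' b i * c i) = 0" by blast
    define d where "d = c(i0 := - (\<Sum>i\<in>J. A b i * c i) / A b i0)"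
    have sumI: "(\<Sum>i\<in>I. A b' i * d i) = A b' i0 * d i0 + (\<Sum>i\<in>J. A b' i * c i)" for b'
    proof -
      have "(\<Sum>i\<in>I. A b' i * d i) = A b' i0 * d i0 + (\<Sum>i\<in>J. A b' i * d i)"
        unfolding J_def using insert.prems i0 by (intro sum.remove) auto
      also have "(\<Sum>i\<in>J. A b' i * d i) = (\<Sum>i\<in>J. A b' i * c i)"
        by (rule sum.cong) (auto simp: d_def J_def)
      finally show ?thesis .
    qed
    show ?thesis
    proof (intro exI[of _ d] conjI ballI)
      fix i assume "i \<in> I"
      then show "d i \<in> K"
        using c(1) insert.prems i0
        by (auto simp: d_def J_def intro!: subfieldD[OF K] subfield_sum[OF K])
    next
      show "\<exists>i\<in>I. d i \<noteq> 0" using c(2) by (auto simp: d_def J_def)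
    next
      fix b' assume b': "b' \<in> insert b B"
      show "(\<Sum>i\<in>I. A b' i * d i) = 0"
      proof (cases "b' = b")
        case True
        then show ?thesis unfolding sumI using i0 by (simp add: d_def)
      next
        case False
        then have "0 = (\<Sum>i\<in>J. A' b' i * c i)" using c(3) b' by auto
        also have "\<dots> = (\<Sum>i\<in>J. A b' i * c i) - A b' i0 / A b i0 * (\<Sum>i\<in>J. A b i * c i)"
          by (simp add: A'_def left_diff_distrib sum_subtractf sum_distrib_left mult.assoc)
        finally show ?thesis unfolding sumI by (simp add: d_def)
      qed
    qed
  qed
qed

section \<open>Dimension and finite extensions\<close>

definition spans_over :: "'a::field set \<Rightarrow> 'a set \<Rightarrow> 'a set \<Rightarrow> bool" where
  "spans_over K B L \<longleftrightarrow> finite B \<and> B \<subseteq> L \<and> (\<forall>x\<in>L. \<exists>c. (\<forall>b\<in>B. c b \<in> K) \<and> x = (\<Sum>b\<in>B. c b * b))"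

lemma finite_dim_over_spans: "finite_dim_over K L \<longleftrightarrow> (\<exists>B. spans_over K B L)"
  by (simp add: finite_dim_over_def spans_over_def)

lemma linear_dependence:
  assumes K: "is_subfield K" and B: "spans_over K B L" and I: "finite I" "card B < card I"
    and e: "\<And>i. i \<in> I \<Longrightarrow> e i \<in> L"
  shows "\<exists>c. (\<forall>i\<in>I. c i \<in> K) \<and> (\<exists>i\<in>I. c i \<noteq> 0) \<and> (\<Sum>i\<in>I. c i * e i) = 0"
proof -
  have "\<forall>i\<in>I. \<exists>c. (\<forall>b\<in>B. c b \<in> K) \<and> e i = (\<Sum>b\<in>B. c b * b)"
    using e B unfolding spans_over_def by blast
  then obtain A where A: "\<And>i. i \<in> I \<Longrightarrow> (\<forall>b\<in>B. A i b \<in> K) \<and> e i = (\<Sum>b\<in>B. A i b * b)" by metis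
  have "\<exists>c. (\<forall>i\<in>I. c i \<in> K) \<and> (\<exists>i\<in>I. c i \<noteq> 0) \<and> (\<forall>b\<in>B. (\<Sum>i\<in>I. A i b * c i) = 0)"
    by (rule homogeneous_system_solution[OF K]) (use A B I in \<open>auto simp: spans_over_def\<close>)
  then obtain c where c: "\<forall>i\<in>I. c i \<in> K" "\<exists>i\<in>I. c i \<noteq> 0" "\<forall>b\<in>B. (\<Sum>i\<in>I. A i b * c i) = 0" by blast
  have "(\<Sum>i\<in>I. c i * e i) = (\<Sum>i\<in>I. \<Sum>b\<in>B. (A i b * c i) * b)"
    using A by (intro sum.cong) (auto simp: sum_distrib_left mult_ac)
  also have "\<dots> = (\<Sum>b\<in>B. (\<Sum>i\<in>I. A i b * c i) * b)"
    by (subst sum.swap) (simp add: sum_distrib_right)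
  also have "\<dots> = 0" using c(3) by simp
  finally show ?thesis using c by blast
qed

text \<open>\<open>L\<close> is only asked to contain the powers of \<open>x\<close>, so that the
  lemma applies to the ring \<open>K[x]\<close> before that ring is known to be a field. With
  \<open>card B\<close> spanning elements, the first \<open>card B + 1\<close> powers of
  \<open>x\<close> are dependent.\<close>

lemma finite_dim_algebraic:
  assumes K: "is_subfield K" and L: "\<And>n. x ^ n \<in> L" and fd: "finite_dim_over K L"
  shows "algebraic_over K x"
proof -
  from fd obtain B where B: "spans_over K B L" by (auto simp: finite_dim_over_spans)
  obtain c where c: "\<forall>i\<in>{..card B}. c i \<in> K" "\<exists>i\<in>{..card B}. c i \<noteq> 0" "(\<Sum>i\<le>card B. c i * x ^ i) = 0"
    using linear_dependence[OF K B, of "{..card B}" "\<lambda>i. x ^ i"] L by auto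
  define q where "q = (\<Sum>i\<le>card B. monom (c i) i)"
  have coeff: "coeff q i = (if i \<le> card B then c i else 0)" for i
    by (simp add: q_def coeff_sum)
  have "q \<noteq> 0" using c(2) coeff by (metis atMost_iff coeff_0)
  moreover have "pov K q" using c(1) subfieldD[OF K] by (auto simp: pov_def coeff)
  moreover have "poly q x = 0" using c(3) by (simp add: q_def poly_sum poly_monom)
  ultimately show ?thesis unfolding algebraic_over_pov by blast
qed

text \<open>An indexed spanning family may take the same value twice; the coefficients of equal
  members are added up.\<close>

lemma finite_dim_overI:
  assumes "finite I" "\<And>i. i \<in> I \<Longrightarrow> e i \<in> L" "is_subfield K"
    and "\<And>x. x \<in> L \<Longrightarrow> \<exists>c. (\<forall>i\<in>I. c i \<in> K) \<and> x = (\<Sum>i\<in>I. c i * e i)"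
  shows "finite_dim_over K L"
  unfolding finite_dim_over_def
proof (intro exI[of _ "e ` I"] conjI ballI)
  fix x assume "x \<in> L"
  then obtain c where c: "\<forall>i\<in>I. c i \<in> K" "x = (\<Sum>i\<in>I. c i * e i)" using assms(4)[of x] by blast
  define d where "d b = (\<Sum>i\<in>{i\<in>I. e i = b}. c i)" for b
  have "x = (\<Sum>b\<in>e ` I. \<Sum>i\<in>{i\<in>I. e i = b}. c i * e i)"
    unfolding c(2) using assms(1) by (rule sum.image_gen)
  also have "\<dots> = (\<Sum>b\<in>e ` I. d b * b)"
    by (rule sum.cong) (auto simp: d_def sum_distrib_right)
  finally show "\<exists>c. (\<forall>b\<in>e ` I. c b \<in> K) \<and> x = (\<Sum>b\<in>e ` I. c b * b)"
    using c(1) by (intro exI[of _ d]) (auto simp: d_def intro!: subfield_sum assms)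
qed (use assms in auto)

lemma finite_dim_over_tower:
  assumes K: "is_subfield K" and M: "is_subfield M" and L: "is_subfield L" and "M \<subseteq> L"
    and KM: "finite_dim_over K M" and LM: "finite_dim_over M L"
  shows "finite_dim_over K L"
proof -
  from KM obtain A where A: "spans_over K A M" by (auto simp: finite_dim_over_spans)
  from LM obtain B where B: "spans_over M B L" by (auto simp: finite_dim_over_spans)
  show ?thesis
  proof (rule finite_dim_overI[where I = "A \<times> B" and e = "\<lambda>(a, b). a * b"])
    show "finite (A \<times> B)" using A B by (auto simp: spans_over_def)
    show "(case i of (a, b) \<Rightarrow> a * b) \<in> L" if "i \<in> A \<times> B" for i
      using that A B \<open>M \<subseteq> L\<close> by (auto simp: spans_over_def intro!: subfieldD[OF L])
    fix x assume "x \<in> L"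
    then obtain c where c: "\<forall>b\<in>B. c b \<in> M" "x = (\<Sum>b\<in>B. c b * b)" using B by (auto simp: spans_over_def)
    from c(1) A have "\<forall>b\<in>B. \<exists>d. (\<forall>a\<in>A. d a \<in> K) \<and> c b = (\<Sum>a\<in>A. d a * a)" by (auto simp: spans_over_def)
    then obtain d where d: "\<And>b. b \<in> B \<Longrightarrow> (\<forall>a\<in>A. d b a \<in> K) \<and> c b = (\<Sum>a\<in>A. d b a * a)" by metis
    have "x = (\<Sum>b\<in>B. \<Sum>a\<in>A. d b a * (a * b))"
      unfolding c(2) using d by (intro sum.cong) (auto simp: sum_distrib_right mult.assoc)
    also have "\<dots> = (\<Sum>a\<in>A. \<Sum>b\<in>B. d b a * (a * b))" by (rule sum.swap)
    also have "\<dots> = (\<Sum>i\<in>A \<times> B. (case i of (a, b) \<Rightarrow> d b a) * (case i of (a, b) \<Rightarrow> a * b))"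
      by (simp add: sum.cartesian_product case_prod_unfold)
    finally show "\<exists>c. (\<forall>i\<in>A \<times> B. c i \<in> K) \<and> x = (\<Sum>i\<in>A \<times> B. c i * (case i of (a, b) \<Rightarrow> a * b))"
      using d by (intro exI[of _ "\<lambda>(a, b). d b a"]) auto
  qed fact
qed

lemma simple_span:
  assumes K: "is_subfield K" and alg: "algebraic_over K x"
  shows "finite_dim_over K {poly g x | g. pov K g}"
proof -
  obtain m where m: "minpoly K x m" using minpoly_exists[OF K alg] .
  show ?thesis
  proof (rule finite_dim_overI[where I = "{..<degree m}" and e = "\<lambda>i. x ^ i"])
    show "x ^ i \<in> {poly g x | g. pov K g}" for i
      using subfieldD[OF K] pov_monom[OF K, of 1 i] by (auto intro!: exI[of _ "monom 1 i"] simp: poly_monom)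
    fix y assume "y \<in> {poly g x | g. pov K g}"
    then obtain g where g: "pov K g" "y = poly g x" by blast
    from m g pov_division[OF K, of m g] obtain q r where
      r: "pov K r" "g = q * m + r" "r = 0 \<or> degree r < degree m" by (auto simp: minpoly_def)
    have "y = poly r x" using g r m by (simp add: minpoly_def)
    also have "\<dots> = (\<Sum>i<degree m. coeff r i * x ^ i)"
    proof -
      have "degree r < degree m" using r(3) minpoly_degree[OF K m] by auto
      then show ?thesis unfolding poly_altdef
        by (intro sum.mono_neutral_left) (auto simp: coeff_eq_0)
    qed
    finally show "\<exists>c. (\<forall>i\<in>{..<degree m}. c i \<in> K) \<and> y = (\<Sum>i<degree m. c i * x ^ i)"
      using r(1) by (intro exI[of _ "coeff r"]) (auto simp: pov_def)
  qed (use K in auto)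
qed

text \<open>For algebraic \<open>x\<close> the ring \<open>K[x]\<close> is already a field: if
  \<open>c + X q\<close> is the minimal polynomial of a nonzero \<open>y\<close>, then the inverse
  of \<open>y\<close> is \<open>- q(y) / c\<close>.\<close>

lemma gen_field_simple:
  assumes K: "is_subfield K" and alg: "algebraic_over K x"
  shows "gen_field K {x} = {poly g x | g. pov K g}" (is "_ = ?S'")
proof -
  define S where "S = ?S'"
  have SI: "poly g x \<in> S" if "pov K g" for g using that by (auto simp: S_def)
  have SE: "\<exists>g. pov K g \<and> y = poly g x" if "y \<in> S" for y using that by (auto simp: S_def)
  have "S \<subseteq> gen_field K {x}"
  proof
    fix y assume "y \<in> S"
    then obtain g where "pov K g" "y = poly g x" using SE by blast
    then show "y \<in> gen_field K {x}"
      using poly_in[OF subfield_gen_field pov_mono[OF _ gen_field_incl(1)]] gen_field_incl(2)[of "{x}" K] by auto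
  qed
  have pw: "y ^ n \<in> S" if "y \<in> S" for y n
    using SE[OF that] SI pov_power[OF K] by (metis poly_power)
  have mul: "y * z \<in> S" if "y \<in> S" "z \<in> S" for y z
    using SE[OF that(1)] SE[OF that(2)] SI pov_mult[OF K] by (metis poly_mult)
  have const: "c \<in> S" if "c \<in> K" for c using SI[of "[:c:]"] that K by simp
  have add: "y + z \<in> S" if "y \<in> S" "z \<in> S" for y z
    using SE[OF that(1)] SE[OF that(2)] SI pov_add[OF K] by (metis poly_add)
  have neg: "- y \<in> S" if "y \<in> S" for y
    using SE[OF that] SI pov_uminus[OF K] by (metis poly_minus)
  have "is_subfield S"
  proof (rule is_subfieldI)
    fix y assume y: "y \<in> S" "y \<noteq> 0"
    have "algebraic_over K y" using pw[OF y(1)] simple_span[OF K alg] unfolding S_def by (rule finite_dim_algebraic[OF K])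
    then obtain m where m: "minpoly K y m" using minpoly_exists[OF K] by blast
    obtain c q where cq: "m = pCons c q" by (cases m)
    have cK: "c \<in> K" and q: "pov K q" using m K by (auto simp: minpoly_def cq)
    \<comment> \<open>With \<open>c = 0\<close> the polynomial \<open>q\<close>, of smaller degree,
      would vanish at \<open>y\<close>.\<close>
    have "c \<noteq> 0"
    proof
      assume "c = 0"
      then have "poly q y = 0" "q \<noteq> 0" using m y(2) by (auto simp: minpoly_def cq)
      then obtain s where "q = s * m" "s \<noteq> 0" using m q by (auto simp: minpoly_def)
      then have "degree q \<ge> degree m" using m by (simp add: degree_mult_eq minpoly_def)
      then show False using \<open>q \<noteq> 0\<close> by (simp add: cq)
    qed
    then have "inverse y = poly q y * (- inverse c)"
      using m y(2) by (simp add: minpoly_def cq field_simps) (metis add.commute eq_neg_iff_add_eq_0 mult.commute)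
    moreover have "poly q y \<in> S"
      using SE[OF y(1)] q SI pov_pcompose[OF K q] by (metis poly_pcompose)
    moreover have "- inverse c \<in> S" using cK subfieldD[OF K] by (intro const) auto
    ultimately show "inverse y \<in> S" using mul by metis
  qed (use const subfieldD(1,2)[OF K] add mul neg in simp_all)
  moreover have "x \<in> S" using SI[of "[:0, 1:]"] K subfieldD(1,2)[OF K] by simp
  ultimately have "gen_field K {x} \<subseteq> S" using const by (intro gen_field_least) auto
  with \<open>S \<subseteq> gen_field K {x}\<close> show ?thesis by (simp add: S_def)
qed

lemma finite_dim_gen_field:
  assumes K: "is_subfield K" and X: "finite X" "\<And>x. x \<in> X \<Longrightarrow> algebraic_over K x"
  shows "finite_dim_over K (gen_field K X)"
  using X
proof (induction X rule: finite_induct)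
  case empty
  then show ?case unfolding gen_field_empty[OF K]
    by (intro finite_dim_overI[where I = "{0::nat}" and e = "\<lambda>_. 1"]) (use subfieldD[OF K] K in auto)
next
  case (insert x X)
  let ?M = "gen_field K X"
  have alg: "algebraic_over ?M x" by (intro algebraic_over_mono[OF insert.prems gen_field_incl(1)]) simp
  have eq: "gen_field K (insert x X) = gen_field ?M {x}"
    using gen_field_Un[of K X "{x}"] by simp
  have "finite_dim_over ?M (gen_field ?M {x})"
    using simple_span[OF subfield_gen_field alg] gen_field_simple[OF subfield_gen_field alg] by simp
  then show ?case unfolding eq
    using insert.IH insert.prems
    by (intro finite_dim_over_tower[OF K subfield_gen_field[of K X] subfield_gen_field gen_field_incl(1)]) auto
qed

lemma finite_dim_subfield_algebraic:
  assumes "is_subfield K" "is_subfield L" "finite_dim_over K L" "x \<in> L"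
  shows "algebraic_over K x"
  using assms by (intro finite_dim_algebraic[where L = L]) (auto intro: subfieldD)

section \<open>Galois extensions\<close>

text \<open>Maps are total on the ambient type and only their values on \<open>K\<close> matter. The
  clause \<open>\<sigma> 1 = 1\<close> rules out the zero map.\<close>

definition hom_on :: "'a::field set \<Rightarrow> ('a \<Rightarrow> 'a) \<Rightarrow> bool" where
  "hom_on K \<sigma> \<longleftrightarrow> \<sigma> 1 = 1 \<and> (\<forall>x\<in>K. \<forall>y\<in>K. \<sigma> (x + y) = \<sigma> x + \<sigma> y \<and> \<sigma> (x * y) = \<sigma> x * \<sigma> y)"

context
  fixes K :: "'a::field set" and \<sigma> :: "'a \<Rightarrow> 'a"
  assumes K: "is_subfield K" and hom: "hom_on K \<sigma>"
begin

lemma hom_on_1: "\<sigma> 1 = 1" and hom_on_add: "x \<in> K \<Longrightarrow> y \<in> K \<Longrightarrow> \<sigma> (x + y) = \<sigma> x + \<sigma> y"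
  and hom_on_mult: "x \<in> K \<Longrightarrow> y \<in> K \<Longrightarrow> \<sigma> (x * y) = \<sigma> x * \<sigma> y"
  using hom by (auto simp: hom_on_def)

lemma hom_on_0: "\<sigma> 0 = 0"
proof -
  have "\<sigma> 0 + \<sigma> 0 = \<sigma> 0 + 0" using hom_on_add[of 0 0] subfieldD(1)[OF K] by (simp only: add_0_right)
  then show ?thesis by (simp only: add_left_cancel)
qed

lemma hom_on_minus: "x \<in> K \<Longrightarrow> \<sigma> (- x) = - \<sigma> x"
  using hom_on_add[of x "-x"] subfieldD[OF K] hom_on_0 by (simp add: add_eq_0_iff)

lemma hom_on_diff: "x \<in> K \<Longrightarrow> y \<in> K \<Longrightarrow> \<sigma> (x - y) = \<sigma> x - \<sigma> y"
  using hom_on_add[of x "-y"] subfieldD[OF K] hom_on_minus by simp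

lemma hom_on_nonzero: "x \<in> K \<Longrightarrow> x \<noteq> 0 \<Longrightarrow> \<sigma> x \<noteq> 0"
  using hom_on_mult[of x "inverse x"] subfieldD[OF K] hom_on_1 by auto

lemma hom_on_inverse: "x \<in> K \<Longrightarrow> \<sigma> (inverse x) = inverse (\<sigma> x)"
proof (cases "x = 0")
  case False
  assume x: "x \<in> K"
  then have "\<sigma> x * \<sigma> (inverse x) = 1"
    using hom_on_mult[of x "inverse x"] subfieldD[OF K] hom_on_1 False by auto
  then show ?thesis by (metis inverse_unique)
qed (simp add: hom_on_0)

lemma hom_on_divide: "x \<in> K \<Longrightarrow> y \<in> K \<Longrightarrow> \<sigma> (x / y) = \<sigma> x / \<sigma> y"
  using hom_on_mult[of x "inverse y"] hom_on_inverse subfieldD[OF K] by (simp add: divide_inverse)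

lemma hom_on_power: "x \<in> K \<Longrightarrow> \<sigma> (x ^ n) = \<sigma> x ^ n"
  by (induction n) (auto simp: hom_on_1 hom_on_mult subfieldD[OF K])

lemma hom_on_of_nat: "\<sigma> (of_nat n) = of_nat n"
  by (induction n) (auto simp: hom_on_0 hom_on_1 hom_on_add subfieldD[OF K])

lemma hom_on_numeral: "\<sigma> (numeral n) = numeral n"
  using hom_on_of_nat[of "numeral n"] by simp

lemma hom_on_sum: "(\<And>i. i \<in> A \<Longrightarrow> f i \<in> K) \<Longrightarrow> \<sigma> (sum f A) = (\<Sum>i\<in>A. \<sigma> (f i))"
  by (induction A rule: infinite_finite_induct)
    (auto simp: hom_on_0 hom_on_add subfield_sum[OF K])

lemma hom_on_prod: "(\<And>i. i \<in> A \<Longrightarrow> f i \<in> K) \<Longrightarrow> \<sigma> (prod f A) = (\<Prod>i\<in>A. \<sigma> (f i))"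
  by (induction A rule: infinite_finite_induct)
    (auto simp: hom_on_1 hom_on_mult subfield_prod[OF K])

lemma hom_on_inj: "inj_on \<sigma> K"
proof (rule inj_onI)
  fix x y assume "x \<in> K" "y \<in> K" "\<sigma> x = \<sigma> y"
  then show "x = y" using hom_on_nonzero[of "x - y"] hom_on_diff subfieldD(4)[OF K] by auto
qed

lemma coeff_map_hom: "coeff (map_poly \<sigma> q) i = \<sigma> (coeff q i)"
  by (simp add: coeff_map_poly hom_on_0)

lemma map_hom_add: "pov K q \<Longrightarrow> pov K r \<Longrightarrow> map_poly \<sigma> (q + r) = map_poly \<sigma> q + map_poly \<sigma> r"
  by (rule poly_eqI) (auto simp: coeff_map_hom hom_on_add povD)

lemma map_hom_mult: "pov K q \<Longrightarrow> pov K r \<Longrightarrow> map_poly \<sigma> (q * r) = map_poly \<sigma> q * map_poly \<sigma> r"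
  by (rule poly_eqI) (auto simp: coeff_map_hom coeff_mult hom_on_sum hom_on_mult povD subfieldD[OF K])

lemma map_hom_prod: "(\<And>i. i \<in> A \<Longrightarrow> pov K (f i)) \<Longrightarrow> map_poly \<sigma> (prod f A) = (\<Prod>i\<in>A. map_poly \<sigma> (f i))"
proof (induction A rule: infinite_finite_induct)
  case (insert x F)
  then show ?case by (auto simp: map_hom_mult pov_prod[OF K])
qed (auto simp: map_poly_1' hom_on_1)

lemma map_hom_poly: "pov K q \<Longrightarrow> x \<in> K \<Longrightarrow> \<sigma> (poly q x) = poly (map_poly \<sigma> q) (\<sigma> x)"
proof (induction q)
  case 0
  then show ?case by (simp add: hom_on_0)
next
  case (pCons c q)
  then have "pov K q" "c \<in> K" using K by auto
  with pCons show ?case using poly_in[OF K, of q x] subfieldD[OF K]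
    by (simp add: map_poly_pCons hom_on_0 hom_on_add hom_on_mult)
qed

lemma degree_map_hom: "pov K q \<Longrightarrow> degree (map_poly \<sigma> q) = degree q"
proof (cases "q = 0")
  case False
  assume q: "pov K q"
  have "\<sigma> (lead_coeff q) \<noteq> 0" using hom_on_nonzero povD[OF q] False by simp
  then have "degree q \<le> degree (map_poly \<sigma> q)" by (intro le_degree) (simp add: coeff_map_hom)
  moreover have "degree (map_poly \<sigma> q) \<le> degree q"
    by (rule degree_le) (auto simp: coeff_map_hom coeff_eq_0 hom_on_0)
  ultimately show ?thesis by simp
qed simp

lemma subfield_hom_image: "is_subfield (\<sigma> ` K)"
proof (rule is_subfieldI)
  show "0 \<in> \<sigma> ` K" using hom_on_0 subfieldD(1)[OF K] by force
  show "1 \<in> \<sigma> ` K" using hom_on_1 subfieldD(2)[OF K] by force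
  show "x + y \<in> \<sigma> ` K" if xy: "x \<in> \<sigma> ` K" "y \<in> \<sigma> ` K" for x y
  proof -
    from xy obtain u v where "u \<in> K" "v \<in> K" "x = \<sigma> u" "y = \<sigma> v" by blast
    then show ?thesis using hom_on_add[of u v] subfieldD(3)[OF K, of u v] by (auto intro!: image_eqI[of _ _ "u + v"])
  qed
  show "x * y \<in> \<sigma> ` K" if xy: "x \<in> \<sigma> ` K" "y \<in> \<sigma> ` K" for x y
  proof -
    from xy obtain u v where "u \<in> K" "v \<in> K" "x = \<sigma> u" "y = \<sigma> v" by blast
    then show ?thesis using hom_on_mult[of u v] subfieldD(5)[OF K, of u v] by (auto intro!: image_eqI[of _ _ "u * v"])
  qed
  show "- x \<in> \<sigma> ` K" if "x \<in> \<sigma> ` K" for x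
    using that hom_on_minus subfieldD(7)[OF K] by force
  show "inverse x \<in> \<sigma> ` K" if "x \<in> \<sigma> ` K" for x
    using that hom_on_inverse subfieldD(6)[OF K] by force
qed

lemma subfield_hom_preimage: "is_subfield S \<Longrightarrow> is_subfield {x \<in> K. \<sigma> x \<in> S}"
  by (rule is_subfieldI)
    (auto simp: hom_on_0 hom_on_1 hom_on_add hom_on_minus hom_on_mult hom_on_inverse subfieldD[OF K] intro: subfieldD)

end

lemma hom_on_subset: "hom_on K \<sigma> \<Longrightarrow> S \<subseteq> K \<Longrightarrow> hom_on S \<sigma>"
  by (auto simp: hom_on_def)

text \<open>\<open>\<sigma>'\<close> applies \<open>\<sigma>\<close> to the coefficients of a
  polynomial representing the element and evaluates at \<open>\<beta>\<close>. Two representatives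
  differ by a multiple of \<open>m\<close>, whose image vanishes at \<open>\<beta>\<close>, so the
  choice does not matter.\<close>

lemma extend_hom_simple:
  fixes B :: "'a::field set"
  assumes B: "is_subfield B" and h: "hom_on B \<sigma>" and m: "minpoly B l m" and root: "poly (map_poly \<sigma> m) \<beta> = 0"
  shows "\<exists>\<sigma>'. hom_on (gen_field B {l}) \<sigma>' \<and> (\<forall>x\<in>B. \<sigma>' x = \<sigma> x) \<and> \<sigma>' l = \<beta>"
proof -
  define \<sigma>' where "\<sigma>' y = poly (map_poly \<sigma> (SOME g. pov B g \<and> y = poly g l)) \<beta>" for y
  have key: "\<sigma>' (poly g l) = poly (map_poly \<sigma> g) \<beta>" if g: "pov B g" for g
  proof -
    define g' where "g' = (SOME g'. pov B g' \<and> poly g l = poly g' l)"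
    have g': "pov B g' \<and> poly g l = poly g' l" unfolding g'_def by (rule someI[of _ g]) (use g in auto)
    then have d: "pov B (g' - g)" "poly (g' - g) l = 0" using g by (auto intro: pov_diff[OF B])
    then obtain s where s: "pov B s" "g' - g = s * m" using m by (auto simp: minpoly_def)
    have "g' = g + s * m" using s by (simp add: algebra_simps)
    then have "map_poly \<sigma> g' = map_poly \<sigma> g + map_poly \<sigma> s * map_poly \<sigma> m"
      using g s m by (simp add: map_hom_add[OF B h] map_hom_mult[OF B h] pov_mult[OF B] minpoly_def)
    then show ?thesis using root by (simp add: \<sigma>'_def flip: g'_def)
  qed
  have alg: "algebraic_over B l" using m by (auto simp: minpoly_def algebraic_over_pov)
  have "hom_on (gen_field B {l}) \<sigma>'"
    unfolding hom_on_def gen_field_simple[OF B alg]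
  proof (intro conjI ballI)
    show "\<sigma>' 1 = 1" using key[of 1] B by (simp add: map_poly_1' hom_on_1[OF B h])
    fix x y assume "x \<in> {poly g l |g. pov B g}" "y \<in> {poly g l |g. pov B g}"
    then obtain g r where gr: "x = poly g l" "y = poly r l" "pov B g" "pov B r" by auto
    show "\<sigma>' (x + y) = \<sigma>' x + \<sigma>' y"
      using key[OF pov_add[OF B gr(3,4)]] key[OF gr(3)] key[OF gr(4)] by (simp add: gr map_hom_add[OF B h])
    show "\<sigma>' (x * y) = \<sigma>' x * \<sigma>' y"
      using key[OF pov_mult[OF B gr(3,4)]] key[OF gr(3)] key[OF gr(4)] by (simp add: gr map_hom_mult[OF B h])
  qed
  moreover have "\<sigma>' x = \<sigma> x" if "x \<in> B" for x
    using key[of "[:x:]"] that B by (simp add: map_poly_pCons hom_on_0[OF B h])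
  moreover have "\<sigma>' l = \<beta>"
    using key[of "[:0, 1:]"] B subfieldD[OF B] by (simp add: map_poly_pCons hom_on_0[OF B h] hom_on_1[OF B h])
  ultimately show ?thesis by blast
qed

text \<open>Generators are adjoined one by one; algebraic closedness of the ambient field provides a
  root of the transported minimal polynomial.\<close>

lemma extend_hom_finite:
  fixes B :: "'a::field set"
  assumes ac: "\<And>q::'a poly. degree q \<ge> 1 \<Longrightarrow> \<exists>x. poly q x = 0"
    and B: "is_subfield B" and h: "hom_on B \<sigma>" and X: "finite X" "\<And>x. x \<in> X \<Longrightarrow> algebraic_over B x"
  shows "\<exists>\<sigma>'. hom_on (gen_field B X) \<sigma>' \<and> (\<forall>x\<in>B. \<sigma>' x = \<sigma> x)"
  using X
proof (induction X rule: finite_induct)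
  case empty
  then show ?case using h gen_field_empty[OF B] by auto
next
  case (insert x X)
  let ?M = "gen_field B X"
  obtain \<sigma>1 where s1: "hom_on ?M \<sigma>1" "\<forall>x\<in>B. \<sigma>1 x = \<sigma> x" using insert by auto
  have alg: "algebraic_over ?M x" by (intro algebraic_over_mono[OF insert.prems gen_field_incl(1)]) simp
  obtain m where m: "minpoly ?M x m" using minpoly_exists[OF subfield_gen_field alg] .
  have "degree (map_poly \<sigma>1 m) \<ge> 1"
    using degree_map_hom[OF subfield_gen_field s1(1), of m] m minpoly_degree[OF subfield_gen_field m] by (auto simp: minpoly_def)
  then obtain \<beta> where "poly (map_poly \<sigma>1 m) \<beta> = 0" using ac by blast
  from extend_hom_simple[OF subfield_gen_field s1(1) m this] obtain \<sigma>2 where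
    s2: "hom_on (gen_field ?M {x}) \<sigma>2" "\<forall>x\<in>?M. \<sigma>2 x = \<sigma>1 x" by blast
  have eq: "gen_field B (insert x X) = gen_field ?M {x}"
    using gen_field_Un[of B X "{x}"] by simp
  have "\<forall>x\<in>B. \<sigma>2 x = \<sigma> x" using s1 s2 gen_field_incl(1)[of B X] by auto
  then show ?case using s2 eq by auto
qed

lemma aut_overD:
  assumes "\<sigma> \<in> aut_over F K" "is_subfield F"
  shows "hom_on K \<sigma>" "bij_betw \<sigma> K K" "\<And>x. x \<in> F \<Longrightarrow> \<sigma> x = x" "x \<in> K \<Longrightarrow> \<sigma> x \<in> K" "\<sigma> ` K = K"
proof -
  show b: "bij_betw \<sigma> K K" using assms(1) by (simp add: aut_over_def)
  show "hom_on K \<sigma>" using assms subfieldD(2)[OF assms(2)] by (auto simp: aut_over_def hom_on_def)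
  show "\<And>x. x \<in> F \<Longrightarrow> \<sigma> x = x" using assms by (auto simp: aut_over_def)
  show "x \<in> K \<Longrightarrow> \<sigma> x \<in> K" "\<sigma> ` K = K" using b by (auto simp: bij_betw_def)
qed

lemma aut_overI: "hom_on K \<sigma> \<Longrightarrow> bij_betw \<sigma> K K \<Longrightarrow> (\<And>x. x \<in> F \<Longrightarrow> \<sigma> x = x) \<Longrightarrow> \<sigma> \<in> aut_over F K"
  by (auto simp: aut_over_def hom_on_def)

lemma id_aut_over: "id \<in> aut_over F K"
  by (auto simp: aut_over_def)

lemma comp_aut_over: "\<sigma> \<in> aut_over F K \<Longrightarrow> \<tau> \<in> aut_over F K \<Longrightarrow> \<sigma> \<circ> \<tau> \<in> aut_over F K"
  by (auto simp: aut_over_def intro: bij_betw_trans dest: bij_betwE)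

lemma inv_aut_over:
  assumes s: "\<sigma> \<in> aut_over F K" and F: "is_subfield F" "F \<subseteq> K" and K: "is_subfield K"
  shows "inv_into K \<sigma> \<in> aut_over F K" "x \<in> K \<Longrightarrow> inv_into K \<sigma> (\<sigma> x) = x" "x \<in> K \<Longrightarrow> \<sigma> (inv_into K \<sigma> x) = x"
proof -
  note D = aut_overD[OF s F(1)]
  have inj: "inj_on \<sigma> K" using D(2) by (simp add: bij_betw_def)
  show 1: "x \<in> K \<Longrightarrow> inv_into K \<sigma> (\<sigma> x) = x" for x using inj by simp
  show 2: "x \<in> K \<Longrightarrow> \<sigma> (inv_into K \<sigma> x) = x" for x using D(5) by (auto intro: f_inv_into_f)
  have 3: "x \<in> K \<Longrightarrow> inv_into K \<sigma> x \<in> K" for x using D(5) by (metis inv_into_into)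
  show "inv_into K \<sigma> \<in> aut_over F K"
    unfolding aut_over_def
  proof (intro CollectI conjI ballI)
    show "bij_betw (inv_into K \<sigma>) K K" using D(2) by (rule bij_betw_inv_into)
    show "inv_into K \<sigma> x = x" if "x \<in> F" for x using 1[of x] D(3)[OF that] that F by auto
    fix x y assume xy: "x \<in> K" "y \<in> K"
    have "\<sigma> (inv_into K \<sigma> x + inv_into K \<sigma> y) = x + y"
      using xy by (simp add: hom_on_add[OF K D(1)] 2 3)
    then show "inv_into K \<sigma> (x + y) = inv_into K \<sigma> x + inv_into K \<sigma> y"
      using 1 3 xy subfieldD(3)[OF K] by metis
    have "\<sigma> (inv_into K \<sigma> x * inv_into K \<sigma> y) = x * y"
      using xy by (simp add: hom_on_mult[OF K D(1)] 2 3)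
    then show "inv_into K \<sigma> (x * y) = inv_into K \<sigma> x * inv_into K \<sigma> y"
      using 1 3 xy subfieldD(5)[OF K] by metis
  qed
qed

text \<open>\<open>aut_over F K\<close> is in general an infinite set, since its members are
  arbitrary outside \<open>K\<close>. Traces and norms are therefore taken over the finite set of
  conjugates, each counted once.\<close>

definition orb :: "'a::field set \<Rightarrow> 'a set \<Rightarrow> 'a \<Rightarrow> 'a set" where
  "orb F K x = {\<sigma> x | \<sigma>. \<sigma> \<in> aut_over F K}"

context
  fixes F K :: "'a::field set"
  assumes gal: "finite_galois_ext F K"
begin

lemma galD: "is_subfield F" "is_subfield K" "F \<subseteq> K" "finite_dim_over F K"
  and galois_fixed: "x \<in> K \<Longrightarrow> (\<And>\<sigma>. \<sigma> \<in> aut_over F K \<Longrightarrow> \<sigma> x = x) \<Longrightarrow> x \<in> F"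
  using gal by (auto simp: finite_galois_ext_def)

lemma gal_algebraic: "x \<in> K \<Longrightarrow> algebraic_over F x"
  using finite_dim_subfield_algebraic galD by blast

lemma map_aut_pov: "\<sigma> \<in> aut_over F K \<Longrightarrow> pov F q \<Longrightarrow> map_poly \<sigma> q = q"
  by (rule poly_eqI) (auto simp: coeff_map_hom[OF galD(2) aut_overD(1)] aut_overD(3) galD povD)

lemma aut_root:
  "\<sigma> \<in> aut_over F K \<Longrightarrow> pov F q \<Longrightarrow> x \<in> K \<Longrightarrow> poly q x = 0 \<Longrightarrow> poly q (\<sigma> x) = 0"
  using map_hom_poly[OF galD(2) aut_overD(1)[OF _ galD(1)], of \<sigma> q x] map_aut_pov[of \<sigma> q] pov_mono[OF _ galD(3), of q]
    hom_on_0[OF galD(2) aut_overD(1)[OF _ galD(1)], of \<sigma>] by simp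

lemma orb_self: "x \<in> orb F K x"
proof -
  have "id x \<in> orb F K x" unfolding orb_def using id_aut_over by blast
  then show ?thesis by simp
qed

lemma orb_sub: "x \<in> K \<Longrightarrow> orb F K x \<subseteq> K"
  unfolding orb_def using aut_overD(4) galD(1) by blast

lemma finite_orb: "x \<in> K \<Longrightarrow> finite (orb F K x)"
proof -
  assume x: "x \<in> K"
  obtain q where q: "q \<noteq> 0" "pov F q" "poly q x = 0" using gal_algebraic[OF x] by (auto simp: algebraic_over_pov)
  have "orb F K x \<subseteq> {y. poly q y = 0}" using aut_root[OF _ q(2) x q(3)] by (auto simp: orb_def)
  then show ?thesis using poly_roots_finite[OF q(1)] finite_subset by blast
qed

lemma aut_orb: "x \<in> K \<Longrightarrow> \<sigma> \<in> aut_over F K \<Longrightarrow> \<sigma> ` orb F K x = orb F K x"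
proof
  assume x: "x \<in> K" and s: "\<sigma> \<in> aut_over F K"
  show "\<sigma> ` orb F K x \<subseteq> orb F K x"
  proof
    fix y assume "y \<in> \<sigma> ` orb F K x"
    then obtain \<tau> where t: "\<tau> \<in> aut_over F K" "y = (\<sigma> \<circ> \<tau>) x" by (auto simp: orb_def)
    then show "y \<in> orb F K x" using comp_aut_over[OF s t(1)] unfolding orb_def by blast
  qed
  show "orb F K x \<subseteq> \<sigma> ` orb F K x"
  proof
    fix y assume y: "y \<in> orb F K x"
    then obtain \<tau> where t: "\<tau> \<in> aut_over F K" "y = \<tau> x" by (auto simp: orb_def)
    have yK: "y \<in> K" using y orb_sub[OF x] by blast
    have "(inv_into K \<sigma> \<circ> \<tau>) x \<in> orb F K x"
      using comp_aut_over[OF inv_aut_over(1)[OF s galD(1,3,2)] t(1)] unfolding orb_def by blast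
    moreover have "\<sigma> ((inv_into K \<sigma> \<circ> \<tau>) x) = y" using inv_aut_over(3)[OF s galD(1,3,2) yK] t by simp
    ultimately show "y \<in> \<sigma> ` orb F K x" by (metis imageI)
  qed
qed

lemma aut_inj_orb: "x \<in> K \<Longrightarrow> \<sigma> \<in> aut_over F K \<Longrightarrow> inj_on \<sigma> (orb F K x)"
  using aut_overD(2)[OF _ galD(1)] orb_sub by (metis bij_betw_def inj_on_subset)

lemma orb_sum_in: "x \<in> K \<Longrightarrow> (\<Sum>y\<in>orb F K x. y) \<in> F"
proof (rule galois_fixed)
  assume x: "x \<in> K"
  then show "(\<Sum>y\<in>orb F K x. y) \<in> K" using orb_sub by (intro subfield_sum galD) auto
  fix \<sigma> assume s: "\<sigma> \<in> aut_over F K"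
  have "\<sigma> (\<Sum>y\<in>orb F K x. y) = (\<Sum>y\<in>orb F K x. \<sigma> y)"
    using orb_sub[OF x] by (intro hom_on_sum[OF galD(2) aut_overD(1)[OF s galD(1)]]) auto
  also have "\<dots> = (\<Sum>y\<in>\<sigma> ` orb F K x. y)" by (simp add: sum.reindex[OF aut_inj_orb[OF x s]])
  finally show "\<sigma> (\<Sum>y\<in>orb F K x. y) = (\<Sum>y\<in>orb F K x. y)" using aut_orb[OF x s] by simp
qed

lemma orb_prod_in: "x \<in> K \<Longrightarrow> (\<Prod>y\<in>orb F K x. y) \<in> F"
proof (rule galois_fixed)
  assume x: "x \<in> K"
  then show "(\<Prod>y\<in>orb F K x. y) \<in> K" using orb_sub by (intro subfield_prod galD) auto
  fix \<sigma> assume s: "\<sigma> \<in> aut_over F K"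
  have "\<sigma> (\<Prod>y\<in>orb F K x. y) = (\<Prod>y\<in>orb F K x. \<sigma> y)"
    using orb_sub[OF x] by (intro hom_on_prod[OF galD(2) aut_overD(1)[OF s galD(1)]]) auto
  also have "\<dots> = (\<Prod>y\<in>\<sigma> ` orb F K x. y)" by (simp add: prod.reindex[OF aut_inj_orb[OF x s]])
  finally show "\<sigma> (\<Prod>y\<in>orb F K x. y) = (\<Prod>y\<in>orb F K x. y)" using aut_orb[OF x s] by simp
qed

text \<open>This is the separable polynomial whose roots are the conjugates of \<open>x\<close>. Its
  coefficients are fixed because automorphisms permute the orbit.\<close>

lemma orb_poly_pov: "x \<in> K \<Longrightarrow> pov F (\<Prod>y\<in>orb F K x. [:-y, 1:])"
  unfolding pov_def
proof (intro allI galois_fixed)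
  fix i assume x: "x \<in> K"
  let ?q = "\<Prod>y\<in>orb F K x. [:-y, 1:]"
  have pov: "y \<in> orb F K x \<Longrightarrow> pov K [:-y, 1:]" for y
    using orb_sub[OF x] galD(2) by (auto intro: subfieldD)
  show "coeff ?q i \<in> K" by (rule povD[OF pov_prod[OF galD(2) pov]])
  fix \<sigma> assume s: "\<sigma> \<in> aut_over F K"
  note h = galD(2) aut_overD(1)[OF s galD(1)]
  have "map_poly \<sigma> ?q = (\<Prod>y\<in>orb F K x. map_poly \<sigma> [:-y, 1:])" by (rule map_hom_prod[OF h pov])
  also have "\<dots> = (\<Prod>y\<in>orb F K x. [:-\<sigma> y, 1:])"
    using orb_sub[OF x] by (intro prod.cong) (auto simp: map_poly_pCons hom_on_0[OF h] hom_on_1[OF h] hom_on_minus[OF h])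
  also have "\<dots> = (\<Prod>y\<in>\<sigma> ` orb F K x. [:-y, 1:])" by (simp add: prod.reindex[OF aut_inj_orb[OF x s]])
  also have "\<dots> = ?q" using aut_orb[OF x s] by simp
  finally show "\<sigma> (coeff ?q i) = coeff ?q i" by (metis coeff_map_hom[OF h])
qed

lemma gal_root_in_orb:
  assumes x: "x \<in> K" and y: "poly (\<Prod>y\<in>orb F K x. [:-y, 1:]) y = 0"
  shows "y \<in> orb F K x"
  using y finite_orb[OF x] by (auto simp: poly_prod)

end

text \<open>The elements that \<open>\<sigma>\<close> maps into the field form a subfield, and so
  does the image of the field; both contain \<open>K\<close> and \<open>X\<close>.\<close>

lemma gen_field_image:
  assumes K: "is_subfield K" and h: "hom_on (gen_field K X) \<sigma>" and fx: "\<And>x. x \<in> K \<Longrightarrow> \<sigma> x = x"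
    and X: "\<sigma> ` X = X"
  shows "bij_betw \<sigma> (gen_field K X) (gen_field K X)"
proof -
  let ?L = "gen_field K X"
  have "?L \<subseteq> {x \<in> ?L. \<sigma> x \<in> ?L}"
  proof (rule gen_field_least)
    show "is_subfield {x \<in> ?L. \<sigma> x \<in> ?L}"
      by (rule subfield_hom_preimage[OF subfield_gen_field h subfield_gen_field])
    show "K \<subseteq> {x \<in> ?L. \<sigma> x \<in> ?L}" using fx gen_field_incl(1)[of K X] by auto
    show "X \<subseteq> {x \<in> ?L. \<sigma> x \<in> ?L}" using X gen_field_incl(2)[of X K] by blast
  qed
  moreover have "?L \<subseteq> \<sigma> ` ?L"
  proof (rule gen_field_least)
    show "is_subfield (\<sigma> ` ?L)" by (rule subfield_hom_image[OF subfield_gen_field h])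
    show "K \<subseteq> \<sigma> ` ?L"
    proof
      fix x assume "x \<in> K"
      then show "x \<in> \<sigma> ` ?L" using fx[of x] gen_field_incl(1)[of K X] by (intro image_eqI[of _ _ x]) auto
    qed
    show "X \<subseteq> \<sigma> ` ?L" using X gen_field_incl(2)[of X K] by blast
  qed
  ultimately show ?thesis using hom_on_inj[OF subfield_gen_field h] by (auto simp: bij_betw_def)
qed

text \<open>The coordinates of a point over the maximal abelian extension may lie in two different
  finite abelian extensions, and putting the curve into normal form enlarges the base field to
  \<open>F'\<close>; this lemma handles both. An automorphism of the compositum over
  \<open>F'\<close> is determined by its restrictions to \<open>K1\<close> and \<open>K2\<close>,
  and there automorphisms commute.\<close>

lemma abelian_compositum:
  fixes F F' K1 K2 :: "'a::field set"
  assumes ac: "\<And>q::'a poly. degree q \<ge> 1 \<Longrightarrow> \<exists>x. poly q x = 0"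
    and K1: "finite_abelian_ext F K1" and K2: "finite_abelian_ext F K2"
    and F': "is_subfield F'" "F \<subseteq> F'"
  shows "\<exists>L. finite_abelian_ext F' L \<and> K1 \<subseteq> L \<and> K2 \<subseteq> L"
proof -
  have gal: "finite_galois_ext F K" if "K \<in> {K1, K2}" for K
    using that K1 K2 by (auto simp: finite_abelian_ext_def)
  have comm: "\<sigma> (\<tau> x) = \<tau> (\<sigma> x)" if "K \<in> {K1, K2}" "\<sigma> \<in> aut_over F K" "\<tau> \<in> aut_over F K" "x \<in> K" for K \<sigma> \<tau> x
    using that K1 K2 by (auto simp: finite_abelian_ext_def)
  note g = galD[OF gal]
  have F: "is_subfield F" using g by blast
  from g(4) obtain B where B: "\<And>K. K \<in> {K1, K2} \<Longrightarrow> spans_over F (B K) K"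
    unfolding finite_dim_over_spans by metis
  \<comment> \<open>All conjugates of spanning sets of \<open>K1\<close> and \<open>K2\<close>.
    Taking the conjugates as well makes the generating set stable under every homomorphism over
    \<open>F'\<close>.\<close>
  define X where "X = (\<Union>K\<in>{K1, K2}. \<Union>x\<in>B K. orb F K x)"
  have BK: "B K \<subseteq> K" "finite (B K)" if "K \<in> {K1, K2}" for K
    using B[OF that] by (auto simp: spans_over_def)
  have finX: "finite X"
    unfolding X_def using finite_orb[OF gal] BK by (intro finite_UN_I) auto
  have sep: "\<exists>Y. finite Y \<and> Y \<subseteq> X \<and> x \<in> Y \<and> pov F (\<Prod>y\<in>Y. [:-y, 1:])" if x: "x \<in> X" for x
  proof -
    from x obtain K b where Kb: "K \<in> {K1, K2}" "b \<in> B K" "x \<in> orb F K b" unfolding X_def by blast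
    have bK: "b \<in> K" using Kb BK by blast
    show ?thesis
    proof (intro exI conjI)
      show "finite (orb F K b)" by (rule finite_orb[OF gal[OF Kb(1)] bK])
      show "orb F K b \<subseteq> X" unfolding X_def using Kb by blast
      show "pov F (\<Prod>y\<in>orb F K b. [:-y, 1:])" by (rule orb_poly_pov[OF gal[OF Kb(1)] bK])
    qed fact
  qed
  define L where "L = gen_field F' X"
  have L: "is_subfield L" unfolding L_def by (rule subfield_gen_field)
  have F'L: "F' \<subseteq> L" and XL: "X \<subseteq> L" unfolding L_def by (rule gen_field_incl)+
  have KL: "K \<subseteq> L" if K: "K \<in> {K1, K2}" for K
  proof
    fix x assume "x \<in> K"
    then obtain c where c: "\<forall>b\<in>B K. c b \<in> F" "x = (\<Sum>b\<in>B K. c b * b)"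
      using B[OF K] by (auto simp: spans_over_def)
    have "b \<in> X" if "b \<in> B K" for b
      unfolding X_def using that K orb_self[OF gal[OF K], of b] by blast
    then show "x \<in> L" unfolding c(2) using c(1) F' F'L XL by (intro subfield_sum[OF L] subfieldD(5)[OF L]) auto
  qed
  have algX: "algebraic_over F x" if x: "x \<in> X" for x
  proof -
    obtain Y where Y: "finite Y" "x \<in> Y" "pov F (\<Prod>y\<in>Y. [:-y, 1:])" using sep[OF x] by blast
    have "(\<Prod>y\<in>Y. [:-y, 1:]) \<noteq> 0" using Y(1) by simp
    moreover have "poly (\<Prod>y\<in>Y. [:-y, 1:]) x = 0" using Y by (auto simp: poly_prod)
    ultimately show ?thesis using Y(3) unfolding algebraic_over_pov by blast
  qed
  have fd: "finite_dim_over F' L"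
    unfolding L_def using algX algebraic_over_mono[OF _ F'(2)] by (intro finite_dim_gen_field F' finX) auto
  \<comment> \<open>\<open>X\<close> is a union of complete root sets of polynomials over
    \<open>F\<close>, so it is mapped into itself, and finiteness turns this into equality.\<close>
  have permX: "\<sigma> ` X = X" if h: "hom_on L \<sigma>" and fx: "\<And>x. x \<in> F' \<Longrightarrow> \<sigma> x = x" for \<sigma>
  proof -
    have "\<sigma> x \<in> X" if x: "x \<in> X" for x
    proof -
      obtain Y where Y: "finite Y" "Y \<subseteq> X" "x \<in> Y" "pov F (\<Prod>y\<in>Y. [:-y, 1:])" using sep[OF x] by blast
      let ?q = "\<Prod>y\<in>Y. [:-y, 1:]"
      have pL: "pov L ?q" using pov_mono[OF Y(4)] F'(2) F'L by blast
      have "map_poly \<sigma> ?q = ?q"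
        by (rule poly_eqI) (use fx povD[OF Y(4)] F'(2) in \<open>auto simp: coeff_map_hom[OF L h]\<close>)
      moreover have "poly ?q x = 0" using Y by (auto simp: poly_prod)
      ultimately have "poly ?q (\<sigma> x) = 0"
        using map_hom_poly[OF L h pL, of x] x XL hom_on_0[OF L h] by auto
      then show ?thesis using Y(1,2) by (auto simp: poly_prod)
    qed
    then have "\<sigma> ` X \<subseteq> X" by blast
    then show ?thesis using finX hom_on_inj[OF L h] XL by (metis card_image card_subset_eq inj_on_subset)
  qed
  have aut: "\<sigma> \<in> aut_over F' L" if h: "hom_on L \<sigma>" and fx: "\<And>x. x \<in> F' \<Longrightarrow> \<sigma> x = x" for \<sigma>
    using h fx gen_field_image[OF F'(1), of X \<sigma>] permX[OF h fx] by (intro aut_overI) (auto simp: L_def)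
  \<comment> \<open>The fixed field is \<open>F'\<close>: generators are removed one at a time.
    Writing \<open>t = g(l)\<close> with \<open>degree g < degree m\<close>, each root of
    \<open>m\<close> is the image of \<open>l\<close> under some automorphism, so
    \<open>g - t\<close> has at least \<open>degree m\<close> roots and is zero.\<close>
  have fixed: "t \<in> F'" if "Y \<subseteq> X" "t \<in> gen_field F' Y" and tf: "\<And>\<sigma>. \<sigma> \<in> aut_over F' L \<Longrightarrow> \<sigma> t = t" for t Y
  proof -
    have "finite Y" using that(1) finX finite_subset by blast
    then show ?thesis using that(1,2)
    proof (induction Y rule: finite_induct)
      case empty
      then show ?case using gen_field_empty[OF F'(1)] by simp
    next
      case (insert l Y)
      define M where "M = gen_field F' Y"
      have M: "is_subfield M" unfolding M_def by (rule subfield_gen_field)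
      have F'M: "F' \<subseteq> M" unfolding M_def by (rule gen_field_incl)
      have eq: "gen_field F' (insert l Y) = gen_field M {l}"
        using gen_field_Un[of F' Y "{l}"] by (simp add: M_def)
      have FM: "F \<subseteq> M" using F'(2) F'M by blast
      have algl: "algebraic_over M l" by (rule algebraic_over_mono[OF algX FM]) (use insert.prems in blast)
      obtain m where m: "minpoly M l m" using minpoly_exists[OF M algl] .
      have "t \<in> {poly g l | g. pov M g}" using insert.prems eq gen_field_simple[OF M algl] by simp
      then obtain g0 where g0: "pov M g0" "t = poly g0 l" by blast
      from pov_division[OF M, of m g0] m g0 obtain q g where
        g: "pov M g" "g0 = q * m + g" "g = 0 \<or> degree g < degree m" by (auto simp: minpoly_def)
      have tg: "t = poly g l" using g g0 m by (simp add: minpoly_def)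
      have dg: "degree g < degree m" using g(3) minpoly_degree[OF M m] by auto
      obtain Z where Z: "finite Z" "Z \<subseteq> X" "l \<in> Z" "pov F (\<Prod>y\<in>Z. [:-y, 1:])" using sep[of l] insert.prems by blast
      let ?w = "\<Prod>y\<in>Z. [:-y, 1:]"
      have "pov M ?w" using pov_mono[OF Z(4)] F' F'M by blast
      moreover have "poly ?w l = 0" using Z by (auto simp: poly_prod)
      ultimately obtain s where s: "?w = s * m" using m by (auto simp: minpoly_def)
      have w0: "?w \<noteq> 0" using Z by simp
      then have sm: "s \<noteq> 0" "m \<noteq> 0" using s by auto
      \<comment> \<open>The product \<open>s * m\<close> has \<open>card Z\<close> distinct roots,
        as many as its degree; \<open>s\<close> accounts for at most \<open>degree s\<close> of
        them, which leaves \<open>degree m\<close> roots for \<open>m\<close>.\<close>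
      have "Z \<subseteq> {x. poly s x = 0} \<union> {x. poly m x = 0}"
      proof
        fix z assume "z \<in> Z"
        then have "poly ?w z = 0" using Z by (auto simp: poly_prod)
        then show "z \<in> {x. poly s x = 0} \<union> {x. poly m x = 0}" unfolding s by auto
      qed
      then have "card Z \<le> card {x. poly s x = 0} + card {x. poly m x = 0}"
        using card_mono[OF finite_UnI[OF poly_roots_finite[OF sm(1)] poly_roots_finite[OF sm(2)]]] card_Un_le le_trans by blast
      also have "card {x. poly s x = 0} \<le> degree s" by (rule card_poly_roots_bound[OF sm(1)])
      finally have "card Z \<le> degree s + card {x. poly m x = 0}" by simp
      moreover have "card Z = degree s + degree m"
      proof -
        have "degree ?w = (\<Sum>y\<in>Z. degree [:-y, 1:])" by (rule degree_prod_eq_sum_degree) auto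
        then show ?thesis using degree_mult_eq[OF sm] s by simp
      qed
      ultimately have cm: "degree m \<le> card {x. poly m x = 0}" by simp
      have same: "poly g l' = t" if l': "poly m l' = 0" for l'
      proof -
        have hid: "hom_on M (\<lambda>x. x)" by (simp add: hom_on_def)
        have "map_poly (\<lambda>x. x) m = m" by (rule poly_eqI) (simp add: coeff_map_poly)
        with l' have "poly (map_poly (\<lambda>x. x) m) l' = 0" by simp
        from extend_hom_simple[OF M hid m this] obtain \<sigma>1 where
          s1: "hom_on (gen_field M {l}) \<sigma>1" "\<forall>x\<in>M. \<sigma>1 x = x" "\<sigma>1 l = l'" by blast
        let ?M1 = "gen_field M {l}"
        have F'M1: "F' \<subseteq> ?M1" using F'M gen_field_incl(1)[of M "{l}"] by blast
        have "\<exists>\<sigma>'. hom_on (gen_field ?M1 X) \<sigma>' \<and> (\<forall>x\<in>?M1. \<sigma>' x = \<sigma>1 x)"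
        proof (rule extend_hom_finite[OF ac subfield_gen_field s1(1) finX])
          have "F \<subseteq> ?M1" using F'(2) F'M1 by blast
          then show "algebraic_over ?M1 x" if "x \<in> X" for x by (rule algebraic_over_mono[OF algX[OF that]])
        qed
        then obtain \<sigma> where s2: "hom_on (gen_field ?M1 X) \<sigma>" "\<forall>x\<in>?M1. \<sigma> x = \<sigma>1 x" by blast
        have "L \<subseteq> gen_field ?M1 X" unfolding L_def by (rule gen_field_mono[OF F'M1]) simp
        then have hL: "hom_on L \<sigma>" by (rule hom_on_subset[OF s2(1)])
        have sM: "\<sigma> x = x" if "x \<in> M" for x using that s1 s2 gen_field_incl(1)[of M "{l}"] by auto
        have sl: "\<sigma> l = l'" using s1 s2 gen_field_incl(2)[of "{l}" M] by auto
        have "\<sigma> \<in> aut_over F' L" using aut[OF hL] sM F'M by blast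
        then have "\<sigma> t = t" by (rule tf)
        have MsubL: "M \<subseteq> L" unfolding M_def L_def using insert.prems by (intro gen_field_mono) auto
        have "\<sigma> t = poly (map_poly \<sigma> g) l'"
          unfolding tg using map_hom_poly[OF L hL pov_mono[OF g(1) MsubL], of l] XL insert.prems sl by auto
        also have "map_poly \<sigma> g = g"
          by (rule poly_eqI) (use sM povD[OF g(1)] in \<open>auto simp: coeff_map_hom[OF L hL]\<close>)
        finally show ?thesis using \<open>\<sigma> t = t\<close> by simp
      qed
      have "g - [:t:] = 0"
      proof (rule ccontr)
        assume nz: "g - [:t:] \<noteq> 0"
        have "{x. poly m x = 0} \<subseteq> {x. poly (g - [:t:]) x = 0}" using same by auto
        then have "card {x. poly m x = 0} \<le> card {x. poly (g - [:t:]) x = 0}"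
          by (intro card_mono poly_roots_finite nz)
        also have "\<dots> \<le> degree (g - [:t:])" by (rule card_poly_roots_bound[OF nz])
        also have "\<dots> \<le> degree g" by (rule degree_diff_le) auto
        finally show False using cm dg by simp
      qed
      then have "t = coeff g 0" by (metis coeff_pCons_0 eq_iff_diff_eq_0)
      then have "t \<in> M" using povD[OF g(1)] by simp
      then show ?case using insert by (simp add: M_def)
    qed
  qed
  have galL: "finite_galois_ext F' L"
    unfolding finite_galois_ext_def using F'(1) L F'L fd fixed[of X] aut_overD(3)[OF _ F'(1)]
    by (auto simp: L_def)
  \<comment> \<open>An automorphism over \<open>F'\<close> permutes the conjugates of every element
    of \<open>K\<close>, hence maps \<open>K\<close> onto itself.\<close>
  have restr: "\<sigma> \<in> aut_over F K" if s: "\<sigma> \<in> aut_over F' L" and K: "K \<in> {K1, K2}" for \<sigma> K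
  proof (rule aut_overI)
    note D = aut_overD[OF s F'(1)]
    show hK: "hom_on K \<sigma>" by (rule hom_on_subset[OF D(1) KL[OF K]])
    show fixF: "\<sigma> x = x" if "x \<in> F" for x using D(3) that F' by blast
    have orbK: "\<sigma> ` orb F K x = orb F K x" if x: "x \<in> K" for x
    proof -
      let ?q = "\<Prod>y\<in>orb F K x. [:-y, 1:]"
      note q = orb_poly_pov[OF gal[OF K] x]
      have mq: "map_poly \<sigma> ?q = ?q"
        by (rule poly_eqI) (use fixF povD[OF q] in \<open>auto simp: coeff_map_hom[OF L D(1)]\<close>)
      have "\<sigma> ` orb F K x \<subseteq> orb F K x"
      proof
        fix z assume "z \<in> \<sigma> ` orb F K x"
        then obtain y where y: "y \<in> orb F K x" "z = \<sigma> y" by blast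
        have yK: "y \<in> K" using y orb_sub[OF gal[OF K] x] by blast
        have pL: "pov L ?q" using pov_mono[OF q] F' F'L by blast
        have "poly ?q y = 0" using y finite_orb[OF gal[OF K] x] by (auto simp: poly_prod)
        then have "poly ?q z = 0" using map_hom_poly[OF L D(1) pL, of y] mq y(2) yK KL[OF K] hom_on_0[OF L D(1)] by auto
        then show "z \<in> orb F K x" by (rule gal_root_in_orb[OF gal[OF K] x])
      qed
      moreover have "inj_on \<sigma> (orb F K x)"
        using hom_on_inj[OF L D(1)] orb_sub[OF gal[OF K] x] KL[OF K] by (meson inj_on_subset order_trans)
      ultimately show ?thesis using finite_orb[OF gal[OF K] x] by (metis card_image card_subset_eq)
    qed
    have "\<sigma> ` K = K"
    proof
      show "\<sigma> ` K \<subseteq> K" using orbK orb_self[OF gal[OF K]] orb_sub[OF gal[OF K]] by blast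
      show "K \<subseteq> \<sigma> ` K"
      proof
        fix x assume x: "x \<in> K"
        then have "x \<in> \<sigma> ` orb F K x" using orbK[OF x] orb_self[OF gal[OF K]] by simp
        then show "x \<in> \<sigma> ` K" using orb_sub[OF gal[OF K] x] by blast
      qed
    qed
    then show "bij_betw \<sigma> K K" using hom_on_inj[OF L D(1)] KL[OF K] by (metis bij_betw_def inj_on_subset)
  qed
  have "\<sigma> (\<tau> x) = \<tau> (\<sigma> x)" if s: "\<sigma> \<in> aut_over F' L" and t: "\<tau> \<in> aut_over F' L" and x: "x \<in> L" for \<sigma> \<tau> x
  proof -
    note S = aut_overD[OF s F'(1)] and T = aut_overD[OF t F'(1)]
    let ?C = "{x \<in> L. \<sigma> (\<tau> x) = \<tau> (\<sigma> x)}"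
    \<comment> \<open>The elements on which the two automorphisms commute form a subfield containing
      the generators.\<close>
    have "gen_field F' X \<subseteq> ?C"
    proof (rule gen_field_least)
      show "is_subfield ?C"
        by (rule is_subfieldI)
          (auto simp: subfieldD[OF L] S(4) T(4) hom_on_0[OF L S(1)] hom_on_0[OF L T(1)] hom_on_1[OF L S(1)] hom_on_1[OF L T(1)]
           hom_on_add[OF L S(1)] hom_on_add[OF L T(1)] hom_on_mult[OF L S(1)] hom_on_mult[OF L T(1)]
           hom_on_minus[OF L S(1)] hom_on_minus[OF L T(1)] hom_on_inverse[OF L S(1)] hom_on_inverse[OF L T(1)])
      show "F' \<subseteq> ?C" using F'L S(3) T(3) by auto
      show "X \<subseteq> ?C"
      proof
        fix y assume y: "y \<in> X"
        then obtain K b where Kb: "K \<in> {K1, K2}" "b \<in> B K" "y \<in> orb F K b" unfolding X_def by blast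
        have "y \<in> K" using Kb BK orb_sub[OF gal[OF Kb(1)]] by blast
        then show "y \<in> ?C" using comm[OF Kb(1) restr[OF s Kb(1)] restr[OF t Kb(1)]] KL[OF Kb(1)] by blast
      qed
    qed
    then show ?thesis using x L_def by blast
  qed
  then have "finite_abelian_ext F' L" using galL by (auto simp: finite_abelian_ext_def)
  then show ?thesis using KL by blast
qed

section \<open>Valuation rings\<close>

lemma gen_field_rational:
  assumes K: "is_subfield K"
  shows "gen_field K {a} = {poly P a / poly Q a | P Q. pov K P \<and> pov K Q \<and> poly Q a \<noteq> 0}" (is "_ = ?S'")
proof -
  define S where "S = ?S'"
  have SI: "poly P a / poly Q a \<in> S" if "pov K P" "pov K Q" "poly Q a \<noteq> 0" for P Q
    using that by (auto simp: S_def)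
  have SE: "\<exists>P Q. pov K P \<and> pov K Q \<and> poly Q a \<noteq> 0 \<and> y = poly P a / poly Q a" if "y \<in> S" for y
    using that by (auto simp: S_def)
  have "S \<subseteq> gen_field K {a}"
  proof
    fix y assume "y \<in> S"
    then obtain P Q where PQ: "pov K P" "pov K Q" "y = poly P a / poly Q a" using SE by blast
    have "poly P a \<in> gen_field K {a}" "poly Q a \<in> gen_field K {a}"
      using PQ poly_in[OF subfield_gen_field pov_mono[OF _ gen_field_incl(1)]] gen_field_incl(2)[of "{a}" K] by auto
    then show "y \<in> gen_field K {a}" unfolding PQ(3) by (rule subfieldD[OF subfield_gen_field])
  qed
  moreover have "is_subfield S"
  proof (rule is_subfieldI)
    show "0 \<in> S" using SI[of 0 1] K by simp
    show "1 \<in> S" using SI[of 1 1] K by simp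
    fix x assume "x \<in> S"
    then obtain P Q where PQ: "pov K P" "pov K Q" "poly Q a \<noteq> 0" "x = poly P a / poly Q a" using SE by blast
    show "- x \<in> S" using SI[of "-P" Q] PQ pov_uminus[OF K] by simp
    show "inverse x \<in> S" if "x \<noteq> 0" using SI[of Q P] PQ that by auto
    fix y assume "y \<in> S"
    then obtain P' Q' where PQ': "pov K P'" "pov K Q'" "poly Q' a \<noteq> 0" "y = poly P' a / poly Q' a" using SE by blast
    show "x + y \<in> S"
      using SI[of "P * Q' + P' * Q" "Q * Q'"] PQ PQ' pov_add[OF K] pov_mult[OF K] by (simp add: add_frac_eq)
    show "x * y \<in> S"
      using SI[of "P * P'" "Q * Q'"] PQ PQ' pov_mult[OF K] by simp
  qed
  moreover have "K \<subseteq> S"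
  proof
    fix c assume "c \<in> K"
    then show "c \<in> S" using SI[of "[:c:]" 1] K by simp
  qed
  moreover have "a \<in> S" using SI[of "[:0, 1:]" 1] K subfieldD(1,2)[OF K] by simp
  ultimately have "gen_field K {a} = S" by (intro antisym gen_field_least) auto
  then show ?thesis by (simp add: S_def)
qed

text \<open>After clearing denominators, a relation for \<open>a\<close> over \<open>K(t)\<close> is
  a polynomial in \<open>t\<close> and \<open>a\<close>, which can be read as an equation for
  \<open>t\<close> over \<open>K(a)\<close>. It does not vanish identically because \<open>a\<close>
  is transcendental.\<close>

lemma algebraic_exchange:
  assumes K: "is_subfield K" and alg: "algebraic_over (gen_field K {t}) a" and tr: "\<not> algebraic_over K a"
  shows "algebraic_over (gen_field K {a}) t"
proof -
  obtain q where q: "q \<noteq> 0" "pov (gen_field K {t}) q" "poly q a = 0" using alg by (auto simp: algebraic_over_pov)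
  define n where "n = degree q"
  have "\<forall>i. \<exists>P Q. pov K P \<and> pov K Q \<and> poly Q t \<noteq> 0 \<and> coeff q i = poly P t / poly Q t"
    using povD[OF q(2)] unfolding gen_field_rational[OF K] by blast
  then obtain P Q where PQ: "\<And>i. pov K (P i)" "\<And>i. pov K (Q i)" "\<And>i. poly (Q i) t \<noteq> 0"
    "\<And>i. coeff q i = poly (P i) t / poly (Q i) t" by metis
  define R where "R i = P i * (\<Prod>j\<in>{..n} - {i}. Q j)" for i
  have R: "pov K (R i)" for i unfolding R_def by (intro pov_mult[OF K] pov_prod[OF K] PQ)
  define D where "D = (\<Prod>j\<le>n. poly (Q j) t)"
  have D0: "D \<noteq> 0" using PQ by (simp add: D_def)
  have Rt: "poly (R i) t = coeff q i * D" if "i \<le> n" for i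
  proof -
    have "D = poly (Q i) t * (\<Prod>j\<in>{..n} - {i}. poly (Q j) t)"
      unfolding D_def using that by (intro prod.remove) auto
    then show ?thesis using PQ by (simp add: R_def poly_prod)
  qed
  define S where "S = (\<Sum>i\<le>n. smult (a ^ i) (R i))"
  have "poly S t = (\<Sum>i\<le>n. a ^ i * (coeff q i * D))" by (simp add: S_def poly_sum Rt)
  also have "\<dots> = D * poly q a" by (simp add: poly_altdef n_def sum_distrib_left mult_ac)
  finally have St: "poly S t = 0" using q by simp
  have "poly (R n) t \<noteq> 0" using Rt[of n] D0 q(1) by (simp add: n_def)
  then have "R n \<noteq> 0" by auto
  then obtain j where j: "coeff (R n) j \<noteq> 0" by (metis leading_coeff_0_iff)
  \<comment> \<open>The coefficient of \<open>t^j\<close> in the relation, as a polynomial over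
    \<open>K\<close> to be evaluated at \<open>a\<close>; the choice of \<open>j\<close> makes it
    nonzero.\<close>
  define T where "T = (\<Sum>i\<le>n. monom (coeff (R i) j) i)"
  have cT: "coeff T i = (if i \<le> n then coeff (R i) j else 0)" for i by (simp add: T_def coeff_sum)
  have "T \<noteq> 0" using cT[of n] j by auto
  moreover have "pov K T" unfolding pov_def using cT povD[OF R] subfieldD(1)[OF K] by simp
  ultimately have "poly T a \<noteq> 0" using tr unfolding algebraic_over_pov by blast
  moreover have "coeff S j = poly T a" by (simp add: S_def T_def coeff_sum poly_sum poly_monom mult.commute)
  ultimately have "S \<noteq> 0" by auto
  moreover have "pov (gen_field K {a}) S"
    unfolding S_def using gen_field_incl(1)[of K "{a}"] gen_field_incl(2)[of "{a}" K]
    by (intro pov_sum pov_smult subfieldD(9) subfield_gen_field pov_mono[OF R]) auto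
  ultimately show ?thesis using St unfolding algebraic_over_pov by blast
qed

text \<open>The function field is given as a finite extension of \<open>k(t)\<close>, but the bad
  rings are measured against \<open>k(a)\<close>; this lemma moves finiteness from one to the
  other.\<close>

lemma finite_dim_change_transcendental:
  assumes k: "is_subfield k" and X: "finite X" "\<And>x. x \<in> X \<Longrightarrow> algebraic_over (gen_field k {t}) x"
    and a: "a \<in> gen_field (gen_field k {t}) X" and tr: "\<not> algebraic_over k a"
  shows "finite_dim_over (gen_field k {a}) (gen_field (gen_field k {t}) X)"
proof -
  let ?F = "gen_field (gen_field k {t}) X" and ?Ka = "gen_field k {a}"
  let ?M = "gen_field ?Ka {t}"
  have "finite_dim_over (gen_field k {t}) ?F" by (intro finite_dim_gen_field subfield_gen_field X)
  then have "algebraic_over (gen_field k {t}) a"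
    using a by (rule finite_dim_subfield_algebraic[OF subfield_gen_field subfield_gen_field])
  then have talg: "algebraic_over ?Ka t" using algebraic_exchange[OF k _ tr] by blast
  have ktM: "gen_field k {t} \<subseteq> ?M" using gen_field_incl(1)[of k "{a}"] by (intro gen_field_mono) auto
  have kF: "k \<subseteq> ?F" and tF: "t \<in> ?F"
    using gen_field_incl(1)[of k "{t}"] gen_field_incl(2)[of "{t}" k] gen_field_incl(1)[of "gen_field k {t}" X] by auto
  have eq: "?F = gen_field ?M X"
  proof
    show "?F \<subseteq> gen_field ?M X" by (rule gen_field_mono[OF ktM]) simp
    show "gen_field ?M X \<subseteq> ?F"
      using a kF tF gen_field_incl(2)[of X "gen_field k {t}"] by (intro gen_field_least subfield_gen_field) auto
  qed
  have M: "finite_dim_over ?Ka ?M"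
    using talg by (intro finite_dim_gen_field subfield_gen_field) auto
  have F: "finite_dim_over ?M (gen_field ?M X)"
  proof (intro finite_dim_gen_field subfield_gen_field X(1))
    show "algebraic_over ?M x" if "x \<in> X" for x by (rule algebraic_over_mono[OF X(2)[OF that] ktM])
  qed
  show ?thesis unfolding eq
    by (rule finite_dim_over_tower[OF subfield_gen_field subfield_gen_field subfield_gen_field gen_field_incl(1) M F])
qed

text \<open>Valuation rings are plain subsets without a value group: a nonzero \<open>y\<close> has
  at most the value of \<open>x\<close> when \<open>x / y \<in> V\<close>. The whole field
  \<open>L\<close> counts as the trivial case.\<close>

definition vring :: "'a::field set \<Rightarrow> 'a set \<Rightarrow> bool" where
  "vring L V \<longleftrightarrow> V \<subseteq> L \<and> 1 \<in> V \<and> (\<forall>x\<in>V. \<forall>y\<in>V. x - y \<in> V \<and> x * y \<in> V) \<and> (\<forall>x\<in>L. x \<in> V \<or> inverse x \<in> V)"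

text \<open>The clause \<open>x = 0\<close> is explicit because \<open>inverse 0 = 0\<close> belongs
  to \<open>V\<close>.\<close>

definition vmax :: "'a::field set \<Rightarrow> 'a set" where
  "vmax V = {x \<in> V. x = 0 \<or> inverse x \<notin> V}"

locale vr =
  fixes L V :: "'a::field set"
  assumes L: "is_subfield L" and V: "vring L V"
begin

lemma V_sub: "x \<in> V \<Longrightarrow> x \<in> L" and V_1 [simp]: "1 \<in> V" and V_diff: "x \<in> V \<Longrightarrow> y \<in> V \<Longrightarrow> x - y \<in> V"
  and V_mult: "x \<in> V \<Longrightarrow> y \<in> V \<Longrightarrow> x * y \<in> V" and V_total: "x \<in> L \<Longrightarrow> x \<in> V \<or> inverse x \<in> V"
  using V by (auto simp: vring_def)

lemma V_0 [simp]: "0 \<in> V" using V_diff[of 1 1] by simp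

lemma V_minus: "x \<in> V \<Longrightarrow> - x \<in> V" using V_diff[of 0 x] by simp

lemma V_add: "x \<in> V \<Longrightarrow> y \<in> V \<Longrightarrow> x + y \<in> V" using V_diff[of x "-y"] V_minus by simp

lemma V_power: "x \<in> V \<Longrightarrow> x ^ n \<in> V" by (induction n) (auto intro: V_mult)

lemma V_sum: "(\<And>i. i \<in> A \<Longrightarrow> f i \<in> V) \<Longrightarrow> sum f A \<in> V"
  by (induction A rule: infinite_finite_induct) (auto intro: V_add)

lemma V_prod: "(\<And>i. i \<in> A \<Longrightarrow> f i \<in> V) \<Longrightarrow> prod f A \<in> V"
  by (induction A rule: infinite_finite_induct) (auto intro: V_mult)

lemma V_of_nat [simp]: "of_nat n \<in> V" by (induction n) (auto intro: V_add)

lemma V_numeral [simp]: "numeral w \<in> V" using V_of_nat[of "numeral w"] by simp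

lemma m_V: "x \<in> vmax V \<Longrightarrow> x \<in> V" by (simp add: vmax_def)

lemma m_0 [simp]: "0 \<in> vmax V" by (simp add: vmax_def)

lemma m_1 [simp]: "1 \<notin> vmax V" by (simp add: vmax_def)

lemma unit_inv: "x \<in> V \<Longrightarrow> x \<notin> vmax V \<Longrightarrow> inverse x \<in> V" by (auto simp: vmax_def)

lemma unit_nz: "x \<notin> vmax V \<Longrightarrow> x \<noteq> 0" by auto

lemma not_V_inv: "x \<in> L \<Longrightarrow> x \<notin> V \<Longrightarrow> inverse x \<in> vmax V"
  using V_total[of x] by (auto simp: vmax_def)

lemma inv_m_not_V: "x \<in> vmax V \<Longrightarrow> x \<noteq> 0 \<Longrightarrow> inverse x \<notin> V" by (simp add: vmax_def)

lemma not_m_inv: "x \<in> L \<Longrightarrow> x \<notin> vmax V \<Longrightarrow> inverse x \<in> V"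
  using V_total[of x] by (auto simp: vmax_def)

lemma m_mult: "x \<in> vmax V \<Longrightarrow> y \<in> V \<Longrightarrow> x * y \<in> vmax V"
proof (rule ccontr)
  assume x: "x \<in> vmax V" and y: "y \<in> V" and n: "x * y \<notin> vmax V"
  then have "inverse (x * y) \<in> V" "x * y \<noteq> 0" using V_mult[OF m_V[OF x] y] by (auto simp: vmax_def)
  then have "inverse (x * y) * y \<in> V" "x \<noteq> 0" using V_mult y by auto
  moreover have "inverse (x * y) * y = inverse x" using \<open>x * y \<noteq> 0\<close> by (simp add: field_simps)
  ultimately have "inverse x \<in> V" by (simp only:)
  then show False using x \<open>x \<noteq> 0\<close> by (simp add: vmax_def)
qed

lemma m_mult2: "x \<in> V \<Longrightarrow> y \<in> vmax V \<Longrightarrow> x * y \<in> vmax V" using m_mult[of y x] by (simp add: mult.commute)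

lemma m_minus: "x \<in> vmax V \<Longrightarrow> - x \<in> vmax V" using m_mult[of x "-1"] V_minus[of 1] by simp

lemma m_add: "x \<in> vmax V \<Longrightarrow> y \<in> vmax V \<Longrightarrow> x + y \<in> vmax V"
proof -
  assume x: "x \<in> vmax V" and y: "y \<in> vmax V"
  show ?thesis
  proof (cases "x = 0 \<or> y = 0")
    case False
    have L': "x / y \<in> L" by (intro subfieldD(8)[OF L] V_sub m_V x y)
    from V_total[OF this] show ?thesis
    proof
      assume "x / y \<in> V"
      then have "y * (x / y + 1) \<in> vmax V" using m_mult[OF y] V_add by simp
      then show ?thesis using False by (simp add: field_simps)
    next
      assume "inverse (x / y) \<in> V"
      then have "x * (inverse (x / y) + 1) \<in> vmax V" using m_mult[OF x] V_add by simp
      then show ?thesis using False by (simp add: field_simps)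
    qed
  qed (use x y in auto)
qed

lemma m_diff: "x \<in> vmax V \<Longrightarrow> y \<in> vmax V \<Longrightarrow> x - y \<in> vmax V"
  using m_add[of x "-y"] m_minus by simp

lemma m_sum: "(\<And>i. i \<in> A \<Longrightarrow> f i \<in> vmax V) \<Longrightarrow> sum f A \<in> vmax V"
  by (induction A rule: infinite_finite_induct) (auto intro: m_add)

text \<open>For an element of \<open>L\<close>, lying outside \<open>vmax V\<close> means having
  value at most zero, so that non-integral elements are covered along with units. This reading of
  \<open>x \<notin> vmax V\<close> is used throughout.\<close>

lemma unit_mult: "x \<in> L \<Longrightarrow> y \<in> L \<Longrightarrow> x \<notin> vmax V \<Longrightarrow> y \<notin> vmax V \<Longrightarrow> x * y \<notin> vmax V"
proof
  assume x: "x \<in> L" "x \<notin> vmax V" and y: "y \<in> L" "y \<notin> vmax V" and xy: "x * y \<in> vmax V"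
  have "x * y * (inverse x * inverse y) \<in> vmax V"
    using m_mult[OF xy] V_mult not_m_inv x y by blast
  moreover have "x * y * (inverse x * inverse y) = 1" using x(2) y(2) by (auto simp: field_simps)
  ultimately show False by simp
qed

lemma unit_power: "x \<in> L \<Longrightarrow> x \<notin> vmax V \<Longrightarrow> x ^ n \<notin> vmax V"
proof (induction n)
  case (Suc n)
  then show ?case using unit_mult[of x "x ^ n"] subfieldD(9)[OF L, of x n] by simp
qed simp

lemma unit_prod: "(\<And>i. i \<in> A \<Longrightarrow> f i \<in> L \<and> f i \<notin> vmax V) \<Longrightarrow> prod f A \<notin> vmax V"
proof (induction A rule: infinite_finite_induct)
  case (insert x A)
  then show ?case using unit_mult[of "f x" "prod f A"] subfield_prod[OF L, of A f] by simp
qed auto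

lemma m_power: "x \<in> vmax V \<Longrightarrow> n > 0 \<Longrightarrow> x ^ n \<in> vmax V"
  using m_mult[of x "x ^ (n - 1)"] V_power[OF m_V] by (cases n) auto

lemma unit_add: "x \<in> L \<Longrightarrow> x \<notin> vmax V \<Longrightarrow> y \<in> vmax V \<Longrightarrow> x + y \<notin> vmax V"
  using m_diff[of "x + y" y] by auto

lemma unit_add2: "x \<in> L \<Longrightarrow> x \<notin> vmax V \<Longrightarrow> y \<in> vmax V \<Longrightarrow> y + x \<notin> vmax V"
  using m_diff[of "y + x" y] by auto

lemma not_V_add: "x \<notin> V \<Longrightarrow> y \<in> V \<Longrightarrow> x + y \<notin> V"
  using V_diff[of "x + y" y] by auto

lemma not_V_mult: "x \<in> L \<Longrightarrow> y \<in> L \<Longrightarrow> x \<notin> V \<Longrightarrow> y \<notin> vmax V \<Longrightarrow> x * y \<notin> V"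
proof
  assume x: "x \<in> L" "x \<notin> V" and y: "y \<in> L" "y \<notin> vmax V" and "x * y \<in> V"
  then have "x * y * inverse y \<in> V" using V_mult not_m_inv by blast
  moreover have "x * y * inverse y = x" using unit_nz[OF y(2)] by simp
  ultimately show False using x(2) by simp
qed

lemma unit_minus: "x \<notin> vmax V \<Longrightarrow> - x \<notin> vmax V" using m_minus[of "-x"] by auto

lemma divide_unit: "x \<in> V \<Longrightarrow> y \<in> L \<Longrightarrow> y \<notin> vmax V \<Longrightarrow> x / y \<in> V"
  by (simp add: divide_inverse V_mult not_m_inv)

lemma divide_unit_m: "x \<in> vmax V \<Longrightarrow> y \<in> L \<Longrightarrow> y \<notin> vmax V \<Longrightarrow> x / y \<in> vmax V"
  by (simp add: divide_inverse m_mult not_m_inv)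

text \<open>Otherwise \<open>y = 1/x\<close> lies in the maximal ideal, and division of the equation
  by \<open>x^n\<close> writes 1 as a combination of positive powers of \<open>y\<close>.\<close>

lemma integral_in_V:
  assumes x: "x \<in> L" and c: "\<And>i. i < n \<Longrightarrow> c i \<in> V" and eq: "x ^ n = (\<Sum>i<n. c i * x ^ i)"
  shows "x \<in> V"
proof (rule ccontr)
  assume nV: "x \<notin> V"
  define y where "y = inverse x"
  have y: "y \<in> vmax V" using not_V_inv[OF x nV] by (simp add: y_def)
  have x0: "x \<noteq> 0" using nV by auto
  have "1 = x ^ n * y ^ n" using x0 by (simp add: y_def flip: power_mult_distrib)
  also have "\<dots> = (\<Sum>i<n. c i * (x ^ i * y ^ n))" by (simp add: eq sum_distrib_right mult.assoc)
  also have "\<dots> = (\<Sum>i<n. c i * y ^ (n - i))"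
  proof (rule sum.cong)
    fix i assume "i \<in> {..<n}"
    then have "y ^ n = y ^ i * y ^ (n - i)" by (simp flip: power_add)
    then show "c i * (x ^ i * y ^ n) = c i * y ^ (n - i)"
      using x0 by (simp add: y_def mult.assoc[symmetric] flip: power_mult_distrib)
  qed simp
  also have "\<dots> \<in> vmax V" by (intro m_sum m_mult2 c m_power y) auto
  finally show False by simp
qed

text \<open>Selects a coefficient of least value; dividing by it makes a linear relation integral
  with one coefficient equal to 1.\<close>

lemma max_elem:
  assumes "finite I" "I \<noteq> {}" "\<And>i. i \<in> I \<Longrightarrow> c i \<in> L" "\<exists>i\<in>I. c i \<noteq> 0"
  shows "\<exists>i0\<in>I. c i0 \<noteq> 0 \<and> (\<forall>i\<in>I. c i / c i0 \<in> V)"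
  using assms
proof (induction I rule: finite_ne_induct)
  case (insert j I)
  show ?case
  proof (cases "\<exists>i\<in>I. c i \<noteq> 0")
    case False
    then show ?thesis using insert.prems by (intro bexI[of _ j]) auto
  next
    case True
    then obtain i0 where i0: "i0 \<in> I" "c i0 \<noteq> 0" "\<forall>i\<in>I. c i / c i0 \<in> V" using insert by auto
    show ?thesis
    proof (cases "c j / c i0 \<in> V")
      case True
      then show ?thesis using i0 by auto
    next
      case False
      then have cj: "c j \<noteq> 0" by auto
      have "inverse (c j / c i0) \<in> V" using V_total[of "c j / c i0"] False insert.prems i0 subfieldD[OF L] by auto
      then have *: "c i0 / c j \<in> V" by simp
      have "c i / c j \<in> V" if "i \<in> I" for i
        using V_mult[OF _ *, of "c i / c i0"] i0 that by auto
      then show ?thesis using cj by (intro bexI[of _ j]) auto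
    qed
  qed
qed auto

end

section \<open>Existence of valuation rings\<close>

definition subring :: "'a::field set \<Rightarrow> bool" where
  "subring S \<longleftrightarrow> 1 \<in> S \<and> (\<forall>x\<in>S. \<forall>y\<in>S. x - y \<in> S \<and> x * y \<in> S)"

lemma subringD:
  assumes "subring S"
  shows "1 \<in> S" "0 \<in> S" "x \<in> S \<Longrightarrow> y \<in> S \<Longrightarrow> x - y \<in> S" "x \<in> S \<Longrightarrow> y \<in> S \<Longrightarrow> x * y \<in> S"
    "x \<in> S \<Longrightarrow> - x \<in> S" "x \<in> S \<Longrightarrow> y \<in> S \<Longrightarrow> x + y \<in> S" "x \<in> S \<Longrightarrow> x ^ n \<in> S"
proof -
  show 1: "1 \<in> S" using assms by (simp add: subring_def)
  show d: "x - y \<in> S" if "x \<in> S" "y \<in> S" for x y using assms that by (simp add: subring_def)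
  show m: "x * y \<in> S" if "x \<in> S" "y \<in> S" for x y using assms that by (simp add: subring_def)
  show 0: "0 \<in> S" using d[OF 1 1] by simp
  show n: "- x \<in> S" if "x \<in> S" for x using d[OF 0 that] by simp
  show "x + y \<in> S" if "x \<in> S" "y \<in> S" using d[OF that(1) n[OF that(2)]] by simp
  show "x ^ n \<in> S" if "x \<in> S" by (induction n) (auto intro: 1 m that)
qed

lemma subring_sum: "subring S \<Longrightarrow> (\<And>i. i \<in> A \<Longrightarrow> f i \<in> S) \<Longrightarrow> sum f A \<in> S"
  by (induction A rule: infinite_finite_induct) (auto intro: subringD)

lemma subring_adjoin:
  assumes S: "subring S"
  shows "subring {poly g x | g. pov S g}" "S \<subseteq> {poly g x | g. pov S g}" "x \<in> {poly g x | g. pov S g}"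
proof -
  note D = subringD[OF S]
  have "poly g x - poly h x \<in> {poly g x | g. pov S g}" "poly g x * poly h x \<in> {poly g x | g. pov S g}"
    if gh: "pov S g" "pov S h" for g h
  proof -
    have "pov S (g - h)" using gh D(3) by (auto simp: pov_def)
    then show "poly g x - poly h x \<in> {poly g x | g. pov S g}" by (metis (mono_tags, lifting) mem_Collect_eq poly_diff)
    have "pov S (g * h)" using gh D(4) by (auto simp: pov_def coeff_mult intro!: subring_sum[OF S])
    then show "poly g x * poly h x \<in> {poly g x | g. pov S g}" by (metis (mono_tags, lifting) mem_Collect_eq poly_mult)
  qed
  moreover have const: "c \<in> {poly g x | g. pov S g}" if "c \<in> S" for c
  proof -
    have "pov S [:c:]" using that D(2) by (auto simp: pov_def coeff_pCons split: nat.split)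
    moreover have "c = poly [:c:] x" by simp
    ultimately show ?thesis by blast
  qed
  ultimately show "subring {poly g x | g. pov S g}" using D(1) unfolding subring_def by blast
  show "S \<subseteq> {poly g x | g. pov S g}" using const by blast
  have "pov S [:0, 1:]" using D by (auto simp: pov_def coeff_pCons split: nat.split)
  moreover have "x = poly [:0, 1:] x" by simp
  ultimately show "x \<in> {poly g x | g. pov S g}" by blast
qed

text \<open>The descent step in Chevalley's extension theorem.\<close>
lemma lower_degree:
  fixes x y z :: "'a::field"
  assumes S: "subring S" and yS: "y \<in> S" and yz: "y * z = 1" and x0: "x \<noteq> 0"
    and units: "\<And>s. s \<in> S \<Longrightarrow> 1 - y * s \<noteq> 0 \<and> inverse (1 - y * s) \<in> S"
    and g: "\<And>i. g i \<in> S" "z = (\<Sum>i\<le>n. g i * x ^ i)"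
    and h: "\<And>i. h i \<in> S" "z = (\<Sum>i\<le>m. h i * inverse x ^ i)"
    and mn: "m \<le> n" "n > 0"
  shows "\<exists>g'. (\<forall>i. g' i \<in> S) \<and> z = (\<Sum>i\<le>n - 1. g' i * x ^ i)"
proof -
  \<comment> \<open>Multiplying the second representation of \<open>z\<close> by \<open>y\<close>
    and moving the constant term to the left, where \<open>1 - y * h 0\<close> is invertible,
    expresses 1 by the powers of \<open>1/x\<close> with exponents 1 to \<open>m\<close>. Multiplied
    by \<open>x^n\<close>, this replaces the leading power by lower ones.\<close>
  define c where "c = inverse (1 - y * h 0)"
  have c: "c \<in> S" "c * (1 - y * h 0) = 1" using units[OF h(1)] by (auto simp: c_def)
  define k where "k i = c * y * h i" for i
  have k: "k i \<in> S" for i unfolding k_def by (intro subringD(4)[OF S] c yS h)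
  have "1 = y * (\<Sum>i\<le>m. h i * inverse x ^ i)" using yz h(2) by simp
  also have "(\<Sum>i\<le>m. h i * inverse x ^ i) = h 0 + (\<Sum>i=1..m. h i * inverse x ^ i)"
    by (simp add: sum.atMost_shift sum.atLeast1_atMost_eq lessThan_Suc_atMost)
  finally have "1 - y * h 0 = y * (\<Sum>i=1..m. h i * inverse x ^ i)" by (simp add: algebra_simps)
  then have "1 = c * (y * (\<Sum>i=1..m. h i * inverse x ^ i))" using c(2) by simp
  also have "\<dots> = (\<Sum>i=1..m. k i * inverse x ^ i)" by (simp add: k_def sum_distrib_left mult.assoc)
  finally have 1: "1 = (\<Sum>i=1..m. k i * inverse x ^ i)" .
  have "x ^ n = (\<Sum>i=1..m. k i * (inverse x ^ i * x ^ n))" by (subst mult_1[symmetric], subst 1) (simp add: sum_distrib_right mult.assoc)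
  also have "\<dots> = (\<Sum>i=1..m. k i * x ^ (n - i))"
  proof (rule sum.cong)
    fix i assume "i \<in> {1..m}"
    then have "x ^ n = x ^ i * x ^ (n - i)" using mn by (simp flip: power_add)
    then show "k i * (inverse x ^ i * x ^ n) = k i * x ^ (n - i)"
      using x0 by (simp add: mult.assoc[symmetric] flip: power_mult_distrib)
  qed simp
  also have "\<dots> = (\<Sum>j\<in>{n - m..n - 1}. k (n - j) * x ^ j)"
    by (rule sum.reindex_bij_witness[of _ "\<lambda>j. n - j" "\<lambda>i. n - i"]) (use mn in auto)
  also have "\<dots> = (\<Sum>j\<le>n - 1. (if n - m \<le> j then k (n - j) else 0) * x ^ j)"
    by (rule sum.mono_neutral_cong_left) auto
  finally have xn: "x ^ n = (\<Sum>j\<le>n - 1. (if n - m \<le> j then k (n - j) else 0) * x ^ j)" .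
  have "z = (\<Sum>i\<le>n - 1. g i * x ^ i) + g n * x ^ n" using g(2) mn by (cases n) auto
  also have "\<dots> = (\<Sum>i\<le>n - 1. (g i + g n * (if n - m \<le> i then k (n - i) else 0)) * x ^ i)"
    unfolding xn by (simp add: sum_distrib_left sum.distrib algebra_simps)
  finally have "z = (\<Sum>i\<le>n - 1. (g i + g n * (if n - m \<le> i then k (n - i) else 0)) * x ^ i)" .
  moreover have "g i + g n * (if n - m \<le> i then k (n - i) else 0) \<in> S" for i
    using g(1) k subringD[OF S] by auto
  ultimately show ?thesis
    by (intro exI[of _ "\<lambda>i. g i + g n * (if n - m \<le> i then k (n - i) else 0)"] conjI allI)
qed

text \<open>If neither \<open>x\<close> nor its inverse is in \<open>S\<close>, maximality puts
  \<open>z\<close> into both \<open>S[x]\<close> and \<open>S[1/x]\<close>, and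
  \<open>lower_degree\<close> shortens the longer representation again and again. The elements
  \<open>1 - y s\<close> are invertible in \<open>S\<close> since adjoining such an inverse cannot
  bring in \<open>z\<close>.\<close>

lemma maximal_subring_vring:
  fixes z :: "'a::field"
  assumes S: "subring S" and yS: "inverse z \<in> S" and zS: "z \<notin> S"
    and max: "\<And>T. subring T \<Longrightarrow> S \<subseteq> T \<Longrightarrow> z \<notin> T \<Longrightarrow> T = S"
  shows "vring UNIV S"
proof -
  define y where "y = inverse z"
  have z0: "z \<noteq> 0" using zS subringD(2)[OF S] by auto
  have yz: "y * z = 1" using z0 by (simp add: y_def)
  have yS': "y \<in> S" using yS by (simp add: y_def)
  note D = subringD[OF S]
  have units: "1 - y * s \<noteq> 0 \<and> inverse (1 - y * s) \<in> S" if s: "s \<in> S" for s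
  proof -
    define c where "c = 1 - y * s"
    have c0: "c \<noteq> 0"
    proof
      assume "c = 0"
      then have "y * s = 1" by (simp add: c_def)
      then have "s = z" using yz z0 by (metis mult_cancel_left mult_zero_left zero_neq_one)
      then show False using s zS by simp
    qed
    have cS: "c \<in> S" unfolding c_def by (intro D s yS')
    \<comment> \<open>Powers of \<open>c\<close> stay congruent to 1 modulo \<open>y\<close>. Hence
      \<open>z * c ^ n \<in> S\<close> would give \<open>z \<in> S\<close>, as
      \<open>y * z = 1\<close>.\<close>
    have cpow: "\<exists>s'\<in>S. c ^ n = 1 - y * s'" for n
    proof (induction n)
      case 0
      then show ?case using D(2) by (intro bexI[of _ 0]) auto
    next
      case (Suc n)
      then obtain s' where s': "s' \<in> S" "c ^ n = 1 - y * s'" by blast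
      have "c ^ Suc n = c * (1 - y * s')" by (simp add: s'(2))
      also have "\<dots> = 1 - y * (s + s' - y * s * s')" by (simp add: c_def algebra_simps)
      finally have "c ^ Suc n = 1 - y * (s + s' - y * s * s')" .
      moreover have "s + s' - y * s * s' \<in> S" by (intro D s s' yS')
      ultimately show ?case by blast
    qed
    let ?T = "{poly g (inverse c) | g. pov S g}"
    have "z \<notin> ?T"
    proof
      assume "z \<in> ?T"
      then obtain g where g: "pov S g" "z = poly g (inverse c)" by blast
      define n where "n = degree g"
      have "z * c ^ n = (\<Sum>i\<le>n. coeff g i * (inverse c ^ i * c ^ n))"
        unfolding g(2) poly_altdef n_def by (simp add: sum_distrib_right mult.assoc)
      also have "\<dots> = (\<Sum>i\<le>n. coeff g i * c ^ (n - i))"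
      proof (rule sum.cong)
        fix i assume "i \<in> {..n}"
        then have "c ^ n = c ^ i * c ^ (n - i)" by (simp flip: power_add)
        then show "coeff g i * (inverse c ^ i * c ^ n) = coeff g i * c ^ (n - i)"
          using c0 by (simp add: mult.assoc[symmetric] flip: power_mult_distrib)
      qed simp
      also have "\<dots> \<in> S" by (intro subring_sum[OF S] D povD[OF g(1)] cS)
      finally have zc: "z * c ^ n \<in> S" .
      obtain s' where s': "s' \<in> S" "c ^ n = 1 - y * s'" using cpow by blast
      have "z = z * c ^ n + s'" using yz by (simp add: s'(2) algebra_simps)
      then show False using D(6)[OF zc s'(1)] zS by simp
    qed
    then have "?T = S" using subring_adjoin[OF S] by (intro max) auto
    then have "inverse c \<in> S" using subring_adjoin(3)[OF S, of "inverse c"] by simp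
    then show ?thesis using c0 by (simp add: c_def)
  qed
  define P where "P x n \<longleftrightarrow> (\<exists>g. (\<forall>i. g i \<in> S) \<and> z = (\<Sum>i\<le>n. g i * x ^ i))" for x n
  have P0: False if "P x 0" for x using that zS unfolding P_def by auto
  have ex: "\<exists>n. P x n" if "x \<notin> S" for x
  proof -
    let ?T = "{poly g x | g. pov S g}"
    have "z \<in> ?T" using max[of ?T] subring_adjoin[OF S, of x] that by blast
    then obtain g where g: "pov S g" "z = poly g x" by blast
    then have "z = (\<Sum>i\<le>degree g. coeff g i * x ^ i)" by (simp add: poly_altdef)
    then show ?thesis unfolding P_def using povD[OF g(1)] by blast
  qed
  have no: False if "P x n" "P (inverse x) m" "x \<noteq> 0" for x n m
    using that
  proof (induction "n + m" arbitrary: n m rule: less_induct)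
    case less
    have nm: "n > 0" "m > 0" using less.prems P0 by (auto intro: Nat.gr0I)
    obtain g where g: "\<And>i. g i \<in> S" "z = (\<Sum>i\<le>n. g i * x ^ i)" using less.prems unfolding P_def by blast
    obtain h where h: "\<And>i. h i \<in> S" "z = (\<Sum>i\<le>m. h i * inverse x ^ i)" using less.prems unfolding P_def by blast
    show False
    proof (cases "m \<le> n")
      case True
      have "P x (n - 1)" unfolding P_def
        by (rule lower_degree[OF S yS' yz less.prems(3) units g h True nm(1)])
      then show False using less.hyps[of "n - 1" m] less.prems nm by simp
    next
      case False
      have "z = (\<Sum>i\<le>n. g i * inverse (inverse x) ^ i)" using g by simp
      have "P (inverse x) (m - 1)" unfolding P_def
        by (rule lower_degree[OF S yS' yz _ units h g(1) \<open>z = (\<Sum>i\<le>n. g i * inverse (inverse x) ^ i)\<close> _ nm(2)])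
          (use less.prems False in auto)
      then show False using less.hyps[of n "m - 1"] less.prems nm by simp
    qed
  qed
  have "x \<in> S \<or> inverse x \<in> S" for x
  proof (cases "x = 0")
    case False
    then show ?thesis using ex[of x] ex[of "inverse x"] no[of x] by blast
  qed (use D in simp)
  then show ?thesis using S by (auto simp: vring_def subring_def)
qed

text \<open>Supplies both the bad rings and the criterion that an element integral at every
  valuation ring is algebraic over the prime field. Zorn's lemma starts from the ring generated by
  \<open>inverse z\<close> over the prime field; it misses \<open>z\<close> because
  \<open>inverse z\<close> is transcendental as well.\<close>

lemma vring_avoiding:
  fixes z :: "'a::field"
  assumes z: "\<not> algebraic_over prime_subfield z"
  shows "\<exists>V. vring UNIV V \<and> inverse z \<in> vmax V"
proof -
  define A where "A = {S. subring S \<and> inverse z \<in> S \<and> z \<notin> S}"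
  let ?k = "prime_subfield :: 'a set"
  note k = subfield_prime_subfield[where 'a = 'a]
  have z0: "z \<noteq> 0" using algebraic_over_mem[OF k subfieldD(1)[OF k]] z by auto
  have kr: "subring ?k" using subfieldD[OF k] by (auto simp: subring_def)
  let ?T = "{poly g (inverse z) | g. pov ?k g}"
  have "z \<notin> ?T"
  proof
    assume "z \<in> ?T"
    then obtain g where g: "pov ?k g" "z = poly g (inverse z)" by blast
    define w where "w = inverse z"
    have "poly (pCons (-1) g) w = 0" using g(2) z0 by (simp add: w_def)
    moreover have "pov ?k (pCons (-1) g)" using g(1) subfieldD[OF k] k by auto
    ultimately have "algebraic_over ?k w" unfolding algebraic_over_pov by (metis pCons_eq_0_iff neg_equal_0_iff_equal zero_neq_one)
    then have fd: "finite_dim_over ?k (gen_field ?k {w})" by (intro finite_dim_gen_field k) auto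
    have "z \<in> gen_field ?k {w}"
      using subfieldD(6)[OF subfield_gen_field, of w ?k "{w}"] gen_field_incl(2)[of "{w}" ?k] by (simp add: w_def)
    then show False using z finite_dim_subfield_algebraic[OF k subfield_gen_field fd] by blast
  qed
  then have "?T \<in> A" using subring_adjoin[OF kr, of "inverse z"] by (auto simp: A_def)
  then have ne: "A \<noteq> {}" by blast
  have "\<exists>M\<in>A. \<forall>X\<in>A. M \<subseteq> X \<longrightarrow> X = M"
  proof (rule subset_Zorn_nonempty[OF ne])
    fix C assume C: "C \<noteq> {}" "subset.chain A C"
    have CA: "C \<subseteq> A" and lin: "\<And>X Y. X \<in> C \<Longrightarrow> Y \<in> C \<Longrightarrow> X \<subseteq> Y \<or> Y \<subseteq> X"
      using C(2) by (auto simp: subset.chain_def)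
    obtain X0 where X0: "X0 \<in> C" using C by blast
    have "subring (\<Union>C)"
      unfolding subring_def
    proof (intro conjI ballI)
      show "1 \<in> \<Union>C" using X0 CA subringD(1) by (auto simp: A_def)
      fix x y assume "x \<in> \<Union>C" "y \<in> \<Union>C"
      then obtain X Y where XY: "X \<in> C" "x \<in> X" "Y \<in> C" "y \<in> Y" by blast
      then obtain W where W: "W \<in> C" "x \<in> W" "y \<in> W" using lin[of X Y] by blast
      then have "subring W" using CA by (auto simp: A_def)
      then show "x - y \<in> \<Union>C" "x * y \<in> \<Union>C" using W subringD by blast+
    qed
    then show "\<Union>C \<in> A" using X0 CA by (auto simp: A_def)
  qed
  then obtain S where S: "S \<in> A" "\<And>X. X \<in> A \<Longrightarrow> S \<subseteq> X \<Longrightarrow> X = S" by blast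
  have "vring UNIV S"
    by (rule maximal_subring_vring[of S z]) (use S in \<open>auto simp: A_def\<close>)
  moreover have "inverse z \<in> vmax S" using S(1) by (auto simp: A_def vmax_def)
  ultimately show ?thesis by blast
qed

lemma algebraic_in_vring:
  assumes V: "vring L V" and L: "is_subfield L" and k: "prime_subfield \<subseteq> V" and x: "x \<in> L" "algebraic_over prime_subfield x"
  shows "x \<in> V"
proof -
  interpret vr L V by unfold_locales fact+
  obtain q where q: "q \<noteq> 0" "pov prime_subfield q" "poly q x = 0" using x(2) by (auto simp: algebraic_over_pov)
  define n where "n = degree q"
  define l where "l = lead_coeff q"
  have l0: "l \<noteq> 0" using q by (simp add: l_def)
  have "0 = (\<Sum>i\<le>n. coeff q i * x ^ i)" using q(3) by (simp add: poly_altdef n_def)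
  also have "\<dots> = (\<Sum>i<n. coeff q i * x ^ i) + l * x ^ n" by (simp add: lessThan_Suc_atMost[symmetric] l_def n_def)
  finally have "x ^ n = - (\<Sum>i<n. coeff q i * x ^ i) / l" using l0 by (simp add: field_simps eq_neg_iff_add_eq_0)
  also have "\<dots> = (\<Sum>i<n. (- coeff q i / l) * x ^ i)" by (simp add: sum_negf sum_divide_distrib)
  finally have eq: "x ^ n = (\<Sum>i<n. (- coeff q i / l) * x ^ i)" .
  show ?thesis
  proof (rule integral_in_V[OF x(1) _ eq])
    fix i
    have "- coeff q i / l \<in> prime_subfield"
      unfolding l_def by (intro subfieldD[OF subfield_prime_subfield] povD[OF q(2)])
    then show "- coeff q i / l \<in> V" using k by blast
  qed
qed

lemma vring_restrict:
  assumes "vring L V" "is_subfield K" "K \<subseteq> L"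
  shows "vring K (V \<inter> K)" "vmax (V \<inter> K) = vmax V \<inter> K"
  using assms subfieldD[OF assms(2)] by (auto simp: vring_def vmax_def)

section \<open>Valuation rings centred at a = 0\<close>

lemma finite_image_factor:
  assumes "finite (f ` A)" "\<And>x y. x \<in> A \<Longrightarrow> y \<in> A \<Longrightarrow> f x = f y \<Longrightarrow> g x = g y"
  shows "finite (g ` A)"
proof -
  have "g ` A \<subseteq> (\<lambda>z. g (SOME x. x \<in> A \<and> f x = z)) ` (f ` A)"
  proof
    fix w assume "w \<in> g ` A"
    then obtain x where x: "x \<in> A" "w = g x" by blast
    define x' where "x' = (SOME x'. x' \<in> A \<and> f x' = f x)"
    have "x' \<in> A \<and> f x' = f x" unfolding x'_def by (rule someI[of _ x]) (use x in simp)
    then have "w = g x'" using assms(2)[of x x'] x by simp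
    then show "w \<in> (\<lambda>z. g (SOME x. x \<in> A \<and> f x = z)) ` (f ` A)"
      using x(1) unfolding x'_def by blast
  qed
  then show ?thesis using assms(1) finite_surj by blast
qed

locale ffield =
  fixes p :: nat and a :: "'a::field"
  assumes p: "p > 0" "of_nat p = (0::'a)" and tr: "\<not> algebraic_over prime_subfield a"
begin

abbreviation "k \<equiv> (prime_subfield :: 'a set)"
abbreviation "Ka \<equiv> gen_field k {a}"

lemma ksf: "is_subfield k" by (rule subfield_prime_subfield)

lemma a_nz: "a \<noteq> 0" using algebraic_over_mem[OF ksf subfieldD(1)[OF ksf]] tr by auto

text \<open>The images of the naturals form a finite set, on which multiplication by a nonzero
  element is injective, hence onto; so inverses exist.\<close>

lemma prime_subfield_char: "k = range of_nat" "finite k"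
proof -
  have "of_nat n = (of_nat (n mod p) :: 'a)" for n
    by (metis p(2) add.right_neutral mod_div_decomp mult_zero_right of_nat_add of_nat_mult add.commute)
  then have "range of_nat \<subseteq> (of_nat ` {..<p} :: 'a set)" using p(1) by (metis image_eqI image_subsetI lessThan_iff mod_less_divisor)
  then have fin: "finite (range of_nat :: 'a set)" using finite_surj by blast
  have add: "x + y \<in> range of_nat" if "x \<in> range of_nat" "y \<in> range of_nat" for x y :: 'a
    using that by (auto simp flip: of_nat_add)
  have mul: "x * y \<in> range of_nat" if "x \<in> range of_nat" "y \<in> range of_nat" for x y :: 'a
    using that by (auto simp flip: of_nat_mult)
  have neg: "- x \<in> range of_nat" if x: "x \<in> range of_nat" for x :: 'a
  proof -
    have "of_nat (p - 1) + 1 = (0 :: 'a)" using p by (metis Suc_pred' of_nat_Suc add.commute)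
    then have "- x = of_nat (p - 1) * x" by (metis add_eq_0_iff2 mult_minus1)
    then show ?thesis using mul x by simp
  qed
  have "is_subfield (range of_nat :: 'a set)"
  proof (rule is_subfieldI)
    show "0 \<in> range (of_nat :: nat \<Rightarrow> 'a)" by (metis of_nat_0 rangeI)
    show "1 \<in> range (of_nat :: nat \<Rightarrow> 'a)" by (metis of_nat_1 rangeI)
    fix x :: 'a assume x: "x \<in> range of_nat" "x \<noteq> 0"
    have "times x ` range of_nat = range of_nat"
      using x mul fin by (intro endo_inj_surj) (auto intro!: inj_onI)
    then obtain y where "y \<in> range of_nat" "x * y = 1" by (metis imageE of_nat_1 rangeI)
    then show "inverse x \<in> range of_nat" by (metis inverse_unique)
  qed (use add mul neg in auto)
  then have "k \<subseteq> range of_nat" by (rule prime_subfield_le)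
  moreover have "range of_nat \<subseteq> k" using subfieldD(10)[OF ksf] by auto
  ultimately show "k = range of_nat" by blast
  then show "finite k" using fin by simp
qed

lemma k_in_vring: "vring L V \<Longrightarrow> is_subfield L \<Longrightarrow> k \<subseteq> V"
  using vr.V_of_nat[of L V] unfolding prime_subfield_char vr_def by auto

text \<open>Every bad ring meets \<open>Ka\<close> in the same ring, the local ring of the rational
  function field at \<open>a = 0\<close>. Algebraicity over \<open>Ka\<close> makes bad rings
  archimedean: each element of the maximal ideal has a power divisible by \<open>a\<close>, and each
  element of \<open>L\<close> becomes integral after multiplication by a power of
  \<open>a\<close>.\<close>

definition bad :: "'a set \<Rightarrow> 'a set \<Rightarrow> bool" where
  "bad L V \<longleftrightarrow> is_subfield L \<and> Ka \<subseteq> L \<and> (\<forall>x\<in>L. algebraic_over Ka x) \<and> vring L V \<and> a \<in> vmax V"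

lemma bad_vr: "bad L V \<Longrightarrow> vr L V" by (simp add: bad_def vr_def)

lemma a_Ka: "a \<in> Ka" "k \<subseteq> Ka" using gen_field_incl[of "{a}" k] gen_field_incl[of k "{a}"] by auto

lemma bad_restrict:
  assumes V: "bad L V" and K: "is_subfield K" "Ka \<subseteq> K" "K \<subseteq> L"
  shows "bad K (V \<inter> K)"
  using V K vring_restrict[of L V K] a_Ka by (auto simp: bad_def)

lemma bad_restrict_UNIV:
  assumes V: "vring UNIV V" "a \<in> vmax V" and K: "is_subfield K" "Ka \<subseteq> K" "\<And>x. x \<in> K \<Longrightarrow> algebraic_over Ka x"
  shows "bad K (V \<inter> K)"
  using V K vring_restrict[of UNIV V K] a_Ka by (auto simp: bad_def)

section \<open>A single bad ring: residues and comparison with powers of \<open>a\<close>\<close>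

context
  fixes L V
  assumes bd: "bad L V"
begin

interpretation vr L V by (rule bad_vr[OF bd])

lemma a_m: "a \<in> vmax V" and KaL: "Ka \<subseteq> L" using bd by (auto simp: bad_def)

lemma kV: "k \<subseteq> V" using k_in_vring V L by blast

lemma k_unit: "c \<in> k \<Longrightarrow> c \<in> vmax V \<Longrightarrow> c = 0"
  using kV subfieldD(6)[OF ksf] by (auto simp: vmax_def)

lemma poly_a_V: "pov k P \<Longrightarrow> poly P a \<in> V"
proof (induction P)
  case (pCons c P)
  then show ?case using kV ksf m_V[OF a_m] by (auto intro!: V_add V_mult)
qed simp

lemma poly_a_unit: "pov k Q \<Longrightarrow> coeff Q 0 \<noteq> 0 \<Longrightarrow> poly Q a \<notin> vmax V"
proof (cases Q)
  case (pCons c q)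
  assume Q: "pov k Q" "coeff Q 0 \<noteq> 0"
  have "c \<in> k" "pov k q" "c \<noteq> 0" using Q ksf pCons by auto
  then have "c \<notin> vmax V" "a * poly q a \<in> vmax V" "c \<in> L"
    using k_unit m_mult[OF a_m poly_a_V] kV V_sub by auto
  then show ?thesis using unit_add[of c "a * poly q a"] pCons by simp
qed

text \<open>As long as the denominator vanishes at 0, integrality of \<open>c\<close> forces the
  numerator to vanish there too, and a factor \<open>a\<close> cancels.\<close>

lemma Ka_V_rep:
  assumes c: "c \<in> Ka" "c \<in> V"
  shows "\<exists>P Q. pov k P \<and> pov k Q \<and> coeff Q 0 \<noteq> 0 \<and> c = poly P a / poly Q a"
proof -
  have "\<exists>P Q. pov k P \<and> pov k Q \<and> coeff Q 0 \<noteq> 0 \<and> c = poly P a / poly Q a"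
    if "pov k P" "pov k Q" "poly Q a \<noteq> 0" "c = poly P a / poly Q a" for P Q
    using that
  proof (induction "degree Q" arbitrary: P Q rule: less_induct)
    case less
    show ?case
    proof (cases "coeff Q 0 = 0")
      case False
      then show ?thesis using less.prems by blast
    next
      case True
      obtain q0 Q' where Q': "Q = pCons q0 Q'" by (cases Q)
      obtain p0 P' where P': "P = pCons p0 P'" by (cases P)
      have q0: "q0 = 0" using True Q' by simp
      have pov: "pov k Q'" "pov k P'" "p0 \<in> k" using less.prems Q' P' ksf by auto
      have "p0 = c * (a * poly Q' a) - a * poly P' a" using less.prems Q' P' q0 by (simp add: field_simps)
      also have "\<dots> \<in> vmax V" by (intro m_diff m_mult2 m_mult c a_m poly_a_V pov)
      finally have p0: "p0 = 0" using k_unit pov(3) by blast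
      have "Q' \<noteq> 0" using less.prems Q' q0 by auto
      then have "degree Q' < degree Q" using Q' by simp
      moreover have "poly Q' a \<noteq> 0" "c = poly P' a / poly Q' a" using less.prems Q' P' p0 q0 a_nz by auto
      ultimately show ?thesis using less.hyps pov by blast
    qed
  qed
  then show ?thesis using c(1) unfolding gen_field_rational[OF ksf] by blast
qed

text \<open>At \<open>a = 0\<close> the rational function field has residue field \<open>k\<close>
  and uniformizer \<open>a\<close>: the constant \<open>c0\<close> is the value of \<open>c\<close>
  at 0.\<close>

lemma Ka_V_residue:
  assumes c: "c \<in> Ka" "c \<in> V"
  shows "\<exists>c0\<in>k. \<exists>d\<in>V. c = c0 + a * d"
proof -
  obtain P Q where PQ: "pov k P" "pov k Q" "coeff Q 0 \<noteq> 0" "c = poly P a / poly Q a" using Ka_V_rep[OF c] by blast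
  obtain q0 Q' where Q': "Q = pCons q0 Q'" by (cases Q)
  obtain p0 P' where P': "P = pCons p0 P'" by (cases P)
  have pov: "pov k Q'" "pov k P'" "p0 \<in> k" "q0 \<in> k" "q0 \<noteq> 0" using PQ Q' P' ksf by auto
  have u: "poly Q a \<notin> vmax V" by (rule poly_a_unit[OF PQ(2,3)])
  have u0: "q0 \<notin> vmax V" using k_unit pov by blast
  have QL: "poly Q a \<in> L" using poly_a_V[OF PQ(2)] V_sub by blast
  have q0L: "q0 \<in> L" using pov kV V_sub by blast
  have nz: "poly Q a \<noteq> 0" using u by auto
  define d where "d = (poly P' a * q0 - p0 * poly Q' a) / (q0 * poly Q a)"
  have "d \<in> V"
    unfolding d_def using pov kV by (intro divide_unit V_diff V_mult poly_a_V unit_mult subfieldD[OF L] q0L QL u u0) auto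
  moreover have "c = p0 / q0 + a * d"
  proof -
    have e: "poly P a * q0 = p0 * poly Q a + a * (poly P' a * q0 - p0 * poly Q' a)"
      by (simp add: P' Q' algebra_simps)
    have "c = (poly P a * q0) / (q0 * poly Q a)" using pov nz by (simp add: PQ(4))
    also have "\<dots> = p0 / q0 + a * d" unfolding e d_def using pov nz by (simp add: add_divide_distrib)
    finally show ?thesis .
  qed
  moreover have "p0 / q0 \<in> k" using pov subfieldD(8)[OF ksf] by blast
  ultimately show ?thesis by blast
qed

lemma Ka_m: "c \<in> Ka \<Longrightarrow> c \<in> vmax V \<Longrightarrow> \<exists>d\<in>V. c = a * d"
proof -
  assume c: "c \<in> Ka" "c \<in> vmax V"
  obtain c0 d where cd: "c0 \<in> k" "d \<in> V" "c = c0 + a * d" using Ka_V_residue[OF c(1) m_V[OF c(2)]] by blast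
  have "c0 = c - a * d" using cd by simp
  also have "\<dots> \<in> vmax V" by (intro m_diff c m_mult a_m cd)
  finally have "c0 = 0" using k_unit cd by blast
  then show ?thesis using cd by auto
qed

lemma poly_a_power: "pov k P \<Longrightarrow> P \<noteq> 0 \<Longrightarrow> \<exists>s u. poly P a = a ^ s * u \<and> u \<in> V \<and> u \<notin> vmax V"
proof (induction P)
  case (pCons c P)
  have c: "c \<in> k" "pov k P" using pCons.prems ksf by auto
  show ?case
  proof (cases "c = 0")
    case True
    then obtain s u where "poly P a = a ^ s * u" "u \<in> V" "u \<notin> vmax V" using pCons c by auto
    then show ?thesis using True by (intro exI[of _ "Suc s"] exI[of _ u]) auto
  next
    case False
    then have "poly (pCons c P) a \<notin> vmax V" using poly_a_unit[OF pCons.prems(1)] by simp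
    then show ?thesis using poly_a_V[OF pCons.prems(1)] by (intro exI[of _ 0] exI[of _ "poly (pCons c P) a"]) auto
  qed
qed simp

lemma Ka_bounded: "c \<in> Ka \<Longrightarrow> c \<noteq> 0 \<Longrightarrow> \<exists>s. a ^ s / c \<in> V"
proof -
  assume c: "c \<in> Ka" "c \<noteq> 0"
  then obtain P Q where PQ: "pov k P" "pov k Q" "poly Q a \<noteq> 0" "c = poly P a / poly Q a"
    unfolding gen_field_rational[OF ksf] by blast
  then have "P \<noteq> 0" using c by auto
  then obtain s u where su: "poly P a = a ^ s * u" "u \<in> V" "u \<notin> vmax V" using poly_a_power PQ by blast
  have "a ^ s / c = poly Q a / u" using su(1) PQ(3,4) a_nz by simp
  also have "\<dots> \<in> V" by (intro divide_unit poly_a_V PQ V_sub su)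
  finally show ?thesis by blast
qed

lemma scaled_relation:
  assumes x: "algebraic_over Ka x"
  obtains d n where "\<And>i. d i \<in> Ka" "\<And>i. d i \<in> V" "\<exists>i\<le>n. d i = 1" "d n \<noteq> 0" "(\<Sum>i\<le>n. d i * x ^ i) = 0" "n > 0"
proof -
  obtain q where q: "q \<noteq> 0" "pov Ka q" "poly q x = 0" using x by (auto simp: algebraic_over_pov)
  define n where "n = degree q"
  have "\<exists>i0\<in>{..n}. coeff q i0 \<noteq> 0 \<and> (\<forall>i\<in>{..n}. coeff q i / coeff q i0 \<in> V)"
    by (rule max_elem) (use q povD[OF q(2)] KaL n_def in \<open>auto intro: bexI[of _ n]\<close>)
  then obtain i0 where i0: "i0 \<le> n" "coeff q i0 \<noteq> 0" "\<forall>i\<le>n. coeff q i / coeff q i0 \<in> V" by auto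
  define d where "d i = coeff q i / coeff q i0" for i
  show ?thesis
  proof
    show "d i \<in> Ka" for i unfolding d_def by (intro subfieldD[OF subfield_gen_field] povD[OF q(2)])
    show "d i \<in> V" for i using i0(3) by (cases "i \<le> n") (auto simp: d_def n_def coeff_eq_0)
    show "\<exists>i\<le>n. d i = 1" using i0 by (auto simp: d_def)
    show "d n \<noteq> 0" using q i0 by (simp add: d_def n_def)
    have "(\<Sum>i\<le>n. d i * x ^ i) = poly q x / coeff q i0"
      by (simp add: poly_altdef n_def d_def sum_divide_distrib)
    then show "(\<Sum>i\<le>n. d i * x ^ i) = 0" using q by simp
    show "n > 0"
    proof (rule ccontr)
      assume "\<not> n > 0"
      then obtain c where "q = [:c:]" unfolding n_def by (metis degree_eq_zeroE neq0_conv)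
      then show False using q by auto
    qed
  qed
qed

text \<open>Let \<open>i0\<close> be the first index with a unit coefficient in an integral relation
  for \<open>x\<close>. The terms before it are divisible by \<open>a\<close>, and those from
  \<open>i0\<close> on add up to a unit times \<open>x^i0\<close>; so \<open>x^i0\<close> is
  divisible by \<open>a\<close>.\<close>

lemma m_arch: "x \<in> vmax V \<Longrightarrow> algebraic_over Ka x \<Longrightarrow> \<exists>n>0. \<exists>y\<in>V. x ^ n = a * y"
proof -
  assume x: "x \<in> vmax V" and alg: "algebraic_over Ka x"
  obtain d n where d: "\<And>i. d i \<in> Ka" "\<And>i. d i \<in> V" "\<exists>i\<le>n. d i = 1" "(\<Sum>i\<le>n. d i * x ^ i) = 0"
    using scaled_relation[OF alg] by metis
  let ?P = "\<lambda>i. i \<le> n \<and> d i \<notin> vmax V"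
  have ex: "\<exists>i. ?P i" using d(3) by (metis m_1)
  define i0 where "i0 = (LEAST i. ?P i)"
  have i0: "?P i0" unfolding i0_def by (rule LeastI_ex[OF ex])
  have less: "d i \<in> vmax V" if "i < i0" for i using not_less_Least[of i ?P] that i0 unfolding i0_def by fastforce
  have "\<forall>i. \<exists>e\<in>V. i < i0 \<longrightarrow> d i = a * e" using Ka_m[OF d(1) less] V_0 by blast
  then obtain e where e: "\<And>i. e i \<in> V" "\<And>i. i < i0 \<Longrightarrow> d i = a * e i" by metis
  define b where "b = d i0 + (\<Sum>i\<in>{i0<..n}. d i * x ^ (i - i0))"
  have xV: "x \<in> V" using m_V[OF x] .
  have bm: "b \<notin> vmax V"
    unfolding b_def using i0 x by (intro unit_add V_sub d m_sum m_mult2 m_power) auto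
  have bL: "b \<in> L" unfolding b_def by (intro V_sub V_add V_sum V_mult V_power d xV)
  have split: "{..n} = {..<i0} \<union> {i0} \<union> {i0<..n}" using i0 by auto
  have "0 = (\<Sum>i<i0. d i * x ^ i) + (d i0 * x ^ i0 + (\<Sum>i\<in>{i0<..n}. d i * x ^ i))"
    using d(4) unfolding split by (subst (asm) sum.union_disjoint) (auto simp: sum.union_disjoint add_ac)
  also have "(\<Sum>i<i0. d i * x ^ i) = a * (\<Sum>i<i0. e i * x ^ i)"
    by (simp add: sum_distrib_left e(2) mult.assoc)
  also have "(\<Sum>i\<in>{i0<..n}. d i * x ^ i) = (\<Sum>i\<in>{i0<..n}. d i * x ^ (i - i0)) * x ^ i0"
    by (auto simp: sum_distrib_right mult.assoc simp flip: power_add intro!: sum.cong)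
  finally have "0 = a * (\<Sum>i<i0. e i * x ^ i) + b * x ^ i0" by (simp add: b_def algebra_simps)
  then have "b * x ^ i0 = a * (- (\<Sum>i<i0. e i * x ^ i))" by (metis add_eq_0_iff mult_minus_right)
  moreover have b0: "b \<noteq> 0" using bm by auto
  ultimately have eq: "x ^ i0 = a * (- (\<Sum>i<i0. e i * x ^ i) / b)" by (simp add: field_simps)
  have "- (\<Sum>i<i0. e i * x ^ i) / b \<in> V" by (intro divide_unit V_minus V_sum V_mult V_power e xV bm bL)
  moreover have "i0 > 0"
  proof (rule ccontr)
    assume "\<not> i0 > 0"
    then show False using eq by simp
  qed
  ultimately show ?thesis using eq by blast
qed

text \<open>Multiplied by the leading coefficient of an integral relation, \<open>x\<close> becomes
  integral; that coefficient lies in \<open>Ka\<close> and divides a power of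
  \<open>a\<close>.\<close>

lemma L_bounded: "x \<in> L \<Longrightarrow> algebraic_over Ka x \<Longrightarrow> \<exists>n. a ^ n * x \<in> V"
proof -
  assume x: "x \<in> L" and alg: "algebraic_over Ka x"
  obtain d n where d: "\<And>i. d i \<in> Ka" "\<And>i. d i \<in> V" "d n \<noteq> 0" "(\<Sum>i\<le>n. d i * x ^ i) = 0" "n > 0"
    using scaled_relation[OF alg] by metis
  define w where "w = d n * x"
  have "0 = d n ^ (n - 1) * (\<Sum>i\<le>n. d i * x ^ i)" using d by simp
  also have "(\<Sum>i\<le>n. d i * x ^ i) = (\<Sum>i<n. d i * x ^ i) + d n * x ^ n"
    by (simp add: lessThan_Suc_atMost[symmetric])
  also have "d n ^ (n - 1) * \<dots> = (\<Sum>i<n. d i * d n ^ (n - 1 - i) * w ^ i) + w ^ n"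
  proof -
    have "d n ^ (n - 1) * (d i * x ^ i) = d i * d n ^ (n - 1 - i) * w ^ i" if "i < n" for i
    proof -
      have "d n ^ (n - 1) = d n ^ (n - 1 - i) * d n ^ i" using that by (simp flip: power_add)
      then show ?thesis by (simp add: w_def power_mult_distrib)
    qed
    moreover have "d n ^ (n - 1) * (d n * x ^ n) = w ^ n"
      using d(5) by (cases n) (auto simp: w_def power_mult_distrib)
    ultimately show ?thesis unfolding distrib_left sum_distrib_left by (intro arg_cong2[of _ _ _ _ "(+)"] sum.cong) auto
  qed
  finally have "w ^ n = (\<Sum>i<n. - (d i * d n ^ (n - 1 - i)) * w ^ i)"
    by (simp add: sum_negf eq_neg_iff_add_eq_0 add.commute)
  then have wV: "w \<in> V"
    by (rule integral_in_V[rotated 2]) (use d x V_sub in \<open>auto simp: w_def intro!: V_minus V_mult V_power subfieldD[OF L]\<close>)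
  obtain s where s: "a ^ s / d n \<in> V" using Ka_bounded d by blast
  have "a ^ s * x = a ^ s / d n * w" using d(3) by (simp add: w_def)
  then show ?thesis using V_mult[OF s wV] by metis
qed

lemma m_arch_power: "x \<in> vmax V \<Longrightarrow> algebraic_over Ka x \<Longrightarrow> \<exists>n0. \<forall>n\<ge>n0. \<exists>y\<in>V. x ^ n = a ^ N * y"
proof -
  assume x: "x \<in> vmax V" and alg: "algebraic_over Ka x"
  obtain n y where ny: "n > 0" "y \<in> V" "x ^ n = a * y" using m_arch[OF x alg] by blast
  show ?thesis
  proof (intro exI[of _ "n * N"] allI impI)
    fix m assume "n * N \<le> m"
    then have "x ^ m = (x ^ n) ^ N * x ^ (m - n * N)" by (simp flip: power_add power_mult)
    also have "\<dots> = a ^ N * (y ^ N * x ^ (m - n * N))" by (simp add: ny(3) power_mult_distrib)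
    finally show "\<exists>y\<in>V. x ^ m = a ^ N * y" using V_mult[OF V_power[OF ny(2)] V_power[OF m_V[OF x]]] by blast
  qed
qed

lemma eventually_small:
  assumes x: "x \<in> vmax V" and z: "z \<in> L" "algebraic_over Ka x" "algebraic_over Ka z"
  shows "\<exists>n0. \<forall>n\<ge>n0. \<exists>y\<in>V. x ^ n * z = a * y"
proof -
  obtain N where N: "a ^ N * z \<in> V" using L_bounded[OF z(1,3)] by blast
  obtain n0 where n0: "\<forall>n\<ge>n0. \<exists>y\<in>V. x ^ n = a ^ Suc N * y" using m_arch_power[OF x z(2)] by blast
  show ?thesis
  proof (intro exI[of _ n0] allI impI)
    fix n assume "n0 \<le> n"
    then obtain y where y: "y \<in> V" "x ^ n = a ^ Suc N * y" using n0 by blast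
    then have "x ^ n * z = a * (y * (a ^ N * z))" by simp
    then show "\<exists>y\<in>V. x ^ n * z = a * y" using V_mult[OF y(1) N] by blast
  qed
qed

end

section \<open>Independence of different bad rings\<close>

lemma bad_alg: "bad L V \<Longrightarrow> x \<in> L \<Longrightarrow> algebraic_over Ka x" by (simp add: bad_def)

text \<open>Integrality of an element of \<open>Ka\<close> at a bad ring means that the rational
  function has no pole at \<open>a = 0\<close>, a condition that does not mention the ring.\<close>

lemma Ka_in_bad: "bad L V \<Longrightarrow> bad L' V' \<Longrightarrow> c \<in> Ka \<Longrightarrow> c \<in> V \<Longrightarrow> c \<in> V'"
proof -
  assume V: "bad L V" and V': "bad L' V'" and c: "c \<in> Ka" "c \<in> V"
  interpret W: vr L' V' by (rule bad_vr[OF V'])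
  obtain P Q where PQ: "pov k P" "pov k Q" "coeff Q 0 \<noteq> 0" "c = poly P a / poly Q a" using Ka_V_rep[OF V c] by blast
  then show "c \<in> V'" using W.divide_unit[OF poly_a_V[OF V'] _ poly_a_unit[OF V']] W.V_sub[OF poly_a_V[OF V']] by blast
qed

text \<open>An element of \<open>W\<close> outside \<open>V\<close> has an inverse with a power
  divisible by \<open>a\<close> in \<open>V\<close>; read in \<open>W\<close>, this makes 1 a
  multiple of \<open>a\<close>.\<close>

lemma bad_incomparable:
  assumes V: "bad L V" and W: "bad L W" and sub: "V \<subseteq> W"
  shows "V = W"
proof (rule ccontr)
  assume "V \<noteq> W"
  then obtain x where x: "x \<in> W" "x \<notin> V" using sub by blast
  interpret V: vr L V by (rule bad_vr[OF V])
  interpret W: vr L W by (rule bad_vr[OF W])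
  have xL: "x \<in> L" using x W.V_sub by blast
  have x0: "x \<noteq> 0" using x by auto
  have iL: "inverse x \<in> L" using xL subfieldD(6)[OF V.L] by blast
  obtain n y where ny: "n > 0" "y \<in> V" "inverse x ^ n = a * y"
    using m_arch[OF V V.not_V_inv[OF xL x(2)] bad_alg[OF V iL]] by blast
  have "1 = x ^ n * inverse x ^ n" using x0 by (simp flip: power_mult_distrib)
  also have "\<dots> = a * (y * x ^ n)" by (simp add: ny(3))
  also have "\<dots> \<in> vmax W" using ny(2) sub x by (intro W.m_mult a_m[OF W] W.V_mult W.V_power) auto
  finally show False by simp
qed

lemma bad_separate:
  assumes V: "bad L V" and W: "bad L W" and ne: "V \<noteq> W"
  shows "\<exists>d\<in>L. d \<notin> V \<and> d \<in> vmax W"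
proof -
  interpret V: vr L V by (rule bad_vr[OF V])
  interpret W: vr L W by (rule bad_vr[OF W])
  obtain b where b: "b \<in> V" "b \<notin> W" using bad_incomparable[OF V W] ne by blast
  obtain c where c: "c \<in> W" "c \<notin> V" using bad_incomparable[OF W V] ne by blast
  have bL: "b \<in> L" "c \<in> L" using b c V.V_sub W.V_sub by auto
  have "c * inverse b \<in> vmax W" by (intro W.m_mult2 c W.not_V_inv bL b)
  moreover have "c * inverse b \<notin> V"
  proof
    assume "c * inverse b \<in> V"
    then have "c * inverse b * b \<in> V" using b V.V_mult by blast
    moreover have "b \<noteq> 0" using b W.V_0 by metis
    ultimately show False using c(2) by (simp add: mult.assoc)
  qed
  ultimately show ?thesis using subfieldD(5)[OF V.L bL(2) subfieldD(6)[OF V.L bL(1)]] by blast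
qed

text \<open>Induction on the number of rings at which \<open>c\<close> has to be small. A separator
  \<open>d\<close> for the new ring \<open>W\<close> may be large at the old ones, and
  \<open>c\<close> may be large at \<open>W\<close>; a high power of \<open>c\<close> balances
  them.\<close>

lemma bad_approx:
  assumes V: "bad L V" and "finite \<W>" "\<And>W. W \<in> \<W> \<Longrightarrow> bad L W \<and> W \<noteq> V"
  shows "\<exists>c\<in>L. c \<notin> V \<and> (\<forall>W\<in>\<W>. c \<in> vmax W)"
  using assms(2,3)
proof (induction \<W> rule: finite_induct)
  case empty
  interpret V: vr L V by (rule bad_vr[OF V])
  show ?case using V.inv_m_not_V[OF a_m[OF V] a_nz] KaL[OF V] a_Ka subfieldD(6)[OF V.L] by blast
next
  case (insert W \<W>)
  interpret V: vr L V by (rule bad_vr[OF V])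
  have bW: "bad L W" "W \<noteq> V" using insert.prems by auto
  interpret W: vr L W by (rule bad_vr[OF bW(1)])
  obtain c where c: "c \<in> L" "c \<notin> V" "\<forall>W\<in>\<W>. c \<in> vmax W" using insert by auto
  obtain d where d: "d \<in> L" "d \<notin> V" "d \<in> vmax W" using bad_separate[OF V bW(1)] bW(2) by auto
  have alg: "algebraic_over Ka c" "algebraic_over Ka d" using c d bad_alg[OF V] by auto
  have "\<forall>W'\<in>\<W>. \<exists>n0. \<forall>n\<ge>n0. \<exists>y\<in>W'. c ^ n * d = a * y"
    using eventually_small[OF _ _ d(1) alg] c(3) insert.prems by blast
  then obtain n0 where n0: "\<And>W' n. W' \<in> \<W> \<Longrightarrow> n0 W' \<le> n \<Longrightarrow> \<exists>y\<in>W'. c ^ n * d = a * y" by metis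
  \<comment> \<open>The sum dominates each single bound, and \<open>Suc\<close> keeps the exponent
    positive.\<close>
  define n where "n = Suc (\<Sum>W'\<in>\<W>. n0 W')"
  have small: "c ^ n * d \<in> vmax W'" if W': "W' \<in> \<W>" for W'
  proof -
    have "n0 W' \<le> (\<Sum>W'\<in>\<W>. n0 W')" using insert.hyps W' by (intro member_le_sum) auto
    then obtain y where "y \<in> W'" "c ^ n * d = a * y" using n0[OF W', of n] by (auto simp: n_def)
    then show ?thesis using vr.m_mult[OF bad_vr a_m, of L W' L] insert.prems W' by auto
  qed
  have cn: "c ^ n \<notin> V"
  proof -
    have "c \<notin> vmax V" using c(2) V.m_V by blast
    then show ?thesis using V.not_V_mult[OF c(1) _ c(2) V.unit_power[OF c(1)], of "n - 1"] subfieldD(9)[OF V.L c(1)]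
      by (simp add: n_def)
  qed
  have dm: "d \<notin> vmax V" using d V.m_V by blast
  show ?case
  proof (cases "c \<in> W")
    case True
    have "c ^ n * d \<in> vmax W" using True d by (intro W.m_mult2 W.V_power)
    moreover have "c ^ n * d \<notin> V" using cn dm c d by (intro V.not_V_mult subfieldD(9)[OF V.L])
    moreover have "c ^ n * d \<in> L" using c d by (intro subfieldD[OF V.L])
    ultimately show ?thesis using small by blast
  next
    case False
    \<comment> \<open>Where \<open>c\<close> is not integral, \<open>u\<close> is a unit near 1;
      where \<open>c\<close> is small, \<open>d / u\<close> equals \<open>c^n d / (1 + c^n)\<close>
      and is small as well.\<close>
    define u where "u = 1 + inverse c ^ n"
    have c0: "c \<noteq> 0" using c(2) V.V_0 by metis
    have uL: "u \<in> L" unfolding u_def using c by (intro subfieldD[OF V.L])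
    have uu: "u \<notin> vmax X" if X: "vr L X" "c \<notin> X" for X
    proof -
      interpret X: vr L X by fact
      show ?thesis unfolding u_def using X.not_V_inv[OF c(1) X(2)] subfieldD(2)[OF X.L]
        by (intro X.unit_add X.m_power) (auto simp: n_def)
    qed
    have uX: "u \<in> X" if X: "vr L X" "c \<notin> X" for X
    proof -
      interpret X: vr L X by fact
      show ?thesis unfolding u_def using X.not_V_inv[OF c(1) X(2)] X.m_V by (intro X.V_add X.V_power) auto
    qed
    have u0: "u \<noteq> 0" using uu[OF V.vr_axioms c(2)] by auto
    have "d / u \<in> vmax W" using W.divide_unit_m[OF d(3) uL] uu[OF W.vr_axioms False] by blast
    moreover have "d / u \<notin> V"
    proof
      assume "d / u \<in> V"
      then have "d / u * u \<in> V" using uX[OF V.vr_axioms c(2)] V.V_mult by blast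
      then show False using d(2) u0 by simp
    qed
    moreover have "d / u \<in> vmax W'" if W': "W' \<in> \<W>" for W'
    proof -
      interpret W': vr L W' using bad_vr insert.prems W' by blast
      have cm: "c \<in> vmax W'" using c W' by blast
      have eq: "d / u = c ^ n * d / (1 + c ^ n)"
      proof -
        have "u = (1 + c ^ n) / c ^ n" using c0 by (simp add: u_def field_simps)
        then show ?thesis by simp
      qed
      show ?thesis unfolding eq using cm c subfieldD(2)[OF W'.L]
        by (intro W'.divide_unit_m small W' W'.unit_add W'.m_power subfieldD[OF V.L]) (auto simp: n_def)
    qed
    ultimately show ?thesis using d(1) uL subfieldD(8)[OF V.L] by blast
  qed
qed

text \<open>\<open>c / (1 + c)\<close> is near 1 where \<open>c\<close> is large and near 0 where
  \<open>c\<close> is small.\<close>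

lemma bad_idempotent:
  assumes V: "bad L V" and W: "finite \<W>" "\<And>W. W \<in> \<W> \<Longrightarrow> bad L W \<and> W \<noteq> V"
  shows "\<exists>e\<in>L. 1 - e \<in> vmax V \<and> (\<forall>W\<in>\<W>. e \<in> vmax W)"
proof -
  interpret V: vr L V by (rule bad_vr[OF V])
  obtain c where c: "c \<in> L" "c \<notin> V" "\<forall>W\<in>\<W>. c \<in> vmax W" using bad_approx[OF V W] by blast
  have c1: "1 + c \<notin> V" using V.not_V_add[OF c(2) V.V_1] by (simp add: add.commute)
  then have n0: "1 + c \<noteq> 0" using V.V_0 by metis
  have cL: "1 + c \<in> L" by (intro subfieldD[OF V.L] c)
  define e where "e = c / (1 + c)"
  have "1 - e = inverse (1 + c)" using n0 by (simp add: e_def field_simps)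
  then have "1 - e \<in> vmax V" using V.not_V_inv[OF cL c1] by simp
  moreover have "e \<in> vmax W" if "W \<in> \<W>" for W
  proof -
    interpret W: vr L W using bad_vr W that by blast
    show ?thesis unfolding e_def using c that cL subfieldD(2)[OF V.L] by (intro W.divide_unit_m W.unit_add) auto
  qed
  moreover have "e \<in> L" unfolding e_def by (intro subfieldD(8)[OF V.L] c cL)
  ultimately show ?thesis by blast
qed

end

section \<open>Finiteness, conjugacy and density\<close>

context ffield
begin

text \<open>Elements near 1 at one bad ring and near 0 at the others are independent over
  \<open>Ka\<close>, so there are at most \<open>card B\<close> bad rings.\<close>

lemma bad_finite:
  assumes B: "spans_over Ka B K"
  shows "finite {U. bad K U}"
proof (rule ccontr)
  assume "infinite {U. bad K U}"
  then obtain \<U> where U: "\<U> \<subseteq> {U. bad K U}" "finite \<U>" "card \<U> = Suc (card B)"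
    using infinite_arbitrarily_large by metis
  have "\<forall>U\<in>\<U>. \<exists>e\<in>K. 1 - e \<in> vmax U \<and> (\<forall>W\<in>\<U> - {U}. e \<in> vmax W)"
    using U by (intro ballI bad_idempotent) auto
  then obtain e where e: "\<And>U. U \<in> \<U> \<Longrightarrow> e U \<in> K" "\<And>U. U \<in> \<U> \<Longrightarrow> 1 - e U \<in> vmax U"
    "\<And>U W. U \<in> \<U> \<Longrightarrow> W \<in> \<U> \<Longrightarrow> W \<noteq> U \<Longrightarrow> e U \<in> vmax W" by (metis DiffI singletonD)
  obtain c where c: "\<forall>U\<in>\<U>. c U \<in> Ka" "\<exists>U\<in>\<U>. c U \<noteq> 0" "(\<Sum>U\<in>\<U>. c U * e U) = 0"
    using linear_dependence[OF subfield_gen_field B, of \<U> e] U e(1) by auto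
  obtain U0 where U0: "U0 \<in> \<U>" using c by blast
  then have b0: "bad K U0" using U by blast
  have "\<exists>U1\<in>\<U>. c U1 \<noteq> 0 \<and> (\<forall>U\<in>\<U>. c U / c U1 \<in> U0)"
    using vr.max_elem[OF bad_vr[OF b0], of \<U> c] U U0 c KaL[OF b0] by blast
  then obtain U1 where U1: "U1 \<in> \<U>" "c U1 \<noteq> 0" "\<And>U. U \<in> \<U> \<Longrightarrow> c U / c U1 \<in> U0" by blast
  have b1: "bad K U1" using U1 U by blast
  interpret vr K U1 by (rule bad_vr[OF b1])
  \<comment> \<open>The relation was normalised at \<open>U0\<close> but is read at
    \<open>U1\<close>; its coefficients stay integral because both rings have the same intersection
    with \<open>Ka\<close>.\<close>
  have d: "c U / c U1 \<in> U1" if "U \<in> \<U>" for U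
    using Ka_in_bad[OF b0 b1] U1(3)[OF that] c(1) that U1(1) subfieldD(8)[OF subfield_gen_field] by blast
  have "0 = (\<Sum>U\<in>\<U>. c U * e U) / c U1" using c by simp
  also have "\<dots> = (\<Sum>U\<in>\<U>. c U / c U1 * e U)" by (simp add: sum_divide_distrib)
  also have "\<dots> = c U1 / c U1 * e U1 + (\<Sum>U\<in>\<U> - {U1}. c U / c U1 * e U)"
    using U1 U by (intro sum.remove) auto
  finally have "e U1 = - (\<Sum>U\<in>\<U> - {U1}. c U / c U1 * e U)" using U1(2) by (simp add: eq_neg_iff_add_eq_0)
  also have "\<dots> \<in> vmax U1" using d e(3) U1(1) by (intro m_minus m_sum m_mult2) auto
  finally have "e U1 + (1 - e U1) \<in> vmax U1" using e(2)[OF U1(1)] by (rule m_add)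
  then show False by simp
qed

text \<open>Elements of \<open>U\<close> independent over \<open>k\<close> modulo \<open>a\<close>
  are independent over \<open>Ka\<close>, since a relation over \<open>Ka\<close> can be scaled to
  have a coefficient 1. So \<open>U/aU\<close> has dimension at most \<open>card B\<close> over the
  finite field \<open>k\<close>, and the combinations of a maximal independent set represent
  it.\<close>

lemma residues_finite:
  assumes B: "spans_over Ka B K" and U: "bad K U"
  shows "\<exists>R. finite R \<and> (\<forall>x\<in>U. \<exists>r\<in>R. \<exists>y\<in>U. x - r = a * y)"
proof -
  interpret vr K U by (rule bad_vr[OF U])
  define ind where "ind X \<longleftrightarrow> finite X \<and> X \<subseteq> U \<and>
    (\<forall>c. (\<forall>x\<in>X. c x \<in> k) \<longrightarrow> (\<exists>y\<in>U. (\<Sum>x\<in>X. c x * x) = a * y) \<longrightarrow> (\<forall>x\<in>X. c x = 0))" for X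
  have bound: "card X \<le> card B" if X: "ind X" for X
  proof (rule ccontr)
    assume "\<not> card X \<le> card B"
    then obtain c where c: "\<forall>x\<in>X. c x \<in> Ka" "\<exists>x\<in>X. c x \<noteq> 0" "(\<Sum>x\<in>X. c x * x) = 0"
      using linear_dependence[OF subfield_gen_field B, of X id] X V_sub unfolding ind_def by (auto simp: subset_iff)
    have "\<exists>x1\<in>X. c x1 \<noteq> 0 \<and> (\<forall>x\<in>X. c x / c x1 \<in> U)"
      using max_elem[of X c] X c KaL[OF U] unfolding ind_def by blast
    then obtain x1 where x1: "x1 \<in> X" "c x1 \<noteq> 0" "\<And>x. x \<in> X \<Longrightarrow> c x / c x1 \<in> U" by blast
    have "\<forall>x\<in>X. \<exists>c0\<in>k. \<exists>d\<in>U. c x / c x1 = c0 + a * d"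
      using Ka_V_residue[OF U] x1 c(1) subfieldD(8)[OF subfield_gen_field] by blast
    then obtain c0 d where cd: "\<And>x. x \<in> X \<Longrightarrow> c0 x \<in> k" "\<And>x. x \<in> X \<Longrightarrow> d x \<in> U"
      "\<And>x. x \<in> X \<Longrightarrow> c x / c x1 = c0 x + a * d x" by metis
    have "0 = (\<Sum>x\<in>X. c x * x) / c x1" using c by simp
    also have "\<dots> = (\<Sum>x\<in>X. c x / c x1 * x)" by (simp add: sum_divide_distrib)
    also have "\<dots> = (\<Sum>x\<in>X. (c0 x + a * d x) * x)" by (intro sum.cong) (use cd in auto)
    also have "\<dots> = (\<Sum>x\<in>X. c0 x * x) + a * (\<Sum>x\<in>X. d x * x)"
      by (simp add: sum.distrib sum_distrib_left algebra_simps)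
    finally have "(\<Sum>x\<in>X. c0 x * x) = a * (- (\<Sum>x\<in>X. d x * x))" by (metis add_eq_0_iff2 mult_minus_right)
    moreover have "- (\<Sum>x\<in>X. d x * x) \<in> U" using X cd unfolding ind_def by (intro V_minus V_sum V_mult) auto
    ultimately have "c0 x1 = 0" using X cd(1) x1(1) unfolding ind_def by blast
    then have "1 = a * d x1" using cd(3)[OF x1(1)] x1(2) by simp
    then show False using m_mult[OF a_m[OF U] cd(2)[OF x1(1)]] m_1 by simp
  qed
  have "ind {}" by (simp add: ind_def)
  then obtain X where X: "ind X" "\<And>Y. ind Y \<Longrightarrow> card Y \<le> card X"
    using ex_has_greatest_nat[of ind "{}" card "Suc (card B)"] bound by (auto simp: less_Suc_eq_le)
  have Xf: "finite X" "X \<subseteq> U" using X(1) by (auto simp: ind_def)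
  \<comment> \<open>Extensional coefficient functions, of which there are finitely many.\<close>
  define R where "R = (\<lambda>c. \<Sum>x\<in>X. c x * x) ` (X \<rightarrow>\<^sub>E k)"
  have "finite R" unfolding R_def by (intro finite_imageI finite_PiE Xf prime_subfield_char)
  moreover have "\<exists>r\<in>R. \<exists>y\<in>U. z - r = a * y" if z: "z \<in> U" for z
  proof (rule ccontr)
    assume no: "\<not> ?thesis"
    have inR: "(\<Sum>x\<in>X. c x * x) \<in> R" if "\<And>x. x \<in> X \<Longrightarrow> c x \<in> k" for c
    proof -
      have "(\<Sum>x\<in>X. c x * x) = (\<Sum>x\<in>X. restrict c X x * x)" by (intro sum.cong) auto
      then show ?thesis unfolding R_def using that by (intro image_eqI[of _ _ "restrict c X"]) auto
    qed
    have zX: "z \<notin> X"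
    proof
      assume "z \<in> X"
      have "(\<Sum>x\<in>X. (if x = z then 1 else 0) * x) = (\<Sum>x\<in>X. if x = z then x else 0)" by (intro sum.cong) auto
      also have "\<dots> = z" using \<open>z \<in> X\<close> Xf by simp
      finally have "z \<in> R" using inR[of "\<lambda>x. if x = z then 1 else 0"] subfieldD(1,2)[OF ksf] by auto
      then show False using no V_0 by (metis diff_self mult_zero_right)
    qed
    have "ind (insert z X)"
      unfolding ind_def
    proof (intro conjI allI impI)
      fix c assume c: "\<forall>x\<in>insert z X. c x \<in> k" and "\<exists>y\<in>U. (\<Sum>x\<in>insert z X. c x * x) = a * y"
      then obtain y where y: "y \<in> U" "c z * z + (\<Sum>x\<in>X. c x * x) = a * y" using Xf zX by auto
      have cz: "c z = 0"
      proof (rule ccontr)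
        assume nz: "c z \<noteq> 0"
        define r where "r = (\<Sum>x\<in>X. (- c x / c z) * x)"
        have "r \<in> R" unfolding r_def using c by (intro inR subfieldD[OF ksf]) auto
        have e1: "r = - (\<Sum>x\<in>X. c x * x) / c z"
          by (simp add: r_def sum_negf sum_divide_distrib)
        have e2: "(\<Sum>x\<in>X. c x * x) = a * y - c z * z" using y(2) by (simp add: algebra_simps)
        have "z - r = a * (y / c z)" unfolding e1 e2 using nz by (simp add: field_simps)
        moreover have "y / c z \<in> U"
          unfolding divide_inverse using y c kV[OF U] subfieldD(6)[OF ksf] by (intro V_mult) auto
        ultimately show False using no \<open>r \<in> R\<close> by blast
      qed
      then have "\<exists>y\<in>U. (\<Sum>x\<in>X. c x * x) = a * y" using y by auto
      then have "\<forall>x\<in>X. c x = 0" using X(1) c unfolding ind_def by auto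
      then show "\<forall>x\<in>insert z X. c x = 0" using cz by simp
    qed (use Xf z in auto)
    then show False using X(2)[of "insert z X"] Xf zX by simp
  qed
  ultimately show ?thesis by blast
qed

section \<open>Bad rings in a Galois extension\<close>

context
  fixes F L
  assumes gal: "finite_galois_ext F L" and KaF: "Ka \<subseteq> F" and algL: "\<And>x. x \<in> L \<Longrightarrow> algebraic_over Ka x"
begin

lemma FL: "is_subfield F" "is_subfield L" "F \<subseteq> L" using galD[OF gal] by auto

lemma aF: "a \<in> F" using KaF a_Ka by blast

lemma vmax_image:
  assumes s: "\<sigma> \<in> aut_over F L" and V: "V \<subseteq> L"
  shows "vmax (\<sigma> ` V) = \<sigma> ` vmax V"
proof -
  note D = aut_overD[OF s FL(1)]
  note h = FL(2) D(1)
  have inj: "inj_on \<sigma> L" using hom_on_inj[OF h] .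
  have iff: "\<sigma> x \<in> \<sigma> ` V \<longleftrightarrow> x \<in> V" if "x \<in> L" for x using inj V that by (meson imageI inj_on_image_mem_iff)
  have "\<sigma> x \<in> vmax (\<sigma> ` V) \<longleftrightarrow> x \<in> vmax V" if x: "x \<in> V" for x
  proof -
    have xL: "x \<in> L" using x V by blast
    have "\<sigma> x = 0 \<longleftrightarrow> x = 0" using hom_on_nonzero[OF h xL] hom_on_0[OF h] by auto
    moreover have "inverse (\<sigma> x) = \<sigma> (inverse x)" using hom_on_inverse[OF h xL] by simp
    ultimately show ?thesis using iff[of "inverse x"] iff[of x] xL x subfieldD(6)[OF FL(2) xL] by (simp add: vmax_def)
  qed
  then show ?thesis by (auto simp: vmax_def)
qed

lemma bad_image:
  assumes bV: "bad L V" and s: "\<sigma> \<in> aut_over F L"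
  shows "bad L (\<sigma> ` V)"
proof -
  note D = aut_overD[OF s FL(1)]
  note h = FL(2) D(1)
  interpret vr L V by (rule bad_vr[OF bV])
  have VL: "V \<subseteq> L" using V_sub by blast
  have "vring L (\<sigma> ` V)"
    unfolding vring_def
  proof (intro conjI ballI)
    show "\<sigma> ` V \<subseteq> L" using VL D(4) by blast
    show "1 \<in> \<sigma> ` V" using hom_on_1[OF h] V_1 by force
    show "x \<in> \<sigma> ` V \<or> inverse x \<in> \<sigma> ` V" if x: "x \<in> L" for x
    proof -
      obtain y where y: "y \<in> L" "x = \<sigma> y" using x D(5) by blast
      then show ?thesis using V_total[OF y(1)] hom_on_inverse[OF h y(1)] by (metis imageI)
    qed
    fix x y assume "x \<in> \<sigma> ` V" "y \<in> \<sigma> ` V"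
    then obtain u v where uv: "u \<in> V" "v \<in> V" "x = \<sigma> u" "y = \<sigma> v" by blast
    have "x - y = \<sigma> (u - v)" "x * y = \<sigma> (u * v)"
      using uv VL by (simp_all add: hom_on_diff[OF h] hom_on_mult[OF h] subset_iff)
    then show "x - y \<in> \<sigma> ` V" "x * y \<in> \<sigma> ` V" using V_diff V_mult uv by auto
  qed
  moreover have "a \<in> vmax (\<sigma> ` V)" using vmax_image[OF s VL] a_m[OF bV] D(3)[OF aF] by force
  ultimately show ?thesis using bV by (auto simp: bad_def)
qed

lemma bad_sub: "bad L V \<Longrightarrow> V \<subseteq> L" by (simp add: bad_def vring_def)

lemma image_inv:
  assumes s: "\<sigma> \<in> aut_over F L" and V: "V \<subseteq> L"
  shows "inv_into L \<sigma> ` \<sigma> ` V = V" "\<sigma> ` inv_into L \<sigma> ` V = V"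
proof -
  have "inv_into L \<sigma> ` \<sigma> ` V = (\<lambda>x. x) ` V" "\<sigma> ` inv_into L \<sigma> ` V = (\<lambda>x. x) ` V"
    unfolding image_image using inv_aut_over(2,3)[OF s FL(1,3,2)] V by (intro image_cong; blast)+
  then show "inv_into L \<sigma> ` \<sigma> ` V = V" "\<sigma> ` inv_into L \<sigma> ` V = V" by simp_all
qed

lemma conj_mem:
  assumes s: "\<sigma> \<in> aut_over F L" and V: "V \<subseteq> L" and x: "x \<in> L"
  shows "\<sigma> x \<in> V \<longleftrightarrow> x \<in> inv_into L \<sigma> ` V"
proof
  assume "\<sigma> x \<in> V"
  then show "x \<in> inv_into L \<sigma> ` V" using inv_aut_over(2)[OF s FL(1,3,2) x] by (intro image_eqI[of _ _ "\<sigma> x"]) auto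
next
  assume "x \<in> inv_into L \<sigma> ` V"
  then obtain y where y: "y \<in> V" "x = inv_into L \<sigma> y" by blast
  then have "\<sigma> x = y" using inv_aut_over(3)[OF s FL(1,3,2), of y] V by blast
  then show "\<sigma> x \<in> V" using y by simp
qed

lemma vmax_conj:
  assumes V: "bad L V" and s: "\<sigma> \<in> aut_over F L" and x: "x \<in> L"
  shows "\<sigma> x \<in> vmax V \<longleftrightarrow> x \<in> vmax (inv_into L \<sigma> ` V)"
proof -
  note s' = inv_aut_over(1)[OF s FL(1,3,2)]
  have eq: "vmax (inv_into L \<sigma> ` V) = inv_into L \<sigma> ` vmax V" by (rule vmax_image[OF s' bad_sub[OF V]])
  have mL: "vmax V \<subseteq> L" using bad_sub[OF V] by (auto simp: vmax_def)
  show ?thesis unfolding eq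
    by (rule conj_mem[OF s mL x])
qed

lemma V_conj:
  assumes V: "bad L V" and s: "\<sigma> \<in> aut_over F L" and x: "x \<in> L"
  shows "\<sigma> x \<in> V \<longleftrightarrow> x \<in> inv_into L \<sigma> ` V"
  by (rule conj_mem[OF s bad_sub[OF V] x])

text \<open>There may be infinitely many maps in \<open>aut_over F L\<close>, but the image of
  \<open>V\<close> depends only on their values at a spanning set, and these lie in finite
  orbits.\<close>

lemma finite_conjugates: "bad L V \<Longrightarrow> finite ((\<lambda>\<sigma>. \<sigma> ` V) ` aut_over F L)"
proof -
  assume V: "bad L V"
  obtain B where B: "spans_over F B L" using galD(4)[OF gal] by (auto simp: finite_dim_over_spans)
  then have BL: "finite B" "B \<subseteq> L" by (auto simp: spans_over_def)
  show ?thesis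
  proof (rule finite_image_factor[where f = "\<lambda>\<sigma>. restrict \<sigma> B"])
    have "(\<lambda>\<sigma>. restrict \<sigma> B) ` aut_over F L \<subseteq> PiE B (orb F L)" by (auto simp: orb_def)
    moreover have "finite (PiE B (orb F L))" using BL finite_orb[OF gal] by (intro finite_PiE) auto
    ultimately show "finite ((\<lambda>\<sigma>. restrict \<sigma> B) ` aut_over F L)" by (rule finite_subset)
    fix \<sigma> \<tau> assume st: "\<sigma> \<in> aut_over F L" "\<tau> \<in> aut_over F L" "restrict \<sigma> B = restrict \<tau> B"
    have "\<sigma> x = \<tau> x" if x: "x \<in> L" for x
    proof -
      obtain c where c: "\<forall>b\<in>B. c b \<in> F" "x = (\<Sum>b\<in>B. c b * b)" using B x by (auto simp: spans_over_def)
      have ex: "\<rho> x = (\<Sum>b\<in>B. c b * \<rho> b)" if r: "\<rho> \<in> aut_over F L" for \<rho>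
      proof -
        note h = FL(2) aut_overD(1)[OF r FL(1)]
        have "\<rho> x = (\<Sum>b\<in>B. \<rho> (c b * b))"
          unfolding c(2) using c(1) BL FL(3) by (intro hom_on_sum[OF h] subfieldD[OF FL(2)]) auto
        also have "\<dots> = (\<Sum>b\<in>B. c b * \<rho> b)"
          using c(1) BL FL(3) aut_overD(3)[OF r FL(1)] by (intro sum.cong refl) (auto simp: hom_on_mult[OF h] subset_iff)
        finally show ?thesis .
      qed
      have "\<sigma> b = \<tau> b" if "b \<in> B" for b using fun_cong[OF st(3), of b] that by simp
      then show ?thesis using ex[OF st(1)] ex[OF st(2)] by simp
    qed
    then show "\<sigma> ` V = \<tau> ` V" using bad_sub[OF V] by (intro image_cong) auto
  qed
qed

text \<open>If the two orbits of rings were disjoint, some \<open>f\<close> would be near 1 on the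
  first and near 0 on the second. Its norm \<open>N\<close> lies in \<open>F\<close>, is a unit at
  \<open>V\<close> and belongs to the maximal ideal of \<open>V'\<close>, which contradicts
  \<open>V \<inter> F = V' \<inter> F\<close>.\<close>

lemma bad_conjugate:
  assumes V: "bad L V" and V': "bad L V'" and eq: "V \<inter> F = V' \<inter> F"
  shows "\<exists>\<sigma>\<in>aut_over F L. V' = \<sigma> ` V"
proof (rule ccontr)
  assume no: "\<not> ?thesis"
  let ?G = "aut_over F L"
  define \<V> where "\<V> = (\<lambda>\<sigma>. \<sigma> ` V) ` ?G"
  define \<V>' where "\<V>' = (\<lambda>\<sigma>. \<sigma> ` V') ` ?G"
  have fin: "finite \<V>" "finite \<V>'" unfolding \<V>_def \<V>'_def by (intro finite_conjugates V V')+
  have bd: "bad L W" if "W \<in> \<V> \<union> \<V>'" for W using that bad_image V V' unfolding \<V>_def \<V>'_def by blast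
  have disj: "\<V> \<inter> \<V>' = {}"
  proof (rule ccontr)
    assume "\<V> \<inter> \<V>' \<noteq> {}"
    then obtain \<sigma> \<tau> where st: "\<sigma> \<in> ?G" "\<tau> \<in> ?G" "\<sigma> ` V = \<tau> ` V'" unfolding \<V>_def \<V>'_def by blast
    have "V' = inv_into L \<tau> ` \<sigma> ` V" using image_inv(1)[OF st(2) bad_sub[OF V']] st(3) by simp
    then have "V' = (inv_into L \<tau> \<circ> \<sigma>) ` V" by (simp add: image_comp)
    then show False using no comp_aut_over[OF inv_aut_over(1)[OF st(2) FL(1,3,2)] st(1)] by blast
  qed
  have "\<forall>W\<in>\<V>. \<exists>e\<in>L. 1 - e \<in> vmax W \<and> (\<forall>X\<in>(\<V> \<union> \<V>') - {W}. e \<in> vmax X)"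
    using bd fin by (intro ballI bad_idempotent) auto
  then obtain e where e: "\<And>W. W \<in> \<V> \<Longrightarrow> e W \<in> L" "\<And>W. W \<in> \<V> \<Longrightarrow> 1 - e W \<in> vmax W"
    "\<And>W X. W \<in> \<V> \<Longrightarrow> X \<in> \<V> \<union> \<V>' \<Longrightarrow> X \<noteq> W \<Longrightarrow> e W \<in> vmax X" by (metis DiffI singletonD)
  define f where "f = (\<Sum>W\<in>\<V>. e W)"
  have fL: "f \<in> L" unfolding f_def by (intro subfield_sum FL e)
  have f1: "1 - f \<in> vmax X" if X: "X \<in> \<V>" for X
  proof -
    interpret X: vr L X using bad_vr bd X by blast
    have "f = e X + (\<Sum>W\<in>\<V> - {X}. e W)" unfolding f_def using X fin by (intro sum.remove) auto
    then have "1 - f = (1 - e X) - (\<Sum>W\<in>\<V> - {X}. e W)" by simp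
    also have "\<dots> \<in> vmax X" using X by (intro X.m_diff e(2)[OF X] X.m_sum e(3)) auto
    finally show ?thesis .
  qed
  have f0: "f \<in> vmax X" if X: "X \<in> \<V>'" for X
  proof -
    interpret X: vr L X using bad_vr bd X by blast
    show ?thesis unfolding f_def using X disj by (intro X.m_sum e) auto
  qed
  interpret V: vr L V by (rule bad_vr[OF V])
  interpret V': vr L V' by (rule bad_vr[OF V'])
  define N where "N = (\<Prod>y\<in>orb F L f. y)"
  have NF: "N \<in> F" unfolding N_def by (rule orb_prod_in[OF gal fL])
  have u: "y \<in> V \<and> y \<notin> vmax V \<and> y \<in> vmax V'" if y: "y \<in> orb F L f" for y
  proof -
    obtain \<sigma> where s: "\<sigma> \<in> ?G" "y = \<sigma> f" using y by (auto simp: orb_def)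
    note s' = inv_aut_over(1)[OF s(1) FL(1,3,2)]
    note h = FL(2) aut_overD(1)[OF s(1) FL(1)]
    have "inv_into L \<sigma> ` V \<in> \<V>" "inv_into L \<sigma> ` V' \<in> \<V>'" using s' by (auto simp: \<V>_def \<V>'_def)
    then have "\<sigma> (1 - f) \<in> vmax V" and *: "y \<in> vmax V'"
      using vmax_conj[OF V s(1), of "1 - f"] vmax_conj[OF V' s(1) fL] f1 f0 fL
        subfieldD(4)[OF FL(2) subfieldD(2)[OF FL(2)] fL] s(2) by auto
    then have m: "1 - y \<in> vmax V" using fL subfieldD(2)[OF FL(2)] by (simp add: hom_on_diff[OF h] hom_on_1[OF h] s(2))
    have "1 - (1 - y) \<in> V" by (intro V.V_diff V.m_V m V.V_1)
    moreover have "y \<notin> vmax V" using V.m_add[OF m, of y] by auto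
    ultimately show ?thesis using * by simp
  qed
  have "N \<in> V" "N \<notin> vmax V" unfolding N_def using u V.V_sub by (auto intro!: V.V_prod V.unit_prod)
  then have "inverse N \<in> V \<inter> F" using V.unit_inv subfieldD(6)[OF FL(1) NF] by auto
  then have i': "inverse N \<in> V'" using eq by blast
  have "N = f * (\<Prod>y\<in>orb F L f - {f}. y)"
    unfolding N_def using orb_self[OF gal] finite_orb[OF gal fL] by (intro prod.remove) auto
  also have "\<dots> \<in> vmax V'" using u orb_self[OF gal] V'.m_V by (intro V'.m_mult V'.V_prod) auto
  finally have "N \<in> vmax V'" .
  moreover have "N \<noteq> 0" using \<open>N \<notin> vmax V\<close> by auto
  ultimately show False using V'.inv_m_not_V i' by blast
qed

text \<open>An element fixed by the decomposition group lies in the completion of \<open>F\<close>.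
  To see this without completions, \<open>x\<close> is multiplied by a fixed factor that is nearly 1
  at \<open>V\<close> and nearly 0 at the other conjugate rings; the trace of the product is then
  congruent to \<open>x\<close> modulo \<open>a\<close>.\<close>

lemma bad_density:
  assumes V: "bad L V" and x: "x \<in> V" and fixed: "\<And>\<sigma>. \<sigma> \<in> aut_over F L \<Longrightarrow> \<sigma> ` V = V \<Longrightarrow> \<sigma> x = x"
  shows "\<exists>f\<in>F. \<exists>y\<in>V. x - f = a * y"
proof -
  let ?G = "aut_over F L"
  define D where "D = {\<sigma>\<in>?G. \<sigma> ` V = V}"
  define \<W> where "\<W> = (\<lambda>\<sigma>. \<sigma> ` V) ` ?G - {V}"
  have fin: "finite \<W>" unfolding \<W>_def using finite_conjugates[OF V] by blast
  have bd: "bad L W" if "W \<in> \<W>" for W using that bad_image[OF V] unfolding \<W>_def by blast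
  interpret V: vr L V by (rule bad_vr[OF V])
  have xL: "x \<in> L" using x V.V_sub by blast
  obtain c where c: "c \<in> L" "1 - c \<in> vmax V" "\<And>W. W \<in> \<W> \<Longrightarrow> c \<in> vmax W"
    using bad_idempotent[OF V fin] bd unfolding \<W>_def by blast
  define Y where "Y = {\<sigma> c | \<sigma>. \<sigma> \<in> D}"
  have YO: "Y \<subseteq> orb F L c" unfolding Y_def D_def orb_def by blast
  have Yf: "finite Y" "Y \<subseteq> L" using YO finite_orb[OF gal c(1)] orb_sub[OF gal c(1)] finite_subset by auto
  have cY: "c \<in> Y" 
  proof -
    have "id \<in> D" using id_aut_over[of F L] by (simp add: D_def)
    then have "id c \<in> Y" unfolding Y_def by blast
    then show ?thesis by simp
  qed
  have Dinv: "inv_into L \<sigma> \<in> D" if "\<sigma> \<in> D" for \<sigma>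
    using that inv_aut_over(1)[OF _ FL(1,3,2)] image_inv(1)[OF _ bad_sub[OF V], of \<sigma>] by (auto simp: D_def)
  have Dcomp: "\<sigma> \<circ> \<tau> \<in> D" if "\<sigma> \<in> D" "\<tau> \<in> D" for \<sigma> \<tau>
  proof -
    have "(\<sigma> \<circ> \<tau>) ` V = \<sigma> ` \<tau> ` V" by (simp only: image_comp)
    then show ?thesis using that comp_aut_over[of \<sigma> F L \<tau>] unfolding D_def by simp
  qed
  \<comment> \<open>\<open>c\<close> is near 1 at \<open>V\<close> and near 0 at the other
    conjugates, but it may be moved by the decomposition group; the product over its images keeps
    both properties and is fixed.\<close>
  define e where "e = (\<Prod>y\<in>Y. y)"
  have eL: "e \<in> L" unfolding e_def using Yf by (intro subfield_prod FL) auto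
  have Yin: "\<sigma> ` Y = Y" if s: "\<sigma> \<in> D" for \<sigma>
  proof -
    have sG: "\<sigma> \<in> ?G" using s by (simp add: D_def)
    have "\<sigma> ` Y \<subseteq> Y"
    proof
      fix z assume "z \<in> \<sigma> ` Y"
      then obtain \<tau> where "\<tau> \<in> D" "z = (\<sigma> \<circ> \<tau>) c" unfolding Y_def by auto
      then show "z \<in> Y" using Dcomp[OF s] unfolding Y_def by blast
    qed
    moreover have "inj_on \<sigma> Y" using aut_inj_orb[OF gal c(1) sG] YO inj_on_subset by blast
    ultimately show ?thesis using Yf by (metis card_image card_subset_eq)
  qed
  have eD: "\<sigma> e = e" if s: "\<sigma> \<in> D" for \<sigma>
  proof -
    have sG: "\<sigma> \<in> ?G" using s by (simp add: D_def)
    note h = FL(2) aut_overD(1)[OF sG FL(1)]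
    have "\<sigma> e = (\<Prod>y\<in>Y. \<sigma> y)" unfolding e_def using Yf by (intro hom_on_prod[OF h]) auto
    also have "\<dots> = (\<Prod>y\<in>\<sigma> ` Y. y)"
      using aut_inj_orb[OF gal c(1) sG] YO by (subst prod.reindex) (auto intro: inj_on_subset)
    finally show ?thesis using Yin[OF s] by (simp add: e_def)
  qed
  have Yunit: "1 - y \<in> vmax V" if y: "y \<in> Y" for y
  proof -
    obtain \<sigma> where s: "\<sigma> \<in> D" "y = \<sigma> c" using y unfolding Y_def by blast
    have sG: "\<sigma> \<in> ?G" using s by (simp add: D_def)
    note h = FL(2) aut_overD(1)[OF sG FL(1)]
    have "inv_into L \<sigma> ` V = V" using Dinv[OF s(1)] by (simp add: D_def)
    then have "\<sigma> (1 - c) \<in> vmax V" using vmax_conj[OF V sG, of "1 - c"] c(2)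
      subfieldD(4)[OF FL(2) subfieldD(2)[OF FL(2)] c(1)] by simp
    then show ?thesis using c(1) subfieldD(2)[OF FL(2)] by (simp add: hom_on_diff[OF h] hom_on_1[OF h] s(2))
  qed
  have e1: "1 - e \<in> vmax V"
  proof -
    have "1 - (\<Prod>y\<in>Z. y) \<in> vmax V \<and> (\<Prod>y\<in>Z. y) \<in> V" if "Z \<subseteq> Y" for Z
    proof -
      have "finite Z" using that Yf finite_subset by blast
      then show ?thesis using that
      proof (induction Z rule: finite_induct)
        case (insert z Z)
        have zm: "1 - z \<in> vmax V" using Yunit insert by blast
        have "1 - (1 - z) \<in> V" by (intro V.V_diff V.V_1 V.m_V zm)
        then have zV: "z \<in> V" by simp
        have "1 - z * (\<Prod>y\<in>Z. y) = (1 - z) + z * (1 - (\<Prod>y\<in>Z. y))" by (simp add: algebra_simps)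
        also have "\<dots> \<in> vmax V" using insert zm zV by (intro V.m_add V.m_mult2) auto
        finally show ?case using insert zV V.V_mult by auto
      qed simp
    qed
    then show ?thesis unfolding e_def by blast
  qed
  have eW: "e \<in> vmax W" if W: "W \<in> \<W>" for W
  proof -
    interpret W: vr L W using bad_vr bd W by blast
    have "y \<in> vmax W" if y: "y \<in> Y" for y
    proof -
      obtain \<sigma> where s: "\<sigma> \<in> D" "y = \<sigma> c" using y unfolding Y_def by blast
      have sG: "\<sigma> \<in> ?G" and sV: "\<sigma> ` V = V" using s by (auto simp: D_def)
      obtain \<tau> where t: "\<tau> \<in> ?G" "W = \<tau> ` V" "W \<noteq> V" using W unfolding \<W>_def by blast
      have "inv_into L \<sigma> ` W = (inv_into L \<sigma> \<circ> \<tau>) ` V" using t by (simp add: image_comp)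
      moreover have "inv_into L \<sigma> ` W \<noteq> V"
        using image_inv(2)[OF sG bad_sub[OF bd[OF W]]] sV t(3) by auto
      ultimately have "inv_into L \<sigma> ` W \<in> \<W>"
        unfolding \<W>_def using comp_aut_over[OF inv_aut_over(1)[OF sG FL(1,3,2)] t(1)] by blast
      then show ?thesis using vmax_conj[OF bd[OF W] sG c(1)] c(3) s(2) by blast
    qed
    moreover have "e = c * (\<Prod>y\<in>Y - {c}. y)" unfolding e_def using cY Yf by (intro prod.remove) auto
    ultimately show ?thesis using cY W.m_V by (auto intro!: W.m_mult W.V_prod)
  qed
  have e1L: "1 - e \<in> L" by (intro subfieldD(2,4)[OF FL(2)] eL)
  obtain n1 where n1: "\<And>n. n \<ge> n1 \<Longrightarrow> \<exists>y\<in>V. (1 - e) ^ n * x = a * y"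
    using eventually_small[OF V e1 xL algL[OF e1L] algL[OF xL]] by blast
  have "\<forall>W\<in>\<W>. \<exists>n0. \<forall>n\<ge>n0. \<exists>y\<in>W. e ^ n * x = a * y"
    using eventually_small[OF bd eW xL algL[OF eL] algL[OF xL]] by blast
  then obtain n0 where n0: "\<And>W n. W \<in> \<W> \<Longrightarrow> n0 W \<le> n \<Longrightarrow> \<exists>y\<in>W. e ^ n * x = a * y" by metis
  define n where "n = Suc (n1 + (\<Sum>W\<in>\<W>. n0 W))"
  have nW: "n0 W \<le> n" if "W \<in> \<W>" for W
    using member_le_sum[OF that, of n0] fin by (simp add: n_def)
  \<comment> \<open>\<open>1 - e'\<close> is divisible by \<open>(1 - e)^n\<close> and
    \<open>e'\<close> by \<open>e^n\<close>, so both approximations are sharpened at once. The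
    exponent \<open>n\<close> is large enough to absorb the denominators of
    \<open>x\<close>.\<close>
  define e' where "e' = 1 - (1 - e ^ n) ^ n"
  define z where "z = x * e'"
  have e'L: "e' \<in> L" unfolding e'_def by (intro subfieldD[OF FL(2)] eL)
  have zL: "z \<in> L" unfolding z_def by (intro subfieldD[OF FL(2)] xL e'L)
  have geo: "\<exists>s. 1 - u ^ n = (1 - u) * s \<and> (\<forall>X. vr L X \<longrightarrow> u \<in> X \<longrightarrow> s \<in> X)" for u :: 'a
  proof (intro exI conjI allI impI)
    show "1 - u ^ n = (1 - u) * (\<Sum>i<n. u ^ i)" by (simp add: one_diff_power_eq)
    show "(\<Sum>i<n. u ^ i) \<in> X" if "vr L X" "u \<in> X" for X
      using that by (intro vr.V_sum[OF that(1)] vr.V_power[OF that(1)])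
  qed
  have eV: "e \<in> V" using V.V_diff[OF V.V_1 V.m_V[OF e1]] by simp
  have zx: "\<exists>y\<in>V. z - x = a * y"
  proof -
    obtain s where s: "1 - e ^ n = (1 - e) * s" "s \<in> V" using geo[of e] eV V.vr_axioms by blast
    obtain y where y: "y \<in> V" "(1 - e) ^ n * x = a * y" using n1[of n] by (auto simp: n_def)
    have "z - x = - (x * (1 - e ^ n) ^ n)" by (simp add: z_def e'_def right_diff_distrib)
    also have "\<dots> = - (x * ((1 - e) * s) ^ n)" by (simp only: s(1))
    also have "\<dots> = - ((1 - e) ^ n * x) * s ^ n" by (simp add: power_mult_distrib)
    also have "\<dots> = a * (- (y * s ^ n))" unfolding y(2) by simp
    finally show ?thesis using V.V_minus[OF V.V_mult[OF y(1) V.V_power[OF s(2)]]] by blast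
  qed
  have zW: "\<exists>y\<in>W. z = a * y" if W: "W \<in> \<W>" for W
  proof -
    interpret W: vr L W using bad_vr bd W by blast
    have eWV: "e \<in> W" using eW[OF W] W.m_V by blast
    then have "1 - e ^ n \<in> W" by (intro W.V_diff W.V_power W.V_1)
    then obtain s where s: "1 - (1 - e ^ n) ^ n = (1 - (1 - e ^ n)) * s" "s \<in> W" using geo[of "1 - e ^ n"] W.vr_axioms by blast
    obtain y where y: "y \<in> W" "e ^ n * x = a * y" using n0[OF W nW[OF W]] by blast
    have "z = x * ((1 - (1 - e ^ n)) * s)" unfolding z_def e'_def s(1) ..
    also have "\<dots> = (e ^ n * x) * s" by simp
    also have "\<dots> = a * (y * s)" unfolding y(2) by simp
    finally show ?thesis using W.V_mult[OF y(1) s(2)] by blast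
  qed
  have zD: "\<sigma> z = z" if s: "\<sigma> \<in> D" for \<sigma>
  proof -
    have sG: "\<sigma> \<in> ?G" using s by (simp add: D_def)
    note h = FL(2) aut_overD(1)[OF sG FL(1)]
    have "\<sigma> x = x" using fixed[of \<sigma>] s by (simp add: D_def)
    moreover have "\<sigma> e' = e'"
      unfolding e'_def using eL subfieldD(2,4,9)[OF FL(2)] eD[OF s]
      by (simp add: hom_on_diff[OF h] hom_on_1[OF h] hom_on_power[OF h])
    ultimately show ?thesis unfolding z_def using xL e'L by (simp add: hom_on_mult[OF h])
  qed
  define f where "f = (\<Sum>y\<in>orb F L z. y)"
  have fF: "f \<in> F" unfolding f_def by (rule orb_sum_in[OF gal zL])
  \<comment> \<open>A conjugate different from \<open>z\<close> comes from an automorphism outside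
    the decomposition group; it carries some other conjugate ring, where \<open>z\<close> is
    divisible by \<open>a\<close>, to \<open>V\<close>.\<close>
  have other: "\<exists>y\<in>V. u = a * y" if u: "u \<in> orb F L z - {z}" for u
  proof -
    obtain \<sigma> where s: "\<sigma> \<in> ?G" "u = \<sigma> z" "u \<noteq> z" using u by (auto simp: orb_def)
    note s' = inv_aut_over(1)[OF s(1) FL(1,3,2)]
    note h = FL(2) aut_overD(1)[OF s(1) FL(1)]
    let ?W = "inv_into L \<sigma> ` V"
    have "?W \<noteq> V"
    proof
      assume "?W = V"
      then have "\<sigma> ` V = V" using image_inv(2)[OF s(1) bad_sub[OF V]] by simp
      then show False using zD[of \<sigma>] s by (simp add: D_def)
    qed
    then have "?W \<in> \<W>" using s' by (auto simp: \<W>_def)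
    then obtain y where y: "y \<in> ?W" "z = a * y" using zW by blast
    have yL: "y \<in> L" using y(1) bad_sub[OF bad_image[OF V s']] by blast
    have "u = a * \<sigma> y" using y(2) s(2) yL aF FL(3) aut_overD(3)[OF s(1) FL(1) aF]
      by (simp add: hom_on_mult[OF h] subset_iff)
    moreover have "\<sigma> y \<in> V" using V_conj[OF V s(1) yL] y(1) by blast
    ultimately show ?thesis by blast
  qed
  then obtain g where g: "\<And>u. u \<in> orb F L z - {z} \<Longrightarrow> g u \<in> V \<and> u = a * g u" by metis
  have "f = z + (\<Sum>u\<in>orb F L z - {z}. u)"
    unfolding f_def using orb_self[OF gal] finite_orb[OF gal zL] by (intro sum.remove) auto
  also have "(\<Sum>u\<in>orb F L z - {z}. u) = a * (\<Sum>u\<in>orb F L z - {z}. g u)"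
    unfolding sum_distrib_left using g by (intro sum.cong) auto
  finally have f: "f = z + a * (\<Sum>u\<in>orb F L z - {z}. g u)" .
  obtain y where y: "y \<in> V" "z - x = a * y" using zx by blast
  have "x - f = a * (- y - (\<Sum>u\<in>orb F L z - {z}. g u))" using y(2) unfolding f by (simp add: algebra_simps)
  moreover have "- y - (\<Sum>u\<in>orb F L z - {z}. g u) \<in> V" using g by (intro V.V_diff V.V_minus y V.V_sum) auto
  ultimately show ?thesis using fF by blast
qed

end

end

section \<open>The group law\<close>

text \<open>The product of ideals. Its associativity and commutativity hold for arbitrary sets,
  which frees later computations from side conditions.\<close>

definition ip :: "'r::comm_ring set \<Rightarrow> 'r set \<Rightarrow> 'r set" where
  "ip I J = {s. \<exists>ps. set ps \<subseteq> I \<times> J \<and> s = sum_list (map (\<lambda>(i, j). i * j) ps)}"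

lemma ip_0: "0 \<in> ip I J"
  unfolding ip_def by (intro CollectI exI[of _ "[]"]) auto

lemma ip_mem: "i \<in> I \<Longrightarrow> j \<in> J \<Longrightarrow> i * j \<in> ip I J"
  unfolding ip_def by (intro CollectI exI[of _ "[(i, j)]"]) auto

lemma ip_add: "s \<in> ip I J \<Longrightarrow> t \<in> ip I J \<Longrightarrow> s + t \<in> ip I J"
proof -
  assume "s \<in> ip I J" "t \<in> ip I J"
  then obtain ps qs where "set ps \<subseteq> I \<times> J" "s = sum_list (map (\<lambda>(i, j). i * j) ps)"
    "set qs \<subseteq> I \<times> J" "t = sum_list (map (\<lambda>(i, j). i * j) qs)" by (auto simp: ip_def)
  then show ?thesis unfolding ip_def by (intro CollectI exI[of _ "ps @ qs"]) auto
qed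

lemma ip_least:
  assumes "\<And>i j. i \<in> I \<Longrightarrow> j \<in> J \<Longrightarrow> i * j \<in> K" "0 \<in> K" "\<And>s t. s \<in> K \<Longrightarrow> t \<in> K \<Longrightarrow> s + t \<in> K"
  shows "ip I J \<subseteq> K"
proof
  fix s assume "s \<in> ip I J"
  then obtain ps where ps: "set ps \<subseteq> I \<times> J" "s = sum_list (map (\<lambda>(i, j). i * j) ps)" by (auto simp: ip_def)
  show "s \<in> K" unfolding ps(2) using ps(1) by (induction ps) (use assms in auto)
qed

lemma ip_comm: "ip I J = ip J I"
proof -
  have "ip I J \<subseteq> ip J I" for I J :: "'a set"
  proof (rule ip_least)
    show "i * j \<in> ip J I" if "i \<in> I" "j \<in> J" for i j using ip_mem[OF that(2,1)] by (simp add: mult.commute)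
  qed (auto simp: ip_0 ip_add)
  then show ?thesis by blast
qed

lemma ip_assoc_sub: "ip (ip I J) K \<subseteq> ip I (ip J K)"
proof (rule ip_least)
  fix s l assume s: "s \<in> ip I J" and l: "l \<in> K"
  have "ip I J \<subseteq> {s. s * l \<in> ip I (ip J K)}"
    by (rule ip_least) (auto simp: ip_0 ip_add distrib_right mult.assoc intro!: ip_mem l)
  then show "s * l \<in> ip I (ip J K)" using s by blast
qed (auto simp: ip_0 ip_add)

lemma ip_assoc: "ip (ip I J) K = ip I (ip J K)"
proof
  show "ip I (ip J K) \<subseteq> ip (ip I J) K"
    using ip_assoc_sub[of K J I] by (metis ip_comm)
qed (rule ip_assoc_sub)

lemma ip_left_comm: "ip I (ip J K) = ip J (ip I K)"
  by (metis ip_assoc ip_comm)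

lemmas ip_ac = ip_assoc ip_comm ip_left_comm

lemma ip_scale: "ip (times f ` I) J = times f ` ip I J"
proof
  show "ip (times f ` I) J \<subseteq> times f ` ip I J"
  proof (rule ip_least)
    show "i * j \<in> times f ` ip I J" if "i \<in> times f ` I" "j \<in> J" for i j
      using that ip_mem[of _ I j J] by (auto simp: mult.assoc)
    show "0 \<in> times f ` ip I J" using ip_0 by force
    show "s + t \<in> times f ` ip I J" if "s \<in> times f ` ip I J" "t \<in> times f ` ip I J" for s t
      using that ip_add[of _ I J] by (auto simp flip: distrib_left)
  qed
  have "ip I J \<subseteq> {s. f * s \<in> ip (times f ` I) J}"
    by (rule ip_least) (auto simp: ip_0 ip_add distrib_left mult.assoc[symmetric] intro!: ip_mem)
  then show "times f ` ip I J \<subseteq> ip (times f ` I) J" by blast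
qed

lemma ip_scale2: "ip I (times f ` J) = times f ` ip I J"
  by (metis ip_scale ip_comm)

text \<open>Over a finite field the product of all \<open>X - x\<close>, plus 1, has no
  root.\<close>

lemma alg_closed_infinite:
  assumes ac: "\<And>q::'a::field poly. degree q \<ge> 1 \<Longrightarrow> \<exists>x. poly q x = 0"
  shows "infinite (UNIV :: 'a set)"
proof
  assume fin: "finite (UNIV :: 'a set)"
  define q where "q = (\<Prod>x\<in>UNIV. [:- x, 1 :: 'a:]) + 1"
  let ?r = "\<Prod>x\<in>UNIV. [:- x, 1 :: 'a:]"
  have dr: "degree ?r = card (UNIV :: 'a set)" by (subst degree_prod_eq_sum_degree) auto
  have "card (UNIV :: 'a set) \<ge> 1" using fin by (simp add: Suc_leI card_gt_0_iff)
  then have "degree q \<ge> 1" unfolding q_def using dr by (subst degree_add_eq_left) auto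
  then obtain x where x: "poly q x = 0" using ac by blast
  have "poly ?r x = 0" using fin by (auto simp: poly_prod)
  then show False using x by (simp add: q_def)
qed

definition wcrv :: "'a::field \<Rightarrow> 'a \<Rightarrow> 'a weierstrass" where
  "wcrv b c = \<lparr>a1 = 1, a2 = 0, a3 = 0, a4 = b, a6 = c\<rparr>"

locale wcurve =
  fixes b c :: "'a::field"
  assumes ac: "\<And>q::'a poly. degree q \<ge> 1 \<Longrightarrow> \<exists>x. poly q x = 0"
    and nonsing: "disc (wcrv b c) \<noteq> 0"
begin

abbreviation "W \<equiv> wcrv b c"

definition C :: "('a \<times> 'a) set" where "C = {(x, y). y ^ 2 + x * y = x ^ 3 + b * x + c}"

abbreviation add (infixl \<open>\<oplus>\<close> 65) where "P \<oplus> Q \<equiv> ec_add W P Q"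

fun ng :: "('a \<times> 'a) option \<Rightarrow> ('a \<times> 'a) option" where
  "ng None = None" | "ng (Some (x, y)) = Some (x, - y - x)"

lemma W_sel [simp]: "a1 W = 1" "a2 W = 0" "a3 W = 0" "a4 W = b" "a6 W = c"
  by (simp_all add: wcrv_def)

lemma C_iff: "(x, y) \<in> C \<longleftrightarrow> y ^ 2 + x * y = x ^ 3 + b * x + c" by (simp add: C_def)

definition E :: "('a \<times> 'a) option set" where "E = {P. on_curve W P}"

lemma E_None [simp]: "None \<in> E" by (simp add: E_def on_curve_def)

lemma E_Some [simp]: "Some q \<in> E \<longleftrightarrow> q \<in> C"
  by (cases q) (simp add: E_def on_curve_def C_iff)

lemma ng_E [simp]: "P \<in> E \<Longrightarrow> ng P \<in> E"
  by (cases P rule: ng.cases) (auto simp: C_iff power2_eq_square algebra_simps)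

lemma ng_C: "(x, y) \<in> C \<Longrightarrow> (x, - y - x) \<in> C"
  by (auto simp: C_iff power2_eq_square algebra_simps)

lemma ng_ng [simp]: "ng (ng P) = P"
  by (cases P rule: ng.cases) auto

lemma same_x: "(x, y) \<in> C \<Longrightarrow> (x, y') \<in> C \<Longrightarrow> y' = y \<or> y' = - y - x"
proof -
  assume "(x, y) \<in> C" "(x, y') \<in> C"
  then have "(y' - y) * (y' + y + x) = 0" by (simp add: C_iff power2_eq_square algebra_simps)
  then have "y' - y = 0 \<or> y' + (y + x) = 0" by (simp add: add.assoc)
  then have "y' = y \<or> y' = - (y + x)" using eq_neg_iff_add_eq_0[of y' "y + x"] by simp
  then show ?thesis by simp
qed

lemma disc_W: "disc W = - (c - b ^ 2) - 64 * b ^ 3 - 432 * c ^ 2 + 72 * b * c"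
  by (simp add: disc_def wb2_def wb4_def wb6_def wb8_def power2_eq_square power3_eq_cube algebra_simps)

text \<open>A singular point expresses \<open>x\<close>, \<open>b\<close> and \<open>c\<close> as
  polynomials in \<open>y\<close>; substituting them makes the discriminant vanish.\<close>

lemma smooth:
  assumes "(x, y) \<in> C" "2 * y + x = 0"
  shows "3 * x ^ 2 + b - y \<noteq> 0"
proof
  assume "3 * x ^ 2 + b - y = 0"
  then have y: "y = 3 * x ^ 2 + b" by simp
  have x: "x = - 2 * y" using assms(2) by (simp add: eq_neg_iff_add_eq_0 add.commute)
  have b: "b = y - 12 * y ^ 2" using y unfolding x by (simp add: power2_eq_square algebra_simps)
  have c: "c = y ^ 2 + x * y - x ^ 3 - b * x" using assms(1) by (simp add: C_iff)
  have "- (c - b ^ 2) - 64 * b ^ 3 - 432 * c ^ 2 + 72 * b * c = 0" unfolding c unfolding b unfolding x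
    by (simp add: power2_eq_square power3_eq_cube algebra_simps)
  then have "disc W = 0" by (simp only: disc_W)
  then show False using nonsing by simp
qed

text \<open>One interface for the chord and the tangent case of \<open>ec_add\<close>: the line
  \<open>y = l x + n\<close> and the factorisation of its intersection with the cubic. Since
  \<open>x3\<close> is fixed by the sum of the roots, the two sides of the factorisation differ by a
  linear polynomial only.\<close>

lemma chord:
  assumes P: "(x1, y1) \<in> C" and Q: "(x2, y2) \<in> C" and ne: "\<not> (x1 = x2 \<and> y1 + y2 + x2 = 0)"
  obtains l n x3 where "Some (x1, y1) \<oplus> Some (x2, y2) = Some (x3, - (l * x3 + n) - x3)"
    "y1 = l * x1 + n" "y2 = l * x2 + n" "x3 = l ^ 2 + l - x1 - x2"
    "\<And>x. x ^ 3 + b * x + c - (l * x + n) ^ 2 - x * (l * x + n) = (x - x1) * (x - x2) * (x - x3)"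
    "x1 \<noteq> x2 \<Longrightarrow> l = (y2 - y1) / (x2 - x1)"
    "x1 = x2 \<Longrightarrow> y1 = y2 \<and> 2 * y1 + x1 \<noteq> 0 \<and> l = (3 * x1 ^ 2 + b - y1) / (2 * y1 + x1)"
proof (cases "x1 = x2")
  case False
  define l where "l = (y2 - y1) / (x2 - x1)"
  define n where "n = (y1 * x2 - y2 * x1) / (x2 - x1)"
  define x3 where "x3 = l ^ 2 + l - x1 - x2"
  have d: "x2 - x1 \<noteq> 0" using False by simp
  have l: "l * (x2 - x1) = y2 - y1" using d by (simp add: l_def)
  have n: "n * (x2 - x1) = y1 * x2 - y2 * x1" using d by (simp add: n_def)
  have "(y1 - (l * x1 + n)) * (x2 - x1) = y1 * (x2 - x1) - (l * (x2 - x1)) * x1 - n * (x2 - x1)"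
    by (simp add: algebra_simps)
  also have "\<dots> = 0" unfolding l n by (simp add: algebra_simps)
  finally have y1: "y1 = l * x1 + n" using d by simp
  have y2: "y2 = l * x2 + n" using l y1 by (simp add: algebra_simps)
  define \<alpha> where "\<alpha> = b - 2 * l * n - n - (x1 * x2 + x1 * x3 + x2 * x3)"
  define \<beta> where "\<beta> = c - n ^ 2 + x1 * x2 * x3"
  have lin: "x ^ 3 + b * x + c - (l * x + n) ^ 2 - x * (l * x + n) - (x - x1) * (x - x2) * (x - x3) = \<alpha> * x + \<beta>" for x
    by (simp add: \<alpha>_def \<beta>_def x3_def power2_eq_square power3_eq_cube algebra_simps)
  have 1: "\<alpha> * x1 + \<beta> = 0" using lin[of x1] P by (simp add: C_iff y1 algebra_simps)
  have 2: "\<alpha> * x2 + \<beta> = 0" using lin[of x2] Q by (simp add: C_iff y2 algebra_simps)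
  have "\<alpha> * (x2 - x1) = (\<alpha> * x2 + \<beta>) - (\<alpha> * x1 + \<beta>)" by (simp add: algebra_simps)
  then have "\<alpha> * (x2 - x1) = 0" by (simp only: 1 2 diff_self)
  then have \<alpha>: "\<alpha> = 0" using d by simp
  then have \<beta>: "\<beta> = 0" using 1 by simp
  have id: "x ^ 3 + b * x + c - (l * x + n) ^ 2 - x * (l * x + n) = (x - x1) * (x - x2) * (x - x3)" for x
    using lin[of x] \<alpha> \<beta> by simp
  have "Some (x1, y1) \<oplus> Some (x2, y2) = Some (l ^ 2 + l - x1 - x2, - (l + 1) * (l ^ 2 + l - x1 - x2) - n)"
    using False by (simp add: ec_add_def Let_def l_def n_def)
  also have "\<dots> = Some (x3, - (l * x3 + n) - x3)" unfolding x3_def[symmetric] by (simp add: algebra_simps)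
  finally have s: "Some (x1, y1) \<oplus> Some (x2, y2) = Some (x3, - (l * x3 + n) - x3)" .
  show ?thesis by (rule that[OF s y1 y2 x3_def id]) (use False in \<open>simp_all add: l_def\<close>)
next
  case True
  have y: "y2 = y1" using same_x[of x1 y1 y2] P Q ne True by auto
  have d: "2 * y1 + x1 \<noteq> 0" 
  proof -
    have "y1 + y2 + x2 = 2 * y1 + x1" unfolding y True by simp
    then show ?thesis using ne True by metis
  qed
  define l where "l = (3 * x1 ^ 2 + b - y1) / (2 * y1 + x1)"
  define n where "n = (- (x1 ^ 3) + b * x1 + 2 * c) / (2 * y1 + x1)"
  define x3 where "x3 = l ^ 2 + l - x1 - x1"
  have l: "l * (2 * y1 + x1) = 3 * x1 ^ 2 + b - y1" using d by (simp add: l_def)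
  have n: "n * (2 * y1 + x1) = - (x1 ^ 3) + b * x1 + 2 * c" using d by (simp add: n_def)
  have "(y1 - (l * x1 + n)) * (2 * y1 + x1) = y1 * (2 * y1 + x1) - (l * (2 * y1 + x1)) * x1 - n * (2 * y1 + x1)"
    by (simp add: algebra_simps)
  also have "\<dots> = 2 * (y1 ^ 2 + x1 * y1) - 2 * (x1 ^ 3 + b * x1 + c)"
    unfolding l n by (simp add: power2_eq_square power3_eq_cube algebra_simps)
  also have "\<dots> = 0" using P by (simp add: C_iff)
  finally have y1: "y1 = l * x1 + n" using d by simp
  define \<alpha> where "\<alpha> = b - 2 * l * n - n - (x1 * x1 + x1 * x3 + x1 * x3)"
  define \<beta> where "\<beta> = c - n ^ 2 + x1 * x1 * x3"
  have lin: "x ^ 3 + b * x + c - (l * x + n) ^ 2 - x * (l * x + n) - (x - x1) * (x - x1) * (x - x3) = \<alpha> * x + \<beta>" for x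
    by (simp add: \<alpha>_def \<beta>_def x3_def power2_eq_square power3_eq_cube algebra_simps)
  have 1: "\<alpha> * x1 + \<beta> = 0" using lin[of x1] P by (simp add: C_iff y1 algebra_simps)
  \<comment> \<open>In the tangent case the formula for the slope is exactly the vanishing of the
    linear coefficient; the root \<open>x1\<close> then kills the constant one.\<close>
  have "\<alpha> = 3 * x1 ^ 2 + b - (l * x1 + n) - l * (2 * (l * x1 + n) + x1)"
    by (simp add: \<alpha>_def x3_def power2_eq_square algebra_simps)
  also have "\<dots> = 0" using l unfolding y1[symmetric] by simp
  finally have \<alpha>: "\<alpha> = 0" .
  then have \<beta>: "\<beta> = 0" using 1 by simp
  have id: "x ^ 3 + b * x + c - (l * x + n) ^ 2 - x * (l * x + n) = (x - x1) * (x - x1) * (x - x3)" for x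
    using lin[of x] \<alpha> \<beta> by simp
  have "Some (x1, y1) \<oplus> Some (x2, y2) = Some (l ^ 2 + l - x1 - x1, - (l + 1) * (l ^ 2 + l - x1 - x1) - n)"
    using ne True y by (simp add: ec_add_def Let_def l_def n_def)
  also have "\<dots> = Some (x3, - (l * x3 + n) - x3)" unfolding x3_def[symmetric] by (simp add: algebra_simps)
  finally have s: "Some (x1, y1) \<oplus> Some (x2, y2) = Some (x3, - (l * x3 + n) - x3)" .
  have y2: "y2 = l * x2 + n" using y y1 by (simp only: True[symmetric])
  have x3: "x3 = l ^ 2 + l - x1 - x2" using x3_def by (simp only: True[symmetric])
  have id': "x ^ 3 + b * x + c - (l * x + n) ^ 2 - x * (l * x + n) = (x - x1) * (x - x2) * (x - x3)" for x
    using id by (simp only: True[symmetric])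
  show ?thesis by (rule that[OF s y1 y2 x3 id']) (use True y d l_def in auto)
qed

lemma chord_third:
  assumes "\<And>x. x ^ 3 + b * x + c - (l * x + n) ^ 2 - x * (l * x + n) = (x - x1) * (x - x2) * (x - x3)"
  shows "(x3, l * x3 + n) \<in> C" "(x3, - (l * x3 + n) - x3) \<in> C"
proof -
  show "(x3, l * x3 + n) \<in> C" using assms[of x3] by (simp add: C_iff algebra_simps)
  then show "(x3, - (l * x3 + n) - x3) \<in> C" by (rule ng_C)
qed

lemma add_None [simp]: "None \<oplus> Q = Q" "P \<oplus> None = P"
  by (auto simp: ec_add_def split: option.splits)

lemma add_ng [simp]: "P \<oplus> ng P = None" "ng P \<oplus> P = None"
  by (cases P rule: ng.cases; simp add: ec_add_def)+

lemma add_E [simp]: "P \<in> E \<Longrightarrow> Q \<in> E \<Longrightarrow> P \<oplus> Q \<in> E"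
proof -
  assume PQ: "P \<in> E" "Q \<in> E"
  show ?thesis
  proof (cases "P = None \<or> Q = None \<or> Q = ng P")
    case False
    then obtain x1 y1 x2 y2 where e: "P = Some (x1, y1)" "Q = Some (x2, y2)" by (metis option.exhaust surj_pair)
    have "\<not> (x1 = x2 \<and> y1 + y2 + x2 = 0)"
    proof
      assume "x1 = x2 \<and> y1 + y2 + x2 = 0"
      then have "y2 + (y1 + x1) = 0" by (simp add: add_ac)
      then have "y2 = - (y1 + x1)" using eq_neg_iff_add_eq_0[of y2 "y1 + x1"] by simp
      then show False using False e \<open>x1 = x2 \<and> _\<close> by simp
    qed
    then obtain l n x3 where "Some (x1, y1) \<oplus> Some (x2, y2) = Some (x3, - (l * x3 + n) - x3)"
      "\<And>x. x ^ 3 + b * x + c - (l * x + n) ^ 2 - x * (l * x + n) = (x - x1) * (x - x2) * (x - x3)"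
      using chord[of x1 y1 x2 y2] PQ e by (metis E_Some)
    then show ?thesis using e chord_third(2)[of l n x1 x2 x3] by simp
  qed (use PQ in auto)
qed

lemma add_comm: "P \<in> E \<Longrightarrow> Q \<in> E \<Longrightarrow> P \<oplus> Q = Q \<oplus> P"
proof -
  assume PQ: "P \<in> E" "Q \<in> E"
  show ?thesis
  proof (cases "P = None \<or> Q = None")
    case False
    then obtain x1 y1 x2 y2 where e: "P = Some (x1, y1)" "Q = Some (x2, y2)" by (metis option.exhaust surj_pair)
    show ?thesis
    proof (cases "x1 = x2")
      case True
      then have "y2 = y1 \<or> y2 = - y1 - x1" using same_x[of x1 y1 y2] PQ e by simp
      then show ?thesis using True e by (auto simp: ec_add_def Let_def)
    next
      case False
      have "(y1 - y2) / (x1 - x2) = (y2 - y1) / (x2 - x1)" "(y2 * x1 - y1 * x2) / (x1 - x2) = (y1 * x2 - y2 * x1) / (x2 - x1)"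
        by (metis minus_diff_eq minus_divide_divide)+
      then show ?thesis using False e by (simp add: ec_add_def Let_def diff_right_commute)
    qed
  qed auto
qed

end

section \<open>Ideals of the coordinate ring\<close>

context wcurve
begin

definition Fp :: "'a poly" where "Fp = [:c, b, 0, 1:]"

text \<open>Elements of the coordinate ring, cut off to 0 outside the curve so that equality of
  functions is equality on the curve.\<close>

definition fn :: "'a poly \<Rightarrow> 'a poly \<Rightarrow> ('a \<times> 'a \<Rightarrow> 'a)" where
  "fn A B = (\<lambda>q. if q \<in> C then poly A (fst q) + poly B (fst q) * snd q else 0)"

definition R :: "('a \<times> 'a \<Rightarrow> 'a) set" where "R = {fn A B | A B. True}"

text \<open>The norm of \<open>A + B y\<close> down to polynomials in \<open>x\<close>: its product
  with its conjugate under \<open>y \<mapsto> - y - x\<close>.\<close>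

definition nrm :: "'a poly \<Rightarrow> 'a poly \<Rightarrow> 'a poly" where
  "nrm A B = A ^ 2 - A * B * [:0, 1:] - B ^ 2 * Fp"

lemma poly_Fp: "poly Fp x = x ^ 3 + b * x + c"
  by (simp add: Fp_def power3_eq_cube algebra_simps)

lemma fn_R [simp]: "fn A B \<in> R" by (auto simp: R_def)

lemma R_E: "h \<in> R \<Longrightarrow> (\<And>A B. h = fn A B \<Longrightarrow> thesis) \<Longrightarrow> thesis" by (auto simp: R_def)

lemma fn_app: "(x, y) \<in> C \<Longrightarrow> fn A B (x, y) = poly A x + poly B x * y" by (simp add: fn_def)

lemma fn_eqI: "(\<And>x y. (x, y) \<in> C \<Longrightarrow> f (x, y) = g (x, y)) \<Longrightarrow> (\<And>q. q \<notin> C \<Longrightarrow> f q = g q) \<Longrightarrow> f = (g :: 'a \<times> 'a \<Rightarrow> 'a)"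
  by (metis ext surj_pair)

lemma fn_add: "fn A B + fn A' B' = fn (A + A') (B + B')"
  by (rule ext) (simp add: fn_def algebra_simps)

lemma fn_diff: "fn A B - fn A' B' = fn (A - A') (B - B')"
  by (rule ext) (simp add: fn_def algebra_simps)

lemma fn_minus: "- fn A B = fn (- A) (- B)"
  by (rule ext) (simp add: fn_def algebra_simps)

lemma fn_0: "0 = fn 0 0"
  by (rule ext) (simp add: fn_def)

lemma fn_mult: "fn A B * fn A' B' = fn (A * A' + B * B' * Fp) (A * B' + A' * B - B * B' * [:0, 1:])"
proof (rule fn_eqI)
  fix x y assume q: "(x, y) \<in> C"
  then have y2: "y * y = poly Fp x - x * y" by (simp add: C_iff poly_Fp power2_eq_square algebra_simps)
  have "(fn A B * fn A' B') (x, y) = poly A x * poly A' x + (poly A x * poly B' x + poly A' x * poly B x) * y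
      + poly B x * poly B' x * (y * y)"
    using q by (simp add: fn_app algebra_simps)
  also have "\<dots> = fn (A * A' + B * B' * Fp) (A * B' + A' * B - B * B' * [:0, 1:]) (x, y)"
    unfolding y2 using q by (simp add: fn_app algebra_simps)
  finally show "(fn A B * fn A' B') (x, y) = fn (A * A' + B * B' * Fp) (A * B' + A' * B - B * B' * [:0, 1:]) (x, y)" .
qed (simp add: fn_def)

lemma nrm_mult: "nrm (A * A' + B * B' * Fp) (A * B' + A' * B - B * B' * [:0, 1:]) = nrm A B * nrm A' B'"
proof -
  have "(A * A' + B * B' * F)\<^sup>2 - (A * A' + B * B' * F) * (A * B' + A' * B - B * B' * X) * X - (A * B' + A' * B - B * B' * X)\<^sup>2 * F
    = (A\<^sup>2 - A * B * X - B\<^sup>2 * F) * (A'\<^sup>2 - A' * B' * X - B'\<^sup>2 * F)" for F X :: "'a poly"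
    by (simp add: power2_eq_square algebra_simps)
  then show ?thesis unfolding nrm_def .
qed

lemma C_point: "\<exists>y. (x, y) \<in> C"
proof -
  have "degree [:- (x ^ 3 + b * x + c), x, 1:] \<ge> 1" by simp
  then obtain y where "poly [:- (x ^ 3 + b * x + c), x, 1:] y = 0" using ac by blast
  then show ?thesis by (auto simp: C_iff power2_eq_square algebra_simps)
qed

lemma C_infinite: "infinite C"
proof
  assume "finite C"
  then have "finite (fst ` C)" by simp
  moreover have "fst ` C = UNIV" using C_point by force
  ultimately show False using alg_closed_infinite[OF ac] by simp
qed

text \<open>\<open>A^2\<close> has even degree and \<open>B^2 Fp\<close> odd degree, so they cannot
  cancel, and the middle term has smaller degree than the larger of them.\<close>

lemma nrm_degree_B: "B \<noteq> 0 \<Longrightarrow> degree (nrm A B) \<ge> 3 \<and> nrm A B \<noteq> 0"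
proof -
  assume B: "B \<noteq> 0"
  let ?X = "[:0, 1:] :: 'a poly"
  have F: "Fp \<noteq> 0" "degree Fp = 3" "lead_coeff Fp = 1" by (auto simp: Fp_def)
  have dB: "degree (B ^ 2 * Fp) = 2 * degree B + 3" "B ^ 2 * Fp \<noteq> 0"
    using B F by (simp_all add: degree_mult_eq power2_eq_square)
  have dAB: "degree (A * B * ?X) \<le> degree A + degree B + 1"
    using degree_mult_le[of "A * B" ?X] degree_mult_le[of A B] by simp
  have dA: "degree (A ^ 2) = 2 * degree A" by (cases "A = 0") (auto simp: degree_power_eq)
  show ?thesis
  proof (cases "degree A \<ge> degree B + 2")
    case True
    have A: "A \<noteq> 0" using True by auto
    have "degree (A ^ 2 - A * B * ?X) = 2 * degree A"
    proof -
      have "degree (A * B * ?X) < degree (A ^ 2)" using True dAB dA by simp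
      then have "degree (A ^ 2 + - (A * B * ?X)) = degree (A ^ 2)" by (intro degree_add_eq_left) (simp only: degree_minus)
      then show ?thesis using dA by (simp only: diff_conv_add_uminus)
    qed
    then have "degree (B ^ 2 * Fp) < degree (A ^ 2 - A * B * ?X)" using True dB by simp
    then have "degree (A ^ 2 - A * B * ?X + - (B ^ 2 * Fp)) = degree (A ^ 2 - A * B * ?X)"
      by (intro degree_add_eq_left) (simp only: degree_minus)
    then have "degree (nrm A B) = 2 * degree A"
      using \<open>degree (A ^ 2 - A * B * ?X) = 2 * degree A\<close> by (simp only: nrm_def diff_conv_add_uminus)
    then show ?thesis using True by auto
  next
    case False
    have "degree (A ^ 2 - A * B * ?X) \<le> 2 * degree B + 2"
      using False dAB dA by (intro degree_diff_le) auto
    then have "degree (A ^ 2 - A * B * ?X) < degree (- (B ^ 2 * Fp))" using dB by simp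
    then have "degree (A ^ 2 - A * B * ?X + - (B ^ 2 * Fp)) = degree (- (B ^ 2 * Fp))" by (rule degree_add_eq_right)
    then have "degree (nrm A B) = 2 * degree B + 3" using dB by (simp only: nrm_def diff_conv_add_uminus degree_minus)
    then show ?thesis by auto
  qed
qed

lemma nrm_0: "nrm A 0 = A ^ 2" by (simp add: nrm_def)

lemma nrm_degree_0: "degree (nrm A 0) = 2 * degree A"
  by (cases "A = 0") (auto simp: nrm_def degree_power_eq)

lemma nrm_nz: "nrm A B = 0 \<Longrightarrow> A = 0 \<and> B = 0"
  using nrm_degree_B[of B A] nrm_0[of A] by (cases "B = 0") auto

lemma nrm_zero: "(x, y) \<in> C \<Longrightarrow> fn A B (x, y) = 0 \<Longrightarrow> poly (nrm A B) x = 0"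
proof -
  assume q: "(x, y) \<in> C" and z: "fn A B (x, y) = 0"
  have "poly A x = - (poly B x * y)" using z q by (simp add: fn_app eq_neg_iff_add_eq_0)
  then have "poly (nrm A B) x = poly B x ^ 2 * (y ^ 2 + x * y - poly Fp x)"
    by (simp add: nrm_def power2_eq_square algebra_simps)
  also have "y ^ 2 + x * y - poly Fp x = 0" using q by (simp add: C_iff poly_Fp)
  finally show ?thesis by simp
qed

lemma fn_zeros_finite:
  assumes "(A, B) \<noteq> (0, 0)"
  shows "finite {q \<in> C. fn A B q = 0}"
proof -
  have nz: "nrm A B \<noteq> 0" using assms nrm_nz by blast
  have fx: "finite {y. (x, y) \<in> C}" for x
  proof -
    have "{y. (x, y) \<in> C} \<subseteq> {y. poly [:- (x ^ 3 + b * x + c), x, 1:] y = 0}"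
      by (auto simp: C_iff power2_eq_square algebra_simps)
    moreover have "finite {y. poly [:- (x ^ 3 + b * x + c), x, 1:] y = 0}" by (rule poly_roots_finite) simp
    ultimately show ?thesis by (rule finite_subset)
  qed
  have "{q \<in> C. fn A B q = 0} \<subseteq> (\<Union>x\<in>{x. poly (nrm A B) x = 0}. Pair x ` {y. (x, y) \<in> C})"
  proof
    fix q assume q: "q \<in> {q \<in> C. fn A B q = 0}"
    obtain x y where xy: "q = (x, y)" by (cases q)
    then show "q \<in> (\<Union>x\<in>{x. poly (nrm A B) x = 0}. Pair x ` {y. (x, y) \<in> C})"
      using nrm_zero[of x y A B] q by (intro UN_I[of x]) auto
  qed
  moreover have "finite (\<Union>x\<in>{x. poly (nrm A B) x = 0}. Pair x ` {y. (x, y) \<in> C})"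
    using poly_roots_finite[OF nz] fx by auto
  ultimately show ?thesis by (rule finite_subset)
qed

lemma fn_inj: "fn A B = fn A' B' \<longleftrightarrow> A = A' \<and> B = B'"
proof
  assume eq: "fn A B = fn A' B'"
  have "fn (A - A') (B - B') = 0" using eq by (simp flip: fn_diff)
  then have "{q \<in> C. fn (A - A') (B - B') q = 0} = C" by (auto simp: fun_eq_iff)
  then show "A = A' \<and> B = B'" using fn_zeros_finite[of "A - A'" "B - B'"] C_infinite by auto
qed auto

lemma fn_eq_0: "fn A B = 0 \<longleftrightarrow> A = 0 \<and> B = 0"
  using fn_inj[of A B 0 0] fn_0 by simp

lemma R_add: "f \<in> R \<Longrightarrow> g \<in> R \<Longrightarrow> f + g \<in> R" by (auto elim!: R_E simp: fn_add)
lemma R_diff: "f \<in> R \<Longrightarrow> g \<in> R \<Longrightarrow> f - g \<in> R" by (auto elim!: R_E simp: fn_diff)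
lemma R_mult: "f \<in> R \<Longrightarrow> g \<in> R \<Longrightarrow> f * g \<in> R" by (auto elim!: R_E simp: fn_mult)
lemma R_0: "0 \<in> R" using fn_0 fn_R by metis

text \<open>The norm is multiplicative and vanishes only at 0.\<close>

lemma R_domain: "f \<in> R \<Longrightarrow> g \<in> R \<Longrightarrow> f * g = 0 \<Longrightarrow> f = 0 \<or> g = 0"
proof -
  assume "f \<in> R" "g \<in> R" and z: "f * g = 0"
  then obtain A B A' B' where fg: "f = fn A B" "g = fn A' B'" by (auto elim!: R_E)
  have "A * A' + B * B' * Fp = 0 \<and> A * B' + A' * B - B * B' * [:0, 1:] = 0"
    using z unfolding fg fn_mult fn_eq_0 .
  then have "nrm A B * nrm A' B' = nrm 0 0" using nrm_mult[of A A' B B'] by simp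
  then have "nrm A B = 0 \<or> nrm A' B' = 0" by (simp add: nrm_def)
  then show ?thesis using nrm_nz fg fn_0 by metis
qed

lemma R_cancel: "f \<in> R \<Longrightarrow> g \<in> R \<Longrightarrow> h \<in> R \<Longrightarrow> f \<noteq> 0 \<Longrightarrow> f * g = f * h \<Longrightarrow> g = h"
  using R_domain[of f "g - h"] R_diff[of g h] by (simp add: right_diff_distrib)

lemma image_cancel:
  assumes "f \<in> R" "f \<noteq> 0" "I \<subseteq> R" "J \<subseteq> R" "times f ` I = times f ` J"
  shows "I = J"
proof -
  have "I \<subseteq> J" if IJ: "I \<subseteq> R" "J \<subseteq> R" "times f ` I = times f ` J" for I J
  proof
    fix x assume x: "x \<in> I"
    then have "f * x \<in> times f ` J" using IJ(3) by blast
    then obtain y where y: "y \<in> J" "f * x = f * y" by blast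
    then have "x = y" using R_cancel[of f x y] assms(1,2) IJ x by blast
    then show "x \<in> J" using y by simp
  qed
  from this[OF assms(3,4,5)] this[OF assms(4,3) assms(5)[symmetric]] show ?thesis by (rule equalityI)
qed

text \<open>The unit of \<open>R\<close> is the indicator of the curve; the constant function 1 does
  not vanish off the curve.\<close>

definition one :: "'a \<times> 'a \<Rightarrow> 'a" where "one = fn 1 0"

lemma one_R: "one \<in> R" by (simp add: one_def)

lemma one_mult: "f \<in> R \<Longrightarrow> one * f = f"
  by (auto elim!: R_E simp: one_def fn_mult)

lemma one_image: "I \<subseteq> R \<Longrightarrow> times one ` I = I"
proof -
  assume "I \<subseteq> R"
  then have "times one ` I = (\<lambda>x. x) ` I" using one_mult by (intro image_cong) auto
  then show ?thesis by simp
qed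

definition ideal :: "('a \<times> 'a \<Rightarrow> 'a) set \<Rightarrow> bool" where
  "ideal I \<longleftrightarrow> I \<subseteq> R \<and> 0 \<in> I \<and> (\<forall>f\<in>I. \<forall>g\<in>I. f + g \<in> I) \<and> (\<forall>r\<in>R. \<forall>f\<in>I. r * f \<in> I)"

lemma ideal_R: "ideal R" by (auto simp: ideal_def R_0 R_add R_mult)

lemma ideal_ip: "ideal I \<Longrightarrow> ideal J \<Longrightarrow> ideal (ip I J)"
proof -
  assume I: "ideal I" and J: "ideal J"
  have "ip I J \<subseteq> R" using I J by (intro ip_least) (auto simp: ideal_def R_0 intro: R_add R_mult)
  moreover have "r * f \<in> ip I J" if r: "r \<in> R" and f: "f \<in> ip I J" for r f
  proof -
    have "ip I J \<subseteq> {f. r * f \<in> ip I J}"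
      by (rule ip_least) (use I r in \<open>auto simp: ideal_def ip_0 distrib_left mult.assoc[symmetric] intro!: ip_add ip_mem\<close>)
    then show ?thesis using f by blast
  qed
  ultimately show ?thesis by (auto simp: ideal_def ip_0 ip_add)
qed

lemma ip_R: "ideal I \<Longrightarrow> ip R I = I"
proof
  assume I: "ideal I"
  show "ip R I \<subseteq> I" using I by (intro ip_least) (auto simp: ideal_def)
  show "I \<subseteq> ip R I"
  proof
    fix f assume f: "f \<in> I"
    then have "f = one * f" using one_mult I by (metis ideal_def subsetD)
    then show "f \<in> ip R I" using ip_mem[OF one_R f] by simp
  qed
qed

lemma ip_sub: "ideal I \<Longrightarrow> ideal J \<Longrightarrow> ip I J \<subseteq> I"
proof (rule ip_least)
  fix i j assume "ideal I" "ideal J" "i \<in> I" "j \<in> J"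
  then have "j * i \<in> I" by (auto simp: ideal_def)
  then show "i * j \<in> I" by (simp add: mult.commute)
qed (auto simp: ideal_def)

text \<open>Infinity corresponds to the unit ideal, an affine point to its maximal ideal. Sums of
  points become products of ideals up to principal factors.\<close>

fun idl :: "('a \<times> 'a) option \<Rightarrow> ('a \<times> 'a \<Rightarrow> 'a) set" where
  "idl None = R" | "idl (Some q) = {h \<in> R. h q = 0}"

lemma ideal_idl: "ideal (idl P)"
  by (cases P) (auto simp: ideal_R, auto simp: ideal_def R_0 R_add R_mult)

abbreviation vt :: "'a \<Rightarrow> 'a \<times> 'a \<Rightarrow> 'a" where "vt x0 \<equiv> fn [:- x0, 1:] 0"
abbreviation hz :: "'a \<Rightarrow> 'a \<times> 'a \<Rightarrow> 'a" where "hz y0 \<equiv> fn [:- y0:] 1"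

lemma vt_nz: "vt x0 \<noteq> 0" by (simp add: fn_eq_0)

lemma vt_idl: "(x0, y0) \<in> C \<Longrightarrow> vt x0 \<in> idl (Some (x0, y0))" by (simp add: fn_app)
lemma hz_idl: "(x0, y0) \<in> C \<Longrightarrow> hz y0 \<in> idl (Some (x0, y0))" by (simp add: fn_app)

lemma idl_gens:
  assumes q: "(x0, y0) \<in> C" and h: "h \<in> idl (Some (x0, y0))"
  shows "\<exists>r\<in>R. \<exists>s\<in>R. h = r * vt x0 + s * hz y0"
proof -
  obtain A B where hAB: "h = fn A B" using h by (auto elim: R_E)
  have "poly (A + smult y0 B) x0 = 0" using h q by (simp add: hAB fn_app mult.commute)
  then have "[:- x0, 1:] dvd A + smult y0 B" by (simp only: poly_eq_0_iff_dvd)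
  then obtain G where G: "A + smult y0 B = [:- x0, 1:] * G" by (rule dvdE)
  have "h = fn G 0 * vt x0 + fn B 0 * hz y0"
  proof -
    have "A = G * [:- x0, 1:] - smult y0 B" using G by (simp add: algebra_simps)
    then show ?thesis by (simp add: hAB fn_mult fn_add)
  qed
  then show ?thesis using fn_R by blast
qed

lemma hz_prod:
  assumes q: "(x0, y0) \<in> C"
  shows "hz y0 * hz (- y0 - x0) = vt x0 * fn [:x0 ^ 2 + b, x0, 1:] (- 1)"
proof (rule fn_eqI)
  fix x y assume p: "(x, y) \<in> C"
  have "(y - y0) * (y + y0 + x0) = (y ^ 2 + x * y) - (y0 ^ 2 + x0 * y0) - (x - x0) * y"
    by (simp add: power2_eq_square algebra_simps)
  also have "\<dots> = (x - x0) * (x0 ^ 2 + b + x * (x0 + x) - y)"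
    using p q unfolding C_iff by (simp add: power2_eq_square power3_eq_cube algebra_simps)
  finally show "(hz y0 * hz (- y0 - x0)) (x, y) = (vt x0 * fn [:x0 ^ 2 + b, x0, 1:] (- 1)) (x, y)"
    using p by (simp add: fn_app algebra_simps)
qed (simp add: fn_def)

text \<open>The vertical line through a point meets the curve in the point and its negative. That
  \<open>x - x0\<close> lies in the product needs a nonzero constant: the difference of the two
  second coordinates or, at a point of order two, the partial derivative that is nonzero by
  smoothness.\<close>

lemma idl_inverse:
  assumes q: "(x0, y0) \<in> C"
  shows "ip (idl (Some (x0, y0))) (idl (Some (x0, - y0 - x0))) = times (vt x0) ` R"
proof
  let ?y = "- y0 - x0" and ?I = "idl (Some (x0, y0))" and ?J = "idl (Some (x0, - y0 - x0))"
  let ?w = "fn [:x0 ^ 2 + b, x0, 1:] (- 1)"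
  have q': "(x0, ?y) \<in> C" by (rule ng_C[OF q])
  show "ip ?I ?J \<subseteq> times (vt x0) ` R"
  proof (rule ip_least)
    fix i j assume "i \<in> ?I" "j \<in> ?J"
    then obtain r s r' s' where *: "r \<in> R" "s \<in> R" "i = r * vt x0 + s * hz y0" "r' \<in> R" "s' \<in> R" "j = r' * vt x0 + s' * hz ?y"
      using idl_gens[OF q] idl_gens[OF q'] by metis
    have "i * j = vt x0 * (r * j + s * hz y0 * r') + s * s' * (hz y0 * hz ?y)"
      unfolding *(3,6) by (simp add: algebra_simps)
    also have "\<dots> = vt x0 * (r * j + s * hz y0 * r' + s * s' * ?w)" unfolding hz_prod[OF q] by (simp add: algebra_simps)
    finally show "i * j \<in> times (vt x0) ` R" using * \<open>j \<in> ?J\<close> by (auto intro!: imageI R_add R_mult)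
  next
    show "0 \<in> times (vt x0) ` R" by (rule image_eqI[of _ _ 0]) (auto simp: R_0)
    show "s + t \<in> times (vt x0) ` R" if "s \<in> times (vt x0) ` R" "t \<in> times (vt x0) ` R" for s t
      using that by (auto simp flip: distrib_left intro!: imageI R_add)
  qed
  have id: "ideal (ip ?I ?J)" by (intro ideal_ip ideal_idl)
  have idR: "r * f \<in> ip ?I ?J" if "r \<in> R" "f \<in> ip ?I ?J" for r f using id that by (auto simp: ideal_def)
  have v: "vt x0 \<in> ?I" "vt x0 \<in> ?J" "hz y0 \<in> ?I" "hz ?y \<in> ?J"
    using vt_idl[OF q] vt_idl[OF q'] hz_idl[OF q] hz_idl[OF q'] by auto
  have "\<exists>d. d \<noteq> 0 \<and> fn [:d:] 0 * vt x0 \<in> ip ?I ?J"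
  proof (cases "2 * y0 + x0 = 0")
    case False
    have "vt x0 * hz ?y + fn [:-1:] 0 * (hz y0 * vt x0) \<in> ip ?I ?J"
      by (intro ip_add ip_mem idR v fn_R)
    moreover have "vt x0 * hz ?y + fn [:-1:] 0 * (hz y0 * vt x0) = fn [:2 * y0 + x0:] 0 * vt x0"
      by (simp add: fn_mult fn_add algebra_simps)
    ultimately show ?thesis using False by (intro exI[of _ "2 * y0 + x0"]) simp
  next
    case True
    \<comment> \<open>The value of \<open>?w\<close> at the point.\<close>
    define d where "d = 3 * x0 ^ 2 + b - y0"
    have d: "d \<noteq> 0" unfolding d_def by (rule smooth[OF q True])
    have wI: "?w - fn [:d:] 0 \<in> ?I"
      using q by (auto simp: fn_app R_diff d_def power2_eq_square algebra_simps)
    have "hz y0 * hz ?y + fn [:-1:] 0 * ((?w - fn [:d:] 0) * vt x0) \<in> ip ?I ?J"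
      by (intro ip_add ip_mem idR v fn_R wI)
    moreover have "hz y0 * hz ?y + fn [:-1:] 0 * ((?w - fn [:d:] 0) * vt x0) = fn [:d:] 0 * vt x0"
      unfolding hz_prod[OF q] by (simp add: fn_mult fn_add fn_diff algebra_simps)
    ultimately show ?thesis using d by auto
  qed
  then obtain d where d: "d \<noteq> 0" "fn [:d:] 0 * vt x0 \<in> ip ?I ?J" by blast
  have "vt x0 = fn [:inverse d:] 0 * (fn [:d:] 0 * vt x0)" using d(1) by (simp add: fn_mult mult.assoc)
  then have "vt x0 \<in> ip ?I ?J" using idR[OF fn_R d(2)] by metis
  then show "times (vt x0) ` R \<subseteq> ip ?I ?J" using idR by (auto simp: mult.commute)
qed

section \<open>Conjugation, the ideal of a line, and the ideal of a sum\<close>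

definition cj :: "('a \<times> 'a \<Rightarrow> 'a) \<Rightarrow> ('a \<times> 'a \<Rightarrow> 'a)" where "cj h = (\<lambda>(x, y). h (x, - y - x))"

lemma cj_C: "(x, - y - x) \<in> C \<longleftrightarrow> (x, y) \<in> C"
  using ng_C[of x y] ng_C[of x "- y - x"] by auto

lemma cj_fn: "cj (fn A B) = fn (A - B * [:0, 1:]) (- B)"
  by (rule ext) (auto simp: cj_def fn_def cj_C algebra_simps)

lemma cj_hom: "cj (f + g) = cj f + cj g" "cj (f * g) = cj f * cj g" "cj 0 = 0"
  by (auto simp: cj_def fun_eq_iff)

lemma cj_R: "f \<in> R \<Longrightarrow> cj f \<in> R" by (auto elim!: R_E simp: cj_fn)

lemma cj_cj: "cj (cj f) = f" by (auto simp: cj_def fun_eq_iff)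

lemma cj_ip: "cj ` ip I J = ip (cj ` I) (cj ` J)"
proof -
  have "cj ` ip I J \<subseteq> ip (cj ` I) (cj ` J)" for I J
  proof -
    have "ip I J \<subseteq> {f. cj f \<in> ip (cj ` I) (cj ` J)}"
      by (rule ip_least) (auto simp: cj_hom ip_0 ip_add intro!: ip_mem)
    then show ?thesis by blast
  qed
  note sub = this
  have cc: "cj ` cj ` K = K" for K by (simp add: image_image cj_cj)
  have "cj ` cj ` ip (cj ` I) (cj ` J) \<subseteq> cj ` ip (cj ` cj ` I) (cj ` cj ` J)" by (intro image_mono sub)
  then show ?thesis using sub[of I J] unfolding cc by blast
qed

lemma cj_idl: "q \<in> C \<Longrightarrow> cj ` idl (Some q) = idl (ng (Some q))"
proof (cases q)
  case (Pair x y)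
  have "cj h \<in> idl (Some (x, - y - x))" if "h \<in> idl (Some (x, y))" for h x y
    using that cj_R by (auto simp: cj_def)
  from this[of _ x y] this[of _ x "- y - x"] show ?thesis unfolding Pair by (auto simp: image_iff) (metis cj_cj)
qed

lemma cj_image_mult: "cj ` times f ` I = times (cj f) ` cj ` I"
  by (auto simp: image_image cj_hom)

lemma ip_principal: "ip (times f ` R) (times g ` R) = times (f * g) ` R"
  unfolding ip_scale ip_scale2 ip_R[OF ideal_R] image_image by (simp add: mult_ac)

text \<open>The product \<open>T\<close> is contained in the principal ideal of the line, so
  \<open>T = L J\<close>. Multiplying \<open>T\<close> by its conjugate and using
  \<open>idl_inverse\<close> at the three points gives the principal ideal of \<open>L L'\<close>;
  hence \<open>J\<close> times its conjugate is \<open>R\<close>, and \<open>J = R\<close>.\<close>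

lemma idl_line:
  assumes p: "(x1, l * x1 + n) \<in> C" "(x2, l * x2 + n) \<in> C" "(x3, l * x3 + n) \<in> C"
    and id: "\<And>x. x ^ 3 + b * x + c - (l * x + n) ^ 2 - x * (l * x + n) = (x - x1) * (x - x2) * (x - x3)"
  shows "ip (idl (Some (x1, l * x1 + n))) (ip (idl (Some (x2, l * x2 + n))) (idl (Some (x3, l * x3 + n))))
    = times (fn [:- n, - l:] 1) ` R"
proof -
  define I where "I x = idl (Some (x, l * x + n))" for x
  define L where "L = fn [:- n, - l:] 1"
  define L' where "L' = fn [:n, l + 1:] 1"
  define T where "T = ip (I x1) (ip (I x2) (I x3))"
  have LR: "L \<in> R" "L' \<in> R" by (auto simp: L_def L'_def)
  have Lnz: "L \<noteq> 0" "L' \<noteq> 0" by (auto simp: L_def L'_def fn_eq_0)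
  have prod: "vt x1 * vt x2 * vt x3 = L * L'"
  proof (rule fn_eqI)
    fix x y assume q: "(x, y) \<in> C"
    have "(x - x1) * (x - x2) * (x - x3) = (y ^ 2 + x * y) - (l * x + n) ^ 2 - x * (l * x + n)"
      using q unfolding id[symmetric] C_iff by simp
    also have "\<dots> = (y - (l * x + n)) * (y + (l * x + n) + x)" by (simp add: power2_eq_square algebra_simps)
    finally show "(vt x1 * vt x2 * vt x3) (x, y) = (L * L') (x, y)"
      using q by (simp add: fn_app L_def L'_def algebra_simps)
  qed (simp add: fn_def L_def)
  have gens: "\<exists>r\<in>R. \<exists>s\<in>R. h = r * vt x + s * L" if h: "h \<in> I x" and x: "(x, l * x + n) \<in> C" for h x
  proof -
    obtain r s where rs: "r \<in> R" "s \<in> R" "h = r * vt x + s * hz (l * x + n)"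
      using idl_gens[OF x] h unfolding I_def by blast
    have "hz (l * x + n) = L + fn [:l:] 0 * vt x" by (simp add: L_def fn_mult fn_add algebra_simps)
    then have "h = (r + s * fn [:l:] 0) * vt x + s * L" using rs by (simp add: algebra_simps)
    then show ?thesis using rs R_add R_mult fn_R by blast
  qed
  have T_id: "ideal T" unfolding T_def I_def by (intro ideal_ip ideal_idl)
  have "T \<subseteq> times L ` R"
    unfolding T_def
  proof (rule ip_least)
    fix i t assume i: "i \<in> I x1" and t: "t \<in> ip (I x2) (I x3)"
    have "ip (I x2) (I x3) \<subseteq> {t. i * t \<in> times L ` R}"
    proof (rule ip_least)
      fix j h assume j: "j \<in> I x2" and h: "h \<in> I x3"
      obtain r1 s1 where 1: "r1 \<in> R" "s1 \<in> R" "i = r1 * vt x1 + s1 * L" using gens[OF i p(1)] by blast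
      obtain r2 s2 where 2: "r2 \<in> R" "s2 \<in> R" "j = r2 * vt x2 + s2 * L" using gens[OF j p(2)] by blast
      obtain r3 s3 where 3: "r3 \<in> R" "s3 \<in> R" "h = r3 * vt x3 + s3 * L" using gens[OF h p(3)] by blast
      have jh: "j \<in> R" "h \<in> R" using j h by (auto simp: I_def)
      have "i * (j * h) = r1 * r2 * r3 * (vt x1 * vt x2 * vt x3) + L * (r1 * vt x1 * (r2 * vt x2) * s3 + r1 * vt x1 * s2 * h + s1 * j * h)"
        unfolding 1(3) 2(3) 3(3) by (simp add: algebra_simps)
      also have "\<dots> = L * (r1 * r2 * r3 * L' + (r1 * vt x1 * (r2 * vt x2) * s3 + r1 * vt x1 * s2 * h + s1 * j * h))"
        unfolding prod by (simp add: algebra_simps)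
      finally show "j * h \<in> {t. i * t \<in> times L ` R}"
        using 1 2 3 jh LR by (auto intro!: imageI R_add R_mult)
    next
      show "0 \<in> {t. i * t \<in> times L ` R}" by (auto intro!: image_eqI[of _ _ 0] simp: R_0)
      show "s + t \<in> {t. i * t \<in> times L ` R}" if "s \<in> {t. i * t \<in> times L ` R}" "t \<in> {t. i * t \<in> times L ` R}" for s t
        using that by (auto simp: distrib_left) (metis R_add distrib_left imageI)
    qed
    then show "i * t \<in> times L ` R" using t by blast
  next
    show "0 \<in> times L ` R" by (rule image_eqI[of _ _ 0]) (auto simp: R_0)
    show "s + t \<in> times L ` R" if "s \<in> times L ` R" "t \<in> times L ` R" for s t
      using that by (auto simp flip: distrib_left intro!: imageI R_add)
  qed
  define J where "J = {j \<in> R. L * j \<in> T}"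
  have TJ: "T = times L ` J" using \<open>T \<subseteq> times L ` R\<close> by (auto simp: J_def)
  have J_id: "ideal J"
    using T_id unfolding J_def ideal_def by (auto simp: R_0 R_add R_mult distrib_left) (metis mult.left_commute)
  have cJ: "ideal (cj ` J)"
  proof -
    have "r * cj f \<in> cj ` J" if "r \<in> R" "f \<in> J" for r f
    proof -
      have "r * cj f = cj (cj r * f)" by (simp add: cj_hom cj_cj)
      then show ?thesis using that J_id cj_R unfolding ideal_def by blast
    qed
    moreover have "0 \<in> cj ` J" using J_id cj_hom(3) unfolding ideal_def by (metis imageI)
    moreover have "cj f + cj g \<in> cj ` J" if "f \<in> J" "g \<in> J" for f g
      using that J_id cj_hom(1)[of f g] unfolding ideal_def by (metis imageI)
    moreover have "cj ` J \<subseteq> R" using J_id cj_R unfolding ideal_def by blast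
    ultimately show ?thesis unfolding ideal_def by blast
  qed
  have cI: "cj ` I x = idl (Some (x, - (l * x + n) - x))" if "(x, l * x + n) \<in> C" for x
    using cj_idl[OF that] by (simp add: I_def)
  have inv: "ip (I x) (cj ` I x) = times (vt x) ` R" if "(x, l * x + n) \<in> C" for x
    using idl_inverse[OF that] cI[OF that] by (simp add: I_def)
  have "ip T (cj ` T) = ip (ip (I x1) (cj ` I x1)) (ip (ip (I x2) (cj ` I x2)) (ip (I x3) (cj ` I x3)))"
    unfolding T_def cj_ip by (simp add: ip_ac)
  also have "\<dots> = times (vt x1 * (vt x2 * vt x3)) ` R"
    by (simp add: inv p ip_principal)
  also have "\<dots> = times (L * L') ` R" using prod by (simp add: mult.assoc)
  finally have 1: "ip T (cj ` T) = times (L * L') ` R" .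
  have cL: "cj L = - L'" by (simp add: L_def L'_def cj_fn fn_minus fn_inj)
  have "ip T (cj ` T) = times (L * - L') ` ip J (cj ` J)"
    unfolding TJ cj_image_mult cL ip_scale ip_scale2 by (simp add: image_image mult_ac)
  also have "\<dots> = times (L * L') ` ip J (cj ` J)"
  proof -
    have m: "- f \<in> ip J (cj ` J)" if "f \<in> ip J (cj ` J)" for f
    proof -
      have "fn (-1) 0 * f \<in> ip J (cj ` J)" using ideal_ip[OF J_id cJ] that by (auto simp: ideal_def)
      moreover have "f \<in> R" using ideal_ip[OF J_id cJ] that by (auto simp: ideal_def)
      then have "fn (-1) 0 * f = - f" by (auto elim!: R_E simp: fn_mult fn_minus)
      ultimately show ?thesis by simp
    qed
    show ?thesis
    proof (intro subset_antisym image_subsetI)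
      fix f assume f: "f \<in> ip J (cj ` J)"
      have "L * - L' * f = (L * L') * (- f)" "(L * L') * f = L * - L' * (- f)" by auto
      then show "L * - L' * f \<in> times (L * L') ` ip J (cj ` J)" "L * L' * f \<in> times (L * - L') ` ip J (cj ` J)"
        using m[OF f] by (simp_all only: imageI)
    qed
  qed
  finally have eq: "times (L * L') ` R = times (L * L') ` ip J (cj ` J)" unfolding 1 .
  have nz: "L * L' \<noteq> 0" using R_domain LR Lnz by blast
  have sub: "ip J (cj ` J) \<subseteq> R" using ideal_ip[OF J_id cJ] unfolding ideal_def by blast
  have "R = ip J (cj ` J)" by (rule image_cancel[OF R_mult[OF LR] nz subset_refl sub eq])
  then have "R \<subseteq> J" using ip_sub[OF J_id cJ] by simp
  then have "J = R" by (auto simp: J_def)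
  then show ?thesis using TJ by (simp add: T_def I_def L_def)
qed

text \<open>Equality in the ideal class group, with explicit multipliers \<open>f\<close> and
  \<open>g\<close> instead of quotients.\<close>

lemma idl_add:
  assumes PQ: "P \<in> E" "Q \<in> E"
  shows "\<exists>f\<in>R. \<exists>g\<in>R. f \<noteq> 0 \<and> g \<noteq> 0 \<and> times f ` ip (idl P) (idl Q) = times g ` idl (P \<oplus> Q)"
proof (cases "P = None \<or> Q = None")
  case True
  then have "ip (idl P) (idl Q) = idl (P \<oplus> Q)" using ip_R[OF ideal_idl] by (auto simp: ip_comm[of _ R])
  moreover have "one \<noteq> 0" by (simp add: one_def fn_eq_0)
  ultimately show ?thesis using one_R by metis
next
  case False
  then obtain x1 y1 x2 y2 where e: "P = Some (x1, y1)" "Q = Some (x2, y2)" by (metis option.exhaust surj_pair)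
  have q: "(x1, y1) \<in> C" "(x2, y2) \<in> C" using PQ e by auto
  have "one \<noteq> 0" by (simp add: one_def fn_eq_0)
  show ?thesis
  proof (cases "x1 = x2 \<and> y1 + y2 + x2 = 0")
    case True
    then have "y2 + (y1 + x1) = 0" by (simp add: add_ac)
    then have "y2 = - (y1 + x1)" using eq_neg_iff_add_eq_0[of y2 "y1 + x1"] by simp
    then have y2: "y2 = - y1 - x1" by simp
    have N: "P \<oplus> Q = None" using True e by (simp add: ec_add_def)
    have Q': "Q = Some (x1, - y1 - x1)" unfolding e(2) y2[symmetric] using True by metis
    have "ip (idl P) (idl Q) = times (vt x1) ` R" unfolding Q' e(1) by (rule idl_inverse[OF q(1)])
    moreover have "ip (idl P) (idl Q) \<subseteq> R" using ideal_ip[OF ideal_idl ideal_idl] by (simp add: ideal_def)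
    ultimately have "times one ` ip (idl P) (idl Q) = times (vt x1) ` idl (P \<oplus> Q)"
      using N one_image by simp
    then show ?thesis using one_R fn_R vt_nz \<open>one \<noteq> 0\<close> by blast
  next
    case ne: False
    obtain l n x3 where l: "P \<oplus> Q = Some (x3, - (l * x3 + n) - x3)"
      "y1 = l * x1 + n" "y2 = l * x2 + n"
      "\<And>x. x ^ 3 + b * x + c - (l * x + n) ^ 2 - x * (l * x + n) = (x - x1) * (x - x2) * (x - x3)"
      using chord[OF q ne] e by metis
    let ?L = "fn [:- n, - l:] 1" and ?T = "Some (x3, l * x3 + n)"
    have q3: "(x3, l * x3 + n) \<in> C" by (rule chord_third[OF l(4)])
    have "ip (idl P) (ip (idl Q) (idl ?T)) = times ?L ` R"
      using idl_line[OF _ _ q3 l(4)] q unfolding e l(2,3) by blast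
    then have "ip (ip (idl P) (ip (idl Q) (idl ?T))) (idl (P \<oplus> Q)) = times ?L ` idl (P \<oplus> Q)"
      by (simp add: ip_scale ip_R[OF ideal_idl])
    moreover have "ip (ip (idl P) (ip (idl Q) (idl ?T))) (idl (P \<oplus> Q)) = ip (ip (idl P) (idl Q)) (ip (idl ?T) (idl (P \<oplus> Q)))"
      by (simp add: ip_assoc)
    moreover have "ip (idl ?T) (idl (P \<oplus> Q)) = times (vt x3) ` R" unfolding l(1) by (rule idl_inverse[OF q3])
    moreover have "ip (ip (idl P) (idl Q)) (times (vt x3) ` R) = times (vt x3) ` ip (idl P) (idl Q)"
      by (simp add: ip_scale2 ip_comm[of _ R] ip_R[OF ideal_ip[OF ideal_idl ideal_idl]])
    ultimately have "times (vt x3) ` ip (idl P) (idl Q) = times ?L ` idl (P \<oplus> Q)" by simp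
    moreover have "?L \<noteq> 0" by (simp add: fn_eq_0)
    ultimately show ?thesis using vt_nz fn_R by blast
  qed
qed

end

section \<open>Associativity\<close>

context wcurve
begin

text \<open>The representation of a function as \<open>fn A B\<close> is unique, so the definite
  description picks out its norm.\<close>

definition ndeg :: "('a \<times> 'a \<Rightarrow> 'a) \<Rightarrow> nat" where
  "ndeg h = degree (THE N. \<exists>A B. h = fn A B \<and> N = nrm A B)"

lemma ndeg_fn: "ndeg (fn A B) = degree (nrm A B)"
proof -
  have "(THE N. \<exists>A' B'. fn A B = fn A' B' \<and> N = nrm A' B') = nrm A B"
    by (rule the_equality) (auto simp: fn_inj)
  then show ?thesis by (simp add: ndeg_def)
qed

lemma ndeg_mult: "f \<in> R \<Longrightarrow> g \<in> R \<Longrightarrow> f \<noteq> 0 \<Longrightarrow> g \<noteq> 0 \<Longrightarrow> ndeg (f * g) = ndeg f + ndeg g"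
proof -
  assume "f \<in> R" "g \<in> R" and nz: "f \<noteq> 0" "g \<noteq> 0"
  then obtain A B A' B' where fg: "f = fn A B" "g = fn A' B'" by (auto elim!: R_E)
  have "nrm A B \<noteq> 0" "nrm A' B' \<noteq> 0" using nz nrm_nz fg fn_eq_0 by blast+
  then show ?thesis unfolding fg fn_mult ndeg_fn nrm_mult by (rule degree_mult_eq)
qed

lemma ndeg_not_1: "h \<in> R \<Longrightarrow> ndeg h \<noteq> 1"
proof -
  assume "h \<in> R"
  then obtain A B where "h = fn A B" by (auto elim: R_E)
  then show ?thesis using nrm_degree_B[of B A] nrm_degree_0[of A] by (cases "B = 0") (auto simp: ndeg_fn)
qed

lemma ndeg_0: "h \<in> R \<Longrightarrow> h \<noteq> 0 \<Longrightarrow> ndeg h = 0 \<Longrightarrow> \<exists>d. d \<noteq> 0 \<and> h = fn [:d:] 0"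
proof -
  assume "h \<in> R" and nz: "h \<noteq> 0" and d: "ndeg h = 0"
  then obtain A B where h: "h = fn A B" by (auto elim: R_E)
  then have B: "B = 0" using nrm_degree_B[of B A] d by (auto simp: ndeg_fn)
  then have "degree A = 0" using d nrm_degree_0[of A] by (simp add: h ndeg_fn)
  then obtain e where "A = [:e:]" by (metis degree_eq_zeroE)
  then show ?thesis using h B nz by (auto simp: fn_eq_0)
qed

lemma ndeg_2: "h \<in> R \<Longrightarrow> ndeg h = 2 \<Longrightarrow> \<exists>d e. d \<noteq> 0 \<and> h = fn [:e, d:] 0"
proof -
  assume "h \<in> R" and d: "ndeg h = 2"
  then obtain A B where h: "h = fn A B" by (auto elim: R_E)
  then have B: "B = 0" using nrm_degree_B[of B A] d by (auto simp: ndeg_fn)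
  then have dA: "degree A = 1" using d nrm_degree_0[of A] by (simp add: h ndeg_fn)
  obtain e A' where A': "A = pCons e A'" by (cases A)
  then have "degree A' = 0" "A' \<noteq> 0" using dA by (auto split: if_splits)
  then obtain d' where "A' = [:d':]" "d' \<noteq> 0" by (metis degree_eq_zeroE pCons_eq_0_iff)
  then show ?thesis using h B A' by auto
qed

lemma ndeg_vt: "ndeg (vt x) = 2"
  unfolding ndeg_fn nrm_degree_0 by simp

lemma ndeg_hz: "ndeg (hz y) = 3"
proof -
  have "nrm [:- y:] 1 = [:y ^ 2 - c, y - b, 0, - 1:]"
    by (simp add: nrm_def Fp_def power2_eq_square)
  then show ?thesis by (simp add: ndeg_fn)
qed

lemma hz_nz: "hz y \<noteq> 0" by (simp add: fn_eq_0)

lemma principalI: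
  assumes f: "f \<in> R" "f \<noteq> 0" and v: "v \<in> R" "v \<noteq> 0" and I: "ideal I" and eq: "times f ` I = times v ` R"
  shows "\<exists>h\<in>R. h \<noteq> 0 \<and> I = times h ` R"
proof -
  have IR: "I \<subseteq> R" using I by (simp add: ideal_def)
  have "v * one \<in> times f ` I" using eq one_R by blast
  then obtain h where h: "h \<in> I" "v * one = f * h" by blast
  have v1: "v * one = v" using one_mult[OF v(1)] by (simp add: mult.commute)
  have hR: "h \<in> R" using h IR by blast
  have "I \<subseteq> times h ` R"
  proof
    fix k assume k: "k \<in> I"
    then obtain r where r: "r \<in> R" "f * k = v * r" using eq by blast
    then have "f * k = f * (h * r)" using h(2) v1 by (simp add: mult.assoc)
    then have "k = h * r" using R_cancel[OF f(1) _ _ f(2)] k IR R_mult[OF hR r(1)] by blast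
    then show "k \<in> times h ` R" using r by blast
  qed
  moreover have "times h ` R \<subseteq> I" using I h(1) by (auto simp: ideal_def mult.commute[of h])
  moreover have "h \<noteq> 0" using h(2) v1 v(2) by auto
  ultimately show ?thesis using hR by blast
qed

text \<open>The norm of a function is a polynomial in x that never has degree one, so the ideal of a point is not
  principal. Hence the ideal class of a point determines it, and the group law is associative because
  the multiplication of ideals is.\<close>
lemma idl_not_principal:
  assumes q: "(x0, y0) \<in> C" and h: "h \<in> R" "h \<noteq> 0"
  shows "idl (Some (x0, y0)) \<noteq> times h ` R"
proof
  assume eq: "idl (Some (x0, y0)) = times h ` R"
  obtain k where k: "k \<in> R" "vt x0 = h * k" using vt_idl[OF q] unfolding eq by blast
  obtain k' where k': "k' \<in> R" "hz y0 = h * k'" using hz_idl[OF q] unfolding eq by blast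
  have nz: "k \<noteq> 0" "k' \<noteq> 0" using k k' vt_nz hz_nz by auto
  \<comment> \<open>A generator would divide functions of norm degree 2 and 3; as degree 1 never
    occurs, it would be constant.\<close>
  have "2 = ndeg h + ndeg k" "3 = ndeg h + ndeg k'"
    using ndeg_mult[OF h(1) k(1) h(2) nz(1)] ndeg_mult[OF h(1) k'(1) h(2) nz(2)]
    by (simp_all add: k(2)[symmetric] k'(2)[symmetric] ndeg_vt ndeg_hz)
  then have "ndeg h = 0" using ndeg_not_1[OF h(1)] ndeg_not_1[OF k(1)] ndeg_not_1[OF k'(1)] by linarith
  then obtain d where d: "d \<noteq> 0" "h = fn [:d:] 0" using ndeg_0[OF h] by blast
  have "h * one \<in> idl (Some (x0, y0))" unfolding eq using one_R by blast
  moreover have "h * one = h" using one_mult[OF h(1)] by (simp add: mult.commute)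
  ultimately have "h (x0, y0) = 0" by simp
  then show False using d q by (simp add: fn_app)
qed

text \<open>A generator divides functions of norm degree 4 and 5, and degree 1 never occurs, so its
  own degree is 0 or 2; degree 0 is impossible for a nonzero function that vanishes at a point.
  Degree 2 makes it a vertical line through both points.\<close>

lemma idl_product_principal:
  assumes p: "(x1, y1) \<in> C" and q: "(x2, y2) \<in> C" and h: "h \<in> R" "h \<noteq> 0"
    and eq: "ip (idl (Some (x1, y1))) (idl (Some (x2, y2))) = times h ` R"
  shows "Some (x2, y2) = ng (Some (x1, y1))"
proof -
  let ?I = "idl (Some (x1, y1))" and ?J = "idl (Some (x2, y2))"
  have "vt x1 * vt x2 \<in> times h ` R" "vt x1 * hz y2 \<in> times h ` R"
    unfolding eq[symmetric] by (intro ip_mem vt_idl[OF p] vt_idl[OF q] hz_idl[OF q])+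
  then obtain k k' where k: "k \<in> R" "vt x1 * vt x2 = h * k" and k': "k' \<in> R" "vt x1 * hz y2 = h * k'" by blast
  have "vt x1 * vt x2 \<noteq> 0" "vt x1 * hz y2 \<noteq> 0" using R_domain[OF fn_R fn_R] vt_nz hz_nz by blast+
  then have nz: "k \<noteq> 0" "k' \<noteq> 0" using k k' by auto
  have "4 = ndeg h + ndeg k" "5 = ndeg h + ndeg k'"
    using ndeg_mult[OF h(1) k(1) h(2) nz(1)] ndeg_mult[OF h(1) k'(1) h(2) nz(2)]
      ndeg_mult[OF fn_R fn_R vt_nz vt_nz, of x1 x2] ndeg_mult[OF fn_R fn_R vt_nz hz_nz, of x1 y2]
    by (simp_all add: k(2)[symmetric] k'(2)[symmetric] ndeg_vt ndeg_hz)
  then have n: "ndeg h = 0 \<or> ndeg h = 2"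
    using ndeg_not_1[OF h(1)] ndeg_not_1[OF k(1)] ndeg_not_1[OF k'(1)] by linarith
  have "h * one \<in> ip ?I ?J" unfolding eq using one_R by blast
  then have hip: "h \<in> ip ?I ?J" using one_mult[OF h(1)] by (simp add: mult.commute)
  have hp: "h (x1, y1) = 0" using hip ip_sub[OF ideal_idl ideal_idl, of "Some (x1, y1)" "Some (x2, y2)"] by auto
  have hq: "h (x2, y2) = 0" using hip ip_sub[OF ideal_idl ideal_idl, of "Some (x2, y2)" "Some (x1, y1)"] by (auto simp: ip_comm)
  have "ndeg h \<noteq> 0"
  proof
    assume "ndeg h = 0"
    then obtain d where "d \<noteq> 0" "h = fn [:d:] 0" using ndeg_0[OF h] by blast
    then show False using hp p by (simp add: fn_app)
  qed
  then have "ndeg h = 2" using n by simp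
  then obtain d e where de: "d \<noteq> 0" "h = fn [:e, d:] 0" using ndeg_2[OF h(1)] by metis
  have e1: "e + x1 * d = 0" "e + x2 * d = 0" using hp hq p q by (simp_all add: de(2) fn_app)
  then have "x1 * d = x2 * d" by (metis add_left_cancel)
  then have x: "x2 = x1" using de(1) by simp
  show ?thesis
  proof (cases "y2 = y1")
    case False
    then show ?thesis using same_x[of x1 y1 y2] p q unfolding x by simp
  next
    case True
    let ?N = "idl (Some (x1, - y1 - x1))"
    have "e = - (x1 * d)" using e1(1) by (simp add: eq_neg_iff_add_eq_0)
    then have hv: "h = vt x1 * fn [:d:] 0" by (simp add: de(2) fn_mult mult.commute)
    have "times h ` R = times (vt x1) ` R"
    proof (intro subset_antisym image_subsetI)
      fix r assume r: "r \<in> R"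
      show "h * r \<in> times (vt x1) ` R" unfolding hv mult.assoc using R_mult[OF fn_R r] by blast
      have "vt x1 * r = h * (fn [:inverse d:] 0 * r)"
      proof -
        have "fn [:d:] 0 * (fn [:inverse d:] 0 * r) = one * r"
          using de(1) by (simp add: mult.assoc[symmetric] fn_mult one_def one_pCons)
        then show ?thesis unfolding hv by (simp only: mult.assoc one_mult[OF r])
      qed
      then show "vt x1 * r \<in> times h ` R" using R_mult[OF fn_R r] by blast
    qed
    moreover have "ip ?I ?I = times h ` R" using eq unfolding x True .
    ultimately have e1: "ip ?I ?I = ip ?I ?N" unfolding idl_inverse[OF p] by (simp only:)
    \<comment> \<open>Cancellation of \<open>?I\<close> from \<open>?I ?I = ?I ?N\<close>: multiply
      by \<open>?N\<close> and use that \<open>?I ?N\<close> is principal.\<close>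
    have "ip (ip ?I ?N) ?I = ip ?I (ip ?I ?N)" by (rule ip_comm)
    also have "\<dots> = ip (ip ?I ?I) ?N" by (rule ip_assoc[symmetric])
    also have "\<dots> = ip (ip ?I ?N) ?N" by (rule arg_cong[OF e1])
    finally have "ip (ip ?I ?N) ?I = ip (ip ?I ?N) ?N" .
    then have "times (vt x1) ` ?I = times (vt x1) ` ?N"
      unfolding idl_inverse[OF p] ip_scale ip_R[OF ideal_idl] .
    moreover have "?I \<subseteq> R" "?N \<subseteq> R" by auto
    ultimately have "?I = ?N" using image_cancel[OF fn_R vt_nz, of ?I ?N] by blast
    then have "hz y1 \<in> ?N" using hz_idl[OF p] by metis
    then have "- y1 - x1 = y1" using ng_C[OF p] by (auto simp: fn_app)
    then show ?thesis using x True by simp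
  qed
qed

text \<open>Multiplication by the ideal of the negative of \<open>Q\<close> turns equality of
  classes into principality of a product of two point ideals.\<close>

lemma idl_inj:
  assumes PQ: "P \<in> E" "Q \<in> E" and fg: "f \<in> R" "f \<noteq> 0" "g \<in> R" "g \<noteq> 0" and eq: "times f ` idl P = times g ` idl Q"
  shows "P = Q"
proof -
  have noneq: False if PQ: "P \<in> E" "P \<noteq> None" and fg: "f \<in> R" "f \<noteq> 0" "g \<in> R" "g \<noteq> 0" and eq: "times f ` idl P = times g ` R" for P f g
  proof -
    obtain x y where e: "P = Some (x, y)" using PQ by (metis option.exhaust surj_pair)
    then have q: "(x, y) \<in> C" using PQ by simp
    show False using principalI[OF fg ideal_idl eq] idl_not_principal[OF q] unfolding e by blast
  qed
  show ?thesis
  proof (cases "P = None \<or> Q = None")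
    case True
    then show ?thesis using noneq[of P f g] noneq[of Q g f] PQ fg eq by (metis idl.simps(1))
  next
    case False
    then obtain x1 y1 x2 y2 where e: "P = Some (x1, y1)" "Q = Some (x2, y2)" by (metis option.exhaust surj_pair)
    have q: "(x1, y1) \<in> C" "(x2, y2) \<in> C" using PQ e by auto
    let ?N = "idl (Some (x2, - y2 - x2))"
    have "times f ` ip (idl P) ?N = ip (times f ` idl P) ?N" by (simp only: ip_scale)
    also have "\<dots> = times g ` ip (idl Q) ?N" by (simp only: eq ip_scale)
    also have "\<dots> = times (g * vt x2) ` R" unfolding e idl_inverse[OF q(2)] by (simp add: image_image mult.assoc)
    finally have eq2: "times f ` ip (idl P) ?N = times (g * vt x2) ` R" .
    have nz: "g * vt x2 \<noteq> 0" using R_domain[OF fg(3) fn_R] fg(4) vt_nz by blast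
    obtain h where h: "h \<in> R" "h \<noteq> 0" "ip (idl P) ?N = times h ` R"
      using principalI[OF fg(1,2) R_mult[OF fg(3) fn_R] nz ideal_ip[OF ideal_idl ideal_idl] eq2] by blast
    have "Some (x2, - y2 - x2) = ng (Some (x1, y1))"
      by (rule idl_product_principal[OF q(1) ng_C[OF q(2)] h(1,2) h(3)[unfolded e(1)]])
    then have "ng Q = ng P" unfolding e by (simp only: ng.simps)
    then show ?thesis by (metis ng_ng)
  qed
qed

lemma add_assoc:
  assumes "P \<in> E" "Q \<in> E" "S \<in> E"
  shows "P \<oplus> Q \<oplus> S = P \<oplus> (Q \<oplus> S)"
proof -
  obtain f1 g1 where 1: "f1 \<in> R" "g1 \<in> R" "f1 \<noteq> 0" "g1 \<noteq> 0" "times f1 ` ip (idl P) (idl Q) = times g1 ` idl (P \<oplus> Q)"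
    using idl_add[OF assms(1,2)] by blast
  obtain f2 g2 where 2: "f2 \<in> R" "g2 \<in> R" "f2 \<noteq> 0" "g2 \<noteq> 0" "times f2 ` ip (idl (P \<oplus> Q)) (idl S) = times g2 ` idl (P \<oplus> Q \<oplus> S)"
    using idl_add[of "P \<oplus> Q" S] assms by auto
  obtain f3 g3 where 3: "f3 \<in> R" "g3 \<in> R" "f3 \<noteq> 0" "g3 \<noteq> 0" "times f3 ` ip (idl Q) (idl S) = times g3 ` idl (Q \<oplus> S)"
    using idl_add[OF assms(2,3)] by blast
  obtain f4 g4 where 4: "f4 \<in> R" "g4 \<in> R" "f4 \<noteq> 0" "g4 \<noteq> 0" "times f4 ` ip (idl P) (idl (Q \<oplus> S)) = times g4 ` idl (P \<oplus> (Q \<oplus> S))"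
    using idl_add[of P "Q \<oplus> S"] assms by auto
  define X where "X = ip (idl P) (ip (idl Q) (idl S))"
  have mm: "times f ` times g ` I = times (f * g) ` I" for f g :: "'a \<times> 'a \<Rightarrow> 'a" and I by (simp add: image_image mult.assoc)
  have "times (f2 * f1) ` X = times f2 ` ip (times f1 ` ip (idl P) (idl Q)) (idl S)"
    unfolding X_def ip_scale ip_assoc mm ..
  also have "\<dots> = times g1 ` times f2 ` ip (idl (P \<oplus> Q)) (idl S)" unfolding 1(5) ip_scale mm by (simp only: mult.commute)
  also have "\<dots> = times (g1 * g2) ` idl (P \<oplus> Q \<oplus> S)" unfolding 2(5) mm ..
  finally have A: "times (f2 * f1) ` X = times (g1 * g2) ` idl (P \<oplus> Q \<oplus> S)" .
  have "times (f4 * f3) ` X = times f4 ` ip (idl P) (times f3 ` ip (idl Q) (idl S))"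
    unfolding X_def ip_scale2 mm ..
  also have "\<dots> = times g3 ` times f4 ` ip (idl P) (idl (Q \<oplus> S))" unfolding 3(5) ip_scale2 mm by (simp only: mult.commute)
  also have "\<dots> = times (g3 * g4) ` idl (P \<oplus> (Q \<oplus> S))" unfolding 4(5) mm ..
  finally have B: "times (f4 * f3) ` X = times (g3 * g4) ` idl (P \<oplus> (Q \<oplus> S))" .
  have "times (f4 * f3 * (g1 * g2)) ` idl (P \<oplus> Q \<oplus> S) = times (f4 * f3) ` times (f2 * f1) ` X" unfolding A mm ..
  also have "\<dots> = times (f2 * f1) ` times (f4 * f3) ` X" unfolding mm by (simp only: mult.commute)
  also have "\<dots> = times (f2 * f1 * (g3 * g4)) ` idl (P \<oplus> (Q \<oplus> S))" unfolding B mm ..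
  finally have eq: "times (f4 * f3 * (g1 * g2)) ` idl (P \<oplus> Q \<oplus> S) = times (f2 * f1 * (g3 * g4)) ` idl (P \<oplus> (Q \<oplus> S))" .
  have nz: "f * g \<noteq> 0 \<and> f * g \<in> R" if "f \<in> R" "g \<in> R" "f \<noteq> 0" "g \<noteq> 0" for f g
    using that R_domain R_mult by blast
  have E': "P \<oplus> Q \<oplus> S \<in> E" "P \<oplus> (Q \<oplus> S) \<in> E" using assms by simp_all
  have a: "f4 * f3 \<noteq> 0 \<and> f4 * f3 \<in> R" by (rule nz[OF 4(1) 3(1) 4(3) 3(3)])
  have b: "g1 * g2 \<noteq> 0 \<and> g1 * g2 \<in> R" by (rule nz[OF 1(2) 2(2) 1(4) 2(4)])
  have c: "f2 * f1 \<noteq> 0 \<and> f2 * f1 \<in> R" by (rule nz[OF 2(1) 1(1) 2(3) 1(3)])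
  have d: "g3 * g4 \<noteq> 0 \<and> g3 * g4 \<in> R" by (rule nz[OF 3(2) 4(2) 3(4) 4(4)])
  have ab: "f4 * f3 * (g1 * g2) \<noteq> 0 \<and> f4 * f3 * (g1 * g2) \<in> R" using nz a b by blast
  have cd: "f2 * f1 * (g3 * g4) \<noteq> 0 \<and> f2 * f1 * (g3 * g4) \<in> R" using nz c d by blast
  show ?thesis
    using ab cd by (intro idl_inj[OF E' _ _ _ _ eq]) auto
qed

abbreviation mul :: "nat \<Rightarrow> ('a \<times> 'a) option \<Rightarrow> ('a \<times> 'a) option" where "mul \<equiv> ec_mult W"

lemma mul_E [simp]: "P \<in> E \<Longrightarrow> mul n P \<in> E" by (induction n) auto

lemma mul_None [simp]: "mul n None = None" by (induction n) auto

lemma mul_1 [simp]: "mul (Suc 0) P = P" by simp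

lemma add_left_comm: "P \<in> E \<Longrightarrow> Q \<in> E \<Longrightarrow> S \<in> E \<Longrightarrow> P \<oplus> (Q \<oplus> S) = Q \<oplus> (P \<oplus> S)"
  using add_assoc[of P Q S] add_assoc[of Q P S] add_comm[of P Q] by simp

lemma mul_add: "P \<in> E \<Longrightarrow> mul (m + n) P = mul m P \<oplus> mul n P"
  by (induction m) (auto simp: add_assoc)

lemma mul_mul: "P \<in> E \<Longrightarrow> mul (m * n) P = mul m (mul n P)"
  by (induction m) (auto simp: mul_add)

lemma mul_distrib: "P \<in> E \<Longrightarrow> Q \<in> E \<Longrightarrow> mul n (P \<oplus> Q) = mul n P \<oplus> mul n Q"
  by (induction n) (auto simp: add_assoc add_left_comm)

lemma add_ng_cancel: "P \<in> E \<Longrightarrow> Q \<in> E \<Longrightarrow> P \<oplus> Q \<oplus> ng Q = P" "P \<in> E \<Longrightarrow> Q \<in> E \<Longrightarrow> P \<oplus> ng Q \<oplus> Q = P"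
  by (simp_all add: add_assoc)

lemma eq_if_diff: "P \<in> E \<Longrightarrow> Q \<in> E \<Longrightarrow> P \<oplus> ng Q = None \<Longrightarrow> P = Q"
  using add_ng_cancel(2)[of P Q] by simp

lemma ng_unique: "P \<in> E \<Longrightarrow> Q \<in> E \<Longrightarrow> P \<oplus> Q = None \<Longrightarrow> Q = ng P"
  using add_assoc[of "ng P" P Q] by simp

lemma mul_ng: "P \<in> E \<Longrightarrow> mul n (ng P) = ng (mul n P)"
  using mul_distrib[of P "ng P" n] ng_unique[of "mul n P" "mul n (ng P)"] by simp

lemma ng_add: "P \<in> E \<Longrightarrow> Q \<in> E \<Longrightarrow> ng (P \<oplus> Q) = ng P \<oplus> ng Q"
proof -
  assume PQ: "P \<in> E" "Q \<in> E"
  have "P \<oplus> Q \<oplus> (ng P \<oplus> ng Q) = P \<oplus> (Q \<oplus> (ng P \<oplus> ng Q))" by (rule add_assoc) (use PQ in simp_all)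
  also have "Q \<oplus> (ng P \<oplus> ng Q) = ng P \<oplus> (Q \<oplus> ng Q)" by (rule add_left_comm) (use PQ in simp_all)
  also have "P \<oplus> (ng P \<oplus> (Q \<oplus> ng Q)) = None" by (simp only: add_ng add_None)
  finally have "P \<oplus> Q \<oplus> (ng P \<oplus> ng Q) = None" .
  then show ?thesis using ng_unique[of "P \<oplus> Q" "ng P \<oplus> ng Q"] PQ by simp
qed

lemma mul_diff: "P \<in> E \<Longrightarrow> m \<le> n \<Longrightarrow> mul n P \<oplus> ng (mul m P) = mul (n - m) P"
  using mul_add[of P "n - m" m] add_ng_cancel(1)[of "mul (n - m) P" "mul m P"] by simp

end

section \<open>Finiteness of n-torsion\<close>

context wcurve
begin

text \<open>In standard notation \<open>gg\<close> is \<open>4 x^3 + b2 x^2 + 2 b4 x + b6\<close>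
  and \<open>ff\<close> is \<open>x^4 - b4 x^2 - 2 b6 x - b8\<close>, the denominator and the
  numerator of the duplication formula.\<close>

definition gg :: "'a \<Rightarrow> 'a" where "gg x = 4 * x ^ 3 + x ^ 2 + 4 * b * x + 4 * c"
definition ff :: "'a \<Rightarrow> 'a" where "ff x = x ^ 4 - 2 * b * x ^ 2 - 8 * c * x - c + b ^ 2"

lemma gg_sq: "(x, y) \<in> C \<Longrightarrow> gg x = (2 * y + x) ^ 2"
proof -
  assume q: "(x, y) \<in> C"
  have "(2 * y + x) ^ 2 = 4 * (y ^ 2 + x * y) + x ^ 2" by (simp add: power2_eq_square algebra_simps)
  also have "y ^ 2 + x * y = x ^ 3 + b * x + c" using q by (simp add: C_iff)
  finally show ?thesis by (simp add: gg_def algebra_simps)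
qed

lemma ff_id:
  assumes "(x, y) \<in> C"
  shows "(3 * x ^ 2 + b - y) ^ 2 + (3 * x ^ 2 + b - y) * (2 * y + x) - 2 * x * (2 * y + x) ^ 2 = ff x"
proof -
  have c: "c = y ^ 2 + x * y - x ^ 3 - b * x" using assms by (simp add: C_iff)
  show ?thesis unfolding ff_def unfolding c
    by (simp add: power2_eq_square power3_eq_cube power4_eq_xxxx algebra_simps)
qed

text \<open>At a common zero both partial derivatives of the curve equation would vanish.\<close>

lemma no_common: "(x, y) \<in> C \<Longrightarrow> gg x = 0 \<Longrightarrow> ff x \<noteq> 0"
proof
  assume q: "(x, y) \<in> C" and z: "gg x = 0" "ff x = 0"
  have d: "2 * y + x = 0" using gg_sq[OF q] z by simp
  have "(3 * x ^ 2 + b - y) ^ 2 = 0" using ff_id[OF q] z d by simp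
  then show False using smooth[OF q d] by simp
qed

lemma double_None: "(x, y) \<in> C \<Longrightarrow> gg x = 0 \<Longrightarrow> Some (x, y) \<oplus> Some (x, y) = None"
proof -
  assume q: "(x, y) \<in> C" and z: "gg x = 0"
  have "2 * y + x = 0" using gg_sq[OF q] z by simp
  then have "y + y + x = 0" by (simp add: mult_2[symmetric])
  then show ?thesis by (simp add: ec_add_def)
qed

lemma double_Some: "(x, y) \<in> C \<Longrightarrow> gg x \<noteq> 0 \<Longrightarrow> \<exists>y'. Some (x, y) \<oplus> Some (x, y) = Some (ff x / gg x, y')"
proof -
  assume q: "(x, y) \<in> C" and nz: "gg x \<noteq> 0"
  have d: "2 * y + x \<noteq> 0" using gg_sq[OF q] nz by auto
  have ne: "\<not> (x = x \<and> y + y + x = 0)"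
  proof
    assume "x = x \<and> y + y + x = 0"
    then have "2 * y + x = 0" unfolding mult_2 by blast
    then show False using d by simp
  qed
  obtain l n x3 where s: "Some (x, y) \<oplus> Some (x, y) = Some (x3, - (l * x3 + n) - x3)" "x3 = l ^ 2 + l - x - x"
    "l = (3 * x ^ 2 + b - y) / (2 * y + x)"
    using chord[OF q q ne] by metis
  have l: "l * (2 * y + x) = 3 * x ^ 2 + b - y" using s(3) d by simp
  have "x3 * gg x = (l * (2 * y + x)) ^ 2 + (l * (2 * y + x)) * (2 * y + x) - 2 * x * (2 * y + x) ^ 2"
    unfolding s(2) gg_sq[OF q] by (simp add: power2_eq_square algebra_simps)
  also have "\<dots> = ff x" unfolding l by (rule ff_id[OF q])
  finally have "x3 = ff x / gg x" using nz by (simp add: eq_divide_eq)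
  then show ?thesis using s(1) by auto
qed

lemma mul_2: "mul 2 P = P \<oplus> P" by (simp add: numeral_2_eq_2)

text \<open>The quartic \<open>ff - x0 gg\<close> has leading coefficient 1 in every characteristic.
  A root gives a point whose double has first coordinate \<open>x0\<close>, which is
  \<open>Q\<close> up to sign.\<close>

lemma halve: "Q \<in> E \<Longrightarrow> \<exists>P\<in>E. mul 2 P = Q"
proof (cases Q)
  case None
  then show ?thesis by (intro bexI[of _ None]) auto
next
  case (Some q)
  assume Q: "Q \<in> E"
  obtain x0 y0 where q: "q = (x0, y0)" by (cases q)
  have qC: "(x0, y0) \<in> C" using Q Some q by simp
  define r where "r = [:- c + b ^ 2 - x0 * (4 * c), - 8 * c - x0 * (4 * b), - 2 * b - x0, - 4 * x0, 1:]"
  have r: "poly r x = ff x - x0 * gg x" for x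
    by (simp add: r_def ff_def gg_def power2_eq_square power3_eq_cube power4_eq_xxxx algebra_simps)
  have "degree r \<ge> 1" by (simp add: r_def)
  then obtain x where "poly r x = 0" using ac by blast
  then have x: "ff x = x0 * gg x" using r by simp
  obtain y where y: "(x, y) \<in> C" using C_point by blast
  have g0: "gg x \<noteq> 0" using no_common[OF y] x by auto
  obtain y' where y': "Some (x, y) \<oplus> Some (x, y) = Some (x0, y')" using double_Some[OF y g0] x g0 by auto
  have "(x0, y') \<in> C" using add_E[of "Some (x, y)" "Some (x, y)"] y y' by simp
  then have "y' = y0 \<or> y' = - y0 - x0" using same_x qC by blast
  then show ?thesis
  proof
    assume "y' = y0"
    then show ?thesis using y y' Some q by (intro bexI[of _ "Some (x, y)"]) (auto simp: mul_2)
  next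
    assume e: "y' = - y0 - x0"
    have "mul 2 (ng (Some (x, y))) = ng (mul 2 (Some (x, y)))" using y by (intro mul_ng) simp
    also have "\<dots> = Q" using y' e Some q by (simp add: mul_2)
    finally show ?thesis using y ng_E[of "Some (x, y)"] by (intro bexI[of _ "ng (Some (x, y))"]) simp_all
  qed
qed

lemma two_torsion_exists: "\<exists>P\<in>E. P \<noteq> None \<and> mul 2 P = None"
proof -
  \<comment> \<open>The coefficient 1 of the square term guarantees a root in characteristic two as
    well.\<close>
  have "degree [:4 * c, 4 * b, 1, 4:] \<ge> 1" by auto
  then obtain x where x: "poly [:4 * c, 4 * b, 1, 4:] x = 0" using ac by blast
  then have g: "gg x = 0" by (simp add: gg_def power2_eq_square power3_eq_cube algebra_simps)
  obtain y where y: "(x, y) \<in> C" using C_point by blast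
  show ?thesis using double_None[OF y g] y by (intro bexI[of _ "Some (x, y)"]) (auto simp: mul_2)
qed

section \<open>Rational functions on the curve up to finitely many points\<close>

definition cof :: "('a \<times> 'a \<Rightarrow> bool) \<Rightarrow> bool" where "cof p \<longleftrightarrow> finite {q \<in> C. \<not> p q}"

lemma cof_mono: "cof p \<Longrightarrow> (\<And>q. q \<in> C \<Longrightarrow> p q \<Longrightarrow> r q) \<Longrightarrow> cof r"
  unfolding cof_def by (erule rev_finite_subset) auto

lemma cof_conj: "cof p \<Longrightarrow> cof r \<Longrightarrow> cof (\<lambda>q. p q \<and> r q)"
proof -
  assume "cof p" "cof r"
  then have "finite ({q \<in> C. \<not> p q} \<union> {q \<in> C. \<not> r q})" by (simp add: cof_def)
  then show ?thesis unfolding cof_def by (rule rev_finite_subset) auto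
qed

lemma cof_R: "v \<in> R \<Longrightarrow> v \<noteq> 0 \<Longrightarrow> cof (\<lambda>q. v q \<noteq> 0)"
proof -
  assume "v \<in> R" "v \<noteq> 0"
  then obtain A B where v: "v = fn A B" "(A, B) \<noteq> (0, 0)" by (auto elim!: R_E simp: fn_eq_0)
  show ?thesis unfolding cof_def using fn_zeros_finite[OF v(2)] v(1) by simp
qed

definition rat :: "('a \<times> 'a \<Rightarrow> 'a) \<Rightarrow> bool" where
  "rat h \<longleftrightarrow> (\<exists>u\<in>R. \<exists>v\<in>R. v \<noteq> 0 \<and> cof (\<lambda>q. v q \<noteq> 0 \<and> h q = u q / v q))"

lemma ratI: "u \<in> R \<Longrightarrow> v \<in> R \<Longrightarrow> v \<noteq> 0 \<Longrightarrow> cof (\<lambda>q. h q = u q / v q) \<Longrightarrow> rat h"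
  unfolding rat_def using cof_conj[OF cof_R] by blast

lemma rat_cong: "rat h \<Longrightarrow> cof (\<lambda>q. h q = h' q) \<Longrightarrow> rat h'"
proof -
  assume "rat h" and c: "cof (\<lambda>q. h q = h' q)"
  then obtain u v where uv: "u \<in> R" "v \<in> R" "v \<noteq> 0" "cof (\<lambda>q. v q \<noteq> 0 \<and> h q = u q / v q)" by (auto simp: rat_def)
  show ?thesis by (rule ratI[OF uv(1-3)]) (rule cof_mono[OF cof_conj[OF uv(4) c]], auto)
qed

lemma cof_True: "(\<And>q. q \<in> C \<Longrightarrow> p q) \<Longrightarrow> cof p"
proof -
  assume "\<And>q. q \<in> C \<Longrightarrow> p q"
  then have "{q \<in> C. \<not> p q} = {}" by auto
  then show ?thesis unfolding cof_def by (simp only: finite.emptyI)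
qed

lemma one_nz: "one \<noteq> 0" by (simp add: one_def fn_eq_0)

lemma rat_fn: "rat (\<lambda>(x, y). poly A x + poly B x * y)"
  by (rule ratI[OF fn_R one_R one_nz, of _ A B]) (auto intro!: cof_True simp: fn_def one_def)

lemma rat_const: "rat (\<lambda>_. d)" using rat_fn[of "[:d:]" 0] by (simp add: case_prod_unfold)
lemma rat_fst: "rat fst" using rat_fn[of "[:0, 1:]" 0] by (simp add: case_prod_unfold)
lemma rat_snd: "rat snd" using rat_fn[of 0 1] by (simp add: case_prod_unfold)

lemma rat_add: "rat f \<Longrightarrow> rat g \<Longrightarrow> rat (\<lambda>q. f q + g q)"
proof -
  assume "rat f" "rat g"
  then obtain u v u' v' where uv: "u \<in> R" "v \<in> R" "v \<noteq> 0" "cof (\<lambda>q. v q \<noteq> 0 \<and> f q = u q / v q)"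
    and uv': "u' \<in> R" "v' \<in> R" "v' \<noteq> 0" "cof (\<lambda>q. v' q \<noteq> 0 \<and> g q = u' q / v' q)" by (auto simp: rat_def)
  show ?thesis
  proof (rule ratI[of "u * v' + u' * v" "v * v'"])
    show "v * v' \<noteq> 0" using R_domain uv uv' by blast
    show "cof (\<lambda>q. f q + g q = (u * v' + u' * v) q / (v * v') q)"
      by (rule cof_mono[OF cof_conj[OF uv(4) uv'(4)]]) (auto simp: add_frac_eq)
  qed (use uv uv' R_add R_mult in auto)
qed

lemma rat_mult: "rat f \<Longrightarrow> rat g \<Longrightarrow> rat (\<lambda>q. f q * g q)"
proof -
  assume "rat f" "rat g"
  then obtain u v u' v' where uv: "u \<in> R" "v \<in> R" "v \<noteq> 0" "cof (\<lambda>q. v q \<noteq> 0 \<and> f q = u q / v q)"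
    and uv': "u' \<in> R" "v' \<in> R" "v' \<noteq> 0" "cof (\<lambda>q. v' q \<noteq> 0 \<and> g q = u' q / v' q)" by (auto simp: rat_def)
  show ?thesis
  proof (rule ratI[of "u * u'" "v * v'"])
    show "v * v' \<noteq> 0" using R_domain uv uv' by blast
    show "cof (\<lambda>q. f q * g q = (u * u') q / (v * v') q)"
      by (rule cof_mono[OF cof_conj[OF uv(4) uv'(4)]]) auto
  qed (use uv uv' R_mult in auto)
qed

lemma rat_inverse: "rat f \<Longrightarrow> rat (\<lambda>q. inverse (f q))"
proof -
  assume "rat f"
  then obtain u v where uv: "u \<in> R" "v \<in> R" "v \<noteq> 0" "cof (\<lambda>q. v q \<noteq> 0 \<and> f q = u q / v q)" by (auto simp: rat_def)
  show ?thesis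
  proof (cases "u = 0")
    case True
    have "cof (\<lambda>q. 0 = inverse (f q))" by (rule cof_mono[OF uv(4)]) (simp add: True)
    then show ?thesis by (rule rat_cong[OF rat_const])
  next
    case False
    show ?thesis by (rule ratI[OF uv(2,1) False]) (rule cof_mono[OF uv(4)], auto)
  qed
qed

lemma rat_minus: "rat f \<Longrightarrow> rat (\<lambda>q. - f q)"
  using rat_mult[OF rat_const[of "-1"], of f] by simp

lemma rat_diff: "rat f \<Longrightarrow> rat g \<Longrightarrow> rat (\<lambda>q. f q - g q)"
  using rat_add[of f "\<lambda>q. - g q"] rat_minus[of g] by simp

lemma rat_divide: "rat f \<Longrightarrow> rat g \<Longrightarrow> rat (\<lambda>q. f q / g q)"
  using rat_mult[of f "\<lambda>q. inverse (g q)"] rat_inverse[of g] by (simp add: divide_inverse)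

lemma rat_power: "rat f \<Longrightarrow> rat (\<lambda>q. f q ^ n)"
  by (induction n) (auto intro: rat_const rat_mult)

lemma rat_dichotomy: "rat h \<Longrightarrow> cof (\<lambda>q. h q = 0) \<or> cof (\<lambda>q. h q \<noteq> 0)"
proof -
  assume "rat h"
  then obtain u v where uv: "u \<in> R" "v \<in> R" "v \<noteq> 0" "cof (\<lambda>q. v q \<noteq> 0 \<and> h q = u q / v q)" by (auto simp: rat_def)
  show ?thesis
  proof (cases "u = 0")
    case True
    have "cof (\<lambda>q. h q = 0)" by (rule cof_mono[OF uv(4)]) (simp add: True)
    then show ?thesis ..
  next
    case False
    have "cof (\<lambda>q. h q \<noteq> 0)" by (rule cof_mono[OF cof_conj[OF uv(4) cof_R[OF uv(1) False]]]) auto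
    then show ?thesis ..
  qed
qed

definition ropt :: "('a \<times> 'a \<Rightarrow> ('a \<times> 'a) option) \<Rightarrow> bool" where
  "ropt f \<longleftrightarrow> cof (\<lambda>q. f q = None) \<or> (\<exists>h1 h2. rat h1 \<and> rat h2 \<and> cof (\<lambda>q. f q = Some (h1 q, h2 q)))"

lemmas rat_intros = rat_add rat_mult rat_minus rat_diff rat_divide rat_power rat_const

text \<open>A rational function vanishes almost everywhere or almost nowhere, so each test in
  \<open>ec_add\<close> has a constant outcome off a finite set, and the sum is again given by one
  formula.\<close>

lemma ropt_add:
  assumes f: "ropt f" and g: "ropt g"
  shows "ropt (\<lambda>q. f q \<oplus> g q)"
proof (cases "cof (\<lambda>q. f q = None) \<or> cof (\<lambda>q. g q = None)")
  case True
  then show ?thesis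
  proof
    assume n: "cof (\<lambda>q. f q = None)"
    from g show ?thesis unfolding ropt_def
    proof (elim disjE exE conjE)
      assume "cof (\<lambda>q. g q = None)"
      from cof_conj[OF n this] have "cof (\<lambda>q. f q \<oplus> g q = None)" by (rule cof_mono) simp
      then show "cof (\<lambda>q. f q \<oplus> g q = None) \<or> (\<exists>h1 h2. rat h1 \<and> rat h2 \<and> cof (\<lambda>q. f q \<oplus> g q = Some (h1 q, h2 q)))" ..
    next
      fix h1 h2 assume h: "rat h1" "rat h2" and "cof (\<lambda>q. g q = Some (h1 q, h2 q))"
      from cof_conj[OF n this(3)] have "cof (\<lambda>q. f q \<oplus> g q = Some (h1 q, h2 q))" by (rule cof_mono) simp
      then show "cof (\<lambda>q. f q \<oplus> g q = None) \<or> (\<exists>h1 h2. rat h1 \<and> rat h2 \<and> cof (\<lambda>q. f q \<oplus> g q = Some (h1 q, h2 q)))"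
        using h by blast
    qed
  next
    assume n: "cof (\<lambda>q. g q = None)"
    from f show ?thesis unfolding ropt_def
    proof (elim disjE exE conjE)
      assume "cof (\<lambda>q. f q = None)"
      from cof_conj[OF n this] have "cof (\<lambda>q. f q \<oplus> g q = None)" by (rule cof_mono) simp
      then show "cof (\<lambda>q. f q \<oplus> g q = None) \<or> (\<exists>h1 h2. rat h1 \<and> rat h2 \<and> cof (\<lambda>q. f q \<oplus> g q = Some (h1 q, h2 q)))" ..
    next
      fix h1 h2 assume h: "rat h1" "rat h2" and "cof (\<lambda>q. f q = Some (h1 q, h2 q))"
      from cof_conj[OF n this(3)] have "cof (\<lambda>q. f q \<oplus> g q = Some (h1 q, h2 q))" by (rule cof_mono) simp
      then show "cof (\<lambda>q. f q \<oplus> g q = None) \<or> (\<exists>h1 h2. rat h1 \<and> rat h2 \<and> cof (\<lambda>q. f q \<oplus> g q = Some (h1 q, h2 q)))"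
        using h by blast
    qed
  qed
next
  case False
  then obtain x1 y1 x2 y2 where h: "rat x1" "rat y1" "rat x2" "rat y2"
    and fg: "cof (\<lambda>q. f q = Some (x1 q, y1 q))" "cof (\<lambda>q. g q = Some (x2 q, y2 q))"
    using f g unfolding ropt_def by blast
  note fg = cof_conj[OF fg]
  have lines: "ropt (\<lambda>q. f q \<oplus> g q)" if ln: "rat l" "rat n" and
    c: "cof (\<lambda>q. f q \<oplus> g q = Some (l q ^ 2 + l q - x1 q - x2 q, - (l q + 1) * (l q ^ 2 + l q - x1 q - x2 q) - n q))" for l n
    unfolding ropt_def
    by (rule disjI2, rule exI, rule exI, intro conjI, rule_tac [3] c) (intro rat_intros ln h)+
  from rat_dichotomy[OF rat_diff[OF h(3,1)]] show ?thesis
  proof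
    assume x: "cof (\<lambda>q. x2 q - x1 q \<noteq> 0)"
    show ?thesis
    proof (rule lines)
      show "rat (\<lambda>q. (y2 q - y1 q) / (x2 q - x1 q))" "rat (\<lambda>q. (y1 q * x2 q - y2 q * x1 q) / (x2 q - x1 q))"
        by (intro rat_intros h)+
    qed (rule cof_mono[OF cof_conj[OF fg x]], auto simp: ec_add_def Let_def)
  next
    assume x: "cof (\<lambda>q. x2 q - x1 q = 0)"
    have ry: "rat (\<lambda>q. y1 q + y2 q + x2 q)" by (intro rat_intros h)
    from rat_dichotomy[OF ry] show ?thesis
    proof
      assume y: "cof (\<lambda>q. y1 q + y2 q + x2 q = 0)"
      have "cof (\<lambda>q. f q \<oplus> g q = None)"
        by (rule cof_mono[OF cof_conj[OF fg cof_conj[OF x y]]]) (auto simp: ec_add_def)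
      then show ?thesis unfolding ropt_def ..
    next
      assume y: "cof (\<lambda>q. y1 q + y2 q + x2 q \<noteq> 0)"
      show ?thesis
      proof (rule lines)
        show "rat (\<lambda>q. (3 * x1 q ^ 2 + b - y1 q) / (2 * y1 q + x1 q))" "rat (\<lambda>q. (- (x1 q ^ 3) + b * x1 q + 2 * c) / (2 * y1 q + x1 q))"
          by (intro rat_intros h)+
      qed (rule cof_mono[OF cof_conj[OF fg cof_conj[OF x y]]], auto simp: ec_add_def Let_def)
    qed
  qed
qed

lemma ropt_mul: "ropt (\<lambda>q. mul n (Some q))"
proof (induction n)
  case 0
  then show ?case unfolding ropt_def using cof_True[of "\<lambda>q. mul 0 (Some q) = None"] by simp
next
  case (Suc n)
  have "cof (\<lambda>q. Some q = Some (fst q, snd q))" by (rule cof_True) simp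
  then have "ropt Some" unfolding ropt_def using rat_fst rat_snd by blast
  then show ?case using ropt_add[OF _ Suc] by simp
qed

text \<open>Multiplication by n is given by rational functions off a finite set, so the n-torsion is finite or
  cofinite; in the second case it is everything. Since doubling is surjective, the least exponent of the curve
  would be odd, contrary to the existence of a point of order two.\<close>
lemma finite_torsion:
  assumes n: "n > 0"
  shows "finite {P \<in> E. mul n P = None}"
proof (rule ccontr)
  assume inf: "infinite {P \<in> E. mul n P = None}"
  have all: "\<forall>P\<in>E. mul n P = None" if inf: "infinite {P \<in> E. mul n P = None}" for n
  proof -
    have "{P \<in> E. mul n P = None} \<subseteq> insert None (Some ` {q \<in> C. mul n (Some q) = None})"
    proof
      fix P assume "P \<in> {P \<in> E. mul n P = None}"
      then show "P \<in> insert None (Some ` {q \<in> C. mul n (Some q) = None})" by (cases P) auto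
    qed
    then have infC: "infinite {q \<in> C. mul n (Some q) = None}" using inf by (meson finite.insertI finite_imageI finite_subset)
    have cofn: "cof (\<lambda>q. mul n (Some q) = None)"
    proof (rule ccontr)
      assume "\<not> ?thesis"
      then obtain h1 h2 where "cof (\<lambda>q. mul n (Some q) = Some (h1 q, h2 q))" using ropt_mul[of n] unfolding ropt_def by blast
      then have "finite {q \<in> C. mul n (Some q) = None}" unfolding cof_def by (rule rev_finite_subset) auto
      then show False using infC by simp
    qed
    \<comment> \<open>The exceptional set is finite while the curve is infinite, so every
      \<open>T\<close> is a sum of two points outside it, both killed by \<open>n\<close>.\<close>
    define D where "D = {P \<in> E. mul n P \<noteq> None}"
    have "D \<subseteq> Some ` {q \<in> C. mul n (Some q) \<noteq> None}"
    proof
      fix P assume "P \<in> D"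
      then show "P \<in> Some ` {q \<in> C. mul n (Some q) \<noteq> None}" by (cases P) (auto simp: D_def)
    qed
    then have Df: "finite D" using cofn unfolding cof_def by (meson finite_imageI finite_subset)
    show ?thesis
    proof
      fix T assume T: "T \<in> E"
      have "finite (D \<union> (\<lambda>P. T \<oplus> ng P) ` D)" using Df by simp
      moreover have "infinite E"
      proof
        assume "finite E"
        then have "finite (Some ` C)" by (rule rev_finite_subset) auto
        then show False using C_infinite by (simp add: finite_image_iff)
      qed
      ultimately obtain P where P: "P \<in> E" "P \<notin> D" "P \<notin> (\<lambda>P. T \<oplus> ng P) ` D"
        by (metis UnCI finite_subset subsetI)
      let ?Q = "T \<oplus> ng P"
      have Q: "?Q \<in> E" using T P by simp
      have eqP: "T \<oplus> ng ?Q = P"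
      proof -
        have "?Q \<oplus> P = T" by (rule add_ng_cancel(2)[OF T P(1)])
        then have "P \<oplus> ?Q = T" using add_comm[OF P(1) Q] by simp
        then show ?thesis using add_ng_cancel(1)[OF P(1) Q] by simp
      qed
      have "?Q \<notin> D"
      proof
        assume "?Q \<in> D"
        then have "T \<oplus> ng ?Q \<in> (\<lambda>P. T \<oplus> ng P) ` D" by (rule imageI)
        then show False using P(3) eqP by simp
      qed
      then have "mul n ?Q = None" "mul n P = None" using P Q by (auto simp: D_def)
      then have "mul n (?Q \<oplus> P) = None" using mul_distrib[OF Q P(1)] by simp
      then show "mul n T = None" using add_ng_cancel(2)[OF T P(1)] by simp
    qed
  qed
  let ?A = "{m. m > 0 \<and> (\<forall>P\<in>E. mul m P = None)}"
  define m where "m = (LEAST m. m \<in> ?A)"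
  have "n \<in> ?A" using all[OF inf] n by simp
  then have m: "m \<in> ?A" unfolding m_def by (rule LeastI)
  obtain Q where Q: "Q \<in> E" "Q \<noteq> None" "mul 2 Q = None" using two_torsion_exists by blast
  have "even m"
  proof (rule ccontr)
    assume "odd m"
    then obtain k where k: "m = k * 2 + 1" by (metis oddE mult.commute)
    have "mul m Q = mul k (mul 2 Q) \<oplus> Q" unfolding k using mul_add[OF Q(1), of "k * 2" 1] mul_mul[OF Q(1), of k 2] by simp
    then show False using m Q by simp
  qed
  then obtain k where k: "m = k * 2" by (metis evenE mult.commute)
  have "mul k S = None" if S: "S \<in> E" for S
  proof -
    obtain P where P: "P \<in> E" "mul 2 P = S" using halve[OF S] by blast
    have "mul k S = mul m P" unfolding k using mul_mul[OF P(1), of k 2] P(2) by simp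
    then show ?thesis using m P by simp
  qed
  then have "k \<in> ?A" using m k by auto
  then have "m \<le> k" unfolding m_def by (rule Least_le)
  then show False using k m by simp
qed

end

section \<open>Good points\<close>

text \<open>The coefficients make j equal to 1728 - 1/a.\<close>
locale tcurve =
  fixes a :: "'a::field"
  assumes ac: "\<And>q::'a poly. degree q \<ge> 1 \<Longrightarrow> \<exists>x. poly q x = 0"
    and nonsing: "disc (wcrv (36 * a) a) \<noteq> 0"
begin

sublocale wcurve "36 * a" a by unfold_locales (fact ac nonsing)+

abbreviation tadd (infixl \<open>\<oplus>\<close> 65) where "P \<oplus> Q \<equiv> ec_add (wcrv (36 * a) a) P Q"

lemma a_nonzero: "a \<noteq> 0" using nonsing disc_W by auto

definition pts :: "'a set \<Rightarrow> ('a \<times> 'a) option set" where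
  "pts L = {P \<in> E. \<forall>x y. P = Some (x, y) \<longrightarrow> x \<in> L \<and> y \<in> L}"

lemma pts_E: "P \<in> pts L \<Longrightarrow> P \<in> E" by (simp add: pts_def)
lemma pts_None [simp]: "None \<in> pts L" by (simp add: pts_def)
lemma pts_Some: "Some (x, y) \<in> pts L \<longleftrightarrow> (x, y) \<in> C \<and> x \<in> L \<and> y \<in> L" by (auto simp: pts_def)

lemma pts_ng: "is_subfield L \<Longrightarrow> P \<in> pts L \<Longrightarrow> ng P \<in> pts L"
  by (cases P rule: ng.cases) (auto simp: pts_Some ng_C intro!: subfieldD)

lemma pts_add:
  assumes L: "is_subfield L" "a \<in> L" and P: "P \<in> pts L" and Q: "Q \<in> pts L"
  shows "P \<oplus> Q \<in> pts L"
proof (cases "P = None \<or> Q = None")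
  case False
  then obtain x1 y1 x2 y2 where e: "P = Some (x1, y1)" "Q = Some (x2, y2)" by (metis option.exhaust surj_pair)
  have m: "(x1, y1) \<in> C" "x1 \<in> L" "y1 \<in> L" "(x2, y2) \<in> C" "x2 \<in> L" "y2 \<in> L" using P Q by (auto simp: e pts_Some)
  show ?thesis
  proof (cases "x1 = x2 \<and> y1 + y2 + x2 = 0")
    case True
    then have "P \<oplus> Q = None" by (simp add: e ec_add_def)
    then show ?thesis by simp
  next
    case ne: False
    show ?thesis
    proof (rule chord[OF m(1,4) ne], goal_cases)
      case (1 l n x3)
      note l = 1(1,2,4,6,7)[folded e]
    have lL: "l \<in> L"
    proof (cases "x1 = x2")
      case True
      then show ?thesis unfolding conjunct2[OF conjunct2[OF l(5)[OF True]]] by (intro subfieldD[OF L(1)] m L(2))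
    next
      case False
      then show ?thesis unfolding l(4)[OF False] by (intro subfieldD[OF L(1)] m)
    qed
    have x3: "x3 \<in> L" unfolding l(3) by (intro subfieldD[OF L(1)] m lL)
    have n: "n = y1 - l * x1" using l(2) by simp
    have nL: "n \<in> L" unfolding n by (intro subfieldD[OF L(1)] m lL)
    have "P \<oplus> Q \<in> E" by (rule add_E[OF pts_E[OF P] pts_E[OF Q]])
    moreover have "- (l * x3 + n) - x3 \<in> L" by (intro subfieldD[OF L(1)] x3 nL lL)
    ultimately show ?thesis unfolding l(1) pts_Some using x3 by simp
    qed
  qed
qed (use P Q in auto)

lemma pts_mul: "is_subfield L \<Longrightarrow> a \<in> L \<Longrightarrow> P \<in> pts L \<Longrightarrow> mul n P \<in> pts L"
  by (induction n) (auto intro: pts_add)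

definition good :: "'a set \<Rightarrow> ('a \<times> 'a) option \<Rightarrow> bool" where
  "good V P \<longleftrightarrow> (\<forall>x y. P = Some (x, y) \<longrightarrow> x \<notin> vmax V)"

lemma good_None [simp]: "good V None" by (simp add: good_def)
lemma good_Some [simp]: "good V (Some (x, y)) \<longleftrightarrow> x \<notin> vmax V" by (simp add: good_def)
lemma good_ng [simp]: "good V (ng P) \<longleftrightarrow> good V P" by (cases P rule: ng.cases) auto

end

locale tcurve_vr = tcurve a + vr L V for a :: "'a::field" and L V +
  assumes am: "a \<in> vmax V"
begin

lemma aL: "a \<in> L" using am m_V V_sub by blast

text \<open>The equation reads \<open>y (y + x) = x^3 + 36 a x + a\<close>: with \<open>x\<close>
  small and \<open>y\<close> not small, the left side would not be small although the right side
  is.\<close>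

lemma y_m: "(x, y) \<in> C \<Longrightarrow> x \<in> vmax V \<Longrightarrow> y \<in> L \<Longrightarrow> y \<in> vmax V"
proof (rule ccontr)
  assume q: "(x, y) \<in> C" and x: "x \<in> vmax V" and y: "y \<in> L" "y \<notin> vmax V"
  have xL: "x \<in> L" using x m_V V_sub by blast
  have "y * (y + x) \<notin> vmax V" by (intro unit_mult unit_add subfieldD[OF L] y x xL)
  moreover have "y * (y + x) = x * x ^ 2 + 36 * a * x + a"
    using q unfolding C_iff by (simp add: power2_eq_square power3_eq_cube algebra_simps)
  moreover have "x * x ^ 2 + 36 * a * x + a \<in> vmax V"
    by (intro m_add am m_mult[OF x] m_mult2[OF _ x] V_power m_V[OF x] V_mult m_V[OF am] V_numeral)
  ultimately show False by simp
qed

text \<open>The good point may have non-integral coordinates, so everything is written in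
  \<open>i = 1/x2\<close> and \<open>v = y2/x2^2\<close>, both integral. Then
  \<open>x3 = num / d^2\<close> with \<open>d\<close> near 1, and each term of \<open>num\<close>
  contains \<open>a\<close>, \<open>x1\<close> or \<open>y1\<close>.\<close>

lemma bad_add:
  assumes P: "P \<in> pts L" "good V P" and S: "S \<in> pts L" "\<not> good V S"
  shows "\<not> good V (P \<oplus> S)"
proof (cases P)
  case None
  then show ?thesis using S by simp
next
  case (Some pq)
  then obtain x2 y2 where e2: "P = Some (x2, y2)" by (metis surj_pair)
  obtain x1 y1 where e1: "S = Some (x1, y1)" using S(2) by (cases S) auto
  have m: "(x1, y1) \<in> C" "x1 \<in> L" "y1 \<in> L" "(x2, y2) \<in> C" "x2 \<in> L" "y2 \<in> L" using P S by (auto simp: e1 e2 pts_Some)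
  have x1: "x1 \<in> vmax V" and x2: "x2 \<notin> vmax V" using P S by (auto simp: e1 e2)
  have y1: "y1 \<in> vmax V" by (rule y_m[OF m(1) x1 m(3)])
  have ne: "x2 \<noteq> x1" using x1 x2 by auto
  have x20: "x2 \<noteq> 0" using x2 by auto
  define i where "i = inverse x2"
  have i: "i \<in> V" unfolding i_def by (rule not_m_inv[OF m(5) x2])
  have ix: "i * x2 = 1" using x20 by (simp add: i_def)
  define v where "v = y2 * i ^ 2"
  have vL: "v \<in> L" unfolding v_def by (intro subfieldD[OF L] m V_sub[OF i])
  have "v ^ 2 + i * v = i + 36 * a * i ^ 3 + a * i ^ 4"
  proof -
    have "v ^ 2 + i * v = i ^ 4 * (y2 ^ 2 + x2 * y2) - i ^ 3 * y2 * (i * x2 - 1)"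
      by (simp add: v_def power2_eq_square power3_eq_cube power4_eq_xxxx algebra_simps)
    also have "\<dots> = i ^ 4 * (x2 ^ 3 + 36 * a * x2 + a)" using m(4) ix unfolding C_iff by simp
    also have "\<dots> = i * (i * x2) ^ 3 + 36 * a * i ^ 3 * (i * x2) + a * i ^ 4"
      by (simp add: power2_eq_square power3_eq_cube power4_eq_xxxx algebra_simps)
    finally show ?thesis using ix by simp
  qed
  then have "v ^ 2 = (i + 36 * a * i ^ 3 + a * i ^ 4) + (- i) * v" by (simp add: algebra_simps)
  then have "v ^ 2 = (\<Sum>j<2. (if j = 0 then i + 36 * a * i ^ 3 + a * i ^ 4 else - i) * v ^ j)"
    by (simp add: numeral_2_eq_2)
  then have v: "v \<in> V"
    by (rule integral_in_V[OF vL, rotated]) (auto intro!: V_add V_mult V_power V_minus i m_V[OF am])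
  obtain l n x3 where l: "P \<oplus> S = Some (x3, - (l * x3 + n) - x3)" "x3 = l ^ 2 + l - x2 - x1" "l = (y1 - y2) / (x1 - x2)"
    using chord[OF m(4,1)] ne e1 e2 by metis
  define d where "d = 1 - x1 * i"
  have "1 + (- (x1 * i)) \<notin> vmax V"
    by (intro unit_add m_minus m_mult x1 i V_sub V_1) simp
  then have du: "d \<notin> vmax V" by (simp add: d_def)
  have dL: "d \<in> L" unfolding d_def by (intro subfieldD[OF L] m V_sub[OF i])
  define num where "num = 2 * a * i ^ 2 + 36 * a * (x1 * i ^ 2 + i) + x1 * (x1 * i + 1) - 2 * y1 * v - v * x1 - y1 * i"
  have numm: "num \<in> vmax V"
  proof -
    have "a * (2 * i ^ 2) + a * (36 * (x1 * i ^ 2 + i)) + x1 * (x1 * i + 1) - y1 * (2 * v) - x1 * v - y1 * i \<in> vmax V"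
      by (intro m_add m_diff m_mult am x1 y1 V_add V_mult V_power i v V_numeral V_1 m_V[OF x1])
    then show ?thesis by (simp add: num_def mult_ac)
  qed
  have lx: "l * (x1 - x2) = y1 - y2" using l(3) ne by simp
  have "x3 * (x1 - x2) ^ 2 = (l * (x1 - x2)) ^ 2 + (l * (x1 - x2)) * (x1 - x2) - (x1 + x2) * (x1 - x2) ^ 2"
    unfolding l(2) by (simp add: power2_eq_square algebra_simps)
  also have "\<dots> = (y1 ^ 2 + x1 * y1 - x1 ^ 3) + (y2 ^ 2 + x2 * y2 - x2 ^ 3) - 2 * y1 * y2 - y2 * x1 - y1 * x2 + x1 * x2 * (x1 + x2)"
    unfolding lx by (simp add: power2_eq_square power3_eq_cube algebra_simps)
  also have "\<dots> = (36 * a * x1 + a) + (36 * a * x2 + a) - 2 * y1 * y2 - y2 * x1 - y1 * x2 + x1 * x2 * (x1 + x2)"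
    using m(1,4) unfolding C_iff by simp
  finally have e: "x3 * (x1 - x2) ^ 2 = (36 * a * x1 + a) + (36 * a * x2 + a) - 2 * y1 * y2 - y2 * x1 - y1 * x2 + x1 * x2 * (x1 + x2)" .
  have "x3 * d ^ 2 = num"
  proof -
    have "d = - (i * (x1 - x2))" using ix by (simp add: d_def algebra_simps)
    then have "x3 * d ^ 2 = i ^ 2 * (x3 * (x1 - x2) ^ 2)" by (simp add: power2_eq_square)
    also have "\<dots> = 2 * a * i ^ 2 + 36 * a * (x1 * i ^ 2 + i * (i * x2)) + x1 * (x1 * i * (i * x2) + (i * x2) * (i * x2)) - 2 * y1 * v - v * x1 - y1 * i * (i * x2)"
      unfolding e by (simp add: v_def power2_eq_square algebra_simps)
    finally show ?thesis using ix by (simp add: num_def)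
  qed
  then have "x3 = num / d ^ 2" using unit_nz[OF du] by (simp add: eq_divide_eq)
  also have "\<dots> \<in> vmax V" by (intro divide_unit_m numm unit_power dL du subfieldD[OF L])
  finally show ?thesis using l(1) by simp
qed

text \<open>Otherwise \<open>P\<close>, as the sum of \<open>- Q\<close> and \<open>P + Q\<close>,
  would not be good by \<open>bad_add\<close>.\<close>

lemma good_add:
  assumes P: "P \<in> pts L" "good V P" and Q: "Q \<in> pts L" "good V Q"
  shows "good V (P \<oplus> Q)"
proof (rule ccontr)
  assume n: "\<not> good V (P \<oplus> Q)"
  have "\<not> good V (ng Q \<oplus> (P \<oplus> Q))"
    by (rule bad_add) (use P Q n pts_ng[OF L] pts_add[OF L aL] in auto)
  moreover have "ng Q \<oplus> (P \<oplus> Q) = P"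
  proof -
    have E': "P \<in> E" "Q \<in> E" using P Q pts_E by auto
    then have "ng Q \<oplus> (P \<oplus> Q) = P \<oplus> Q \<oplus> ng Q" by (intro add_comm) simp_all
    then show ?thesis using add_ng_cancel(1)[OF E'] by simp
  qed
  ultimately show False using P by simp
qed

lemma good_mul: "P \<in> pts L \<Longrightarrow> good V P \<Longrightarrow> good V (mul n P)"
  by (induction n) (auto intro!: good_add pts_mul[OF L aL])

text \<open>The left side is \<open>l (l + 1) - x1 - x2\<close>, and the values 0 and -1 of
  \<open>l\<close> are the slopes of the tangents at the node.\<close>

lemma slope_good:
  assumes "l \<in> L" "x1 \<in> vmax V" "x2 \<in> vmax V" "l \<notin> vmax V" "l + 1 \<notin> vmax V"
  shows "l ^ 2 + l - x1 - x2 \<notin> vmax V"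
proof -
  have "l * (l + 1) \<notin> vmax V" by (intro unit_mult assms subfieldD[OF L])
  then have "l * (l + 1) + (- x1 - x2) \<notin> vmax V"
    by (rule unit_add[rotated]) (intro subfieldD[OF L] assms m_diff m_minus)+
  then show ?thesis by (simp add: power2_eq_square algebra_simps)
qed

lemma slope_bad:
  assumes l: "l \<in> L" and x: "x1 \<in> vmax V" "x2 \<in> vmax V" and b: "l ^ 2 + l - x1 - x2 \<in> vmax V"
  shows "l \<in> V"
proof (rule ccontr)
  assume n: "l \<notin> V"
  then have "l \<notin> vmax V" "l + 1 \<notin> vmax V" using m_V not_V_add[OF n V_1] by auto
  then show False using slope_good[OF l x] b by simp
qed

text \<open>Equality of values, expressed without a value group.\<close>

definition eqv :: "'a \<Rightarrow> 'a \<Rightarrow> bool" where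
  "eqv u v \<longleftrightarrow> (u = 0 \<longleftrightarrow> v = 0) \<and> u / v \<in> V \<and> v / u \<in> V"

lemma eqv_minus: "eqv u v \<Longrightarrow> eqv (- u) (- v)" by (simp add: eqv_def)

text \<open>For a difference of two points the slope satisfies two denominator-free equations, valid
  for chords and tangents alike; whichever of \<open>x1 - x2\<close> and \<open>y1 - y2\<close> is
  nonzero determines \<open>l\<close>.\<close>

lemma slope_identity:
  assumes p: "(x1, y1) \<in> C" and q: "(x2, y2) \<in> C" and ne: "\<not> (x1 = x2 \<and> y1 = y2)"
  obtains l n x3 where "Some (x1, y1) \<oplus> ng (Some (x2, y2)) = Some (x3, - (l * x3 + n) - x3)" "x3 = l ^ 2 + l - x1 - x2"
    "l * (y1 - y2) = x1 ^ 2 + x1 * x2 + x2 ^ 2 + 36 * a - y1" "l * (x1 - x2) = y1 + y2 + x2"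
    "x1 \<noteq> x2 \<or> y1 + y2 + x2 = 0"
proof -
  have q': "(x2, - y2 - x2) \<in> C" by (rule ng_C[OF q])
  have ne': "\<not> (x1 = x2 \<and> y1 + (- y2 - x2) + x2 = 0)" using ne by auto
  show thesis
  proof (rule chord[OF p q' ne'], goal_cases)
  case (1 l n x3)
  note l = 1
  have lx: "l * (x1 - x2) = y1 + y2 + x2"
  proof (cases "x1 = x2")
    case True
    then show ?thesis using l(7) by simp
  next
    case False
    then have "l * (x2 - x1) = - y2 - x2 - y1" using l(6) by simp
    then have "- (l * (x2 - x1)) = - (- y2 - x2 - y1)" by (simp only:)
    then show ?thesis by (simp add: algebra_simps)
  qed
  have ly: "l * (y1 - y2) = x1 ^ 2 + x1 * x2 + x2 ^ 2 + 36 * a - y1"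
  proof (cases "x1 = x2")
    case True
    have t: "y1 = - y2 - x2" "2 * y1 + x1 \<noteq> 0" "l = (3 * x1 ^ 2 + 36 * a - y1) / (2 * y1 + x1)" using l(7)[OF True] by auto
    have "l * (2 * y1 + x1) = 3 * x1 ^ 2 + 36 * a - y1" using t(2,3) by simp
    moreover have "y1 - y2 = 2 * y1 + x1" unfolding t(1) True by simp
    ultimately have e: "l * (y1 - y2) = 3 * x1 ^ 2 + 36 * a - y1" by (simp only:)
    show ?thesis unfolding e True by (simp add: power2_eq_square)
  next
    case False
    have "(l * (y1 - y2)) * (x1 - x2) = (l * (x1 - x2)) * (y1 - y2)" by (simp add: mult_ac)
    also have "\<dots> = (y1 ^ 2 + x1 * y1) - (y2 ^ 2 + x2 * y2) - (x1 - x2) * y1"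
      unfolding lx by (simp add: power2_eq_square algebra_simps)
    also have "\<dots> = (x1 ^ 2 + x1 * x2 + x2 ^ 2 + 36 * a - y1) * (x1 - x2)"
      using p q unfolding C_iff by (simp add: power2_eq_square power3_eq_cube algebra_simps)
    finally show ?thesis using False by simp
  qed
  have nd: "x1 \<noteq> x2 \<or> y1 + y2 + x2 = 0" using l(7) by (cases "x1 = x2") simp_all
  show thesis by (rule that[OF _ l(4) ly lx nd]) (simp only: ng.simps l(1))
  qed
qed

lemma slope_L:
  assumes "l * (y1 - y2) = x1 ^ 2 + x1 * x2 + x2 ^ 2 + 36 * a - y1" "l * (x1 - x2) = y1 + y2 + x2"
    and "x1 \<in> L" "y1 \<in> L" "x2 \<in> L" "y2 \<in> L" "\<not> (x1 = x2 \<and> y1 = y2)"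
  shows "l \<in> L"
proof (cases "x1 = x2")
  case False
  then have "l = (y1 + y2 + x2) / (x1 - x2)" using assms(2) by (simp add: eq_divide_eq)
  then show ?thesis by (simp add: subfieldD[OF L] assms)
next
  case True
  then have "l = (x1 ^ 2 + x1 * x2 + x2 ^ 2 + 36 * a - y1) / (y1 - y2)" using assms(1,7) by (simp add: eq_divide_eq)
  then show ?thesis by (simp add: subfieldD[OF L] assms aL)
qed

text \<open>The first point lies near the branch \<open>y = 0\<close> of the node. Dividing by
  \<open>x1\<close> gives \<open>l (1 - r) = s + t + r\<close> with \<open>s\<close> and
  \<open>t\<close> small and \<open>r\<close> a unit, so \<open>l\<close> is near neither 0 nor
  -1.\<close>

lemma same_valuation_A:
  assumes p: "(x1, y1) \<in> C" "x1 \<in> L" "y1 \<in> L" and q: "(x2, y2) \<in> C" "x2 \<in> L" "y2 \<in> L"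
    and x: "x1 \<in> vmax V" "x2 \<in> vmax V" and ex: "eqv x1 x2" and ey: "eqv y1 y2"
    and A: "x1 \<noteq> 0" "y1 / x1 \<in> vmax V"
  shows "good V (Some (x1, y1) \<oplus> ng (Some (x2, y2)))"
proof (cases "x1 = x2 \<and> y1 = y2")
  case True
  then have "Some (x1, y1) \<oplus> ng (Some (x2, y2)) = None" using add_ng(1)[of "Some (x1, y1)"] by simp
  then show ?thesis by simp
next
  case ne: False
  obtain l n x3 where l: "Some (x1, y1) \<oplus> ng (Some (x2, y2)) = Some (x3, - (l * x3 + n) - x3)" "x3 = l ^ 2 + l - x1 - x2"
    "l * (y1 - y2) = x1 ^ 2 + x1 * x2 + x2 ^ 2 + 36 * a - y1" "l * (x1 - x2) = y1 + y2 + x2" "x1 \<noteq> x2 \<or> y1 + y2 + x2 = 0"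
    using slope_identity[OF p(1) q(1) ne] by metis
  have lL: "l \<in> L" by (rule slope_L[OF l(3,4) p(2,3) q(2,3) ne])
  have x20: "x2 \<noteq> 0" using ex A by (simp add: eqv_def)
  define r where "r = x2 / x1"
  define s where "s = y1 / x1"
  define t where "t = y2 / x1"
  have r: "r \<in> V" "r \<notin> vmax V"
  proof -
    show "r \<in> V" using ex by (simp add: r_def eqv_def)
    have "inverse r \<in> V" using ex A x20 by (simp add: r_def eqv_def)
    then show "r \<notin> vmax V" using A x20 by (simp add: vmax_def r_def)
  qed
  have sm: "s \<in> vmax V" using A by (simp add: s_def)
  have tm: "t \<in> vmax V"
  proof (cases "y1 = 0")
    case True
    then show ?thesis using ey by (simp add: t_def eqv_def)
  next
    case False
    then have e: "t = (y1 / x1) * (y2 / y1)" by (simp add: t_def)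
    show ?thesis unfolding e by (rule m_mult[OF A(2)]) (use ey in \<open>simp add: eqv_def\<close>)
  qed
  have e1: "l * (1 - r) = s + t + r"
  proof -
    have "l * (1 - r) = l * (x1 - x2) / x1" using A(1) by (simp add: r_def field_simps)
    also have "\<dots> = s + t + r" unfolding l(4) by (simp add: r_def s_def t_def add_divide_distrib)
    finally show ?thesis .
  qed
  have e2: "(l + 1) * (1 - r) = s + t + 1" using e1 by (simp add: algebra_simps)
  have rV: "1 - r \<in> V" using r V_diff V_1 by blast
  have "l \<notin> vmax V"
  proof
    assume "l \<in> vmax V"
    then have "l * (1 - r) \<in> vmax V" using rV by (rule m_mult)
    then have "l * (1 - r) - (s + t) \<in> vmax V" by (intro m_diff m_add sm tm)
    then show False using e1 r by simp
  qed
  moreover have "l + 1 \<notin> vmax V"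
  proof
    assume "l + 1 \<in> vmax V"
    then have "(l + 1) * (1 - r) \<in> vmax V" using rV by (rule m_mult)
    then have "(l + 1) * (1 - r) - (s + t) \<in> vmax V" by (intro m_diff m_add sm tm)
    then show False using e2 by simp
  qed
  ultimately show ?thesis using slope_good[OF lL x] l(1,2) by simp
qed

text \<open>Near the branch \<open>y = 0\<close> the previous lemma applies, and negation carries
  the branch \<open>y = - x\<close> to it. When instead \<open>x1 / y1\<close> is integral, one
  divides by \<open>y1\<close>; the curve equation then makes \<open>a / y1\<close> small.\<close>

lemma same_valuation:
  assumes p: "(x1, y1) \<in> C" "x1 \<in> L" "y1 \<in> L" and q: "(x2, y2) \<in> C" "x2 \<in> L" "y2 \<in> L"
    and x: "x1 \<in> vmax V" "x2 \<in> vmax V" and ex: "eqv x1 x2" and ey: "eqv y1 y2" and exy: "eqv (y1 + x1) (y2 + x2)"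
  shows "good V (Some (x1, y1) \<oplus> ng (Some (x2, y2)))"
proof -
  consider "x1 \<noteq> 0" "y1 / x1 \<in> vmax V" | "x1 \<noteq> 0" "(y1 + x1) / x1 \<in> vmax V"
    | "x1 = 0 \<or> y1 / x1 \<notin> vmax V" by blast
  then show ?thesis
  proof cases
    case 1
    then show ?thesis using same_valuation_A[OF p q x ex ey] by blast
  next
    case 2
    have m: "- y1 - x1 = - (y1 + x1)" "- y2 - x2 = - (y2 + x2)" by simp_all
    have "(- y1 - x1) / x1 \<in> vmax V" using m_minus[OF 2(2)] unfolding m by (simp only: minus_divide_left)
    moreover have "eqv (- y1 - x1) (- y2 - x2)" unfolding m by (rule eqv_minus[OF exy])
    moreover have "- y1 - x1 \<in> L" "- y2 - x2 \<in> L" by (intro subfieldD[OF L] p q)+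
    ultimately have "good V (Some (x1, - y1 - x1) \<oplus> ng (Some (x2, - y2 - x2)))"
      using same_valuation_A[OF ng_C[OF p(1)] p(2) _ ng_C[OF q(1)] q(2) _ x ex _ 2(1)] by blast
    then have "good V (ng (Some (x1, y1)) \<oplus> ng (ng (Some (x2, y2))))" by simp
    moreover have "ng (Some (x1, y1)) \<oplus> ng (ng (Some (x2, y2))) = ng (Some (x1, y1) \<oplus> ng (Some (x2, y2)))"
      using ng_add[of "Some (x1, y1)" "ng (Some (x2, y2))"] p q ng_E[of "Some (x2, y2)"] by simp
    ultimately show ?thesis by (simp only: good_ng)
  next
    case 3
    have y1: "y1 \<in> vmax V" by (rule y_m[OF p(1) x(1) p(3)])
    have xV: "x1 \<in> V" "x2 \<in> V" "y1 \<in> V" using x y1 m_V by auto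
    have y10: "y1 \<noteq> 0"
    proof
      assume "y1 = 0"
      moreover have "x1 \<noteq> 0 \<or> y1 \<noteq> 0" using p(1) a_nonzero unfolding C_iff by auto
      ultimately show False using 3 by simp
    qed
    define r where "r = x1 / y1"
    have r: "r \<in> V"
    proof (cases "x1 = 0")
      case True
      then show ?thesis by (simp add: r_def)
    next
      case False
      then have "inverse (y1 / x1) \<in> V" using 3 not_m_inv[of "y1 / x1"] p subfieldD(8)[OF L] by blast
      then show ?thesis by (simp add: r_def)
    qed
    have y20: "y2 \<noteq> 0" using ey y10 by (simp add: eqv_def)
    define s where "s = y2 / y1"
    have s: "s \<in> V" "s \<notin> vmax V" using ey y10 y20 by (auto simp: s_def eqv_def vmax_def)
    define r2 where "r2 = x2 / y1"
    have r2: "r2 \<in> V"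
    proof (cases "x1 = 0")
      case True
      then show ?thesis using ex by (simp add: r2_def eqv_def)
    next
      case False
      then have e: "r2 = r * (x2 / x1)" by (simp add: r2_def r_def)
      show ?thesis unfolding e by (rule V_mult[OF r]) (use ex in \<open>simp add: eqv_def\<close>)
    qed
    have ay: "a / y1 \<in> vmax V"
    proof -
      have u: "1 + 36 * x1 \<notin> vmax V" by (intro unit_add m_mult2 x V_numeral V_sub V_1) simp
      have uL: "1 + 36 * x1 \<in> L" by (intro subfieldD[OF L] p)
      have "a * (1 + 36 * x1) = y1 * (y1 + x1 - x1 ^ 2 * r)"
        using p(1) y10 unfolding C_iff by (simp add: r_def power2_eq_square power3_eq_cube algebra_simps)
      then have "a / y1 = (y1 + x1 - x1 ^ 2 * r) / (1 + 36 * x1)" using y10 unit_nz[OF u] by (simp add: frac_eq_eq mult.commute)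
      moreover have "y1 + x1 - x1 * (x1 * r) \<in> vmax V" by (intro m_add m_diff y1 x m_mult V_mult r xV)
      ultimately show ?thesis using divide_unit_m[OF _ uL u] by (simp add: power2_eq_square mult.assoc)
    qed
    define q' where "q' = x1 ^ 2 + x1 * x2 + x2 ^ 2 + 36 * a"
    have qm: "q' / y1 \<in> vmax V"
    proof -
      have "q' / y1 = x1 * r + x2 * r + x2 * r2 + 36 * (a / y1)"
        by (simp add: q'_def r_def r2_def power2_eq_square add_divide_distrib)
      also have "\<dots> \<in> vmax V" by (intro m_add m_mult m_mult2[OF _ ay] x r r2 V_numeral)
      finally show ?thesis .
    qed
    show ?thesis
    proof (cases "x1 = x2 \<and> y1 = y2")
      case True
      then have "Some (x1, y1) \<oplus> ng (Some (x2, y2)) = None" using add_ng(1)[of "Some (x1, y1)"] by simp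
      then show ?thesis by simp
    next
      case ne: False
      obtain l n x3 where l: "Some (x1, y1) \<oplus> ng (Some (x2, y2)) = Some (x3, - (l * x3 + n) - x3)" "x3 = l ^ 2 + l - x1 - x2"
        "l * (y1 - y2) = x1 ^ 2 + x1 * x2 + x2 ^ 2 + 36 * a - y1" "l * (x1 - x2) = y1 + y2 + x2"
        using slope_identity[OF p(1) q(1) ne] by metis
      have lL: "l \<in> L" by (rule slope_L[OF l(3,4) p(2,3) q(2,3) ne])
      have e1: "l * (1 - s) = q' / y1 - 1"
      proof -
        have "l * (1 - s) = l * (y1 - y2) / y1" using y10 by (simp add: s_def field_simps)
        also have "\<dots> = q' / y1 - 1" unfolding l(3) q'_def[symmetric] using y10 by (simp add: diff_divide_distrib)
        finally show ?thesis .
      qed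
      have "(l + 1) * (1 - s) = l * (1 - s) + (1 - s)" by (simp add: algebra_simps)
      also have "\<dots> = q' / y1 - s" unfolding e1 by simp
      finally have e2: "(l + 1) * (1 - s) = q' / y1 - s" .
      have sV: "1 - s \<in> V" using s V_diff V_1 by blast
      have "l \<notin> vmax V"
      proof
        assume "l \<in> vmax V"
        then have "l * (1 - s) \<in> vmax V" using sV by (rule m_mult)
        then have "q' / y1 - l * (1 - s) \<in> vmax V" by (intro m_diff qm)
        then show False using e1 by simp
      qed
      moreover have "l + 1 \<notin> vmax V"
      proof
        assume "l + 1 \<in> vmax V"
        then have "(l + 1) * (1 - s) \<in> vmax V" using sV by (rule m_mult)
        then have "q' / y1 - (l + 1) * (1 - s) \<in> vmax V" by (intro m_diff qm)
        then show False using e2 s by simp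
      qed
      ultimately show ?thesis using slope_good[OF lL x] l(1,2) by simp
    qed
  qed
qed

text \<open>If neither the sum nor the difference were good, both slopes would be integral; together
  with the congruence of \<open>x1\<close> and \<open>x2\<close> they make \<open>x1\<close> and
  \<open>y1\<close> divisible by \<open>a\<close>. The equation of the curve then gives
  \<open>a\<close> as \<open>a^2\<close> times an integral element.\<close>

lemma close_points:
  assumes p: "(x1, y1) \<in> C" "x1 \<in> L" "y1 \<in> L" and q: "(x2, y2) \<in> C" "x2 \<in> L" "y2 \<in> L"
    and x: "x1 \<in> vmax V" "x2 \<in> vmax V" and d: "x1 - x2 = a * d" "d \<in> V"
  shows "good V (Some (x1, y1) \<oplus> Some (x2, y2)) \<or> good V (Some (x1, y1) \<oplus> ng (Some (x2, y2)))"
proof (cases "x1 = x2")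
  case True
  then have "y2 = y1 \<or> y2 = - y1 - x1" using same_x p q by blast
  then show ?thesis
  proof
    assume "y2 = y1"
    then show ?thesis using True add_ng(1)[of "Some (x1, y1)"] by simp
  next
    assume "y2 = - y1 - x1"
    then have "Some (x2, y2) = ng (Some (x1, y1))" using True by simp
    then show ?thesis by (simp only: add_ng good_None simp_thms)
  qed
next
  case False
  show ?thesis
  proof (rule ccontr)
    assume no: "\<not> ?thesis"
    obtain l n x3 where l: "Some (x1, y1) \<oplus> ng (Some (x2, y2)) = Some (x3, - (l * x3 + n) - x3)" "x3 = l ^ 2 + l - x1 - x2"
      "l * (y1 - y2) = x1 ^ 2 + x1 * x2 + x2 ^ 2 + 36 * a - y1" "l * (x1 - x2) = y1 + y2 + x2"
      using slope_identity[OF p(1) q(1)] False by metis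
    have lL: "l \<in> L" using slope_L[OF l(3,4) p(2,3) q(2,3)] False by simp
    obtain k n' x3' where k: "Some (x1, y1) \<oplus> Some (x2, y2) = Some (x3', - (k * x3' + n') - x3')" "x3' = k ^ 2 + k - x1 - x2"
      "k = (y2 - y1) / (x2 - x1)"
      using chord[OF p(1) q(1)] False by metis
    have kL: "k \<in> L" unfolding k(3) by (intro subfieldD[OF L] p q)
    have lV: "l \<in> V" using no l(1,2) by (intro slope_bad[OF lL x]) simp
    have kV: "k \<in> V" using no k(1,2) by (intro slope_bad[OF kL x]) simp
    have "k * (x2 - x1) = y2 - y1" using k(3) False by simp
    then have "- (k * (x2 - x1)) = - (y2 - y1)" by (simp only:)
    then have ky: "y1 - y2 = k * (a * d)" unfolding d(1)[symmetric] by (simp add: algebra_simps)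
    have ly: "y1 + y2 + x2 = l * (a * d)" using l(4) unfolding d(1) by simp
    have x1e: "x1 = x2 + a * d" using d(1) by (simp add: algebra_simps)
    define Z where "Z = 3 * x2 ^ 2 + a * (3 * x2 * d + a * d ^ 2 + 36)"
    have y1e: "y1 = Z - a * (l * k * d)"
    proof -
      have "y1 = x1 ^ 2 + x1 * x2 + x2 ^ 2 + 36 * a - l * (y1 - y2)" using l(3) by simp
      also have "\<dots> = Z - a * (l * k * d)" unfolding ky x1e Z_def by (simp add: power2_eq_square algebra_simps)
      finally show ?thesis .
    qed
    \<comment> \<open>The right side is a multiple of \<open>a\<close> except for the term
      \<open>6 x2^2\<close> inside \<open>2 y1\<close>, which moves to the left and leaves the unit
      factor \<open>1 + 6 x2\<close>.\<close>
    have "x2 = (y1 + y2 + x2) + (y1 - y2) - 2 * y1" by simp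
    also have "\<dots> = l * (a * d) + k * (a * d) - 2 * (Z - a * (l * k * d))" unfolding ly ky y1e[symmetric] ..
    finally have "x2 * (1 + 6 * x2) = a * (l * d + k * d + 2 * (l * k * d) - 2 * (3 * x2 * d + a * d ^ 2 + 36))"
      unfolding Z_def by (simp add: power2_eq_square algebra_simps)
    moreover define w where "w = l * d + k * d + 2 * (l * k * d) - 2 * (3 * x2 * d + a * d ^ 2 + 36)"
    ultimately have xw: "x2 * (1 + 6 * x2) = a * w" by simp
    have aV: "a \<in> V" "x2 \<in> V" using am x m_V by auto
    have wV: "w \<in> V" unfolding w_def by (intro V_add V_diff V_mult V_power lV kV d aV V_numeral)
    have u: "1 + 6 * x2 \<notin> vmax V" by (intro unit_add m_mult2 x V_numeral V_sub V_1) simp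
    have uL: "1 + 6 * x2 \<in> L" by (intro subfieldD[OF L] q)
    define e where "e = w / (1 + 6 * x2)"
    have eV: "e \<in> V" unfolding e_def by (intro divide_unit wV uL u)
    have x2e: "x2 = a * e" using xw unit_nz[OF u] by (simp add: e_def eq_divide_eq)
    define f where "f = 3 * (e * x2) + (3 * x2 * d + a * d ^ 2 + 36) - l * k * d"
    have fV: "f \<in> V" unfolding f_def by (intro V_add V_diff V_mult V_power lV kV d eV aV V_numeral)
    have y1f: "y1 = a * f"
    proof -
      have "x2 ^ 2 = a * (e * x2)" by (subst (1) power2_eq_square, subst (1) x2e) simp
      then show ?thesis unfolding y1e Z_def f_def by (simp add: algebra_simps)
    qed
    define g where "g = e + d"
    have gV: "g \<in> V" unfolding g_def by (intro V_add eV d)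
    have x1g: "x1 = a * g" using x1e x2e by (simp add: g_def algebra_simps)
    have "a = y1 ^ 2 + x1 * y1 - x1 ^ 3 - 36 * a * x1" using p(1) unfolding C_iff by simp
    also have "\<dots> = a * (a * (f ^ 2 + g * f - a * g ^ 3 - 36 * g))"
      unfolding x1g y1f by (simp add: power2_eq_square power3_eq_cube algebra_simps)
    finally have "1 = a * (f ^ 2 + g * f - a * g ^ 3 - 36 * g)" using a_nonzero by simp
    also have "\<dots> \<in> vmax V" by (intro m_mult am V_add V_diff V_mult V_power fV gV aV V_numeral)
    finally show False by simp
  qed
qed

end

section \<open>Torsion points that are good everywhere\<close>

text \<open>Put M = 1 where X is integral and M = X elsewhere. Then M(X(i+1)) G(X(i)) is a unit times M(X(i))^4, and
  the product over a cycle expresses the product of the G(X(i)) as a unit times a cube of elements with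
  integral inverse.\<close>
lemma (in vr) doubling_cycle:
  fixes X :: "nat \<Rightarrow> 'a"
  assumes LU: "L = UNIV" and cyc: "X n = X 0"
    and step: "\<And>i. G (X i) \<noteq> 0 \<and> X (Suc i) = F (X i) / G (X i)"
    and int: "\<And>i. X i \<in> V \<Longrightarrow> F (X i) \<in> V \<and> G (X i) \<in> V \<and> \<not> (F (X i) \<in> vmax V \<and> G (X i) \<in> vmax V)"
    and nonint: "\<And>i. X i \<notin> V \<Longrightarrow> F (X i) / X i ^ 4 \<in> V - vmax V \<and> G (X i) / X i ^ 3 \<in> V"
  shows "inverse (\<Prod>i<n. G (X i)) \<in> V"
proof -
  define M where "M x = (if x \<in> V then 1 else x)" for x
  have Mnz: "M x \<noteq> 0" for x using V_0 by (auto simp: M_def)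
  have Minv: "inverse (M x) \<in> V" for x using not_V_inv[of x] m_V LU by (auto simp: M_def)
  have "\<exists>u. u \<in> V \<and> u \<notin> vmax V \<and> M (X (Suc i)) * G (X i) = u * M (X i) ^ 4" for i
  proof (cases "X i \<in> V")
    case True
    note I = int[OF True] and S = step[of i]
    show ?thesis
    proof (cases "X (Suc i) \<in> V")
      case in_V: True
      have "G (X i) \<notin> vmax V"
      proof
        assume g: "G (X i) \<in> vmax V"
        have "F (X i) = X (Suc i) * G (X i)" using S by simp
        then show False using m_mult2[OF in_V g] I g by simp
      qed
      then show ?thesis using I True in_V by (intro exI[of _ "G (X i)"]) (simp add: M_def)
    next
      case False
      have "F (X i) \<notin> vmax V"
      proof
        assume f: "F (X i) \<in> vmax V"
        then have "G (X i) \<notin> vmax V" using I by blast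
        then have "F (X i) / G (X i) \<in> V" using I LU by (intro divide_unit) auto
        then show False using False S by simp
      qed
      then show ?thesis using I S True False by (intro exI[of _ "F (X i)"]) (simp add: M_def)
    qed
  next
    case False
    note N = nonint[OF False] and S = step[of i]
    have x0: "X i \<noteq> 0" using False V_0 by metis
    define f where "f = F (X i) / X i ^ 4"
    define g where "g = G (X i) / X i ^ 3"
    have f: "f \<in> V" "f \<notin> vmax V" "g \<in> V" using N by (auto simp: f_def g_def)
    have f0: "f \<noteq> 0" using f by auto
    have g0: "g \<noteq> 0" using S x0 by (simp add: g_def)
    have eq: "X (Suc i) * g = X i * f"
      using S x0 by (simp add: f_def g_def field_simps power3_eq_cube power4_eq_xxxx)
    have "X (Suc i) \<notin> V"
    proof
      assume "X (Suc i) \<in> V"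
      then have "X (Suc i) * g / f \<in> V" using f LU by (intro divide_unit V_mult) auto
      then show False using False f0 by (simp add: eq)
    qed
    then show ?thesis using False f S x0 by (intro exI[of _ f]) (simp add: M_def f_def)
  qed
  then obtain u where u: "\<And>i. u i \<in> V" "\<And>i. u i \<notin> vmax V" "\<And>i. M (X (Suc i)) * G (X i) = u i * M (X i) ^ 4" by metis
  define PM where "PM = (\<Prod>i<n. M (X i))"
  have PM0: "PM \<noteq> 0" using Mnz by (simp add: PM_def)
  \<comment> \<open>Along a cycle a shift of the index permutes the factors, so one
    \<open>PM\<close> cancels against \<open>PM^4\<close> and a cube remains.\<close>
  have shift: "(\<Prod>i<n. M (X (Suc i))) = PM"
  proof (cases n)
    case (Suc m)
    have "(\<Prod>i<n. M (X (Suc i))) = (\<Prod>i<m. M (X (Suc i))) * M (X n)" by (simp add: Suc)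
    also have "\<dots> = M (X 0) * (\<Prod>i<m. M (X (Suc i)))" by (simp add: cyc mult.commute)
    also have "\<dots> = PM" unfolding PM_def Suc by (rule prod.lessThan_Suc_shift[symmetric])
    finally show ?thesis .
  qed (simp add: PM_def)
  have "PM * (\<Prod>i<n. G (X i)) = (\<Prod>i<n. M (X (Suc i)) * G (X i))" by (simp add: shift prod.distrib)
  also have "\<dots> = (\<Prod>i<n. u i) * PM ^ 4" by (simp add: u(3) prod.distrib PM_def prod_power_distrib)
  finally have "(\<Prod>i<n. G (X i)) = (\<Prod>i<n. u i) * PM ^ 3" using PM0 by (simp add: power4_eq_xxxx power3_eq_cube)
  then have "inverse (\<Prod>i<n. G (X i)) = inverse (\<Prod>i<n. u i) * inverse PM ^ 3" by (simp add: power_inverse)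
  also have "inverse (\<Prod>i<n. u i) \<in> V" using u LU by (intro unit_inv V_prod unit_prod) auto
  then have "inverse (\<Prod>i<n. u i) * inverse PM ^ 3 \<in> V"
    unfolding PM_def by (intro V_mult V_power) (simp_all add: prod_inversef[symmetric] V_prod Minv)
  finally show ?thesis .
qed

text \<open>The quotient of the torsion argument does not depend on the model: a change of
  coordinates multiplies the discriminant by \<open>k^2\<close> and each denominator of the
  duplication formula by \<open>k\<close>.\<close>

lemma scaled_quotient: "k \<noteq> 0 \<Longrightarrow> (k ^ 2 * w) ^ n / (k ^ n * t) ^ 2 = w ^ n * inverse t ^ 2" for k w t :: "'a::field"
proof -
  assume "k \<noteq> 0"
  moreover have "(k ^ 2 * w) ^ n = (k ^ n) ^ 2 * w ^ n" by (simp add: power_mult_distrib power_mult[symmetric] mult.commute)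
  moreover have "(k ^ n * t) ^ 2 = (k ^ n) ^ 2 * t ^ 2" by (rule power_mult_distrib)
  ultimately show ?thesis by (simp add: divide_inverse power_inverse)
qed

lemma numeral_Bit0_char2: "(2::'a::field) = 0 \<Longrightarrow> numeral (num.Bit0 n) = (0::'a)"
  using mult_2[of "numeral n :: 'a"] numeral_Bit0[of n, where 'a='a] by (metis mult_zero_left)

locale tff = tcurve a + ffield p a for a :: "'a::field" and p
begin

lemma vr_UNIV: "vring UNIV V \<Longrightarrow> vr UNIV V" by (simp add: vr_def subfield_UNIV)

lemma bad_place_exists: "\<exists>V. vring UNIV V \<and> a \<in> vmax V"
proof -
  have "\<not> algebraic_over prime_subfield (inverse a)"
  proof
    assume "algebraic_over prime_subfield (inverse a)"
    then have fd: "finite_dim_over k (gen_field k {inverse a})" by (intro finite_dim_gen_field ksf) auto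
    have "inverse (inverse a) \<in> gen_field k {inverse a}"
      by (rule subfieldD(6)[OF subfield_gen_field]) (use gen_field_incl(2)[of "{inverse a}" k] in simp)
    then show False using tr finite_dim_subfield_algebraic[OF ksf subfield_gen_field fd] by simp
  qed
  then show ?thesis using vring_avoiding[of "inverse a"] by simp
qed

text \<open>Plays the part of the product formula. By \<open>vring_avoiding\<close> the element is
  algebraic over the prime field; then its inverse is algebraic and hence integral too.\<close>

lemma everywhere_integral_unit:
  fixes z :: 'a
  assumes z: "\<And>V. vring UNIV V \<Longrightarrow> z \<in> V" and V: "vring UNIV V" and m: "z \<in> vmax V"
  shows "z = 0"
proof (rule ccontr)
  assume z0: "z \<noteq> 0"
  have alg: "algebraic_over k z"
  proof (rule ccontr)
    assume "\<not> algebraic_over k z"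
    then obtain V where "vring UNIV V" "inverse z \<in> vmax V" using vring_avoiding by blast
    then show False using z[of V] z0 by (auto simp: vmax_def)
  qed
  then have fd: "finite_dim_over k (gen_field k {z})" by (intro finite_dim_gen_field ksf) auto
  have "inverse z \<in> gen_field k {z}"
    by (rule subfieldD(6)[OF subfield_gen_field]) (use gen_field_incl(2)[of "{z}" k] in simp)
  then have "algebraic_over k (inverse z)" using finite_dim_subfield_algebraic[OF ksf subfield_gen_field fd] by blast
  then have "inverse z \<in> V" using algebraic_in_vring[OF V subfield_UNIV k_in_vring[OF V subfield_UNIV]] by simp
  then show False using m z0 by (simp add: vmax_def)
qed

text \<open>Ranges over valuation rings of the whole ambient field, because roots of auxiliary
  polynomials enter without a record of the finite extension that contains them.\<close>

definition allgood :: "('a \<times> 'a) option \<Rightarrow> bool" where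
  "allgood P \<longleftrightarrow> P \<in> E \<and> (\<forall>V. vring UNIV V \<longrightarrow> a \<in> vmax V \<longrightarrow> good V P)"

lemma pts_UNIV: "pts UNIV = E" by (auto simp: pts_def)

lemma tvr: "vring UNIV V \<Longrightarrow> a \<in> vmax V \<Longrightarrow> tcurve_vr a UNIV V"
  by (simp add: tcurve_vr_def tcurve_vr_axioms_def tcurve_axioms vr_UNIV)

lemma allgood_add: "allgood P \<Longrightarrow> allgood Q \<Longrightarrow> allgood (P \<oplus> Q)"
  unfolding allgood_def using tcurve_vr.good_add[OF tvr] by (simp add: pts_UNIV)

lemma allgood_ng: "allgood P \<Longrightarrow> allgood (ng P)"
  unfolding allgood_def by simp

lemma allgood_mul: "allgood P \<Longrightarrow> allgood (mul n P)"
  by (induction n) (auto simp: allgood_add, simp add: allgood_def)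

lemma disc_tate: "disc (wcrv (36 * a) a) = - a * (1 - 1728 * a) ^ 2"
  unfolding disc_W by (simp add: power2_eq_square power3_eq_cube algebra_simps)

lemma gg_tate: "gg x = 4 * x ^ 3 + x ^ 2 + 144 * a * x + 4 * a"
  unfolding gg_def by simp

lemma ff_tate: "ff x = x ^ 4 - 72 * a * x ^ 2 - 8 * a * x - a + 1296 * a ^ 2"
  unfolding ff_def by (simp add: power2_eq_square)

section \<open>Characteristic different from two\<close>

context
  assumes two: "(2::'a) \<noteq> 0"
begin

lemma four: "(4::'a) \<noteq> 0"
proof -
  have "(4::'a) = 2 * 2" by simp
  then show ?thesis using two by (metis mult_eq_0_iff)
qed

lemma two_unit: "vring UNIV V \<Longrightarrow> (2::'a) \<notin> vmax V"
proof
  assume V: "vring UNIV V" and m: "(2::'a) \<in> vmax V"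
  have "(2::'a) \<in> k" "inverse (2::'a) \<in> k" by (intro subfieldD[OF ksf])+
  then show False using k_in_vring[OF V subfield_UNIV] m two by (auto simp: vmax_def)
qed

lemma third_roots:
  assumes "gg e1 = 0"
  obtains e2 e3 where "\<And>x. gg x = 4 * (x - e1) * (x - e2) * (x - e3)" "36 * a = e1 * e2 + e1 * e3 + e2 * e3"
    "a = - (e1 * e2 * e3)" "1 = - 4 * (e1 + e2 + e3)"
proof -
  let ?q = "[:144 * a + e1 + 4 * e1 ^ 2, 1 + 4 * e1, 4:]"
  have "degree ?q \<ge> 1" using four by simp
  then obtain e2 where e2: "poly ?q e2 = 0" using ac by blast
  define e3 where "e3 = - (1 + 4 * e1 + 4 * e2) / 4"
  have e3: "4 * e3 = - (1 + 4 * e1 + 4 * e2)" using four by (simp add: e3_def)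
  have one: "1 = - 4 * (e1 + e2 + e3)" using e3 by (simp add: algebra_simps)
  have q: "144 * a + e1 + 4 * e1 ^ 2 + e2 * (1 + 4 * e1) + 4 * e2 ^ 2 = 0" using e2 by (simp add: power2_eq_square algebra_simps)
  have fac: "gg x = 4 * (x - e1) * (x - e2) * (x - e3)" for x
  proof -
    have "4 * (x - e1) * (x - e2) * (x - e3) = (x - e1) * (x - e2) * (4 * x - 4 * e3)" by (simp add: algebra_simps)
    also have "\<dots> = gg x - gg e1 - (x - e1) * (144 * a + e1 + 4 * e1 ^ 2 + e2 * (1 + 4 * e1) + 4 * e2 ^ 2)"
      unfolding e3 gg_tate by (simp add: power2_eq_square power3_eq_cube algebra_simps)
    finally show ?thesis using q assms by simp
  qed
  have "144 * a + (e1 + 4 * e1 ^ 2 + e2 * (1 + 4 * e1) + 4 * e2 ^ 2) = 0" using q by (simp only: add.assoc)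
  then have "144 * a = - (e1 + 4 * e1 ^ 2 + e2 * (1 + 4 * e1) + 4 * e2 ^ 2)" by (simp only: eq_neg_iff_add_eq_0)
  then have "4 * (36 * a) = - (e1 + 4 * e1 ^ 2 + e2 * (1 + 4 * e1) + 4 * e2 ^ 2)" by simp
  also have "\<dots> = e1 * (4 * e2) + e1 * (- (1 + 4 * e1 + 4 * e2)) + e2 * (- (1 + 4 * e1 + 4 * e2))"
    by (simp add: power2_eq_square algebra_simps)
  also have "\<dots> = 4 * (e1 * e2 + e1 * e3 + e2 * e3)" unfolding e3[symmetric] by (simp add: algebra_simps)
  finally have s2: "36 * a = e1 * e2 + e1 * e3 + e2 * e3" by (rule mult_left_cancel[THEN iffD1, OF four])
  have "4 * a = 4 * (- (e1 * e2 * e3))" using fac[of 0] unfolding gg_tate by simp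
  then have s3: "a = - (e1 * e2 * e3)" by (rule mult_left_cancel[THEN iffD1, OF four])
  show thesis by (rule that[OF fac s2 s3 one])
qed

text \<open>The first identity says that the first coordinate of a double, minus \<open>e1\<close>,
  is a square; the others express the discriminant and \<open>c4\<close> by the roots.\<close>

lemma roots_identities:
  assumes s2: "36 * a = e1 * e2 + e1 * e3 + e2 * e3" and s3: "a = - (e1 * e2 * e3)" and one: "1 = - 4 * (e1 + e2 + e3)"
  shows "ff x - e1 * gg x = ((x - e1) ^ 2 - (e1 - e2) * (e1 - e3)) ^ 2"
    and "disc (wcrv (36 * a) a) = 16 * ((e1 - e2) * (e1 - e3) * (e2 - e3)) ^ 2"
    and "1 - 1728 * a = 16 * ((e3 - e1) ^ 2 - (e2 - e1) * (e3 - e1) + (e2 - e1) ^ 2)"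
proof -
  \<comment> \<open>\<open>s\<close> equals 1. Inserting it makes the identities homogeneous in the
    roots, so that they hold as polynomial identities.\<close>
  define s where "s = - 4 * (e1 + e2 + e3)"
  have s1: "s = 1" using one by (simp add: s_def)
  define B where "B = 36 * a"
  define A where "A = a"
  have B: "B = e1 * e2 + e1 * e3 + e2 * e3" and A: "A = - (e1 * e2 * e3)" using s2 s3 by (simp_all add: A_def B_def)
  have "ff x - e1 * gg x = x ^ 4 - 2 * B * x ^ 2 - 8 * A * x - s * A + B ^ 2 - e1 * (4 * x ^ 3 + s * x ^ 2 + 4 * B * x + 4 * A)"
    unfolding ff_def gg_def s1 A_def B_def by simp
  also have "\<dots> = ((x - e1) ^ 2 - (e1 - e2) * (e1 - e3)) ^ 2"
    unfolding s_def A B by (simp add: power2_eq_square power3_eq_cube power4_eq_xxxx algebra_simps)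
  finally show "ff x - e1 * gg x = ((x - e1) ^ 2 - (e1 - e2) * (e1 - e3)) ^ 2" .
  have "disc (wcrv (36 * a) a) = - (s ^ 2 * (s * A - B ^ 2)) - 64 * B ^ 3 - 432 * A ^ 2 + 72 * s * B * A"
    unfolding disc_W s1 A_def B_def by simp
  also have "\<dots> = 16 * ((e1 - e2) * (e1 - e3) * (e2 - e3)) ^ 2"
    unfolding s_def A B by (simp add: power2_eq_square power3_eq_cube algebra_simps)
  finally show "disc (wcrv (36 * a) a) = 16 * ((e1 - e2) * (e1 - e3) * (e2 - e3)) ^ 2" .
  have "1 - 1728 * a = s ^ 2 - 48 * B" unfolding s1 B_def by simp
  also have "\<dots> = 16 * ((e3 - e1) ^ 2 - (e2 - e1) * (e3 - e1) + (e2 - e1) ^ 2)"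
    unfolding s_def B by (simp add: power2_eq_square algebra_simps)
  finally show "1 - 1728 * a = 16 * ((e3 - e1) ^ 2 - (e2 - e1) * (e3 - e1) + (e2 - e1) ^ 2)" .
qed

text \<open>The Legendre parameter l satisfies 256 (1 - l + l^2)^3 / (l (1 - l))^2 = j = 1728 - 1/a, so that l and 1 - l are
  units wherever a is not in the maximal ideal.\<close>
lemma legendre:
  assumes V: "vring UNIV V" and am: "a \<notin> vmax V"
    and s2: "36 * a = e1 * e2 + e1 * e3 + e2 * e3" and s3: "a = - (e1 * e2 * e3)" and one: "1 = - 4 * (e1 + e2 + e3)"
    and ne: "e3 \<noteq> e1" and lV: "(e2 - e1) / (e3 - e1) \<in> V"
  shows "(e2 - e1) / (e3 - e1) \<notin> vmax V" "1 - (e2 - e1) / (e3 - e1) \<notin> vmax V"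
proof -
  interpret vr UNIV V by (rule vr_UNIV[OF V])
  define v where "v = e3 - e1"
  define l where "l = (e2 - e1) / v"
  have v0: "v \<noteq> 0" using ne by (simp add: v_def)
  have lv: "e2 - e1 = l * v" using v0 by (simp add: l_def)
  have lV': "l \<in> V" using lV by (simp add: l_def v_def)
  have e23: "e2 - e3 = (l - 1) * v"
  proof -
    have "e2 - e3 = (e2 - e1) - v" by (simp add: v_def)
    then show ?thesis by (simp add: lv algebra_simps)
  qed
  define \<eta> where "\<eta> = 1 - l + l ^ 2"
  define \<epsilon> where "\<epsilon> = (l * (l - 1)) ^ 2"
  have c4: "1 - 1728 * a = 16 * v ^ 2 * \<eta>"
    unfolding roots_identities(3)[OF s2 s3 one] v_def[symmetric] lv \<eta>_def by (simp add: power2_eq_square algebra_simps)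
  have "16 * ((e1 - e2) * (e1 - e3) * (e2 - e3)) ^ 2 = 16 * ((e2 - e1) * v * (e2 - e3)) ^ 2"
    by (simp add: v_def power2_eq_square algebra_simps)
  also have "\<dots> = 16 * v ^ 6 * \<epsilon>" unfolding lv e23 \<epsilon>_def by (simp add: power2_eq_square power_numeral_reduce algebra_simps)
  finally have d: "16 * ((e1 - e2) * (e1 - e3) * (e2 - e3)) ^ 2 = 16 * v ^ 6 * \<epsilon>" .
  have "16 * v ^ 6 * \<epsilon> = disc (wcrv (36 * a) a)" unfolding roots_identities(2)[OF s2 s3 one] d ..
  also have "\<dots> = - a * (16 * v ^ 2 * \<eta>) ^ 2" unfolding disc_tate c4 ..
  finally have "16 * v ^ 6 * \<epsilon> = - a * (16 * v ^ 2 * \<eta>) ^ 2" .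
  then have eq16: "16 * v ^ 4 * (v ^ 2 * \<epsilon>) = 16 * v ^ 4 * (- 16 * a * \<eta> ^ 2)"
    by (simp add: power2_eq_square power_numeral_reduce algebra_simps)
  have "(16::'a) \<noteq> 0"
  proof -
    have "(16::'a) = 4 * 4" by simp
    then show ?thesis using four by (metis mult_eq_0_iff)
  qed
  then have "16 * v ^ 4 \<noteq> 0" using v0 by simp
  then have ve: "v ^ 2 * \<epsilon> = - 16 * a * \<eta> ^ 2" using eq16 by (rule mult_left_cancel[THEN iffD1])
  have "(1 - 1728 * a) * \<epsilon> = 16 * \<eta> * (v ^ 2 * \<epsilon>)" unfolding c4 by (simp add: mult_ac)
  also have "\<dots> = - (256 * a * \<eta> ^ 3)" unfolding ve by (simp add: power2_eq_square power3_eq_cube)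
  finally have "a * (1728 * \<epsilon> - 256 * \<eta> ^ 3) = \<epsilon>" by (simp add: algebra_simps)
  then have aeq: "a * (1728 * \<epsilon> + - (256 * \<eta> ^ 3)) = \<epsilon>" by simp
  have "l \<notin> vmax V \<and> 1 - l \<notin> vmax V"
  proof (rule ccontr)
    assume "\<not> ?thesis"
    then have "l * (l - 1) \<in> vmax V"
      using m_mult[of l "l - 1"] m_mult2[of l "l - 1"] m_minus[of "1 - l"] V_diff[OF lV' V_1] lV' by auto
    then have ll: "l * (l - 1) \<in> vmax V" .
    then have em: "\<epsilon> \<in> vmax V" unfolding \<epsilon>_def by (intro m_power) simp_all
    have "1 + l * (l - 1) \<notin> vmax V" by (rule unit_add[OF _ m_1 ll]) simp
    then have eta: "\<eta> \<notin> vmax V" by (simp add: \<eta>_def power2_eq_square algebra_simps)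
    have "(256::'a) = 2 ^ 8" by simp
    then have "(256::'a) \<notin> vmax V" using unit_power[OF _ two_unit[OF V], of 8] by simp
    then have "256 * \<eta> ^ 3 \<notin> vmax V" by (intro unit_mult unit_power eta) simp_all
    then have "- (256 * \<eta> ^ 3) \<notin> vmax V" by (rule unit_minus)
    then have u: "1728 * \<epsilon> + - (256 * \<eta> ^ 3) \<notin> vmax V" using m_mult2[OF V_numeral em] by (intro unit_add2) auto
    then have "a = \<epsilon> / (1728 * \<epsilon> + - (256 * \<eta> ^ 3))" using aeq unit_nz[OF u] by (simp only: eq_divide_eq) simp
    then have "a \<in> vmax V" using divide_unit_m[OF em _ u] by simp
    then show False using am by simp
  qed
  then show "(e2 - e1) / (e3 - e1) \<notin> vmax V" "1 - (e2 - e1) / (e3 - e1) \<notin> vmax V" by (simp_all add: l_def v_def)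
qed

text \<open>In the coordinate \<open>X\<close>, which moves the roots to 0, \<open>l\<close> and 1,
  doubling becomes \<open>(X^2 - l)^2 / (4 X (X - 1) (X - l))\<close>. Numerator and denominator
  have no common zero in the residue field because 2, \<open>l\<close> and \<open>1 - l\<close> are
  units.\<close>

lemma legendre_cycle:
  assumes V: "vring UNIV V" and am: "a \<notin> vmax V"
    and fac: "\<And>x. gg x = 4 * (x - e1) * (x - e2) * (x - e3)"
    and s2: "36 * a = e1 * e2 + e1 * e3 + e2 * e3" and s3: "a = - (e1 * e2 * e3)" and one: "1 = - 4 * (e1 + e2 + e3)"
    and ne: "e3 \<noteq> e1" and lV: "(e2 - e1) / (e3 - e1) \<in> V"
    and cyc: "x n = x 0" and step: "\<And>i. gg (x i) \<noteq> 0 \<and> x (Suc i) = ff (x i) / gg (x i)"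
  shows "disc (wcrv (36 * a) a) ^ n / (\<Prod>i<n. gg (x i)) ^ 2 \<in> V"
proof -
  interpret vr UNIV V by (rule vr_UNIV[OF V])
  define v where "v = e3 - e1"
  define l where "l = (e2 - e1) / v"
  have v0: "v \<noteq> 0" using ne by (simp add: v_def)
  have lv: "e2 - e1 = l * v" using v0 by (simp add: l_def)
  have lu: "l \<in> V" "l \<notin> vmax V" "1 - l \<notin> vmax V"
    using legendre[OF V am s2 s3 one ne lV] lV by (simp_all add: l_def v_def)
  define X where "X i = (x i - e1) / v" for i
  define F where "F t = (t ^ 2 - l) ^ 2" for t
  define G where "G t = 4 * t * (t - 1) * (t - l)" for t
  have xX: "x i - e1 = v * X i" for i using v0 by (simp add: X_def)
  have gG: "gg (x i) = v ^ 3 * G (X i)" for i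
  proof -
    have "x i - e2 = (x i - e1) - (e2 - e1)" "x i - e3 = (x i - e1) - v" by (simp_all add: v_def)
    then have "gg (x i) = 4 * (v * X i) * (v * X i - l * v) * (v * X i - v)" unfolding fac lv[symmetric] xX[symmetric] by simp
    then show ?thesis by (simp add: G_def power3_eq_cube algebra_simps)
  qed
  have G0: "G (X i) \<noteq> 0" for i using gG[of i] step[of i] by auto
  have XS: "X (Suc i) = F (X i) / G (X i)" for i
  proof -
    have e13: "(e1 - e2) * (e1 - e3) = l * v * v"
    proof -
      have "(e1 - e2) * (e1 - e3) = (e2 - e1) * v" by (simp add: v_def algebra_simps)
      then show ?thesis by (simp add: lv)
    qed
    have "ff (x i) - e1 * gg (x i) = ((v * X i) ^ 2 - l * v * v) ^ 2"
      unfolding roots_identities(1)[OF s2 s3 one] xX e13 ..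
    also have "\<dots> = v ^ 4 * F (X i)" by (simp add: F_def power2_eq_square power4_eq_xxxx algebra_simps)
    finally have f: "ff (x i) - e1 * gg (x i) = v ^ 4 * F (X i)" .
    have g0: "gg (x i) \<noteq> 0" using step by blast
    have "X (Suc i) = (ff (x i) / gg (x i) - e1) / v" unfolding X_def using step[of i] by simp
    also have "\<dots> = (ff (x i) - e1 * gg (x i)) / (v * gg (x i))" using g0 v0 by (simp add: field_simps)
    also have "v * gg (x i) = v ^ 4 * G (X i)" unfolding gG by (simp add: power4_eq_xxxx power3_eq_cube mult.assoc)
    also have "(ff (x i) - e1 * gg (x i)) / (v ^ 4 * G (X i)) = v ^ 4 * F (X i) / (v ^ 4 * G (X i))" unfolding f ..
    also have "\<dots> = F (X i) / G (X i)" using v0 by simp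
    finally show ?thesis .
  qed
  have inv: "inverse (\<Prod>i<n. G (X i)) \<in> V"
  proof (rule doubling_cycle[where F = F and G = G and X = X])
    show "X n = X 0" by (simp add: X_def cyc)
    show "G (X i) \<noteq> 0 \<and> X (Suc i) = F (X i) / G (X i)" for i using G0 XS by blast
    show "F (X i) \<in> V \<and> G (X i) \<in> V \<and> \<not> (F (X i) \<in> vmax V \<and> G (X i) \<in> vmax V)" if XV: "X i \<in> V" for i
    proof (intro conjI notI)
      show FV: "F (X i) \<in> V" unfolding F_def by (intro V_power V_diff XV lu)
      show "G (X i) \<in> V" unfolding G_def by (intro V_mult V_diff XV lu V_numeral V_1)
      assume *: "F (X i) \<in> vmax V \<and> G (X i) \<in> vmax V"
      have fm: "X i ^ 2 - l \<in> vmax V" using * unit_power[of "X i ^ 2 - l" 2] by (auto simp: F_def)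
      have "(4::'a) = 2 * 2" by simp
      then have "(4::'a) \<notin> vmax V" using unit_mult[OF _ _ two_unit[OF V] two_unit[OF V]] by simp
      then have "X i \<in> vmax V \<or> X i - 1 \<in> vmax V \<or> X i - l \<in> vmax V"
        using * unit_mult[of "4 * X i * (X i - 1)" "X i - l"] unit_mult[of "4 * X i" "X i - 1"] unit_mult[of 4 "X i"]
        unfolding G_def by blast
      then show False
      proof (elim disjE)
        assume "X i \<in> vmax V"
        then have "X i * X i - (X i ^ 2 - l) \<in> vmax V" by (intro m_diff m_mult fm XV)
        then show False using lu by (simp add: power2_eq_square)
      next
        assume m1: "X i - 1 \<in> vmax V"
        have "(X i ^ 2 - l) - (X i - 1) * (X i + 1) \<in> vmax V" by (rule m_diff[OF fm m_mult[OF m1]]) (intro XV V_add V_1)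
        then show False using lu by (simp add: power2_eq_square algebra_simps)
      next
        assume m1: "X i - l \<in> vmax V"
        have "(X i - l) * (X i + l) - (X i ^ 2 - l) \<in> vmax V" by (rule m_diff[OF m_mult[OF m1] fm]) (intro XV V_add lu)
        moreover have "(X i - l) * (X i + l) - (X i ^ 2 - l) = l * (1 - l)" by (simp add: power2_eq_square algebra_simps)
        ultimately show False using unit_mult[of l "1 - l"] lu by simp
      qed
    qed
    show "F (X i) / X i ^ 4 \<in> V - vmax V \<and> G (X i) / X i ^ 3 \<in> V" if XV: "X i \<notin> V" for i
    proof -
      define j where "j = inverse (X i)"
      have j: "j \<in> vmax V" unfolding j_def by (rule not_V_inv[OF _ XV]) simp
      have jV: "j \<in> V" using m_V[OF j] .
      have x0: "X i \<noteq> 0" using XV V_0 by metis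
      have Xj: "X i = inverse j" by (simp add: j_def)
      have j0: "j \<noteq> 0" using x0 by (simp add: j_def)
      have F: "F (X i) / X i ^ 4 = (1 - l * j ^ 2) ^ 2"
        unfolding F_def Xj using j0 by (simp add: field_simps power2_eq_square power4_eq_xxxx)
      have G: "G (X i) / X i ^ 3 = 4 * (1 - j) * (1 - l * j)"
        unfolding G_def Xj using j0 by (simp add: field_simps power3_eq_cube)
      have "1 + - (l * j ^ 2) \<notin> vmax V" by (intro unit_add m_minus m_mult2 m_power j lu) simp_all
      then have "(1 - l * j ^ 2) ^ 2 \<notin> vmax V" using unit_power[of "1 - l * j ^ 2" 2] by simp
      moreover have "(1 - l * j ^ 2) ^ 2 \<in> V" by (intro V_power V_diff V_mult jV lu V_1)
      moreover have "4 * (1 - j) * (1 - l * j) \<in> V" by (intro V_diff V_mult jV lu V_1 V_numeral)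
      ultimately show ?thesis unfolding F G by blast
    qed
  qed simp
  have "disc (wcrv (36 * a) a) = 16 * ((e2 - e1) * v * (e2 - e3)) ^ 2"
    unfolding roots_identities(2)[OF s2 s3 one] by (simp add: v_def power2_eq_square algebra_simps)
  also have "e2 - e3 = l * v - v" unfolding lv[symmetric] by (simp add: v_def)
  finally have d: "disc (wcrv (36 * a) a) = (v ^ 3) ^ 2 * (16 * (l * (l - 1)) ^ 2)"
    unfolding lv by (simp add: power2_eq_square power3_eq_cube algebra_simps)
  have "(\<Prod>i<n. gg (x i)) = (v ^ 3) ^ n * (\<Prod>i<n. G (X i))" by (simp add: gG prod.distrib)
  then have "disc (wcrv (36 * a) a) ^ n / (\<Prod>i<n. gg (x i)) ^ 2 = (16 * (l * (l - 1)) ^ 2) ^ n * inverse (\<Prod>i<n. G (X i)) ^ 2"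
    unfolding d using v0 by (simp only: scaled_quotient power_not_zero not_False_eq_True)
  also have "\<dots> \<in> V" by (intro V_mult V_power V_diff lu inv V_1 V_numeral)
  finally show ?thesis .
qed

text \<open>If \<open>e1\<close> were a double root, \<open>ff\<close> would vanish there together
  with \<open>gg\<close>.\<close>

lemma roots_distinct:
  assumes fac: "\<And>x. gg x = 4 * (x - e1) * (x - e2) * (x - e3)"
    and s2: "36 * a = e1 * e2 + e1 * e3 + e2 * e3" and s3: "a = - (e1 * e2 * e3)" and one: "1 = - 4 * (e1 + e2 + e3)"
  shows "e2 \<noteq> e1" "e3 \<noteq> e1"
proof -
  have g: "gg e1 = 0" by (simp add: fac)
  obtain y where "(e1, y) \<in> C" using C_point by blast
  then have "ff e1 \<noteq> 0" using no_common g by blast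
  then have "((e1 - e2) * (e1 - e3)) ^ 2 \<noteq> 0" using roots_identities(1)[OF s2 s3 one, of e1] g by simp
  then show "e2 \<noteq> e1" "e3 \<noteq> e1" by auto
qed

text \<open>The Legendre parameter or its inverse is integral, and exchanging \<open>e2\<close> and
  \<open>e3\<close> inverts it.\<close>

lemma cycle_integral_odd:
  assumes V: "vring UNIV V" and am: "a \<notin> vmax V"
    and cyc: "x n = x 0" and step: "\<And>i. gg (x i) \<noteq> 0 \<and> x (Suc i) = ff (x i) / gg (x i)"
  shows "disc (wcrv (36 * a) a) ^ n / (\<Prod>i<n. gg (x i)) ^ 2 \<in> V"
proof -
  interpret vr UNIV V by (rule vr_UNIV[OF V])
  have "degree [:4 * a, 144 * a, 1, 4:] \<ge> 1" using four by simp
  then obtain e1 where "poly [:4 * a, 144 * a, 1, 4:] e1 = 0" using ac by blast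
  then have "gg e1 = 0" unfolding gg_tate by (simp add: power2_eq_square power3_eq_cube algebra_simps)
  then obtain e2 e3 where e: "\<And>x. gg x = 4 * (x - e1) * (x - e2) * (x - e3)" "36 * a = e1 * e2 + e1 * e3 + e2 * e3"
    "a = - (e1 * e2 * e3)" "1 = - 4 * (e1 + e2 + e3)" using third_roots by blast
  note ne = roots_distinct[OF e]
  show ?thesis
  proof (cases "(e2 - e1) / (e3 - e1) \<in> V")
    case True
    then show ?thesis by (rule legendre_cycle[OF V am e ne(2) _ cyc step])
  next
    case False
    then have "inverse ((e2 - e1) / (e3 - e1)) \<in> V" using V_total by blast
    then have l: "(e3 - e1) / (e2 - e1) \<in> V" by simp
    have e1': "\<And>x. gg x = 4 * (x - e1) * (x - e3) * (x - e2)" unfolding e(1) by (simp only: mult_ac)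
    have e': "36 * a = e1 * e3 + e1 * e2 + e3 * e2" "a = - (e1 * e3 * e2)" "1 = - 4 * (e1 + e3 + e2)"
      using e(2-4) by (simp_all add: mult_ac add_ac)
    show ?thesis by (rule legendre_cycle[OF V am e1' e' ne(1) l cyc step])
  qed
qed

text \<open>In terms of the Legendre parameter \<open>z = (l - 1)^2 / l\<close>, which is integral
  at the rings that do not contain \<open>a\<close> in their maximal ideal. At a bad ring
  \<open>x\<close> is not small while \<open>e2 + e3\<close> and \<open>e2 e3\<close> are, so the
  other two roots go to the node and \<open>z\<close> is small; but \<open>z\<close> is
  nonzero.\<close>

lemma no_two_torsion_odd:
  assumes Q: "allgood (Some (x, y))" and g: "gg x = 0"
  shows False
proof -
  obtain e2 e3 where e: "\<And>t. gg t = 4 * (t - x) * (t - e2) * (t - e3)" "36 * a = x * e2 + x * e3 + e2 * e3"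
    "a = - (x * e2 * e3)" "1 = - 4 * (x + e2 + e3)" using third_roots[OF g] by blast
  note ne = roots_distinct[OF e]
  define z where "z = (e2 - e3) ^ 2 / ((x - e2) * (x - e3))"
  have e23: "e2 \<noteq> e3"
  proof
    assume "e2 = e3"
    then have "disc (wcrv (36 * a) a) = 0" using roots_identities(2)[OF e(2,3,4)] by simp
    then show False using nonsing by simp
  qed
  have z0: "z \<noteq> 0" using e23 ne by (auto simp: z_def)
  have bad: "z \<in> vmax V" if V: "vring UNIV V" and am: "a \<in> vmax V" for V
  proof -
    interpret vr UNIV V by (rule vr_UNIV[OF V])
    have xm: "x \<notin> vmax V" using Q V am by (simp add: allgood_def)
    have x0: "x \<noteq> 0" using xm by auto
    have "e2 * e3 = - a / x" using e(3) x0 by (simp add: field_simps)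
    then have p: "e2 * e3 \<in> vmax V" using divide_unit_m[OF m_minus[OF am] _ xm] by simp
    have "x * (e2 + e3) = 36 * a - e2 * e3" unfolding e(2) by (simp add: algebra_simps)
    moreover have "36 * a - e2 * e3 \<in> vmax V" by (intro m_diff m_mult2 am p V_numeral)
    ultimately have xs: "x * (e2 + e3) \<in> vmax V" by simp
    have "x * (e2 + e3) / x \<in> vmax V" by (rule divide_unit_m[OF xs UNIV_I xm])
    then have s: "e2 + e3 \<in> vmax V" using x0 by simp
    have "(e2 + e3) ^ 2 - 4 * (e2 * e3) \<in> vmax V" by (intro m_diff m_power m_mult2 s p V_numeral) simp
    then have num: "(e2 - e3) ^ 2 \<in> vmax V" by (simp add: power2_eq_square algebra_simps)
    have "x ^ 2 + (e2 * e3 - x * (e2 + e3)) \<notin> vmax V" by (intro unit_add unit_power xm m_diff p xs) simp_all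
    then have "(x - e2) * (x - e3) \<notin> vmax V" by (simp add: power2_eq_square algebra_simps)
    then show ?thesis unfolding z_def by (intro divide_unit_m num) simp_all
  qed
  have "z \<in> V" if V: "vring UNIV V" for V
  proof (cases "a \<in> vmax V")
    case True
    then show ?thesis using bad[OF V] vr.m_V[OF vr_UNIV[OF V]] by blast
  next
    case am: False
    interpret vr UNIV V by (rule vr_UNIV[OF V])
    have leg: "(c - d) ^ 2 / ((x - c) * (x - d)) \<in> V"
      if e': "36 * a = x * c + x * d + c * d" "a = - (x * c * d)" "1 = - 4 * (x + c + d)" "d \<noteq> x" "c \<noteq> x" "(c - x) / (d - x) \<in> V" for c d
    proof -
      define v where "v = d - x"
      define l where "l = (c - x) / v"
      have v0: "v \<noteq> 0" using e' by (simp add: v_def)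
      have lv: "c - x = l * v" using v0 by (simp add: l_def)
      have l: "l \<in> V" "l \<notin> vmax V" using e'(6) legendre(1)[OF V am e'(1-4,6)] by (simp_all add: l_def v_def)
      have l0: "l \<noteq> 0" using l by auto
      have "c - d = l * v - v" unfolding lv[symmetric] by (simp add: v_def)
      moreover have "(x - c) * (x - d) = (c - x) * v" by (simp add: v_def algebra_simps)
      ultimately have "(c - d) ^ 2 / ((x - c) * (x - d)) = (l * v - v) ^ 2 / (l * v * v)" by (simp add: lv)
      also have "\<dots> = (l - 1) ^ 2 / l" using v0 l0 by (simp add: field_simps power2_eq_square)
      also have "\<dots> \<in> V" by (intro divide_unit V_power V_diff l V_1) simp
      finally show ?thesis .
    qed
    show ?thesis
    proof (cases "(e2 - x) / (e3 - x) \<in> V")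
      case True
      show ?thesis unfolding z_def by (rule leg[OF e(2,3,4) ne(2,1) True])
    next
      case False
      then have "inverse ((e2 - x) / (e3 - x)) \<in> V" using V_total by blast
      then have l: "(e3 - x) / (e2 - x) \<in> V" by simp
      have e': "36 * a = x * e3 + x * e2 + e3 * e2" "a = - (x * e3 * e2)" "1 = - 4 * (x + e3 + e2)"
        using e(2-4) by (simp_all add: mult_ac add_ac)
      have "z = (e3 - e2) ^ 2 / ((x - e3) * (x - e2))" by (simp add: z_def power2_commute mult.commute)
      then show ?thesis using leg[OF e' ne l] by simp
    qed
  qed
  then have "z = 0" using bad_place_exists bad everywhere_integral_unit[of z] by blast
  then show False using z0 by simp
qed

end

section \<open>Characteristic two\<close>

context
  assumes two0: "(2::'a) = 0"
begin

lemmas even0 = numeral_Bit0_char2[OF two0]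

lemma gg_char2: "gg x = x ^ 2"
  unfolding gg_tate by (simp add: even0)

lemma ff_char2: "ff x = x ^ 4 - a"
  unfolding ff_tate by (simp add: even0)

lemma disc_char2: "disc (wcrv (36 * a) a) = - a"
  unfolding disc_tate by (simp add: even0)

lemma sq_add_char2: "(u + v) ^ 2 = u ^ 2 + v ^ (2::nat)" for u v :: 'a
  by (simp add: power2_sum two0)

text \<open>For a root \<open>\<alpha>\<close> of \<open>a \<alpha>^12 = \<alpha>^3 + 1\<close> the substitution \<open>x = X / \<alpha>^2 + 1 / \<alpha>^3\<close> turns the doubling map into
  \<open>(X^4 - \<alpha> X^2) / (\<alpha>^2 X^2 + 1)\<close>, whose numerator and denominator have no common zero modulo the maximal ideal.\<close>
lemma cycle_integral_char2:
  assumes V: "vring UNIV V" and am: "a \<notin> vmax V"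
    and cyc: "x n = x 0" and step: "\<And>i. gg (x i) \<noteq> 0 \<and> x (Suc i) = ff (x i) / gg (x i)"
  shows "disc (wcrv (36 * a) a) ^ n / (\<Prod>i<n. gg (x i)) ^ 2 \<in> V"
proof -
  interpret vr UNIV V by (rule vr_UNIV[OF V])
  \<comment> \<open>\<open>\<alpha>\<close> is the parameter of the Deuring form
    \<open>Y^2 + \<alpha> X Y + Y = X^3\<close>, whose invariant in characteristic two is
    \<open>\<alpha>^12 / (\<alpha>^3 + 1)\<close>; the equation says that this equals
    \<open>1/a\<close>.\<close>
  let ?q = "monom a 12 - monom 1 3 - 1 :: 'a poly"
  have "coeff ?q 12 \<noteq> 0" using a_nonzero by simp
  then have "degree ?q \<ge> 12" by (rule le_degree)
  then obtain \<alpha> where "poly ?q \<alpha> = 0" using ac[of ?q] by (meson le_trans one_le_numeral)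
  then have al: "a * \<alpha> ^ 12 = \<alpha> ^ 3 + 1" by (simp add: poly_monom algebra_simps)
  have a0: "\<alpha> \<noteq> 0" using al by (metis add.left_neutral mult_zero_right power_zero_numeral zero_neq_one)
  define \<beta> where "\<beta> = inverse \<alpha>"
  have ab: "\<alpha> * \<beta> = 1" using a0 by (simp add: \<beta>_def)
  have b0: "\<beta> \<noteq> 0" using a0 by (simp add: \<beta>_def)
  have abk: "\<beta> ^ (k + m) * \<alpha> ^ k = \<beta> ^ m" for k m
  proof -
    have "\<beta> ^ (k + m) * \<alpha> ^ k = (\<alpha> * \<beta>) ^ k * \<beta> ^ m" by (simp add: power_add power_mult_distrib)
    then show ?thesis by (simp add: ab)
  qed
  have "a = (a * \<alpha> ^ 12) * \<beta> ^ 12" using abk[of 12 0] by (simp add: mult.assoc mult.commute)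
  also have "\<dots> = \<beta> ^ 12 * \<alpha> ^ 3 + \<beta> ^ 12" unfolding al by (simp add: algebra_simps)
  also have "\<beta> ^ 12 * \<alpha> ^ 3 = \<beta> ^ 9" using abk[of 3 9] by simp
  finally have ab9: "a = \<beta> ^ 9 + \<beta> ^ 12" .
  have aV: "\<alpha> \<in> V"
  proof (rule ccontr)
    assume "\<alpha> \<notin> V"
    then have "\<beta> \<in> vmax V" unfolding \<beta>_def by (intro not_V_inv) auto
    then have "\<beta> ^ 9 + \<beta> ^ 12 \<in> vmax V" by (intro m_add m_power) simp_all
    then show False using am unfolding ab9[symmetric] by blast
  qed
  define X where "X i = (x i - \<beta> ^ 3) * \<alpha> ^ 2" for i
  define F where "F t = t ^ 4 - \<alpha> * t ^ 2" for t
  define G where "G t = \<alpha> ^ 2 * t ^ 2 + 1" for t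
  have xX: "x i = \<beta> ^ 2 * X i + \<beta> ^ 3" for i
  proof -
    have "\<beta> ^ 2 * X i = (\<beta> ^ 2 * \<alpha> ^ 2) * (x i - \<beta> ^ 3)" by (simp add: X_def)
    also have "\<beta> ^ 2 * \<alpha> ^ 2 = 1" using abk[of 2 0] by simp
    finally show ?thesis by simp
  qed
  have x2: "x i ^ 2 = \<beta> ^ 4 * X i ^ 2 + \<beta> ^ 6" for i
    unfolding xX[of i] sq_add_char2 by (simp add: power_mult_distrib flip: power_mult)
  have gG: "gg (x i) = \<beta> ^ 6 * G (X i)" for i
  proof -
    have "\<beta> ^ 6 * G (X i) = (\<beta> ^ 6 * \<alpha> ^ 2) * X i ^ 2 + \<beta> ^ 6" unfolding G_def by (simp add: algebra_simps)
    then show ?thesis using abk[of 2 4] by (simp add: gg_char2 x2)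
  qed
  have fF: "ff (x i) - \<beta> ^ 3 * gg (x i) = \<beta> ^ 8 * F (X i)" for i
  proof -
    have "x i ^ 4 = (x i ^ 2) ^ 2" by (simp flip: power_mult)
    also have "\<dots> = \<beta> ^ 8 * X i ^ 4 + \<beta> ^ 12" unfolding x2 sq_add_char2 by (simp add: power_mult_distrib flip: power_mult)
    finally have "ff (x i) = \<beta> ^ 8 * X i ^ 4 - \<beta> ^ 9" unfolding ff_char2 using ab9 by (simp add: diff_eq_eq)
    moreover have "\<beta> ^ 3 * gg (x i) = \<beta> ^ 7 * X i ^ 2 + \<beta> ^ 9"
      unfolding gg_char2 x2 by (simp add: distrib_left mult.assoc[symmetric] flip: power_add)
    ultimately have "ff (x i) - \<beta> ^ 3 * gg (x i) = \<beta> ^ 8 * X i ^ 4 - \<beta> ^ 7 * X i ^ 2 - 2 * \<beta> ^ 9" by (simp add: algebra_simps)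
    also have "\<dots> = \<beta> ^ 8 * X i ^ 4 - (\<beta> ^ 8 * \<alpha>) * X i ^ 2" using abk[of 1 7] by (simp add: two0)
    also have "\<dots> = \<beta> ^ 8 * F (X i)" unfolding F_def by (simp add: algebra_simps)
    finally show ?thesis .
  qed
  have G0: "G (X i) \<noteq> 0" for i using gG[of i] step[of i] by auto
  have XS: "X (Suc i) = F (X i) / G (X i)" for i
  proof -
    have g0: "gg (x i) \<noteq> 0" using step by blast
    have "X (Suc i) = (ff (x i) / gg (x i) - \<beta> ^ 3) * \<alpha> ^ 2" unfolding X_def using step[of i] by simp
    also have "\<dots> = (ff (x i) - \<beta> ^ 3 * gg (x i)) * \<alpha> ^ 2 / gg (x i)" using g0 by (simp add: field_simps)
    also have "(ff (x i) - \<beta> ^ 3 * gg (x i)) * \<alpha> ^ 2 = (\<beta> ^ 8 * \<alpha> ^ 2) * F (X i)" unfolding fF by simp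
    also have "\<beta> ^ 8 * \<alpha> ^ 2 = \<beta> ^ 6" using abk[of 2 6] by simp
    finally show ?thesis unfolding gG using b0 by simp
  qed
  have inv: "inverse (\<Prod>i<n. G (X i)) \<in> V"
  proof (rule doubling_cycle[where F = F and G = G and X = X])
    show "X n = X 0" by (simp add: X_def cyc)
    show "G (X i) \<noteq> 0 \<and> X (Suc i) = F (X i) / G (X i)" for i using G0 XS by blast
    show "F (X i) \<in> V \<and> G (X i) \<in> V \<and> \<not> (F (X i) \<in> vmax V \<and> G (X i) \<in> vmax V)" if XV: "X i \<in> V" for i
    proof (intro conjI notI)
      show "F (X i) \<in> V" unfolding F_def by (intro V_power V_mult V_diff XV aV)
      show "G (X i) \<in> V" unfolding G_def by (intro V_mult V_add V_power XV aV V_1)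
      assume *: "F (X i) \<in> vmax V \<and> G (X i) \<in> vmax V"
      have Xu: "X i \<notin> vmax V"
      proof
        assume "X i \<in> vmax V"
        then have "G (X i) - \<alpha> ^ 2 * X i ^ 2 \<in> vmax V" using * by (intro m_diff m_mult2 m_power V_power aV) auto
        then show False by (simp add: G_def)
      qed
      have "F (X i) = X i ^ 2 * (X i ^ 2 - \<alpha>)" by (simp add: F_def power2_eq_square power4_eq_xxxx algebra_simps)
      then have fm: "X i ^ 2 - \<alpha> \<in> vmax V" using * unit_mult[OF _ _ unit_power[OF _ Xu, of 2]] by auto
      \<comment> \<open>Eliminating \<open>X i\<close> from numerator and denominator leaves the
        discriminant \<open>\<alpha>^3 + 1\<close> of the Deuring form, which is
        \<open>a \<alpha>^12\<close>.\<close>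
      have "G (X i) - \<alpha> ^ 2 * (X i ^ 2 - \<alpha>) \<in> vmax V" using * by (intro m_diff m_mult2 fm V_power aV) auto
      then have m1: "\<alpha> ^ 3 + 1 \<in> vmax V" by (simp add: G_def power2_eq_square power3_eq_cube algebra_simps)
      have au: "\<alpha> \<notin> vmax V"
      proof
        assume "\<alpha> \<in> vmax V"
        then have "(\<alpha> ^ 3 + 1) - \<alpha> ^ 3 \<in> vmax V" by (intro m_diff m1 m_power) simp_all
        then show False by simp
      qed
      have "a = (\<alpha> ^ 3 + 1) / \<alpha> ^ 12" unfolding al[symmetric] using a0 by simp
      then have "a \<in> vmax V" using divide_unit_m[OF m1 UNIV_I unit_power[OF UNIV_I au]] by simp
      then show False using am by simp
    qed
    show "F (X i) / X i ^ 4 \<in> V - vmax V \<and> G (X i) / X i ^ 3 \<in> V" if XV: "X i \<notin> V" for i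
    proof -
      define j where "j = inverse (X i)"
      have j: "j \<in> vmax V" unfolding j_def by (rule not_V_inv[OF _ XV]) simp
      have jV: "j \<in> V" using m_V[OF j] .
      have x0: "X i \<noteq> 0" using XV V_0 by metis
      have Xj: "X i = inverse j" by (simp add: j_def)
      have j0: "j \<noteq> 0" using x0 by (simp add: j_def)
      have F: "F (X i) / X i ^ 4 = 1 + - (\<alpha> * j ^ 2)"
        unfolding F_def Xj using j0 by (simp add: field_simps power2_eq_square power4_eq_xxxx)
      have G: "G (X i) / X i ^ 3 = \<alpha> ^ 2 * j + j ^ 3"
        unfolding G_def Xj using j0 by (simp add: field_simps power2_eq_square power3_eq_cube)
      have "1 + - (\<alpha> * j ^ 2) \<notin> vmax V" by (intro unit_add m_minus m_mult2 m_power j aV) simp_all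
      moreover have "1 + - (\<alpha> * j ^ 2) \<in> V" by (intro V_add V_minus V_power V_mult jV aV V_1)
      moreover have "\<alpha> ^ 2 * j + j ^ 3 \<in> V" by (intro V_add V_power V_mult jV aV)
      ultimately show ?thesis unfolding F G by blast
    qed
  qed simp
  have d: "disc (wcrv (36 * a) a) = (\<beta> ^ 6) ^ 2 * - (\<alpha> ^ 3 + 1)"
  proof -
    have "(\<beta> ^ 6) ^ 2 * - (\<alpha> ^ 3 + 1) = - (\<beta> ^ 12 * \<alpha> ^ 3 + \<beta> ^ 12)" by (simp add: algebra_simps flip: power_mult)
    also have "\<beta> ^ 12 * \<alpha> ^ 3 = \<beta> ^ 9" using abk[of 3 9] by simp
    finally show ?thesis unfolding disc_char2 ab9[symmetric] ..
  qed
  have "(\<Prod>i<n. gg (x i)) = (\<beta> ^ 6) ^ n * (\<Prod>i<n. G (X i))" by (simp add: gG prod.distrib)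
  then have "disc (wcrv (36 * a) a) ^ n / (\<Prod>i<n. gg (x i)) ^ 2 = (- (\<alpha> ^ 3 + 1)) ^ n * inverse (\<Prod>i<n. G (X i)) ^ 2"
    unfolding d using b0 by (simp only: scaled_quotient power_not_zero not_False_eq_True)
  also have "\<dots> \<in> V" by (intro V_mult V_power V_minus V_add aV inv V_1)
  finally show ?thesis .
qed

text \<open>A point of order two has \<open>x = 0\<close> here and reduces to the node at every bad
  ring.\<close>

lemma no_two_torsion_char2: "allgood (Some (x, y)) \<Longrightarrow> gg x \<noteq> 0"
proof
  assume Q: "allgood (Some (x, y))" and "gg x = 0"
  then have "x = 0" by (simp add: gg_char2)
  moreover obtain V where V: "vring UNIV V" "a \<in> vmax V" using bad_place_exists by blast
  ultimately have "x \<in> vmax V" using vr.m_0[OF vr_UNIV[OF V(1)]] by simp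
  then show False using Q V by (simp add: allgood_def)
qed

end

lemma cycle_integral_good:
  assumes "vring UNIV V" "a \<notin> vmax V" "x n = x 0" "\<And>i. gg (x i) \<noteq> 0 \<and> x (Suc i) = ff (x i) / gg (x i)"
  shows "disc (wcrv (36 * a) a) ^ n / (\<Prod>i<n. gg (x i)) ^ 2 \<in> V"
proof (cases "(2::'a) = 0")
  case True
  then show ?thesis using assms by (rule cycle_integral_char2)
next
  case False
  then show ?thesis using assms by (rule cycle_integral_odd)
qed

text \<open>For integral \<open>x\<close>, \<open>ff\<close> is \<open>x^4\<close> plus a multiple
  of \<open>a\<close>, hence not small, so numerator and denominator of the duplication formula are
  never both small. The factor \<open>a\<close> of the discriminant then makes the quotient
  small.\<close>

lemma cycle_integral_bad:
  assumes V: "vring UNIV V" "a \<in> vmax V" and n: "n > 0"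
    and cyc: "x n = x 0" and step: "\<And>i. gg (x i) \<noteq> 0 \<and> x (Suc i) = ff (x i) / gg (x i)"
    and u: "\<And>i. x i \<notin> vmax V"
  shows "disc (wcrv (36 * a) a) ^ n / (\<Prod>i<n. gg (x i)) ^ 2 \<in> vmax V"
proof -
  interpret vr UNIV V by (rule vr_UNIV[OF assms(1)])
  note am = assms(2)
  have aV: "a \<in> V" using m_V[OF am] .
  have "inverse (\<Prod>i<n. gg (x i)) \<in> V"
  proof (rule doubling_cycle[where F = ff and G = gg and X = x, OF _ cyc step])
    show "ff (x i) \<in> V \<and> gg (x i) \<in> V \<and> \<not> (ff (x i) \<in> vmax V \<and> gg (x i) \<in> vmax V)" if XV: "x i \<in> V" for i
    proof (intro conjI notI)
      show "ff (x i) \<in> V" unfolding ff_tate by (intro V_power V_mult V_diff V_add XV aV V_numeral)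
      show "gg (x i) \<in> V" unfolding gg_tate by (intro V_power V_mult V_diff V_add XV aV V_numeral)
      assume *: "ff (x i) \<in> vmax V \<and> gg (x i) \<in> vmax V"
      have "x i ^ 4 + a * (- 72 * x i ^ 2 - 8 * x i - 1 + 1296 * a) \<notin> vmax V"
        by (intro unit_add unit_power u m_mult am V_power V_mult V_diff V_add V_minus XV aV V_numeral V_1) simp_all
      moreover have "x i ^ 4 + a * (- 72 * x i ^ 2 - 8 * x i - 1 + 1296 * a) = ff (x i)"
        unfolding ff_tate by (simp add: power2_eq_square algebra_simps)
      ultimately show False using * by simp
    qed
    show "ff (x i) / x i ^ 4 \<in> V - vmax V \<and> gg (x i) / x i ^ 3 \<in> V" if XV: "x i \<notin> V" for i
    proof -
      define j where "j = inverse (x i)"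
      have j: "j \<in> vmax V" unfolding j_def by (rule not_V_inv[OF _ XV]) simp
      have jV: "j \<in> V" using m_V[OF j] .
      have x0: "x i \<noteq> 0" using XV V_0 by metis
      have xj: "x i = inverse j" by (simp add: j_def)
      have j0: "j \<noteq> 0" using x0 by (simp add: j_def)
      have F: "ff (x i) / x i ^ 4 = 1 + j * (- 72 * a * j - 8 * a * j ^ 2 - a * j ^ 3 + 1296 * a ^ 2 * j ^ 3)"
        unfolding ff_tate xj using j0 by (simp add: field_simps power2_eq_square power3_eq_cube power4_eq_xxxx)
      have G: "gg (x i) / x i ^ 3 = 4 + j + 144 * a * j ^ 2 + 4 * a * j ^ 3"
        unfolding gg_tate xj using j0 by (simp add: field_simps power2_eq_square power3_eq_cube)
      have w: "- 72 * a * j - 8 * a * j ^ 2 - a * j ^ 3 + 1296 * a ^ 2 * j ^ 3 \<in> V"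
        by (intro V_power V_mult V_diff V_add V_minus jV aV V_numeral V_1)
      have "ff (x i) / x i ^ 4 \<notin> vmax V" unfolding F by (intro unit_add m_mult j w) simp_all
      moreover have "ff (x i) / x i ^ 4 \<in> V" unfolding F by (intro V_add V_mult w jV V_1)
      moreover have "gg (x i) / x i ^ 3 \<in> V" unfolding G by (intro V_power V_mult V_add jV aV V_numeral)
      ultimately show ?thesis by blast
    qed
  qed simp
  then have "inverse (\<Prod>i<n. gg (x i)) ^ 2 \<in> V" by (rule V_power)
  moreover have "disc (wcrv (36 * a) a) ^ n \<in> vmax V"
    unfolding disc_tate by (intro m_power m_mult m_minus am V_power V_diff V_mult aV V_1 V_numeral n)
  ultimately show ?thesis using m_mult by (simp add: divide_inverse power_inverse)
qed

lemma allgood_two_torsion: "allgood Q \<Longrightarrow> mul 2 Q = None \<Longrightarrow> Q = None"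
proof (rule ccontr)
  assume Q: "allgood Q" "mul 2 Q = None" "Q \<noteq> None"
  then obtain x y where q: "Q = Some (x, y)" by auto
  have c: "(x, y) \<in> C" using Q(1) by (simp add: allgood_def q)
  have "gg x = 0" using double_Some[OF c] Q(2) by (auto simp: mul_2 q)
  then show False using Q(1) no_two_torsion_odd no_two_torsion_char2 unfolding q by blast
qed

lemma allgood_two_power_torsion: "allgood Q \<Longrightarrow> mul (2 ^ i) Q = None \<Longrightarrow> Q = None"
proof (induction i)
  case (Suc i)
  have E: "Q \<in> E" using Suc by (simp add: allgood_def)
  have "mul 2 (mul (2 ^ i) Q) = None" using Suc(3) mul_mul[OF E, of 2 "2 ^ i"] by simp
  then show ?case by (rule Suc.IH[OF Suc.prems(1) allgood_two_torsion[OF allgood_mul[OF Suc.prems(1)]]])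
qed (simp add: allgood_def)

text \<open>Powers of two repeat modulo \<open>n\<close>. The difference \<open>2^l P - P\<close> is
  killed by a power of two, hence vanishes, and the successive doubles of \<open>P\<close> form a
  cycle.\<close>

lemma allgood_torsion:
  assumes P: "allgood P" and n: "n > 0" "mul n P = None"
  shows "P = None"
proof (rule ccontr)
  assume P0: "P \<noteq> None"
  have E: "P \<in> E" using P by (simp add: allgood_def)
  have per: "mul (m mod n) P = mul m P" for m
  proof -
    have "mul m P = mul (m mod n + (m div n) * n) P" by simp
    also have "\<dots> = mul (m mod n) P" unfolding mul_add[OF E] mul_mul[OF E] n by simp
    finally show ?thesis ..
  qed
  have "\<not> inj (\<lambda>i. 2 ^ i mod n)"
  proof
    assume "inj (\<lambda>i. 2 ^ i mod n)"
    moreover have "range (\<lambda>i. 2 ^ i mod n) \<subseteq> {..<n}" using n by auto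
    ultimately show False using finite_imageD finite_subset infinite_UNIV_nat by blast
  qed
  then obtain i0 j0 where "i0 \<noteq> j0" "(2::nat) ^ i0 mod n = 2 ^ j0 mod n" unfolding inj_def by blast
  then obtain i j where ij: "i < j" "(2::nat) ^ i mod n = 2 ^ j mod n" by (metis linorder_neqE_nat)
  define l where "l = j - i"
  have l: "l > 0" "j = i + l" using ij by (auto simp: l_def)
  have eq: "mul (2 ^ j) P = mul (2 ^ i) P" using per[of "2 ^ i"] per[of "2 ^ j"] ij by simp
  define D where "D = mul (2 ^ l) P \<oplus> ng P"
  have "mul (2 ^ i) D = mul (2 ^ i) (mul (2 ^ l) P) \<oplus> ng (mul (2 ^ i) P)"
    unfolding D_def using E by (simp add: mul_distrib mul_ng)
  also have "mul (2 ^ i) (mul (2 ^ l) P) = mul (2 ^ j) P" unfolding l power_add mul_mul[OF E] ..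
  finally have "mul (2 ^ i) D = None" unfolding eq by simp
  moreover have "allgood D" unfolding D_def using P by (intro allgood_add allgood_ng allgood_mul)
  ultimately have "D = None" by (rule allgood_two_power_torsion[rotated])
  then have cycP: "mul (2 ^ l) P = P" unfolding D_def by (rule eq_if_diff[OF mul_E[OF E] E])
  define Q where "Q i = mul (2 ^ i) P" for i
  have QS: "Q (Suc i) = Q i \<oplus> Q i" for i unfolding Q_def power_Suc mul_mul[OF E] mul_2 ..
  have Qg: "allgood (Q i)" for i unfolding Q_def by (rule allgood_mul[OF P])
  have Q0: "Q i \<noteq> None" for i using allgood_two_power_torsion[OF P, of i] P0 unfolding Q_def by blast
  then have "\<forall>i. \<exists>x y. Q i = Some (x, y)" by (metis option.exhaust surj_pair)
  then obtain x y where xy: "\<And>i. Q i = Some (x i, y i)" by metis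
  have C: "(x i, y i) \<in> C" for i using Qg[of i] by (simp add: allgood_def xy)
  have g0: "gg (x i) \<noteq> 0" for i
  proof
    assume "gg (x i) = 0"
    then have "Q (Suc i) = None" unfolding QS unfolding xy by (rule double_None[OF C])
    then show False using Q0 by blast
  qed
  have step: "gg (x i) \<noteq> 0 \<and> x (Suc i) = ff (x i) / gg (x i)" for i
    using double_Some[OF C g0, of i] QS[of i] g0[of i] unfolding xy by auto
  have cyc: "x l = x 0" using cycP xy[of l] xy[of 0] by (simp add: Q_def)
  define z where "z = disc (wcrv (36 * a) a) ^ l / (\<Prod>i<l. gg (x i)) ^ 2"
  have bad: "z \<in> vmax V" if V: "vring UNIV V" "a \<in> vmax V" for V
  proof -
    have "x i \<notin> vmax V" for i using Qg[of i] V by (simp add: allgood_def xy)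
    then show ?thesis unfolding z_def by (rule cycle_integral_bad[OF V l(1) cyc step])
  qed
  have "z \<in> V" if V: "vring UNIV V" for V
  proof (cases "a \<in> vmax V")
    case True
    then show ?thesis using bad[OF V] vr.m_V[OF vr_UNIV[OF V]] by blast
  next
    case False
    then show ?thesis unfolding z_def by (rule cycle_integral_good[where x = x, OF V _ cyc step])
  qed
  then have "z = 0" using bad_place_exists bad everywhere_integral_unit[of z] by blast
  then show False using nonsing g0 by (simp add: z_def)
qed

end

section \<open>The Galois action\<close>

context tff
begin

definition act :: "('a \<Rightarrow> 'a) \<Rightarrow> ('a \<times> 'a) option \<Rightarrow> ('a \<times> 'a) option" where
  "act \<sigma> = map_option (map_prod \<sigma> \<sigma>)"

lemma act_simps [simp]: "act \<sigma> None = None" "act \<sigma> (Some (x, y)) = Some (\<sigma> x, \<sigma> y)"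
  by (simp_all add: act_def)

context
  fixes F L
  assumes gal: "finite_galois_ext F L" and KaF: "Ka \<subseteq> F" and algL: "\<And>x. x \<in> L \<Longrightarrow> algebraic_over Ka x"
begin

lemma subF: "is_subfield F" and subL: "is_subfield L" and FsubL: "F \<subseteq> L" using galD[OF gal] by auto

lemma a_in_L: "a \<in> L" using KaF a_Ka FsubL by blast

lemma hom_a: "\<sigma> \<in> aut_over F L \<Longrightarrow> \<sigma> a = a"
  by (rule aut_overD(3)[OF _ subF]) (use KaF a_Ka in auto)

lemma act_C:
  assumes s: "\<sigma> \<in> aut_over F L" and q: "(x, y) \<in> C" "x \<in> L" "y \<in> L"
  shows "(\<sigma> x, \<sigma> y) \<in> C"
proof -
  note h = aut_overD(1)[OF s subF]
  note r = hom_on_add[OF subL h] hom_on_mult[OF subL h] hom_on_power[OF subL h] hom_on_numeral[OF subL h] hom_a[OF s]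
    and cl = q(2,3) a_in_L subfieldD[OF subL]
  have eq: "y ^ 2 + x * y = x ^ 3 + 36 * a * x + a" using q(1) unfolding C_iff .
  have "\<sigma> (y ^ 2 + x * y) = \<sigma> (x ^ 3 + 36 * a * x + a)" unfolding eq ..
  moreover have "\<sigma> (y ^ 2 + x * y) = \<sigma> y ^ 2 + \<sigma> x * \<sigma> y" by (simp add: r cl)
  moreover have "\<sigma> (x ^ 3 + 36 * a * x + a) = \<sigma> x ^ 3 + 36 * a * \<sigma> x + a" by (simp add: r cl)
  ultimately show ?thesis unfolding C_iff by simp
qed

lemma act_pts: "\<sigma> \<in> aut_over F L \<Longrightarrow> P \<in> pts L \<Longrightarrow> act \<sigma> P \<in> pts L"
  by (cases P) (auto simp: pts_Some act_C aut_overD(4)[OF _ subF])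

lemma act_add:
  assumes s: "\<sigma> \<in> aut_over F L" and P: "P \<in> pts L" and Q: "Q \<in> pts L"
  shows "act \<sigma> (P \<oplus> Q) = act \<sigma> P \<oplus> act \<sigma> Q"
proof (cases "P = None \<or> Q = None")
  case False
  then obtain x1 y1 x2 y2 where e: "P = Some (x1, y1)" "Q = Some (x2, y2)" by (metis option.exhaust surj_pair)
  have m: "(x1, y1) \<in> C" "x1 \<in> L" "y1 \<in> L" "(x2, y2) \<in> C" "x2 \<in> L" "y2 \<in> L" using P Q by (auto simp: e pts_Some)
  note h = aut_overD(1)[OF s subF]
  note r = hom_on_add[OF subL h] hom_on_diff[OF subL h] hom_on_minus[OF subL h] hom_on_mult[OF subL h] hom_on_divide[OF subL h]
     hom_on_power[OF subL h] hom_on_numeral[OF subL h] hom_a[OF s]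
    and cl = m(2,3,5,6) a_in_L subfieldD[OF subL]
  have inj: "\<sigma> u = \<sigma> v \<longleftrightarrow> u = v" if "u \<in> L" "v \<in> L" for u v
    using hom_on_inj[OF subL h] that by (auto simp: inj_on_def)
  have x12: "\<sigma> x1 = \<sigma> x2 \<longleftrightarrow> x1 = x2" using inj m by blast
  have sm: "\<sigma> y1 + \<sigma> y2 + \<sigma> x2 = \<sigma> (y1 + y2 + x2)" by (simp add: r cl)
  have s0: "\<sigma> y1 + \<sigma> y2 + \<sigma> x2 = 0 \<longleftrightarrow> y1 + y2 + x2 = 0"
    unfolding sm using inj[of "y1 + y2 + x2" 0] hom_on_0[OF subL h] by (simp add: cl)
  show ?thesis
  proof (cases "x1 = x2 \<and> y1 + y2 + x2 = 0")
    case True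
    then have "P \<oplus> Q = None" by (simp add: e ec_add_def)
    moreover have "act \<sigma> P \<oplus> act \<sigma> Q = None" using True x12 s0 by (simp add: e ec_add_def)
    ultimately show ?thesis by simp
  next
    case ne: False
    have ne': "\<not> (\<sigma> x1 = \<sigma> x2 \<and> \<sigma> y1 + \<sigma> y2 + \<sigma> x2 = 0)" using ne x12 s0 by blast
    show ?thesis
    proof (rule chord[OF m(1,4) ne], goal_cases)
      case (1 l n x3)
      note l = 1
      show ?thesis
      proof (rule chord[OF act_C[OF s m(1-3)] act_C[OF s m(4-6)] ne'], goal_cases)
        case (1 l' n' x3')
        note l' = 1
        have "l \<in> L \<and> l' = \<sigma> l"
        proof (cases "x1 = x2")
          case True
          note u = l(7)[OF True] and u' = l'(7)[OF x12[THEN iffD2, OF True]]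
          show ?thesis unfolding conjunct2[OF conjunct2[OF u]] conjunct2[OF conjunct2[OF u']] by (simp add: r cl)
        next
          case False
          then have "\<sigma> x1 \<noteq> \<sigma> x2" using x12 by simp
          then show ?thesis unfolding l(6)[OF False] using l'(6) by (simp add: r cl)
        qed
        then have lL: "l \<in> L" and l'e: "l' = \<sigma> l" by auto
        have n: "n = y1 - l * x1" using l(2) by simp
        have n': "n' = \<sigma> y1 - l' * \<sigma> x1" using l'(2) by simp
        have nL: "n \<in> L" unfolding n by (intro subfieldD[OF subL] m lL)
        have n'e: "n' = \<sigma> n" unfolding n' n l'e by (simp add: r cl lL)
        have x3L: "x3 \<in> L" unfolding l(4) by (intro subfieldD[OF subL] m lL)
        have x3e: "x3' = \<sigma> x3" unfolding l(4) l'(4) l'e by (simp add: r cl lL)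
        show ?thesis unfolding e act_simps l(1) l'(1) x3e l'e n'e by (simp add: r cl lL nL x3L)
      qed
    qed
  qed
qed auto

lemma act_mul: "\<sigma> \<in> aut_over F L \<Longrightarrow> P \<in> pts L \<Longrightarrow> act \<sigma> (mul n P) = mul n (act \<sigma> P)"
  by (induction n) (simp_all add: act_add pts_mul[OF subL a_in_L])

lemma image_restrict:
  assumes s: "\<sigma> \<in> aut_over F L" and V: "V \<subseteq> L"
  shows "\<sigma> ` V \<inter> F = V \<inter> F"
proof -
  have fx: "\<sigma> x = x" if "x \<in> F" for x using aut_overD(3)[OF s subF] that .
  have "x \<in> V" if v: "v \<in> V" "x \<in> F" "x = \<sigma> v" for x v
  proof -
    have "\<sigma> x = \<sigma> v" using fx v by simp
    then have "x = v" using hom_on_inj[OF subL aut_overD(1)[OF s subF]] v V FsubL by (auto simp: inj_on_def)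
    then show ?thesis using v by simp
  qed
  moreover have "x \<in> \<sigma> ` V" if "x \<in> V" "x \<in> F" for x using fx[OF that(2)] that(1) by (metis imageI)
  ultimately show ?thesis by blast
qed

lemma good_act:
  assumes V: "bad L V" and s: "\<sigma> \<in> aut_over F L" and P: "P \<in> pts L"
  shows "good V (act \<sigma> P) \<longleftrightarrow> good (inv_into L \<sigma> ` V) P"
  using P vmax_conj[OF gal KaF algL V s] by (cases P) (auto simp: pts_Some)

lemma tcv: "bad L V \<Longrightarrow> tcurve_vr a L V"
  by (simp add: tcurve_vr_def tcurve_vr_axioms_def tcurve_axioms bad_vr a_m)

section \<open>An automorphism in the decomposition group of a bad ring\<close>

context
  fixes V \<tau>
  assumes bV: "bad L V" and t: "\<tau> \<in> aut_over F L" and tV: "\<tau> ` V = V"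
begin

interpretation tcurve_vr a L V by (rule tcv[OF bV])

lemma tau_V: "x \<in> V \<Longrightarrow> \<tau> x \<in> V" using tV by blast

lemma tau_vmax: "x \<in> vmax V \<Longrightarrow> \<tau> x \<in> vmax V"
  using vmax_image[OF gal KaF algL t bad_sub[OF gal KaF algL bV]] tV by auto

lemma tau_vmax_iff: "x \<in> L \<Longrightarrow> \<tau> x \<in> vmax V \<longleftrightarrow> x \<in> vmax V"
  using vmax_conj[OF gal KaF algL bV t] image_inv(1)[OF gal KaF algL t bad_sub[OF gal KaF algL bV]] tV by simp

text \<open>The orbit of \<open>x\<close> is finite, so two powers of \<open>\<tau>\<close> agree at
  \<open>x\<close>; injectivity cancels the smaller one.\<close>

lemma tau_period:
  assumes x: "x \<in> L"
  shows "\<exists>m. (\<tau> ^^ Suc m) x = x"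
proof -
  have pw: "\<tau> ^^ i \<in> aut_over F L" for i
  proof (induction i)
    case (Suc i)
    then show ?case unfolding funpow.simps by (rule comp_aut_over[OF t])
  qed (use id_aut_over[of F L] in \<open>simp add: id_def\<close>)
  have "range (\<lambda>i. (\<tau> ^^ i) x) \<subseteq> orb F L x" using pw by (auto simp: orb_def)
  then have "finite (range (\<lambda>i. (\<tau> ^^ i) x))" using finite_orb[OF gal x] finite_subset by blast
  then have "\<not> inj (\<lambda>i. (\<tau> ^^ i) x)" using finite_imageD infinite_UNIV_nat by blast
  then obtain i0 j0 where "i0 \<noteq> j0" "(\<tau> ^^ i0) x = (\<tau> ^^ j0) x" unfolding inj_def by blast
  then obtain i j where ij: "i < j" "(\<tau> ^^ i) x = (\<tau> ^^ j) x" by (metis linorder_neqE_nat)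
  have j: "j = i + Suc (j - i - 1)" using ij by simp
  have "(\<tau> ^^ j) x = (\<tau> ^^ i) ((\<tau> ^^ Suc (j - i - 1)) x)" by (subst j, subst funpow_add) simp
  then have "(\<tau> ^^ i) x = (\<tau> ^^ i) ((\<tau> ^^ Suc (j - i - 1)) x)" using ij by simp
  moreover have "inj_on (\<tau> ^^ i) L" by (rule hom_on_inj[OF subL aut_overD(1)[OF pw subF]])
  moreover have "(\<tau> ^^ Suc (j - i - 1)) x \<in> L" using aut_overD(4)[OF pw subF x] .
  ultimately have "x = (\<tau> ^^ Suc (j - i - 1)) x" using x unfolding inj_on_def by blast
  then show ?thesis by metis
qed

text \<open>If \<open>\<tau> x / x\<close> is integral, so are its images under the powers of
  \<open>\<tau>\<close>. Their product over a period is 1, and leaving out the first factor yields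
  \<open>x / \<tau> x\<close>: an order-preserving map of finite order preserves values.\<close>

lemma tau_quotient:
  assumes x: "x \<in> L" "x \<noteq> 0" and q: "\<tau> x / x \<in> V"
  shows "x / \<tau> x \<in> V"
proof -
  note h = aut_overD(1)[OF t subF]
  have pL: "(\<tau> ^^ i) x \<in> L \<and> (\<tau> ^^ i) x \<noteq> 0" for i
  proof (induction i)
    case (Suc i)
    then show ?case using aut_overD(4)[OF t subF] hom_on_nonzero[OF subL h] by simp
  qed (use x in simp)
  have st: "(\<tau> ^^ Suc i) x / (\<tau> ^^ i) x \<in> V" for i
  proof (induction i)
    case (Suc i)
    have "(\<tau> ^^ Suc (Suc i)) x / (\<tau> ^^ Suc i) x = \<tau> ((\<tau> ^^ Suc i) x / (\<tau> ^^ i) x)"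
      using hom_on_divide[OF subL h, of "(\<tau> ^^ Suc i) x" "(\<tau> ^^ i) x"] pL[of i] pL[of "Suc i"] by simp
    then show ?case using tau_V[OF Suc] by simp
  qed (use q in simp)
  have r: "(\<tau> ^^ Suc i) x / \<tau> x \<in> V" for i
  proof (induction i)
    case 0
    have "\<tau> x \<noteq> 0" using pL[of 1] by simp
    then show ?case by simp
  next
    case (Suc i)
    have "(\<tau> ^^ Suc (Suc i)) x / \<tau> x = ((\<tau> ^^ Suc (Suc i)) x / (\<tau> ^^ Suc i) x) * ((\<tau> ^^ Suc i) x / \<tau> x)"
      using pL[of "Suc i"] by simp
    then show ?case using V_mult[OF st[of "Suc i"] Suc] by (simp only:)
  qed
  obtain m where "(\<tau> ^^ Suc m) x = x" using tau_period[OF x(1)] by blast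
  then show ?thesis using r[of m] by (simp only:)
qed

lemma eqv_tau: "x \<in> L \<Longrightarrow> eqv (\<tau> x) x"
proof -
  assume x: "x \<in> L"
  note h = aut_overD(1)[OF t subF]
  show ?thesis
  proof (cases "x = 0")
    case True
    then show ?thesis using hom_on_0[OF subL h] by (simp add: eqv_def)
  next
    case False
    have t0: "\<tau> x \<noteq> 0" using hom_on_nonzero[OF subL h x False] .
    have qL: "\<tau> x / x \<in> L" using x aut_overD(4)[OF t subF x] by (rule subfieldD(8)[OF subL, rotated])
    from V_total[OF qL] have "\<tau> x / x \<in> V \<and> x / \<tau> x \<in> V"
    proof
      assume "\<tau> x / x \<in> V"
      then show ?thesis using tau_quotient[OF x False] by blast
    next
      assume "inverse (\<tau> x / x) \<in> V"
      then have i: "x / \<tau> x \<in> V" by simp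
      have ix: "inverse x \<in> L" "inverse x \<noteq> 0" using subfieldD(6)[OF subL x] False by auto
      have "\<tau> (inverse x) / inverse x = x / \<tau> x" using hom_on_inverse[OF subL h x] by (simp add: field_simps)
      then have "inverse x / \<tau> (inverse x) \<in> V" using tau_quotient[OF ix] i by simp
      then have "\<tau> x / x \<in> V" using hom_on_inverse[OF subL h x] by (simp add: field_simps)
      then show ?thesis using i by blast
    qed
    then show ?thesis using False t0 by (simp add: eqv_def)
  qed
qed

text \<open>For a point reducing to the node, \<open>\<tau>\<close> preserves the values of
  \<open>x\<close>, \<open>y\<close> and \<open>y + x\<close>, as \<open>same_valuation\<close>
  asks; a good point has a good image.\<close>

lemma act_diff_good:
  assumes P: "P \<in> pts L"
  shows "good V (act \<tau> P \<oplus> ng P)"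
proof (cases P)
  case (Some q)
  obtain x y where q: "q = (x, y)" by force
  have m: "(x, y) \<in> C" "x \<in> L" "y \<in> L" using P by (auto simp: Some q pts_Some)
  note h = aut_overD(1)[OF t subF]
  show ?thesis
  proof (cases "x \<in> vmax V")
    case True
    have "eqv (\<tau> y + \<tau> x) (y + x)" using eqv_tau[of "y + x"] hom_on_add[OF subL h m(3,2)] subfieldD(3)[OF subL m(3,2)] by simp
    then show ?thesis unfolding Some q act_simps
      by (intro same_valuation act_C[OF t] aut_overD(4)[OF t subF] m True tau_vmax eqv_tau)
  next
    case False
    then have g: "good V P" "good V (act \<tau> P)" by (simp_all add: Some q tau_vmax_iff m)
    show ?thesis by (rule good_add[OF act_pts[OF t P] g(2) pts_ng[OF subL P]]) (simp add: g)
  qed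
qed simp

end

text \<open>Rings above one ring of \<open>F\<close> are conjugate, hence so are their decomposition
  groups, and conjugation by commuting automorphisms changes nothing.\<close>

lemma decomposition_independent:
  assumes com: "\<forall>\<sigma>\<in>aut_over F L. \<forall>\<tau>\<in>aut_over F L. \<forall>x\<in>L. \<sigma> (\<tau> x) = \<tau> (\<sigma> x)"
    and V: "bad L V" "bad L V'" "V \<inter> F = V' \<inter> F" and t: "\<tau> \<in> aut_over F L" "\<tau> ` V = V"
  shows "\<tau> ` V' = V'"
proof -
  obtain \<sigma> where s: "\<sigma> \<in> aut_over F L" "V' = \<sigma> ` V" using bad_conjugate[OF gal KaF algL V] by blast
  have VL: "v \<in> L" if "v \<in> V" for v using bad_sub[OF gal KaF algL V(1)] that by blast
  have "\<tau> ` \<sigma> ` V = (\<lambda>v. \<tau> (\<sigma> v)) ` V" by (rule image_image)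
  also have "\<dots> = (\<lambda>v. \<sigma> (\<tau> v)) ` V" by (rule image_cong[OF refl]) (use com t(1) s(1) VL in blast)
  also have "\<dots> = \<sigma> ` \<tau> ` V" by (rule image_image[symmetric])
  finally show ?thesis unfolding s t .
qed

text \<open>By density the first coordinates of the multiples that are not good have at most
  \<open>M\<close> residues modulo \<open>a\<close>. Among the first \<open>M + 1\<close> multiples
  two agree, and \<open>close_points\<close> makes their sum or difference good, a multiple with
  index at most \<open>2 * M + 2\<close>. The factorial is divisible by that index, whichever it
  is.\<close>

lemma multiple_good:
  assumes bV: "bad L V" and Z: "Z \<in> pts L"
    and inv: "\<And>\<tau>. \<tau> \<in> aut_over F L \<Longrightarrow> \<tau> ` V = V \<Longrightarrow> act \<tau> Z = Z"
    and S: "finite S" "card S \<le> M" and res: "\<And>f. f \<in> V \<inter> F \<Longrightarrow> \<exists>r\<in>S. \<exists>y\<in>V \<inter> F. f - r = a * y"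
  shows "good V (mul (fact (2 * M + 2)) Z)"
proof -
  interpret tcurve_vr a L V by (rule tcv[OF bV])
  have RE: "Z \<in> E" by (rule pts_E[OF Z])
  have "\<exists>d. 0 < d \<and> d \<le> 2 * M + 2 \<and> good V (mul d Z)"
  proof (rule ccontr)
    assume no: "\<not> (\<exists>d. 0 < d \<and> d \<le> 2 * M + 2 \<and> good V (mul d Z))"
    define I where "I = {1..M + 1}"
    have nb: "\<not> good V (mul i Z)" if "i \<in> I" for i
    proof -
      have "0 < i" "i \<le> 2 * M + 2" using that by (auto simp: I_def)
      then show ?thesis using no by blast
    qed
    have "\<forall>i. \<exists>x y. i \<in> I \<longrightarrow> mul i Z = Some (x, y) \<and> x \<in> vmax V" using nb unfolding good_def by blast
    then obtain x y where xy: "\<And>i. i \<in> I \<Longrightarrow> mul i Z = Some (x i, y i)" "\<And>i. i \<in> I \<Longrightarrow> x i \<in> vmax V" by metis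
    have pt: "(x i, y i) \<in> C" "x i \<in> L" "y i \<in> L" if "i \<in> I" for i
      using pts_mul[OF subL a_in_L Z, of i] unfolding xy(1)[OF that] pts_Some by auto
    have "\<exists>r\<in>S. \<exists>d\<in>V. x i - r = a * d" if i: "i \<in> I" for i
    proof -
      have fx: "\<tau> (x i) = x i" if t: "\<tau> \<in> aut_over F L" "\<tau> ` V = V" for \<tau>
      proof -
        have "act \<tau> (mul i Z) = mul i Z" unfolding act_mul[OF t(1) Z] inv[OF t] ..
        then show ?thesis unfolding xy(1)[OF i] by simp
      qed
      have "\<exists>f\<in>F. \<exists>u\<in>V. x i - f = a * u" by (rule bad_density[OF gal KaF algL bV m_V[OF xy(2)[OF i]]]) (assumption | erule (1) fx)+
      then obtain f u where f: "f \<in> F" "u \<in> V" "x i - f = a * u" by blast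
      have "f = x i - a * u" using f(3) by (simp add: algebra_simps)
      then have "f \<in> V" using V_diff V_mult m_V xy(2)[OF i] am f(2) by simp
      then obtain r w where r: "r \<in> S" "w \<in> V" "f - r = a * w" using res f(1) by blast
      have "x i - r = (x i - f) + (f - r)" by simp
      also have "\<dots> = a * (u + w)" unfolding f(3) r(3) by (simp add: distrib_left)
      finally show ?thesis using r(1) V_add[OF f(2) r(2)] by blast
    qed
    then obtain r d where r: "\<And>i. i \<in> I \<Longrightarrow> r i \<in> S" "\<And>i. i \<in> I \<Longrightarrow> d i \<in> V" "\<And>i. i \<in> I \<Longrightarrow> x i - r i = a * d i" by metis
    have "\<not> inj_on r I"
    proof
      assume "inj_on r I"
      then have "card I \<le> card S" using r(1) S(1) by (intro card_inj_on_le[of r]) auto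
      then show False using S(2) by (simp add: I_def)
    qed
    then obtain i0 j0 where "i0 \<in> I" "j0 \<in> I" "i0 \<noteq> j0" "r i0 = r j0" unfolding inj_on_def by blast
    then obtain i j where ij: "i \<in> I" "j \<in> I" "i < j" "r i = r j" by (metis linorder_neqE_nat)
    have "x i - x j = (x i - r i) - (x j - r j)" using ij(4) by simp
    also have "\<dots> = a * (d i - d j)" unfolding r(3)[OF ij(1)] r(3)[OF ij(2)] by (simp add: right_diff_distrib)
    finally have xd: "x i - x j = a * (d i - d j)" .
    have "good V (mul i Z \<oplus> mul j Z) \<or> good V (mul i Z \<oplus> ng (mul j Z))"
      unfolding xy(1)[OF ij(1)] xy(1)[OF ij(2)]
      by (rule close_points[OF pt[OF ij(1)] pt[OF ij(2)] xy(2)[OF ij(1)] xy(2)[OF ij(2)] xd V_diff[OF r(2)[OF ij(1)] r(2)[OF ij(2)]]])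
    then show False
    proof
      assume "good V (mul i Z \<oplus> mul j Z)"
      then have "good V (mul (i + j) Z)" unfolding mul_add[OF RE] .
      moreover have "0 < i + j" "i + j \<le> 2 * M + 2" using ij by (auto simp: I_def)
      ultimately show False using no by blast
    next
      assume g: "good V (mul i Z \<oplus> ng (mul j Z))"
      have "ng (mul i Z \<oplus> ng (mul j Z)) = ng (mul i Z) \<oplus> mul j Z" using RE by (simp add: ng_add)
      also have "\<dots> = mul j Z \<oplus> ng (mul i Z)" using RE by (intro add_comm) simp_all
      also have "\<dots> = mul (j - i) Z" using ij by (intro mul_diff RE) simp
      finally have "good V (mul (j - i) Z)" using g good_ng by metis
      moreover have "0 < j - i" "j - i \<le> 2 * M + 2" using ij by (auto simp: I_def)
      ultimately show False using no by blast
    qed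
  qed
  then obtain d where d: "0 < d" "d \<le> 2 * M + 2" "good V (mul d Z)" by blast
  then have "d dvd fact (2 * M + 2)" by (intro dvd_fact) auto
  then obtain c where c: "fact (2 * M + 2) = c * d" by (metis dvd_def mult.commute)
  show ?thesis unfolding c mul_mul[OF RE] by (rule good_mul[OF pts_mul[OF subL a_in_L Z] d(3)])
qed

text \<open>Goodness is known at the bad rings of \<open>L\<close>, while \<open>allgood\<close>
  ranges over the ambient field; restriction to \<open>L\<close> connects the two.\<close>

lemma torsion_good_everywhere:
  assumes Q: "Q \<in> pts L" "n > 0" "mul n Q = None" and g: "\<And>V. bad L V \<Longrightarrow> good V Q"
  shows "Q = None"
proof -
  have "good V Q" if V: "vring UNIV V" "a \<in> vmax V" for V
  proof -
    have "bad L (V \<inter> L)" using KaF FsubL by (intro bad_restrict_UNIV V subL algL) auto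
    then have "good (V \<inter> L) Q" by (rule g)
    then show ?thesis using Q(1) vring_restrict(2)[OF V(1) subL] by (cases Q) (auto simp: pts_Some)
  qed
  then have "allgood Q" using pts_E[OF Q(1)] by (simp add: allgood_def)
  then show ?thesis using allgood_torsion Q by blast
qed

text \<open>Removing one ring \<open>U\<close> costs \<open>N^e\<close>, then \<open>N\<close>, then
  \<open>N^e\<close> again: the first kills the differences \<open>\<tau> Q - Q\<close>, so that
  \<open>N^e Q\<close> is invariant under the decomposition group above \<open>U\<close>; the factor
  \<open>N\<close> makes it good above \<open>U\<close>; the last is the induction hypothesis for
  the result. The recursion \<open>e \<mapsto> 2 e + 1\<close> gives
  \<open>2 ^ card S - 1\<close>.\<close>

lemma torsion_exponent:
  fixes M :: nat and S :: "'a set set"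
  defines "N \<equiv> fact (2 * M + 2)"
  assumes com: "\<forall>\<sigma>\<in>aut_over F L. \<forall>\<tau>\<in>aut_over F L. \<forall>x\<in>L. \<sigma> (\<tau> x) = \<tau> (\<sigma> x)"
    and res: "\<And>U. bad F U \<Longrightarrow> \<exists>S. finite S \<and> card S \<le> M \<and> (\<forall>f\<in>U. \<exists>r\<in>S. \<exists>y\<in>U. f - r = a * y)"
    and S: "finite S"
  shows "Q \<in> pts L \<Longrightarrow> \<exists>n>0. mul n Q = None \<Longrightarrow> (\<And>V. bad L V \<Longrightarrow> V \<inter> F \<notin> S \<Longrightarrow> good V Q)
    \<Longrightarrow> mul (N ^ (2 ^ card S - 1)) Q = None"
  using S
proof (induction S arbitrary: Q rule: finite_induct)
  case empty
  then obtain n where "n > 0" "mul n Q = None" by blast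
  then have "Q = None" using torsion_good_everywhere[OF empty(1)] empty(3) by blast
  then show ?case by simp
next
  case (insert U S)
  note IH = insert.IH and Q = insert.prems(1) and gQ = insert.prems(3)
  have QE: "Q \<in> E" by (rule pts_E[OF Q])
  obtain n where n: "n > 0" "mul n Q = None" using insert.prems(2) by blast
  define e where "e = (2::nat) ^ card S - 1"
  define Z where "Z = mul (N ^ e) Q"
  have Z: "Z \<in> pts L" unfolding Z_def by (rule pts_mul[OF subL a_in_L Q])
  have fixR: "act \<tau> Z = Z" if V: "bad L V" "V \<inter> F = U" and t: "\<tau> \<in> aut_over F L" "\<tau> ` V = V" for V \<tau>
  proof -
    define T where "T = act \<tau> Q \<oplus> ng Q"
    have aQ: "act \<tau> Q \<in> pts L" by (rule act_pts[OF t(1) Q])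
    note aQE = pts_E[OF aQ]
    have T: "T \<in> pts L" unfolding T_def by (rule pts_add[OF subL a_in_L aQ pts_ng[OF subL Q]])
    have mT: "mul i T = act \<tau> (mul i Q) \<oplus> ng (mul i Q)" for i
      unfolding T_def mul_distrib[OF aQE ng_E[OF QE]] mul_ng[OF QE] act_mul[OF t(1) Q] ..
    have "mul n T = None" unfolding mT n by simp
    \<comment> \<open>Above \<open>U\<close> this is \<open>act_diff_good\<close>, applied to all
      rings at once by commutativity. Above the other rings outside \<open>S\<close> both
      \<open>Q\<close> and its image are good, since \<open>\<tau>\<close> permutes the rings above
      a given one.\<close>
    moreover have "good V' T" if V': "bad L V'" "V' \<inter> F \<notin> S" for V'
    proof (cases "V' \<inter> F = U")
      case True
      have "\<tau> ` V' = V'" by (rule decomposition_independent[OF com V(1) V'(1) _ t]) (simp_all add: V True)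
      then show ?thesis unfolding T_def by (rule act_diff_good[OF V'(1) t(1) _ Q])
    next
      case False
      interpret tcurve_vr a L V' by (rule tcv[OF V'(1)])
      note iv = inv_aut_over(1)[OF t(1) subF FsubL subL]
      have "(inv_into L \<tau> ` V') \<inter> F = V' \<inter> F" by (rule image_restrict[OF iv bad_sub[OF gal KaF algL V'(1)]])
      then have ni: "(inv_into L \<tau> ` V') \<inter> F \<notin> insert U S" using False V'(2) by (metis insert_iff)
      have bi: "bad L (inv_into L \<tau> ` V')" by (rule bad_image[OF gal KaF algL V'(1) iv])
      have "good (inv_into L \<tau> ` V') Q" by (rule gQ[OF bi ni])
      then have g1: "good V' (act \<tau> Q)" using good_act[OF V'(1) t(1) Q] by simp
      have g2: "good V' (ng Q)" using gQ[OF V'(1)] False V'(2) by simp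
      show ?thesis unfolding T_def by (rule good_add[OF aQ g1 pts_ng[OF subL Q] g2])
    qed
    ultimately have "mul (N ^ e) T = None" unfolding e_def using n(1) by (intro IH[OF T]) auto
    then have "act \<tau> Z \<oplus> ng Z = None" unfolding mT Z_def .
    then show ?thesis by (rule eq_if_diff[OF pts_E[OF act_pts[OF t(1) Z]] pts_E[OF Z]])
  qed
  have "good V (mul N Z)" if V: "bad L V" "V \<inter> F \<notin> S" for V
  proof (cases "V \<inter> F = U")
    case True
    have "bad F (V \<inter> F)" by (rule bad_restrict[OF V(1) subF KaF FsubL])
    then obtain S' where S': "finite S'" "card S' \<le> M" "\<forall>f\<in>V \<inter> F. \<exists>r\<in>S'. \<exists>y\<in>V \<inter> F. f - r = a * y" using res by blast
    show ?thesis unfolding N_def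
      by (rule multiple_good[OF V(1) Z fixR[OF V(1) True] S'(1,2)]) (use S'(3) in blast)+
  next
    case False
    have g: "good V Q" using gQ[OF V(1)] False V(2) by simp
    interpret tcurve_vr a L V by (rule tcv[OF V(1)])
    show ?thesis unfolding Z_def by (intro good_mul pts_mul subL a_in_L Q g)
  qed
  moreover have "mul n (mul N Z) = None"
  proof -
    have "mul n (mul N Z) = mul (n * (N * N ^ e)) Q" unfolding Z_def mul_mul[OF QE] ..
    also have "\<dots> = mul ((N * N ^ e) * n) Q" by (simp only: mult.commute)
    also have "\<dots> = None" unfolding mul_mul[OF QE] n by simp
    finally show ?thesis .
  qed
  ultimately have "mul (N ^ e) (mul N Z) = None" unfolding e_def using n(1) by (intro IH[OF pts_mul[OF subL a_in_L Z]]) auto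
  then have "mul (N ^ e * (N * N ^ e)) Q = None" unfolding Z_def mul_mul[OF QE] .
  moreover have "N ^ e * (N * N ^ e) = N ^ (2 ^ card (insert U S) - 1)"
  proof -
    have "N ^ e * (N * N ^ e) = N ^ (e + Suc e)" by (simp only: power_add power_Suc)
    also have "e + Suc e = 2 ^ card (insert U S) - 1"
    proof -
      have "(1::nat) \<le> 2 ^ card S" by simp
      moreover have "(2::nat) ^ card (insert U S) = 2 * 2 ^ card S" using insert.hyps by simp
      ultimately show ?thesis unfolding e_def by linarith
    qed
    finally show ?thesis .
  qed
  ultimately show ?case by (simp only:)
qed

end

theorem abelian_torsion_exponent:
  assumes F: "is_subfield F" "Ka \<subseteq> F" "finite_dim_over Ka F"
  shows "\<exists>N>0. \<forall>L P. finite_abelian_ext F L \<longrightarrow> P \<in> pts L \<longrightarrow> (\<exists>n>0. mul n P = None) \<longrightarrow> mul N P = None"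
proof -
  obtain B where B: "spans_over Ka B F" using F(3) unfolding finite_dim_over_spans by blast
  have fin: "finite {U. bad F U}" by (rule bad_finite[OF B])
  have "\<forall>U. \<exists>Z. bad F U \<longrightarrow> finite Z \<and> (\<forall>x\<in>U. \<exists>r\<in>Z. \<exists>y\<in>U. x - r = a * y)" using residues_finite[OF B] by blast
  then obtain Z where Z: "\<And>U. bad F U \<Longrightarrow> finite (Z U) \<and> (\<forall>x\<in>U. \<exists>r\<in>Z U. \<exists>y\<in>U. x - r = a * y)" by metis
  \<comment> \<open>A sum bounds all residue counts simultaneously.\<close>
  define M where "M = (\<Sum>U | bad F U. card (Z U))"
  have cM: "card (Z U) \<le> M" if "bad F U" for U
    unfolding M_def by (rule member_le_sum[of U "{U. bad F U}" "\<lambda>U. card (Z U)"]) (use that fin in auto)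
  define N where "N = (fact (2 * M + 2) :: nat) ^ (2 ^ card {U. bad F U} - 1)"
  have "mul N P = None" if ab: "finite_abelian_ext F L" and P: "P \<in> pts L" "\<exists>n>0. mul n P = None" for L P
  proof -
    have gal: "finite_galois_ext F L" using ab by (simp add: finite_abelian_ext_def)
    have com: "\<forall>\<sigma>\<in>aut_over F L. \<forall>\<tau>\<in>aut_over F L. \<forall>x\<in>L. \<sigma> (\<tau> x) = \<tau> (\<sigma> x)"
      using ab by (simp add: finite_abelian_ext_def)
    note g = galD[OF gal]
    have fdL: "finite_dim_over Ka L" by (rule finite_dim_over_tower[OF subfield_gen_field g(1,2,3) F(3) g(4)])
    have algL: "\<And>x. x \<in> L \<Longrightarrow> algebraic_over Ka x"
      by (rule finite_dim_subfield_algebraic[OF subfield_gen_field g(2) fdL])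
    have res: "\<exists>S. finite S \<and> card S \<le> M \<and> (\<forall>f\<in>U. \<exists>r\<in>S. \<exists>y\<in>U. f - r = a * y)" if U: "bad F U" for U
      using Z[OF U] cM[OF U] by blast
    show ?thesis unfolding N_def
    proof (rule torsion_exponent[OF gal F(2) algL com res fin P])
      show "good V P" if "bad L V" "V \<inter> F \<notin> {U. bad F U}" for V
        using bad_restrict[OF that(1) g(1) F(2) g(3)] that(2) by simp
    qed
  qed
  moreover have "N > 0" by (simp add: N_def)
  ultimately show ?thesis by blast
qed

end

section \<open>Change of coordinates\<close>

text \<open>The intercept in \<open>ec_add\<close> has a formula of its own; on the curve it equals
  \<open>y1 - l * x1\<close>, so that only the slope has to be transformed.\<close>

lemma ec_add_slope:
  fixes E :: "'a::field weierstrass"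
  assumes P: "on_curve E (Some (x1, y1))" and Q: "on_curve E (Some (x2, y2))"
    and ne: "\<not> (x1 = x2 \<and> y1 + y2 + a1 E * x2 + a3 E = 0)"
    and l1: "x1 \<noteq> x2 \<Longrightarrow> l = (y2 - y1) / (x2 - x1)"
    and l2: "x1 = x2 \<Longrightarrow> l = (3 * x1 ^ 2 + 2 * a2 E * x1 + a4 E - a1 E * y1) / (2 * y1 + a1 E * x1 + a3 E)"
    and x3: "x3 = l ^ 2 + a1 E * l - a2 E - x1 - x2"
  shows "ec_add E (Some (x1, y1)) (Some (x2, y2)) = Some (x3, - (l + a1 E) * x3 - (y1 - l * x1) - a3 E)"
proof (cases "x1 = x2")
  case True
  define d where "d = 2 * y1 + a1 E * x1 + a3 E"
  have cP: "y1 ^ 2 + a1 E * x1 * y1 + a3 E * y1 = x1 ^ 3 + a2 E * x1 ^ 2 + a4 E * x1 + a6 E" using P by (simp add: on_curve_def)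
  have cQ: "y2 ^ 2 + a1 E * x1 * y2 + a3 E * y2 = x1 ^ 3 + a2 E * x1 ^ 2 + a4 E * x1 + a6 E" using Q True by (simp add: on_curve_def)
  have "(y1 - y2) * (y1 + y2 + a1 E * x2 + a3 E)
      = (y1 ^ 2 + a1 E * x1 * y1 + a3 E * y1) - (y2 ^ 2 + a1 E * x1 * y2 + a3 E * y2)"
    using True by (simp add: power2_eq_square algebra_simps)
  also have "\<dots> = 0" unfolding cP cQ by simp
  finally have "y1 = y2" using ne True by simp
  then have d0: "d \<noteq> 0" using ne True by (simp add: d_def algebra_simps)
  have ld: "l * d = 3 * x1 ^ 2 + 2 * a2 E * x1 + a4 E - a1 E * y1" using l2[OF True] d0 by (simp add: d_def)
  have "(y1 - l * x1) * d = y1 * d - (l * d) * x1" by (simp add: algebra_simps)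
  also have "\<dots> = 2 * (y1 ^ 2 + a1 E * x1 * y1 + a3 E * y1) - a3 E * y1 - 3 * x1 ^ 3 - 2 * a2 E * x1 ^ 2 - a4 E * x1"
    unfolding ld by (simp add: d_def power2_eq_square power3_eq_cube algebra_simps)
  also have "\<dots> = - (x1 ^ 3) + a4 E * x1 + 2 * a6 E - a3 E * y1" unfolding cP by (simp add: algebra_simps)
  finally have "y1 - l * x1 = (- (x1 ^ 3) + a4 E * x1 + 2 * a6 E - a3 E * y1) / d" using d0 by (simp add: eq_divide_eq)
  then show ?thesis using True ne l2 by (simp add: ec_add_def Let_def x3 d_def)
next
  case False
  have "y1 - l * x1 = (y1 * x2 - y2 * x1) / (x2 - x1)" unfolding l1[OF False] using False by (simp add: field_simps)
  then show ?thesis using False ne l1 by (simp add: ec_add_def Let_def x3)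
qed

text \<open>The substitution \<open>x = u^2 x' + r\<close>, \<open>y = u^3 y' + s u^2 x' + t\<close>
  carries \<open>W\<close> to the normal form with parameter \<open>a\<close>. The transformation
  formulas are solved for the coefficients of \<open>W\<close>, in an order in which each can be
  substituted into the next.\<close>

locale coord_change =
  fixes W :: "'a::field weierstrass" and a u r s t :: 'a
  assumes u: "u \<noteq> 0" and c1: "a1 W = u - 2 * s" and c2: "a2 W = s * a1 W - 3 * r + s ^ 2"
    and c3: "a3 W = - r * a1 W - 2 * t"
    and c4: "a4 W = u ^ 4 * (36 * a) + s * a3 W - 2 * r * a2 W + (t + r * s) * a1 W - 3 * r ^ 2 + 2 * s * t"
    and c6: "a6 W = u ^ 6 * a - r * a4 W - r ^ 2 * a2 W - r ^ 3 + t * a3 W + t ^ 2 + r * t * a1 W"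
begin

lemma b_invariants:
  "wb2 W = u ^ 2 - 12 * r"
  "wb4 W = 72 * a * u ^ 4 - r * u ^ 2 + 6 * r ^ 2"
  "wb6 W = 4 * a * u ^ 6 - 144 * a * u ^ 4 * r + r ^ 2 * u ^ 2 - 4 * r ^ 3"
  "wb8 W = (a - 1296 * a ^ 2) * u ^ 8 - 12 * a * u ^ 6 * r + 216 * a * u ^ 4 * r ^ 2 - r ^ 3 * u ^ 2 + 3 * r ^ 4"
  unfolding wb2_def wb4_def wb6_def wb8_def c6 unfolding c4 unfolding c2 c3 unfolding c1
  by (simp_all add: power_numeral_reduce algebra_simps)

lemma disc_change: "disc W = u ^ 12 * (- a * (1 - 1728 * a) ^ 2)"
  unfolding disc_def b_invariants by (simp add: power_numeral_reduce algebra_simps)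

lemma c4_change: "wc4 W = u ^ 4 * (1 - 1728 * a)"
  unfolding wc4_def b_invariants by (simp add: power_numeral_reduce algebra_simps)

definition psi :: "('a \<times> 'a) option \<Rightarrow> ('a \<times> 'a) option" where
  "psi = map_option (\<lambda>(x, y). (u ^ 2 * x + r, u ^ 3 * y + s * u ^ 2 * x + t))"

lemma psi_simps [simp]: "psi None = None" "psi (Some (x, y)) = Some (u ^ 2 * x + r, u ^ 3 * y + s * u ^ 2 * x + t)"
  by (simp_all add: psi_def)

lemma psi_None: "psi P = None \<longleftrightarrow> P = None" by (simp add: psi_def)

lemma on_curve_psi: "on_curve W (psi P) \<longleftrightarrow> on_curve (wcrv (36 * a) a) P"
proof (cases P)
  case (Some q)
  obtain x y where q: "q = (x, y)" by force
  let ?X = "u ^ 2 * x + r" and ?Y = "u ^ 3 * y + s * u ^ 2 * x + t"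
  have "?Y ^ 2 + a1 W * ?X * ?Y + a3 W * ?Y - (?X ^ 3 + a2 W * ?X ^ 2 + a4 W * ?X + a6 W)
      = u ^ 6 * (y ^ 2 + x * y - (x ^ 3 + 36 * a * x + a))"
    unfolding c6 unfolding c4 unfolding c2 c3 unfolding c1
    by (simp add: power_numeral_reduce algebra_simps)
  then have "?Y ^ 2 + a1 W * ?X * ?Y + a3 W * ?Y = ?X ^ 3 + a2 W * ?X ^ 2 + a4 W * ?X + a6 W
      \<longleftrightarrow> y ^ 2 + x * y = x ^ 3 + 36 * a * x + a" using u by (metis mult_eq_0_iff power_not_zero right_minus_eq)
  then show ?thesis unfolding Some q psi_simps on_curve_def wcrv_def by simp
qed (simp add: on_curve_def)

lemma psi_add:
  assumes P: "on_curve (wcrv (36 * a) a) P" and Q: "on_curve (wcrv (36 * a) a) Q"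
  shows "ec_add W (psi P) (psi Q) = psi (ec_add (wcrv (36 * a) a) P Q)"
proof (cases "P = None \<or> Q = None")
  case True
  then show ?thesis by (auto simp: ec_add_def split: option.splits)
next
  case False
  then obtain x1 y1 x2 y2 where e: "P = Some (x1, y1)" "Q = Some (x2, y2)" by (metis option.exhaust surj_pair)
  let ?E = "wcrv (36 * a) a"
  have w: "a1 ?E = 1" "a2 ?E = 0" "a3 ?E = 0" "a4 ?E = 36 * a" "a6 ?E = a" by (simp_all add: wcrv_def)
  define X1 Y1 X2 Y2 where XY: "X1 = u ^ 2 * x1 + r" "Y1 = u ^ 3 * y1 + s * u ^ 2 * x1 + t"
    "X2 = u ^ 2 * x2 + r" "Y2 = u ^ 3 * y2 + s * u ^ 2 * x2 + t"
  have oc: "on_curve W (Some (X1, Y1))" "on_curve W (Some (X2, Y2))"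
    using on_curve_psi[of P] on_curve_psi[of Q] P Q by (simp_all add: e XY)
  have xX: "X1 = X2 \<longleftrightarrow> x1 = x2" using u by (simp add: XY)
  have neg: "Y1 + Y2 + a1 W * X2 + a3 W = u ^ 3 * (y1 + y2 + x2)" if "x1 = x2"
    unfolding XY c3 unfolding c1 that by (simp add: power_numeral_reduce algebra_simps)
  show ?thesis
  proof (cases "x1 = x2 \<and> y1 + y2 + x2 = 0")
    case True
    then have "ec_add ?E P Q = None" by (simp add: e ec_add_def w)
    moreover have "ec_add W (Some (X1, Y1)) (Some (X2, Y2)) = None" using True neg xX by (simp add: ec_add_def)
    ultimately show ?thesis by (simp add: e XY)
  next
    case ne: False
    define l where "l = (if x1 = x2 then (3 * x1 ^ 2 + 36 * a - y1) / (2 * y1 + x1) else (y2 - y1) / (x2 - x1))"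
    define x3 where "x3 = l ^ 2 + l - x1 - x2"
    have "ec_add ?E (Some (x1, y1)) (Some (x2, y2)) = Some (x3, - (l + a1 ?E) * x3 - (y1 - l * x1) - a3 ?E)"
      by (rule ec_add_slope) (use P Q ne in \<open>simp_all add: e w l_def x3_def\<close>)
    then have add1: "ec_add ?E P Q = Some (x3, - (l + 1) * x3 - (y1 - l * x1))" unfolding e w by simp
    define l' where "l' = u * l + s"
    define x3' where "x3' = u ^ 2 * x3 + r"
    have ne': "\<not> (X1 = X2 \<and> Y1 + Y2 + a1 W * X2 + a3 W = 0)" using ne neg xX u by auto
    have lA: "l' = (Y2 - Y1) / (X2 - X1)" if "X1 \<noteq> X2"
    proof -
      have x12: "x2 - x1 \<noteq> 0" using that xX by auto
      have "Y2 - Y1 = u ^ 3 * (y2 - y1) + s * u ^ 2 * (x2 - x1)" unfolding XY by (simp add: algebra_simps)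
      moreover have "y2 - y1 = l * (x2 - x1)" using x12 by (auto simp: l_def)
      ultimately have "Y2 - Y1 = l' * (u ^ 2 * (x2 - x1))" by (simp add: l'_def power_numeral_reduce algebra_simps)
      moreover have "X2 - X1 = u ^ 2 * (x2 - x1)" unfolding XY by (simp add: algebra_simps)
      ultimately show ?thesis using x12 u by simp
    qed
    have lB: "l' = (3 * X1 ^ 2 + 2 * a2 W * X1 + a4 W - a1 W * Y1) / (2 * Y1 + a1 W * X1 + a3 W)" if "X1 = X2"
    proof -
      have x12: "x1 = x2" using that xX by simp
      have cv: "y1 ^ 2 + x1 * y1 = x1 ^ 3 + 36 * a * x1 + a" "y2 ^ 2 + x1 * y2 = x1 ^ 3 + 36 * a * x1 + a"
        using P Q by (simp_all add: e on_curve_def w x12)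
      have "(y1 - y2) * (y1 + y2 + x2) = (y1 ^ 2 + x1 * y1) - (y2 ^ 2 + x1 * y2)"
        using x12 by (simp add: power2_eq_square algebra_simps)
      also have "\<dots> = 0" unfolding cv by simp
      finally have "y1 = y2" using ne x12 by simp
      then have d0: "2 * y1 + x1 \<noteq> 0" using ne x12 by (simp add: algebra_simps)
      have "2 * Y1 + a1 W * X1 + a3 W = u ^ 3 * (2 * y1 + x1)"
        unfolding XY c3 unfolding c1 by (simp add: power_numeral_reduce algebra_simps)
      moreover have "3 * X1 ^ 2 + 2 * a2 W * X1 + a4 W - a1 W * Y1 = u ^ 4 * (3 * x1 ^ 2 + 36 * a - y1) + s * u ^ 3 * (2 * y1 + x1)"
        unfolding XY c4 unfolding c2 c3 unfolding c1 by (simp add: power_numeral_reduce algebra_simps)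
      moreover have "3 * x1 ^ 2 + 36 * a - y1 = l * (2 * y1 + x1)" using x12 d0 by (simp add: l_def)
      moreover have "u ^ 4 * (l * (2 * y1 + x1)) + s * u ^ 3 * (2 * y1 + x1) = l' * (u ^ 3 * (2 * y1 + x1))"
        by (simp add: l'_def power_numeral_reduce algebra_simps)
      ultimately show ?thesis using d0 u by simp
    qed
    have x3': "x3' = l' ^ 2 + a1 W * l' - a2 W - X1 - X2"
      unfolding x3'_def x3_def l'_def XY c2 unfolding c1 by (simp add: power_numeral_reduce algebra_simps)
    have "ec_add W (Some (X1, Y1)) (Some (X2, Y2)) = Some (x3', - (l' + a1 W) * x3' - (Y1 - l' * X1) - a3 W)"
      by (rule ec_add_slope[OF oc ne' lA lB x3'])
    also have "- (l' + a1 W) * x3' - (Y1 - l' * X1) - a3 W = u ^ 3 * (- (l + 1) * x3 - (y1 - l * x1)) + s * u ^ 2 * x3 + t"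
      unfolding x3'_def l'_def XY c3 unfolding c1 by (simp add: power_numeral_reduce algebra_simps)
    finally show ?thesis unfolding add1 by (simp add: e XY x3'_def)
  qed
qed

lemma psi_inverse:
  assumes "on_curve W P"
  shows "P = psi (map_option (\<lambda>(X, Y). ((X - r) / u ^ 2, (Y - s * (X - r) - t) / u ^ 3)) P)"
  using u by (cases P) (auto simp: psi_def)

lemma psi_mult:
  assumes P: "\<And>n. on_curve (wcrv (36 * a) a) (ec_mult (wcrv (36 * a) a) n P)" "on_curve (wcrv (36 * a) a) P"
  shows "ec_mult W n (psi P) = psi (ec_mult (wcrv (36 * a) a) n P)"
  by (induction n) (simp_all add: psi_add P)

end

text \<open>The classical relation between \<open>c4\<close>, \<open>c6\<close> and the
  discriminant. The squared bracket is \<open>- c6\<close>, written in the form that appears when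
  \<open>u\<close> is tested for zero.\<close>

lemma c4_c6_disc:
  fixes W :: "'a::field weierstrass"
  shows "wc4 W ^ 3 - (wb2 W * wc4 W + 12 * (18 * wb6 W - wb2 W * wb4 W)) ^ 2 = 1728 * disc W"
proof -
  have b8: "4 * wb8 W = wb2 W * wb6 W - wb4 W ^ 2"
    unfolding wb2_def wb4_def wb6_def wb8_def by (simp add: power2_eq_square algebra_simps)
  have "1728 * disc W = - 432 * wb2 W ^ 2 * (4 * wb8 W) - 13824 * wb4 W ^ 3 - 46656 * wb6 W ^ 2 + 15552 * wb2 W * wb4 W * wb6 W"
    unfolding disc_def by (simp add: algebra_simps)
  also have "\<dots> = wc4 W ^ 3 - (wb2 W * wc4 W + 12 * (18 * wb6 W - wb2 W * wb4 W)) ^ 2"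
    unfolding b8 wc4_def by (simp add: power_numeral_reduce algebra_simps)
  finally show ?thesis ..
qed

text \<open>The two conditions say that \<open>j\<close> is neither 0 nor 1728: \<open>c4\<close> is
  the denominator of \<open>r\<close>, and \<open>u = 0\<close> would mean \<open>c6 = 0\<close>.
  Only a quadratic equation for \<open>s\<close> has to be solved, so the base field becomes
  \<open>F(s)\<close>.\<close>

lemma coord_change_exists:
  fixes W :: "'a::field weierstrass"
  assumes ac: "\<And>q::'a poly. degree q \<ge> 1 \<Longrightarrow> \<exists>x. poly q x = 0"
    and c4: "wc4 W \<noteq> 0" and c6: "wc4 W ^ 3 \<noteq> 1728 * disc W"
    and F: "is_subfield F" and W: "a1 W \<in> F" "a2 W \<in> F" "a3 W \<in> F" "a4 W \<in> F" "a6 W \<in> F"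
  shows "\<exists>a u r s t. coord_change W a u r s t \<and> algebraic_over F s \<and> {a, u, r, s, t} \<subseteq> gen_field F {s}"
proof -
  define b2 b4 b6 where b: "b2 = wb2 W" "b4 = wb4 W" "b6 = wb6 W"
  note bd = b[unfolded wb2_def wb4_def wb6_def]
  \<comment> \<open>This \<open>r\<close> solves \<open>a4' = 36 a6'\<close>, which is linear in \<open>r\<close> once \<open>u^2 = b2 + 12 r\<close>.\<close>
  define r where "r = (18 * b6 - b2 * b4) / wc4 W"
  have rc: "r * (b2 ^ 2 - 24 * b4) = 18 * b6 - b2 * b4" using c4 by (simp add: r_def wc4_def b)
  have bF: "b2 \<in> F" "b4 \<in> F" "b6 \<in> F" unfolding bd by (intro subfieldD[OF F] W)+
  have rF: "r \<in> F" unfolding r_def wc4_def b[symmetric] by (intro subfieldD[OF F] bF)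
  \<comment> \<open>The condition that the new coefficient of \<open>x^2\<close> vanishes.\<close>
  have "degree [:- (a2 W + 3 * r), a1 W, 1:] \<ge> 1" by simp
  then obtain s where s0: "poly [:- (a2 W + 3 * r), a1 W, 1:] s = 0" using ac by blast
  then have s: "s ^ 2 + a1 W * s = a2 W + 3 * r" by (simp add: power2_eq_square algebra_simps)
  have "pov F [:- (a2 W + 3 * r), a1 W, 1:]" using F by (simp add: subfieldD[OF F] W rF)
  then have algs: "algebraic_over F s" unfolding algebraic_over_pov using s0 by (intro exI[of _ "[:- (a2 W + 3 * r), a1 W, 1:]"]) simp
  note G = subfieldD[OF subfield_gen_field[of F "{s}"]]
  have sG: "s \<in> gen_field F {s}" using gen_field_incl(2)[of "{s}" F] by simp
  note WG = W[THEN subsetD[OF gen_field_incl(1)[of F "{s}"]]] rF[THEN subsetD[OF gen_field_incl(1)[of F "{s}"]]]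
  \<comment> \<open>Makes the new coefficient of \<open>x y\<close> equal to 1.\<close>
  define u where "u = a1 W + 2 * s"
  have "u ^ 2 = a1 W ^ 2 + 4 * (s ^ 2 + a1 W * s)" by (simp add: u_def power2_eq_square algebra_simps)
  then have u2: "u ^ 2 = b2 + 12 * r" unfolding s bd by (simp add: algebra_simps)
  have u0: "u \<noteq> 0"
  proof
    assume "u = 0"
    then have "(b2 + 12 * r) * wc4 W = 0" using u2 by simp
    moreover have "r * wc4 W = 18 * b6 - b2 * b4" using c4 by (simp add: r_def)
    ultimately have "b2 * wc4 W + 12 * (18 * b6 - b2 * b4) = 0" by (simp add: distrib_right mult.assoc)
    then show False using c4_c6_disc[of W] c6 unfolding b by simp
  qed
  have "\<exists>t. t \<in> gen_field F {s} \<and> a3 W = - r * a1 W - 2 * t \<and>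
      u ^ 2 * (a4 W - s * a3 W + 2 * r * a2 W - (t + r * s) * a1 W + 3 * r ^ 2 - 2 * s * t)
      = 36 * (a6 W + r * a4 W + r ^ 2 * a2 W + r ^ 3 - t * a3 W - t ^ 2 - r * t * a1 W)"
  proof (cases "(2::'a) = 0")
    case True
    note ev = numeral_Bit0_char2[OF True]
    have ua: "u = a1 W" by (simp add: u_def ev)
    have "r * b2 ^ 2 = - (b2 * b4)" using rc by (simp add: ev)
    then have "a1 W ^ 3 * (r * a1 W) = a1 W ^ 3 * (- a3 W)" unfolding bd by (simp add: ev power_numeral_reduce algebra_simps)
    moreover have "a1 W ^ 3 \<noteq> 0" using u0 ua by simp
    ultimately have ra: "r * a1 W = - a3 W" by (metis mult_left_cancel)
    \<comment> \<open>In characteristic two the new \<open>a3\<close> does not involve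
      \<open>t\<close> and vanishes by the choice of \<open>r\<close>; since 36 is zero,
      \<open>t\<close> is left to make the new \<open>a4\<close> vanish.\<close>
    define t where "t = (a4 W - s * a3 W - r * s * a1 W + 3 * r ^ 2) / a1 W"
    have ta: "t * a1 W = a4 W - s * a3 W - r * s * a1 W + 3 * r ^ 2" using u0 ua by (simp add: t_def)
    have "a4 W - s * a3 W + 2 * r * a2 W - (t + r * s) * a1 W + 3 * r ^ 2 - 2 * s * t = 0"
      unfolding distrib_right ta by (simp add: ev)
    moreover have "t \<in> gen_field F {s}" unfolding t_def
      by (intro G WG sG)
    moreover have "a3 W = - r * a1 W - 2 * t" using ra True by simp
    moreover have "36 * (a6 W + r * a4 W + r ^ 2 * a2 W + r ^ 3 - t * a3 W - t ^ 2 - r * t * a1 W) = 0" using ev by simp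
    ultimately show ?thesis by (intro exI[of _ t] conjI) simp_all
  next
    case two: False
    \<comment> \<open>Forced by the vanishing of the new \<open>a3\<close>.\<close>
    define t where "t = - (a3 W + r * a1 W) / 2"
    have t2: "2 * t = - (a3 W + r * a1 W)" using two by (simp add: t_def)
    define A4 where "A4 = a4 W - s * a3 W + 2 * r * a2 W - (t + r * s) * a1 W + 3 * r ^ 2 - 2 * s * t"
    define A6 where "A6 = a6 W + r * a4 W + r ^ 2 * a2 W + r ^ 3 - t * a3 W - t ^ 2 - r * t * a1 W"
    have "2 * A4 = 2 * a4 W - 2 * s * a3 W + 4 * r * a2 W - (2 * t) * a1 W - 2 * r * s * a1 W + 6 * r ^ 2 - 2 * s * (2 * t)"
      by (simp add: A4_def algebra_simps)
    then have A4: "2 * A4 = b4 + r * b2 + 6 * r ^ 2" unfolding t2 bd by (simp add: power2_eq_square algebra_simps)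
    have "4 * A6 = 4 * a6 W + 4 * r * a4 W + 4 * r ^ 2 * a2 W + 4 * r ^ 3 - 2 * (2 * t) * a3 W - (2 * t) ^ 2 - 2 * r * (2 * t) * a1 W"
      by (simp add: A6_def power2_eq_square algebra_simps)
    then have A6: "4 * A6 = b6 + 2 * r * b4 + r ^ 2 * b2 + 4 * r ^ 3" unfolding t2 bd by (simp add: power2_eq_square algebra_simps)
    have "2 * (u ^ 2 * A4) = u ^ 2 * (2 * A4)" by simp
    also have "\<dots> = 18 * (b6 + 2 * r * b4 + r ^ 2 * b2 + 4 * r ^ 3) + (r * (b2 ^ 2 - 24 * b4) - (18 * b6 - b2 * b4))"
      unfolding u2 A4 by (simp add: power_numeral_reduce algebra_simps)
    also have "\<dots> = 2 * (36 * A6)" unfolding rc A6[symmetric] by simp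
    finally have "u ^ 2 * A4 = 36 * A6" by (rule mult_left_cancel[THEN iffD1, OF two])
    moreover have "t \<in> gen_field F {s}" unfolding t_def
      by (intro G WG)
    moreover have "a3 W = - r * a1 W - 2 * t" unfolding t2 by simp
    ultimately show ?thesis unfolding A4_def A6_def by blast
  qed
  then obtain t where t: "t \<in> gen_field F {s}" and a3: "a3 W = - r * a1 W - 2 * t"
    and A: "u ^ 2 * (a4 W - s * a3 W + 2 * r * a2 W - (t + r * s) * a1 W + 3 * r ^ 2 - 2 * s * t)
      = 36 * (a6 W + r * a4 W + r ^ 2 * a2 W + r ^ 3 - t * a3 W - t ^ 2 - r * t * a1 W)" by blast
  define A4 where "A4 = a4 W - s * a3 W + 2 * r * a2 W - (t + r * s) * a1 W + 3 * r ^ 2 - 2 * s * t"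
  define A6 where "A6 = a6 W + r * a4 W + r ^ 2 * a2 W + r ^ 3 - t * a3 W - t ^ 2 - r * t * a1 W"
  \<comment> \<open>The new \<open>a6\<close> is the parameter; the choice of \<open>r\<close> and
    \<open>t\<close> has made the new \<open>a4\<close> equal to 36 times it.\<close>
  define a where "a = A6 / u ^ 6"
  have A6: "u ^ 6 * a = A6" using u0 by (simp add: a_def)
  have "u ^ 2 * (u ^ 4 * (36 * a)) = 36 * (u ^ 6 * a)" by (simp add: power_numeral_reduce)
  also have "\<dots> = u ^ 2 * A4" unfolding A6 using A by (simp add: A4_def A6_def)
  finally have A4: "u ^ 4 * (36 * a) = A4" by (rule mult_left_cancel[THEN iffD1, OF power_not_zero[OF u0]])
  have uG: "u \<in> gen_field F {s}" unfolding u_def by (intro G WG sG)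
  have "a \<in> gen_field F {s}" unfolding a_def A6_def by (intro G WG uG t)
  moreover have "coord_change W a u r s t"
  proof
    show "a1 W = u - 2 * s" by (simp add: u_def)
    show "a2 W = s * a1 W - 3 * r + s ^ 2" using s by (simp add: algebra_simps)
    show "a4 W = u ^ 4 * (36 * a) + s * a3 W - 2 * r * a2 W + (t + r * s) * a1 W - 3 * r ^ 2 + 2 * s * t"
      unfolding A4 A4_def by simp
    show "a6 W = u ^ 6 * a - r * a4 W - r ^ 2 * a2 W - r ^ 3 + t * a3 W + t ^ 2 + r * t * a1 W"
      unfolding A6 A6_def by simp
  qed (rule u0 a3)+
  ultimately show ?thesis using algs uG WG(6) sG t by blast
qed

theorem theorem4p2:
  fixes F :: "'a::field set" and p :: nat and E :: "'a weierstrass"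
  assumes alg_closed: "\<And>q::'a poly. degree q \<ge> 1 \<Longrightarrow> \<exists>x. poly q x = 0"
    and FF: "global_function_field p F"
    and Ell: "elliptic_over F E"
    and nonisotriv: "\<not> isotrivial E"
  shows "finite (torsion_points E (max_abelian_ext F))"
proof -
  let ?k = "prime_subfield :: 'a set"
  note ksf = subfield_prime_subfield[where 'a='a]
  obtain t0 where p: "prime p" "of_nat p = (0::'a)" and F: "is_subfield F" and t0: "t0 \<in> F"
    and fdF: "finite_dim_over (gen_field ?k {t0}) F" using FF unfolding global_function_field_def by blast
  have EF: "a1 E \<in> F" "a2 E \<in> F" "a3 E \<in> F" "a4 E \<in> F" "a6 E \<in> F" and disc: "disc E \<noteq> 0"
    using Ell by (auto simp: elliptic_over_def)
  have jtr: "j_inv E \<notin> ?k" using nonisotriv algebraic_over_mem[OF ksf] unfolding isotrivial_def by blast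
  have "wc4 E \<noteq> 0"
  proof
    assume "wc4 E = 0"
    then have "j_inv E = 0" by (simp add: j_inv_def)
    then show False using jtr subfieldD(1)[OF ksf] by simp
  qed
  moreover have "wc4 E ^ 3 \<noteq> 1728 * disc E"
  proof
    assume "wc4 E ^ 3 = 1728 * disc E"
    then have "j_inv E = 1728" using disc by (simp add: j_inv_def)
    moreover have "(1728::'a) \<in> ?k" by (rule subfieldD(11)[OF ksf])
    ultimately show False using jtr by simp
  qed
  ultimately obtain a u r s t where cc: "coord_change E a u r s t" and algs: "algebraic_over F s"
    and G: "{a, u, r, s, t} \<subseteq> gen_field F {s}" using coord_change_exists[OF alg_closed _ _ F EF] by metis
  define F' where "F' = gen_field F {s}"
  have F': "is_subfield F'" "F \<subseteq> F'" unfolding F'_def by (rule subfield_gen_field gen_field_incl)+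
  have G': "a \<in> F'" "u \<in> F'" "r \<in> F'" "s \<in> F'" "t \<in> F'" using G by (simp_all add: F'_def)
  interpret cc: coord_change E a u r s t by (rule cc)
  let ?W = "wcrv (36 * a) a"
  have dW: "disc ?W = - a * (1 - 1728 * a) ^ 2"
    unfolding disc_def wb2_def wb4_def wb6_def wb8_def wcrv_def by (simp add: power2_eq_square power3_eq_cube algebra_simps)
  have dE: "disc E = u ^ 12 * disc ?W" unfolding dW by (rule cc.disc_change)
  have dW0: "disc ?W \<noteq> 0" using disc dE by auto
  have a0: "a \<noteq> 0" and a1: "1 - 1728 * a \<noteq> 0" using dW0 unfolding dW by auto
  \<comment> \<open>This amounts to \<open>j = 1728 - 1/a\<close>, so that transcendence passes from
    \<open>j\<close> to \<open>a\<close>.\<close>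
  have "j_inv E = (u ^ 12 * (1 - 1728 * a) ^ 2 * (1 - 1728 * a)) / (u ^ 12 * (1 - 1728 * a) ^ 2 * (- a))"
    unfolding j_inv_def cc.c4_change cc.disc_change by (simp add: power_mult_distrib power_numeral_reduce mult_ac)
  also have "\<dots> = (1 - 1728 * a) / (- a)" by (rule mult_divide_mult_cancel_left) (use cc.u a1 in simp)
  finally have j: "j_inv E = (1 - 1728 * a) / (- a)" .
  have tra: "\<not> algebraic_over ?k a"
  proof
    assume "algebraic_over ?k a"
    then have fd: "finite_dim_over ?k (gen_field ?k {a})" by (intro finite_dim_gen_field ksf) auto
    have "a \<in> gen_field ?k {a}" using gen_field_incl(2)[of "{a}"] by simp
    then have "j_inv E \<in> gen_field ?k {a}" unfolding j by (intro subfieldD[OF subfield_gen_field])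
    then show False using finite_dim_subfield_algebraic[OF ksf subfield_gen_field fd] nonisotriv by (simp add: isotrivial_def)
  qed
  interpret T: tff a p
    by unfold_locales (use alg_closed dW0 prime_gt_0_nat[OF p(1)] p(2) tra in simp_all)
  have kF: "?k \<subseteq> F" by (rule prime_subfield_le[OF F])
  have KaF': "T.Ka \<subseteq> F'" by (rule gen_field_least[OF F'(1)]) (use kF F'(2) G' in auto)
  \<comment> \<open>\<open>F'\<close> is generated over \<open>k(t0)\<close> by finitely many
    algebraic elements, the form in which \<open>t0\<close> can be replaced by
    \<open>a\<close>.\<close>
  have fdF': "finite_dim_over T.Ka F'"
  proof -
    let ?K = "gen_field ?k {t0}"
    have K: "is_subfield ?K" by (rule subfield_gen_field)
    have KF: "?K \<subseteq> F" by (rule gen_field_least[OF F kF]) (use t0 in simp)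
    obtain B where B: "finite B" "B \<subseteq> F" "\<And>x. x \<in> F \<Longrightarrow> \<exists>c. (\<forall>b\<in>B. c b \<in> ?K) \<and> x = (\<Sum>b\<in>B. c b * b)"
      using fdF unfolding finite_dim_over_def by blast
    have FB: "F = gen_field ?K B"
    proof
      show "gen_field ?K B \<subseteq> F" by (rule gen_field_least[OF F KF B(2)])
      show "F \<subseteq> gen_field ?K B"
      proof
        fix x assume "x \<in> F"
        then obtain c where c: "\<forall>b\<in>B. c b \<in> ?K" "x = (\<Sum>b\<in>B. c b * b)" using B(3) by blast
        show "x \<in> gen_field ?K B" unfolding c(2)
          by (intro subfield_sum subfield_gen_field subfieldD(5)[OF subfield_gen_field])
            (use c(1) gen_field_incl[of ?K B] gen_field_incl(2)[of B ?K] in blast)+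
      qed
    qed
    have F'eq: "F' = gen_field ?K (B \<union> {s})" unfolding gen_field_Un FB[symmetric] F'_def ..
    have "finite_dim_over F F'" unfolding F'_def by (intro finite_dim_gen_field F) (use algs in auto)
    then have fd: "finite_dim_over ?K F'" by (rule finite_dim_over_tower[OF K F F' fdF])
    show ?thesis unfolding F'eq
    proof (rule finite_dim_change_transcendental[OF ksf _ _ _ tra])
      show "algebraic_over ?K x" if "x \<in> B \<union> {s}" for x
        using finite_dim_subfield_algebraic[OF K F'(1) fd, of x] that B(2) F'(2) G' by blast
      show "a \<in> gen_field ?K (B \<union> {s})" using G' unfolding F'eq by simp
    qed (use B(1) in simp)
  qed
  obtain N where N: "N > 0" "\<And>L P. finite_abelian_ext F' L \<Longrightarrow> P \<in> T.pts L \<Longrightarrow> \<exists>n>0. T.mul n P = None \<Longrightarrow> T.mul N P = None"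
    using T.abelian_torsion_exponent[OF F'(1) KaF' fdF'] by blast
  have "torsion_points E (max_abelian_ext F) \<subseteq> cc.psi ` {P \<in> T.E. T.mul N P = None}"
  proof
    fix P assume "P \<in> torsion_points E (max_abelian_ext F)"
    then obtain n where oc: "on_curve E P" and rat: "\<And>X Y. P = Some (X, Y) \<Longrightarrow> X \<in> max_abelian_ext F \<and> Y \<in> max_abelian_ext F"
      and n: "n > 0" "ec_mult E n P = None" unfolding torsion_points_def rat_points_def by blast
    define Q where "Q = map_option (\<lambda>(X, Y). ((X - r) / u ^ 2, (Y - s * (X - r) - t) / u ^ 3)) P"
    have PQ: "P = cc.psi Q" unfolding Q_def by (rule cc.psi_inverse[OF oc])
    have Qoc: "on_curve ?W Q" using oc cc.on_curve_psi[of Q] PQ by simp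
    then have QE: "Q \<in> T.E" by (simp add: T.E_def)
    have mE: "on_curve ?W (ec_mult ?W m Q)" for m using T.mul_E[OF QE, of m] by (simp add: T.E_def)
    have "cc.psi (T.mul n Q) = None" using n(2) cc.psi_mult[OF mE Qoc, of n] PQ by simp
    then have tor: "T.mul n Q = None" by (simp add: cc.psi_None)
    have "T.mul N Q = None"
    proof (cases P)
      case None
      then show ?thesis by (simp add: Q_def)
    next
      case (Some q)
      obtain X Y where q: "q = (X, Y)" by force
      \<comment> \<open>The two coordinates may come from different members of the union; both
        extensions are placed in one that is abelian over \<open>F'\<close>.\<close>
      obtain K1 K2 where K: "finite_abelian_ext F K1" "X \<in> K1" "finite_abelian_ext F K2" "Y \<in> K2"
        using rat[of X Y] unfolding Some q max_abelian_ext_def by blast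
      obtain L where L: "finite_abelian_ext F' L" "K1 \<subseteq> L" "K2 \<subseteq> L"
        using abelian_compositum[OF alg_closed K(1,3) F'] by blast
      have sL: "is_subfield L" "F' \<subseteq> L" using L(1) by (auto simp: finite_abelian_ext_def finite_galois_ext_def)
      have XY: "X \<in> L" "Y \<in> L" using K L by auto
      have gL: "u \<in> L" "r \<in> L" "s \<in> L" "t \<in> L" using sL(2) G' by auto
      have Qs: "Q = Some ((X - r) / u ^ 2, (Y - s * (X - r) - t) / u ^ 3)" by (simp add: Q_def Some q)
      have "(X - r) / u ^ 2 \<in> L" "(Y - s * (X - r) - t) / u ^ 3 \<in> L" by (intro subfieldD[OF sL(1)] XY gL)+
      then have "Q \<in> T.pts L" using QE unfolding T.pts_def Qs by simp
      then show ?thesis using N(2)[OF L(1)] n(1) tor by blast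
    qed
    then show "P \<in> cc.psi ` {P \<in> T.E. T.mul N P = None}" using PQ QE by blast
  qed
  then show ?thesis using finite_subset[OF _ finite_imageI[OF T.finite_torsion[OF N(1)]]] by blast
qed

end
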